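(* Let $d \ge 1$ and let $L, M \subseteq \mathbb{R}^d$ be lattices of the same volume such that $\overline{L+M} = \mathbb{R}^d$ (i.e. the subgroup $L+M$ is dense in $\mathbb{R}^d$). Then there is a bounded Lebesgue measurable set $E \subseteq \mathbb{R}^d$ such that $L \oplus E = \mathbb{R}^d$ and $M \oplus E = \mathbb{R}^d$ are both tilings (up to measure zero), i.e. $$\sum_{\ell \in L} \mathbf{1}_E(x-\ell) = 1 \quad\text{and}\quad \sum_{m \in M} \mathbf{1}_E(x-m) = 1 \quad \text{for almost all } x \in \mathbb{R}^d.$$
   Context: A lattice in $\mathbb{R}^d$ is a discrete subgroup of $\mathbb{R}^d$ which linearly spans $\mathbb{R}^d$; equivalently, a set $A\mathbb{Z}^d$ with $A$ a non-singular real $d\times d$ matrix. The volume of the lattice $A\mathbb{Z}^d$ is $|\det A|$ (the Lebesgue measure of any measurable fundamental domain). $L+M = \{\ell+m : \ell\in L, m\in M\}$ and the bar denotes topological closure. $\mathbf{1}_E$ denotes the indicator function of $E$. Statements that $L\oplus E=\mathbb{R}^d$ or $M \oplus E=\mathbb{R}^d$ is a tiling are understood to hold except possibly on a set of Lebesgue measure zero, as made explicit in the displayed equations. *)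

theory Defs
  imports "HOL-Analysis.Analysis"
begin

definition is_lattice :: "(real ^ 'n) set \<Rightarrow> bool" where
  "is_lattice L \<longleftrightarrow>
     0 \<in> L \<and> (\<forall>x\<in>L. \<forall>y\<in>L. x + y \<in> L) \<and> (\<forall>x\<in>L. - x \<in> L) \<and>
     discrete L \<and> span L = UNIV"

definition int_vectors :: "(real ^ 'n) set" where
  "int_vectors = {z. \<forall>i. z $ i \<in> \<int>}"

definition matrix_lattice :: "real ^ 'n ^ 'n \<Rightarrow> (real ^ 'n) set" where
  "matrix_lattice A = (\<lambda>z. A *v z) ` int_vectors"

text \<open>The choice of the generating matrix is immaterial, see \<open>lattice_volume_matrix_lattice\<close>.\<close>

definition lattice_volume :: "(real ^ 'n) set \<Rightarrow> real" where
  "lattice_volume L = \<bar>det (SOME A :: real ^ 'n ^ 'n. det A \<noteq> 0 \<and> L = matrix_lattice A)\<bar>"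

lemma matrix_lattice_subset_det_le:
  fixes A B :: "real ^ 'n ^ 'n"
  assumes B: "det B \<noteq> 0" and sub: "matrix_lattice B \<subseteq> matrix_lattice A"
  shows "\<bar>det A\<bar> \<le> \<bar>det B\<bar>"
proof -
  have "\<exists>z. z \<in> int_vectors \<and> column j B = A *v z" for j
  proof -
    have "axis j 1 \<in> (int_vectors :: (real ^ 'n) set)"
      by (auto simp: int_vectors_def axis_def)
    then have "B *v axis j 1 \<in> matrix_lattice A"
      using sub by (auto simp: matrix_lattice_def)
    then show ?thesis
      by (auto simp: matrix_lattice_def matrix_vector_mul_component matrix_vector_mult_basis)
  qed
  then obtain z where z: "\<And>j. z j \<in> int_vectors" "\<And>j. column j B = A *v z j"
    by metis
  define U :: "real ^ 'n ^ 'n" where "U = (\<chi> i j. z j $ i)"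
  have "B $ i $ j = (A ** U) $ i $ j" for i j
    using arg_cong[OF z(2)[of j], of "\<lambda>v. v $ i"]
    by (simp add: column_def matrix_matrix_mult_def matrix_vector_mult_def U_def)
  then have eq: "B = A ** U"
    by (simp add: vec_eq_iff)
  have "U $ i $ j \<in> \<int>" for i j
    using z(1)[of j] by (simp add: U_def int_vectors_def)
  then have "det U \<in> \<int>"
    unfolding det_def by (intro Ints_sum Ints_mult Ints_prod) auto
  moreover have "det U \<noteq> 0"
    using B by (simp add: eq det_mul)
  ultimately have "1 \<le> \<bar>det U\<bar>"
    by (rule Ints_nonzero_abs_ge1)
  then show ?thesis
    by (simp add: eq det_mul abs_mult mult_le_cancel_left1)
qed

lemma lattice_volume_matrix_lattice:
  fixes A :: "real ^ 'n ^ 'n"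
  assumes "det A \<noteq> 0"
  shows "lattice_volume (matrix_lattice A) = \<bar>det A\<bar>"
proof -
  define B :: "real ^ 'n ^ 'n"
    where "B = (SOME B. det B \<noteq> 0 \<and> matrix_lattice A = matrix_lattice B)"
  have "det B \<noteq> 0 \<and> matrix_lattice A = matrix_lattice B"
    unfolding B_def by (rule someI[of _ A]) (simp add: assms)
  then have "\<bar>det B\<bar> = \<bar>det A\<bar>"
    using assms by (intro antisym matrix_lattice_subset_det_le) auto
  then show ?thesis
    by (simp add: lattice_volume_def B_def)
qed

end

theory Submission
  imports Defs "HOL-Library.Function_Algebras" "HOL-Library.Transitive_Closure_Table"
begin

text \<open>Choose a very fine lattice \<open>\<Lambda> \<subseteq> L + M\<close> that has a free complement \<open>\<int>\<^sup>k\<close> in \<open>L + M\<close>, and bounded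
  fundamental domains \<open>DL\<close>, \<open>DM\<close> of \<open>L\<close> and \<open>M\<close>. A common tile amounts to a measurable matching of \<open>DL\<close> with \<open>DM\<close>
  by finitely many translations from \<open>L + M\<close>. Since the volumes agree, there is a fractional such matching, given
  by overlaps of translates of the two domains. Summed over the cosets of \<open>\<Lambda>\<close> it becomes a bounded real flow for
  the free action of \<open>\<int>\<^sup>k\<close> on the torus modulo \<open>\<Lambda>\<close>, with integral divergence (the numbers of points of a coset in \<open>DL\<close> and
  \<open>DM\<close>). Exhausting almost every orbit by nested finite regions with thin boundary crossings, the flow is rounded
  measurably to an integral flow at bounded distance. Because \<open>\<Lambda>\<close> is fine, every coset has enough points that need not
  move to absorb the rounding error, so the integral flow is again realised by a matching.\<close>

section \<open>Rounding flows on finite graphs\<close>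

text \<open>The obstacle is that rounding must keep every divergence and have one error bound for
  regions of all sizes. On a finite graph, a flow with integral divergences and integral boundary
  values can be rounded edge by edge to a floor or a ceiling. So the task is to make the flow
  integral on the edges that leave a box. Circulations in a collar on both sides of the boundary do
  this: fractional parts travel along a forest of crossing edges, and the load on each edge is
  bounded in terms of the step set \<open>S\<close> alone. These circulations run around the box, so
  the collar has to be connected. In rank one the two ends of an interval are not connected; there
  the flow through a cut has a fractional part that is constant along the orbit, and it is
  subtracted beforehand. The order of the choices matters. The translations of the fractional
  matching come from the two domains alone, and the rank of the complement is at most twice the
  dimension whatever \<open>\<Lambda>\<close> is. Hence the rounding error is known before the
  fineness of \<open>\<Lambda>\<close> is fixed.\<close>

lemma homogeneous_system_nontrivial_solution:
  fixes c :: "'v \<Rightarrow> 'e \<Rightarrow> real"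
  assumes "finite V" "finite E" "card V < card E"
  shows "\<exists>z. (\<exists>e\<in>E. z e \<noteq> 0) \<and> (\<forall>v\<in>V. (\<Sum>e\<in>E. c v e * z e) = 0)"
  using assms
proof (induction V arbitrary: c E rule: finite_induct)
  case empty
  then have "E \<noteq> {}" by auto
  then show ?case by (intro exI[of _ "\<lambda>_. 1"]) auto
next
  case (insert v V)
  show ?case
  proof (cases "\<forall>e\<in>E. c v e = 0")
    case True
    obtain z where "\<exists>e\<in>E. z e \<noteq> 0" "\<forall>w\<in>V. (\<Sum>e\<in>E. c w e * z e) = 0"
      using insert.IH[of E c] insert.prems insert.hyps by auto
    then show ?thesis using True by (intro exI[of _ z]) (auto intro!: sum.neutral)
  next
    case False
    then obtain e0 where e0: "e0 \<in> E" "c v e0 \<noteq> 0" by auto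
    define E' where "E' = E - {e0}"
    have E': "finite E'" "card V < card E'" "e0 \<notin> E'" "E = insert e0 E'"
      using insert e0 by (auto simp: E'_def)
    \<comment> \<open>The equation of \<open>v\<close> is solved for the unknown at
      \<open>e0\<close> and substituted into the others.\<close>
    define c' where "c' w e = c w e - c w e0 * c v e / c v e0" for w e
    obtain z where z: "\<exists>e\<in>E'. z e \<noteq> 0" "\<forall>w\<in>V. (\<Sum>e\<in>E'. c' w e * z e) = 0"
      using insert.IH[of E' c'] E' by auto
    define s where "s = (\<Sum>e\<in>E'. c v e * z e)"
    define z' where "z' e = (if e = e0 then - s / c v e0 else z e)" for e
    have sumE: "(\<Sum>e\<in>E. c w e * z' e) = c w e0 * (- s / c v e0) + (\<Sum>e\<in>E'. c w e * z e)" for w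
    proof -
      have "(\<Sum>e\<in>E'. c w e * z' e) = (\<Sum>e\<in>E'. c w e * z e)"
        using E'(3) by (intro sum.cong) (auto simp: z'_def)
      then show ?thesis using E' by (simp add: z'_def)
    qed
    have "(\<Sum>e\<in>E. c w e * z' e) = 0" if "w \<in> insert v V" for w
    proof (cases "w = v")
      case True
      then show ?thesis using e0 by (simp add: sumE s_def)
    next
      case False
      then have "0 = (\<Sum>e\<in>E'. c' w e * z e)" using z that by auto
      also have "\<dots> = (\<Sum>e\<in>E'. c w e * z e) - (\<Sum>e\<in>E'. c w e0 / c v e0 * (c v e * z e))"
        by (simp add: c'_def algebra_simps sum_subtractf)
      also have "\<dots> = (\<Sum>e\<in>E'. c w e * z e) - c w e0 / c v e0 * s"
        by (simp add: s_def sum_distrib_left)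
      finally show ?thesis by (simp add: sumE)
    qed
    moreover have "\<exists>e\<in>E. z' e \<noteq> 0"
      using z(1) E' by (auto simp: z'_def)
    ultimately show ?thesis by blast
  qed
qed

text \<open>A graph in which every vertex has degree at least two contains a cycle. A dimension
  count replaces the search for it: there are at least as many undirected edges as vertices, and one
  vertex equation is redundant, so the homogeneous system has a nontrivial solution.\<close>

lemma fractional_circulation_exists:
  fixes X :: "('g::ab_group_add \<times> 'g) set"
  assumes X: "finite X" "X \<noteq> {}" and ne0: "\<And>a s. (a, s) \<in> X \<Longrightarrow> s \<noteq> 0"
    and flip: "\<And>a s. (a, s) \<in> X \<Longrightarrow> (a + s, - s) \<in> X"
    and deg: "\<And>a s. (a, s) \<in> X \<Longrightarrow> \<exists>t. t \<noteq> s \<and> (a, t) \<in> X"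
  shows "\<exists>z :: 'g \<times> 'g \<Rightarrow> real. (\<exists>e\<in>X. z e \<noteq> 0) \<and> (\<forall>a s. (a, s) \<in> X \<longrightarrow> z (a + s, - s) = - z (a, s)) \<and>
           (\<forall>v. (\<Sum>e\<in>{e\<in>X. fst e = v}. z e) = 0)"
proof -
  define fl where "fl = (\<lambda>(a::'g, s::'g). (a + s, - s))"
  have fl_fl: "fl (fl e) = e" for e by (cases e) (simp add: fl_def)
  have flX: "fl e \<in> X" if "e \<in> X" for e using that flip by (cases e) (auto simp: fl_def)
  have fl_ne: "fl e \<noteq> e" if "e \<in> X" for e
    using that ne0 by (cases e) (auto simp: fl_def)
  \<comment> \<open>An injection into \<open>nat\<close> singles out one orientation of every edge;
    the unknowns are the values on these.\<close>
  obtain h :: "'g \<times> 'g \<Rightarrow> nat" where h: "inj_on h X"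
    using X(1) by (metis finite_imp_inj_to_nat_seg)
  define Y where "Y = {e\<in>X. h e < h (fl e)}"
  have Y: "Y \<subseteq> X" "finite Y" using X by (auto simp: Y_def)
  have XY: "X = Y \<union> fl ` Y"
  proof (intro set_eqI iffI)
    fix e assume e: "e \<in> X"
    have "h e \<noteq> h (fl e)" using h e flX fl_ne by (metis inj_onD)
    then have "e \<in> Y \<or> fl e \<in> Y" using e flX fl_fl by (auto simp: Y_def)
    then show "e \<in> Y \<union> fl ` Y" using fl_fl by (metis UnI1 UnI2 imageI)
  qed (use Y flX in auto)
  have disj: "Y \<inter> fl ` Y = {}" by (auto simp: Y_def fl_fl)
  have inj_fl: "inj_on fl A" for A by (metis fl_fl inj_onI)
  have cardX: "card X = 2 * card Y"
    using Y disj by (subst XY) (simp add: card_Un_disjoint card_image inj_fl)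
  define W where "W = fst ` X"
  have W: "finite W" "W \<noteq> {}" using X by (auto simp: W_def)
  have "2 * card W \<le> card X"
  proof -
    have "(\<Union>w\<in>W. {e\<in>X. fst e = w}) = X" by (auto simp: W_def)
    moreover have "card (\<Union>w\<in>W. {e\<in>X. fst e = w}) = (\<Sum>w\<in>W. card {e\<in>X. fst e = w})"
      using X W by (intro card_UN_disjoint) auto
    ultimately have "card X = (\<Sum>w\<in>W. card {e\<in>X. fst e = w})" by simp
    moreover have "2 \<le> card {e\<in>X. fst e = w}" if w: "w \<in> W" for w
    proof -
      obtain s where s: "(w, s) \<in> X" using w by (auto simp: W_def)
      obtain t where t: "t \<noteq> s" "(w, t) \<in> X" using deg[OF s] by auto
      have "card {(w, s), (w, t)} \<le> card {e\<in>X. fst e = w}"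
        using X s t by (intro card_mono) auto
      then show ?thesis using t by simp
    qed
    ultimately show ?thesis
      using sum_mono[of W "\<lambda>_. 2" "\<lambda>w. card {e\<in>X. fst e = w}"] by simp
  qed
  then have WY: "card W \<le> card Y" using cardX by simp
  \<comment> \<open>The divergences over all vertices add up to zero, so the equation at
    \<open>v0\<close> follows from the others. Leaving it out turns
    \<open>card W \<le> card Y\<close> into the strict inequality that is needed.\<close>
  obtain v0 where v0: "v0 \<in> W" using W by auto
  define c where "c v e = (if fst e = v then 1 else 0) - (if fst (fl e) = v then 1 else (0::real))" for v e
  have "card (W - {v0}) < card Y"
    using v0 W WY by (metis card_Diff1_less order_less_le_trans)
  then obtain z0 where z0: "\<exists>e\<in>Y. z0 e \<noteq> 0" "\<forall>v\<in>W - {v0}. (\<Sum>e\<in>Y. c v e * z0 e) = 0"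
    using homogeneous_system_nontrivial_solution[of "W - {v0}" Y c] W Y by auto
  define z where "z e = (if e \<in> Y then z0 e else - z0 (fl e))" for e
  have zfl: "z (fl e) = - z e" if "e \<in> X" for e
    using that disj XY fl_fl unfolding z_def by (smt (verit, best) Un_iff disjoint_iff image_iff)
  have divz: "(\<Sum>e\<in>{e\<in>X. fst e = v}. z e) = (\<Sum>e\<in>Y. c v e * z0 e)" for v
  proof -
    have "(\<Sum>e\<in>{e\<in>X. fst e = v}. z e) = (\<Sum>e\<in>X. if fst e = v then z e else 0)"
      using X by (simp add: sum.inter_filter)
    also have "\<dots> = (\<Sum>e\<in>Y. if fst e = v then z e else 0) + (\<Sum>e\<in>fl ` Y. if fst e = v then z e else 0)"
      using Y disj by (subst XY) (simp add: sum.union_disjoint)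
    also have "(\<Sum>e\<in>fl ` Y. if fst e = v then z e else 0) = (\<Sum>e\<in>Y. if fst (fl e) = v then z (fl e) else 0)"
      by (simp add: sum.reindex inj_fl)
    also have "(\<Sum>e\<in>Y. if fst e = v then z e else 0) + \<dots> = (\<Sum>e\<in>Y. c v e * z0 e)"
      unfolding sum.distrib[symmetric]
    proof (intro sum.cong refl)
      fix e assume e: "e \<in> Y"
      then have z1: "z e = z0 e" by (simp add: z_def)
      have "z (fl e) = - z0 e" using zfl[of e] e Y z1 by auto
      note z1 this
      then show "(if fst e = v then z e else 0) + (if fst (fl e) = v then z (fl e) else 0) = c v e * z0 e"
        by (simp add: c_def)
    qed
    finally show ?thesis .
  qed
  have tot: "(\<Sum>v\<in>W. \<Sum>e\<in>Y. c v e * z0 e) = 0"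
  proof -
    have "(\<Sum>v\<in>W. \<Sum>e\<in>Y. c v e * z0 e) = (\<Sum>e\<in>Y. (\<Sum>v\<in>W. c v e) * z0 e)"
      by (subst sum.swap) (simp add: sum_distrib_right)
    also have "\<dots> = 0"
    proof (intro sum.neutral ballI)
      fix e assume "e \<in> Y"
      then have "fst e \<in> W" "fst (fl e) \<in> W" using Y flX[of e] by (auto simp: W_def)
      then have "(\<Sum>v\<in>W. c v e) = 0" using W by (simp add: c_def sum_subtractf)
      then show "(\<Sum>v\<in>W. c v e) * z0 e = 0" by simp
    qed
    finally show ?thesis .
  qed
  have rest: "(\<Sum>v\<in>W - {v0}. \<Sum>e\<in>Y. c v e * z0 e) = 0"
    using z0(2) by (intro sum.neutral) blast
  have v00: "(\<Sum>e\<in>Y. c v0 e * z0 e) = 0"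
    using tot unfolding sum.remove[OF W(1) v0] rest by (simp only: add_0_right)
  have "(\<Sum>e\<in>{e\<in>X. fst e = v}. z e) = 0" for v
    unfolding divz
  proof (cases "v \<in> W")
    case False
    then have "c v e = 0" if "e \<in> Y" for e
      using that Y flX[of e] by (force simp: W_def c_def)
    then show "(\<Sum>e\<in>Y. c v e * z0 e) = 0" by (intro sum.neutral) simp
  next
    case True
    then show "(\<Sum>e\<in>Y. c v e * z0 e) = 0" using z0(2) v00 by (cases "v = v0") blast+
  qed
  moreover have "\<exists>e\<in>X. z e \<noteq> 0" using z0(1) Y by (auto simp: z_def)
  ultimately show ?thesis
    using zfl by (intro exI[of _ z]) (auto simp: fl_def)
qed

text \<open>Supplies the degree condition of \<open>fractional_circulation_exists\<close>: where the
  divergence is integral, fractional edges do not come alone.\<close>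

lemma Ints_one_missing:
  fixes f :: "'b \<Rightarrow> real"
  assumes "finite S" "(\<Sum>s\<in>S. f s) \<in> \<int>" "s \<in> S" "f s \<notin> \<int>"
  shows "\<exists>t\<in>S. t \<noteq> s \<and> f t \<notin> \<int>"
proof (rule ccontr)
  assume "\<not> ?thesis"
  then have "(\<Sum>t\<in>S - {s}. f t) \<in> \<int>" by (intro Ints_sum) auto
  moreover have "f s = (\<Sum>t\<in>S. f t) - (\<Sum>t\<in>S - {s}. f t)"
    using assms by (simp add: sum.remove)
  ultimately show False using assms by (metis Ints_diff)
qed

text \<open>Integrality of network flows: moving along a circulation supported on the fractional edges
  until one more value becomes an integer.\<close>

lemma integral_flow_rounding:
  fixes V S :: "'g::ab_group_add set" and F :: "'g \<Rightarrow> 'g \<Rightarrow> real"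
  assumes fin: "finite V" "finite S" and S: "\<And>s. s \<in> S \<Longrightarrow> - s \<in> S" "0 \<notin> S"
    and "\<And>a s. a \<in> V \<Longrightarrow> s \<in> S \<Longrightarrow> a + s \<in> V \<Longrightarrow> F (a + s) (- s) = - F a s"
    and "\<And>a s. a \<in> V \<Longrightarrow> s \<in> S \<Longrightarrow> a + s \<notin> V \<Longrightarrow> F a s \<in> \<int>"
    and "\<And>a. a \<in> V \<Longrightarrow> (\<Sum>s\<in>S. F a s) \<in> \<int>"
  shows "\<exists>H :: 'g \<Rightarrow> 'g \<Rightarrow> int. (\<forall>a\<in>V. \<forall>s\<in>S. \<lfloor>F a s\<rfloor> \<le> H a s \<and> H a s \<le> \<lceil>F a s\<rceil>) \<and>
           (\<forall>a\<in>V. \<forall>s\<in>S. a + s \<in> V \<longrightarrow> H (a + s) (- s) = - H a s) \<and>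
           (\<forall>a\<in>V. of_int (\<Sum>s\<in>S. H a s) = (\<Sum>s\<in>S. F a s))"
  using assms(5-7)
proof (induction "card {(a, s). a \<in> V \<and> s \<in> S \<and> F a s \<notin> \<int>}" arbitrary: F rule: less_induct)
  case less
  define X where "X F = {(a, s). a \<in> V \<and> s \<in> S \<and> F a s \<notin> \<int>}" for F :: "'g \<Rightarrow> 'g \<Rightarrow> real"
  have finX: "finite (X F)" for F
    by (rule finite_subset[of _ "V \<times> S"]) (use fin in \<open>auto simp: X_def\<close>)
  show ?case
  proof (cases "X F = {}")
    case True
    then have int: "of_int \<lfloor>F a s\<rfloor> = F a s" if "a \<in> V" "s \<in> S" for a s
      using that by (auto simp: X_def)
    show ?thesis
    proof (intro exI[of _ "\<lambda>a s. \<lfloor>F a s\<rfloor>"] conjI ballI impI)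
      fix a s assume as: "a \<in> V" "s \<in> S"
      show "\<lfloor>F a s\<rfloor> \<le> \<lceil>F a s\<rceil>" using le_of_int_ceiling of_int_floor_le order_trans of_int_le_iff by (metis floor_le_ceiling)
      assume "a + s \<in> V"
      then have "F (a + s) (- s) = of_int (- \<lfloor>F a s\<rfloor>)" 
        using as less.prems(1)[of a s] int[of a s, symmetric] by (metis of_int_minus)
      then show "\<lfloor>F (a + s) (- s)\<rfloor> = - \<lfloor>F a s\<rfloor>" by (simp only: floor_of_int)
    next
      fix a assume a: "a \<in> V"
      show "of_int (\<Sum>s\<in>S. \<lfloor>F a s\<rfloor>) = (\<Sum>s\<in>S. F a s)"
        unfolding of_int_sum by (rule sum.cong[OF refl int[OF a]])
    qed auto
  next
    case False
    have "\<exists>z. (\<exists>e\<in>X F. z e \<noteq> 0) \<and> (\<forall>a s. (a, s) \<in> X F \<longrightarrow> z (a + s, - s) = - z (a, s)) \<and>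
           (\<forall>v. (\<Sum>e\<in>{e\<in>X F. fst e = v}. z e) = (0::real))"
    proof (rule fractional_circulation_exists[OF finX False])
      fix a s assume as: "(a, s) \<in> X F"
      then show "s \<noteq> 0" using S by (auto simp: X_def)
      have "a + s \<in> V" using as less.prems(2) by (auto simp: X_def)
      then show "(a + s, - s) \<in> X F" using as less.prems(1) S(1) by (auto simp: X_def minus_in_Ints_iff)
      show "\<exists>t. t \<noteq> s \<and> (a, t) \<in> X F"
        using Ints_one_missing[of S "F a" s] as less.prems(3)[of a] fin by (auto simp: X_def)
    qed
    then obtain z where z: "\<exists>e\<in>X F. z e \<noteq> 0" "\<And>a s. (a, s) \<in> X F \<Longrightarrow> z (a + s, - s) = - z (a, s)"
      "\<And>v. (\<Sum>e\<in>{e\<in>X F. fst e = v}. z e) = (0::real)" by blast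
    define P where "P = {e\<in>X F. z e \<noteq> 0}"
    \<comment> \<open>How far the flow can move along \<open>z\<close> until the value at
      \<open>e\<close> meets the next integer. At the minimum \<open>t\<close> of these times no
      value has left its unit interval, and an edge attaining the minimum has become
      integral.\<close>
    define b where "b e = (let x = F (fst e) (snd e) in if z e > 0 then (of_int \<lceil>x\<rceil> - x) / z e else (of_int \<lfloor>x\<rfloor> - x) / z e)" for e
    have P: "finite P" "P \<noteq> {}" using finX z(1) by (auto simp: P_def)
    have bpos: "b e > 0" if "e \<in> P" for e
    proof -
      let ?x = "F (fst e) (snd e)"
      have x: "?x \<notin> \<int>" using that by (auto simp: P_def X_def)
      have "of_int \<lfloor>?x\<rfloor> \<noteq> ?x" "of_int \<lceil>?x\<rceil> \<noteq> ?x" using x by (metis Ints_of_int)+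
      then have "of_int \<lfloor>?x\<rfloor> < ?x" "?x < of_int \<lceil>?x\<rceil>"
        using of_int_floor_le[of ?x] le_of_int_ceiling[of ?x] by linarith+
      then show ?thesis using that unfolding b_def Let_def P_def
        by (auto simp: zero_less_divide_iff)
    qed
    define t where "t = Min (b ` P)"
    have t: "t > 0" using P bpos by (auto simp: t_def)
    have "t \<in> b ` P" unfolding t_def using P by (intro Min_in) auto
    then obtain e1 where e1: "e1 \<in> P" "t = b e1" by blast
    define F' where "F' a s = F a s + (if (a, s) \<in> X F then t * z (a, s) else 0)" for a s
    have bounds: "of_int \<lfloor>F a s\<rfloor> \<le> F' a s \<and> F' a s \<le> of_int \<lceil>F a s\<rceil>" for a s
    proof (cases "(a, s) \<in> P")
      case True
      then have "t \<le> b (a, s)" using P by (auto simp: t_def)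
      have PX: "(a, s) \<in> X F" "z (a, s) \<noteq> 0" using True by (auto simp: P_def)
      then have F': "F' a s = F a s + t * z (a, s)" by (simp add: F'_def)
      have fc: "of_int \<lfloor>F a s\<rfloor> \<le> F a s" "F a s \<le> of_int \<lceil>F a s\<rceil>" by auto
      show ?thesis
      proof (cases "z (a, s) > 0")
        case True
        then have "t * z (a, s) \<le> of_int \<lceil>F a s\<rceil> - F a s" "0 \<le> t * z (a, s)"
          using \<open>t \<le> b (a, s)\<close> t by (simp_all add: b_def Let_def pos_le_divide_eq)
        then show ?thesis using fc F' by linarith
      next
        case False
        then have neg: "z (a, s) < 0" using PX by simp
        then have "of_int \<lfloor>F a s\<rfloor> - F a s \<le> t * z (a, s)"
          using \<open>t \<le> b (a, s)\<close> False by (simp add: b_def Let_def neg_le_divide_eq)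
        moreover have "t * z (a, s) \<le> 0" using neg t by (simp add: mult_le_0_iff)
        ultimately show ?thesis using fc F' by linarith
      qed
    next
      case False
      then show ?thesis by (auto simp: F'_def P_def)
    qed
    have int': "F' a s = F a s" if "(a, s) \<notin> X F" for a s using that by (simp add: F'_def)
    have sub: "X F' \<subseteq> X F" using int' by (auto simp: X_def)
    have divF': "(\<Sum>s\<in>S. F' a s) = (\<Sum>s\<in>S. F a s)" if "a \<in> V" for a
    proof -
      have "(\<Sum>s\<in>S. if (a, s) \<in> X F then z (a, s) else 0) = (\<Sum>s\<in>{s\<in>S. (a, s) \<in> X F}. z (a, s))"
        using fin by (simp add: sum.inter_filter)
      also have "\<dots> = (\<Sum>e\<in>{e\<in>X F. fst e = a}. z e)"
        by (rule sum.reindex_bij_witness[of _ snd "\<lambda>s. (a, s)"]) (auto simp: X_def)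
      finally have "(\<Sum>s\<in>S. if (a, s) \<in> X F then z (a, s) else 0) = 0" using z(3) by simp
      then have "t * (\<Sum>s\<in>S. if (a, s) \<in> X F then z (a, s) else 0) = 0" by simp
      then have "(\<Sum>s\<in>S. if (a, s) \<in> X F then t * z (a, s) else 0) = 0"
        by (simp add: sum_distrib_left if_distrib cong: if_cong)
      then show ?thesis by (simp add: F'_def sum.distrib)
    qed
    have "F' (fst e1) (snd e1) \<in> \<int>"
    proof -
      have "e1 \<in> X F" "z e1 \<noteq> 0" using e1 by (auto simp: P_def)
      then show ?thesis unfolding F'_def e1(2) b_def Let_def by auto
    qed
    then have "e1 \<notin> X F'" "e1 \<in> X F" using e1 by (auto simp: X_def P_def)
    then have "card (X F') < card (X F)" using sub finX by (metis psubset_card_mono psubsetI)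
    moreover have "F' (a + s) (- s) = - F' a s" if "a \<in> V" "s \<in> S" "a + s \<in> V" for a s
    proof -
      have "(a + s, - s) \<in> X F \<longleftrightarrow> (a, s) \<in> X F"
        using that less.prems(1)[of a s] S by (auto simp: X_def minus_in_Ints_iff)
      then show ?thesis using that less.prems(1)[of a s] z(2)[of a s] by (auto simp: F'_def)
    qed
    moreover have "F' a s \<in> \<int>" if "a \<in> V" "s \<in> S" "a + s \<notin> V" for a s
      using that less.prems(2)[of a s] int'[of a s] by (auto simp: X_def)
    moreover have "(\<Sum>s\<in>S. F' a s) \<in> \<int>" if "a \<in> V" for a
      using less.prems(3)[OF that] divF'[OF that] by simp
    ultimately have "\<exists>H :: 'g \<Rightarrow> 'g \<Rightarrow> int. (\<forall>a\<in>V. \<forall>s\<in>S. \<lfloor>F' a s\<rfloor> \<le> H a s \<and> H a s \<le> \<lceil>F' a s\<rceil>) \<and>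
           (\<forall>a\<in>V. \<forall>s\<in>S. a + s \<in> V \<longrightarrow> H (a + s) (- s) = - H a s) \<and>
           (\<forall>a\<in>V. of_int (\<Sum>s\<in>S. H a s) = (\<Sum>s\<in>S. F' a s))"
      unfolding X_def by (rule less.hyps)
    then obtain H where H: "\<forall>a\<in>V. \<forall>s\<in>S. \<lfloor>F' a s\<rfloor> \<le> H a s \<and> H a s \<le> \<lceil>F' a s\<rceil>"
           "\<forall>a\<in>V. \<forall>s\<in>S. a + s \<in> V \<longrightarrow> H (a + s) (- s) = - H a s"
           "\<forall>a\<in>V. of_int (\<Sum>s\<in>S. H a s) = (\<Sum>s\<in>S. F' a s)"
      by blast
    have "\<lfloor>F a s\<rfloor> \<le> \<lfloor>F' a s\<rfloor>" "\<lceil>F' a s\<rceil> \<le> \<lceil>F a s\<rceil>" for a s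
      using bounds[of a s] by (simp_all add: le_floor_iff ceiling_le_iff)
    then have "\<forall>a\<in>V. \<forall>s\<in>S. \<lfloor>F a s\<rfloor> \<le> H a s \<and> H a s \<le> \<lceil>F a s\<rceil>"
      using H(1) by (meson order_trans)
    then show ?thesis using H(2,3) divF' by (intro exI[of _ H] conjI) auto
  qed
qed

section \<open>Circulations around boxes\<close>

text \<open>A flow is a function of a start \<open>b\<close> and a step \<open>t\<close>, with
  opposite values on an edge and its reversal. This one sends one unit from \<open>a\<close> to
  \<open>a + s\<close>.\<close>

definition edge_flow :: "'g::ab_group_add \<Rightarrow> 'g \<Rightarrow> 'g \<Rightarrow> 'g \<Rightarrow> real" where
  "edge_flow a s b t = of_bool (b = a \<and> t = s) - of_bool (b = a + s \<and> t = - s)"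

definition antisymmetric_flow :: "('g::ab_group_add \<Rightarrow> 'g \<Rightarrow> real) \<Rightarrow> bool" where
  "antisymmetric_flow f \<longleftrightarrow> (\<forall>b t. f (b + t) (- t) = - f b t)"

lemma antisymmetric_flowD: "antisymmetric_flow f \<Longrightarrow> f (b + t) (- t) = - f b t"
  by (simp add: antisymmetric_flow_def)

lemma antisymmetric_edge_flow: "antisymmetric_flow (edge_flow a s)"
proof -
  have "b + t = a \<and> - t = s \<longleftrightarrow> b = a + s \<and> t = - s" for b t
    by (auto simp: algebra_simps)
  moreover have "b + t = a + s \<and> - t = - s \<longleftrightarrow> b = a \<and> t = s" for b t
    by auto
  ultimately show ?thesis
    by (simp add: antisymmetric_flow_def edge_flow_def)
qed

lemma antisymmetric_flow_add: "antisymmetric_flow f \<Longrightarrow> antisymmetric_flow g \<Longrightarrow> antisymmetric_flow (\<lambda>b t. f b t + g b t)"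
  by (simp add: antisymmetric_flow_def)

lemma antisymmetric_flow_diff: "antisymmetric_flow f \<Longrightarrow> antisymmetric_flow g \<Longrightarrow> antisymmetric_flow (\<lambda>b t. f b t - g b t)"
  by (simp add: antisymmetric_flow_def)

lemma edge_flow_divergence:
  assumes "finite S" "s \<in> S" "- s \<in> S"
  shows "(\<Sum>t\<in>S. edge_flow a s b t) = of_bool (b = a) - of_bool (b = a + s)"
proof -
  have "(\<Sum>t\<in>S. of_bool (b = c \<and> t = u) :: real) = of_bool (b = c)" if "u \<in> S" for c u
  proof (cases "b = c")
    case True
    then show ?thesis using assms(1) that by (simp add: of_bool_def)
  qed simp
  then show ?thesis using assms by (simp add: edge_flow_def sum_subtractf)
qed

text \<open>Written as conditions on \<open>a\<close> and \<open>s\<close>, so that for fixed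
  \<open>(b, t)\<close> a sum over a family of edges is estimated by counting members of the
  family.\<close>

lemma edge_flow_bound:
  "\<bar>edge_flow a s b t\<bar> \<le> of_bool (a = b \<and> s = t) + of_bool (a = b + t \<and> s = - t)"
proof -
  have "b = a + s \<and> t = - s \<longleftrightarrow> a = b + t \<and> s = - t" by (auto simp: algebra_simps)
  then show ?thesis by (auto simp: edge_flow_def)
qed

lemma edge_flow_nonzero:
  "edge_flow a s b t \<noteq> 0 \<Longrightarrow> (b = a \<and> b + t = a + s \<and> t = s) \<or> (b = a + s \<and> b + t = a \<and> t = - s)"
  by (cases "b = a \<and> t = s"; cases "b = a + s \<and> t = - s") (auto simp: edge_flow_def)

text \<open>Superposing the unit flows of the edges leaves only the two ends in the divergence.
  Distinctness keeps the values at most 1: the first edge touches \<open>x\<close>, which the flow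
  on the rest of the path avoids.\<close>

lemma path_flow_aux:
  assumes "rtrancl_path r x xs y" "distinct (x # xs)" "finite S"
    and r: "\<And>x y. r x y \<Longrightarrow> y - x \<in> S \<and> x - y \<in> S"
  shows "\<exists>P. antisymmetric_flow P \<and> (\<forall>b. (\<Sum>t\<in>S. P b t) = of_bool (b = x) - of_bool (b = y)) \<and>
     (\<forall>b t. P b t \<noteq> 0 \<longrightarrow> t \<in> S \<and> b \<in> set (x # xs) \<and> b + t \<in> set (x # xs)) \<and> (\<forall>b t. \<bar>P b t\<bar> \<le> 1)"
  using assms(1,2)
proof (induction rule: rtrancl_path.induct)
  case (base x)
  show ?case by (intro exI[of _ "\<lambda>_ _. 0"]) (simp add: antisymmetric_flow_def)
next
  case (step x y ys z)
  then obtain P where P: "antisymmetric_flow P" "\<And>b. (\<Sum>t\<in>S. P b t) = of_bool (b = y) - of_bool (b = z)"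
    "\<And>b t. P b t \<noteq> 0 \<Longrightarrow> t \<in> S \<and> b \<in> set (y # ys) \<and> b + t \<in> set (y # ys)" "\<And>b t. \<bar>P b t\<bar> \<le> 1"
    by auto
  have x: "x \<notin> set (y # ys)" using step.prems by simp
  have S: "y - x \<in> S" "- (y - x) \<in> S" using r[OF step.hyps(1)] by auto
  let ?Q = "\<lambda>b t. edge_flow x (y - x) b t + P b t"
  have e: "b \<in> {x, y} \<and> b + t \<in> {x, y} \<and> (b = x \<or> b + t = x) \<and> t \<in> S"
    if "edge_flow x (y - x) b t \<noteq> 0" for b t
    using edge_flow_nonzero[OF that] S by auto
  have "\<bar>?Q b t\<bar> \<le> 1" for b t
  proof (cases "edge_flow x (y - x) b t = 0")
    case False
    then have "P b t = 0" using e[OF False] P(3)[of b t] x by auto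
    then show ?thesis by (simp add: edge_flow_def)
  qed (use P(4) in auto)
  moreover have "t \<in> S \<and> b \<in> set (x # y # ys) \<and> b + t \<in> set (x # y # ys)" if "?Q b t \<noteq> 0" for b t
    using that e[of b t] P(3)[of b t] by (cases "P b t = 0") auto
  moreover have "(\<Sum>t\<in>S. ?Q b t) = of_bool (b = x) - of_bool (b = z)" for b
    using edge_flow_divergence[OF assms(3) S, of x b] P(2)[of b] by (simp add: sum.distrib)
  ultimately show ?case
    using antisymmetric_flow_add[OF antisymmetric_edge_flow P(1)] by (intro exI[of _ ?Q]) blast
qed

text \<open>The walk is first cut down to a simple path, because repeated edges would spoil the
  bound 1.\<close>

lemma path_flow:
  assumes "r\<^sup>*\<^sup>* x y" "finite S" and r: "\<And>x y. r x y \<Longrightarrow> y - x \<in> S \<and> x - y \<in> S \<and> x \<in> A \<and> y \<in> A" and "x \<in> A"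
  shows "\<exists>P. antisymmetric_flow P \<and> (\<forall>b. (\<Sum>t\<in>S. P b t) = of_bool (b = x) - of_bool (b = y)) \<and>
     (\<forall>b t. P b t \<noteq> 0 \<longrightarrow> t \<in> S \<and> b \<in> A \<and> b + t \<in> A) \<and> (\<forall>b t. \<bar>P b t\<bar> \<le> 1)"
proof -
  obtain xs where "rtrancl_path r x xs y" using assms(1) by (auto simp: rtranclp_eq_rtrancl_path)
  then obtain xs' where xs': "rtrancl_path r x xs' y" "distinct (x # xs')"
    by (rule rtrancl_path_distinct)
  have r': "\<And>x y. r x y \<Longrightarrow> y - x \<in> S \<and> x - y \<in> S" using r by blast
  have "set xs' \<subseteq> A" using xs'(1)
    by (induction rule: rtrancl_path.induct) (use r in auto)
  then have sub: "set (x # xs') \<subseteq> A" using assms(4) by auto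
  obtain P where P: "antisymmetric_flow P" "\<forall>b. (\<Sum>t\<in>S. P b t) = of_bool (b = x) - of_bool (b = y)"
     "\<forall>b t. P b t \<noteq> 0 \<longrightarrow> t \<in> S \<and> b \<in> set (x # xs') \<and> b + t \<in> set (x # xs')" "\<forall>b t. \<bar>P b t\<bar> \<le> 1"
    using path_flow_aux[OF xs' assms(2) r'] by blast
  have "\<forall>b t. P b t \<noteq> 0 \<longrightarrow> t \<in> S \<and> b \<in> A \<and> b + t \<in> A"
    using P(3) sub by blast
  then show ?thesis using P(1,2,4) by blast
qed

lemma sum_of_bool_le_card:
  assumes "finite Y" "finite B" "\<And>e. e \<in> Y \<Longrightarrow> P e \<Longrightarrow> e \<in> B"
  shows "(\<Sum>e\<in>Y. of_bool (P e) :: real) \<le> card B"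
proof -
  have "(\<Sum>e\<in>Y. of_bool (P e) :: real) = card {e\<in>Y. P e}"
    using assms(1) by (simp add: of_bool_def sum.If_cases Int_def)
  also have "\<dots> \<le> card B" using assms by (auto intro!: card_mono)
  finally show ?thesis .
qed

text \<open>Fractional parts are pushed from the leaves of a forest to its roots; the amount leaving a node
  is the fractional part of the total weight of its descendants.\<close>

lemma forest_rounding:
  fixes par :: "'e \<Rightarrow> 'e" and depth :: "'e \<Rightarrow> nat" and grp :: "'e \<Rightarrow> 'h"
  assumes fin: "finite X" and Rt: "Rt \<subseteq> X"
    and par: "\<And>e. e \<in> X - Rt \<Longrightarrow> par e \<in> X" "\<And>e. e \<in> X - Rt \<Longrightarrow> depth (par e) < depth e"
    and grp: "\<And>e. e \<in> X - Rt \<Longrightarrow> grp (par e) = grp e"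
    and root: "\<And>r r'. r \<in> Rt \<Longrightarrow> r' \<in> Rt \<Longrightarrow> grp r = grp r' \<Longrightarrow> r = r'"
  shows "\<exists>D. (\<forall>e\<in>X. D e \<subseteq> X) \<and>
    (\<forall>F :: 'e \<Rightarrow> real. (\<forall>h. (\<Sum>e\<in>{e\<in>X. grp e = h}. F e) \<in> \<int>) \<longrightarrow>
      (\<forall>e\<in>X. F e + (\<Sum>c\<in>{c\<in>X - Rt. par c = e}. frac (\<Sum>d\<in>D c. F d)) -
                 (if e \<in> Rt then 0 else frac (\<Sum>d\<in>D e. F d)) \<in> \<int>))"
proof -
  define r where "r = {(c, par c) | c. c \<in> X - Rt}"
  \<comment> \<open>The descendants of \<open>e\<close>, chosen before any weights: in the
    application the weights vary with a point of the space, and the correction must depend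
    measurably on them.\<close>
  define D where "D e = {d\<in>X. (d, e) \<in> r\<^sup>*}" for e
  have sv: "single_valued r" by (auto simp: r_def single_valued_def)
  have dep: "depth y \<le> depth x" if "(x, y) \<in> r\<^sup>*" for x y
    using that
  proof (induction rule: rtrancl_induct)
    case (step y z)
    then show ?case using par(2)[of y] by (auto simp: r_def)
  qed simp
  define C where "C e = {c\<in>X - Rt. par c = e}" for e
  have finD: "finite (D e)" "finite (C e)" for e using fin by (auto simp: D_def C_def)
  have Dun: "D e = insert e (\<Union>c\<in>C e. D c)" if "e \<in> X" for e
  proof (intro set_eqI iffI)
    fix d assume d: "d \<in> D e"
    then have "(d, e) \<in> r\<^sup>*" "d \<in> X" by (auto simp: D_def)
    then show "d \<in> insert e (\<Union>c\<in>C e. D c)"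
      by (cases rule: rtranclE) (auto simp: r_def D_def C_def)
  next
    fix d assume d: "d \<in> insert e (\<Union>c\<in>C e. D c)"
    then consider "d = e" | c where "c \<in> C e" "d \<in> D c" by blast
    then show "d \<in> D e"
    proof cases
      case 2
      then have "(d, c) \<in> r\<^sup>*" "(c, e) \<in> r" "d \<in> X" by (auto simp: D_def C_def r_def)
      then show ?thesis by (auto simp: D_def)
    qed (use that in \<open>simp add: D_def\<close>)
  qed
  have eD: "e \<notin> D c" if "c \<in> C e" for c e
  proof
    assume "e \<in> D c"
    then have "depth c \<le> depth e" using dep by (auto simp: D_def)
    then show False using that par(2)[of c] by (auto simp: C_def)
  qed
  have aux: "c = c'" if "c \<in> C e" "c' \<in> C e" "(c, c') \<in> r\<^sup>*" for c c' e
    using that(3)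
  proof (cases rule: converse_rtranclE)
    case (step y)
    then have "y = e" using that by (auto simp: r_def C_def)
    then have "depth c' \<le> depth e" using step dep by auto
    then show ?thesis using that par(2)[of c'] by (auto simp: C_def)
  qed
  \<comment> \<open>Since \<open>r\<close> is a function, two nodes above a common descendant are
    comparable, and comparable siblings coincide because depth drops towards the root.\<close>
  have disj: "D c \<inter> D c' = {}" if c: "c \<in> C e" "c' \<in> C e" "c \<noteq> c'" for c c' e
  proof (rule ccontr)
    assume "D c \<inter> D c' \<noteq> {}"
    then obtain d where "(d, c) \<in> r\<^sup>*" "(d, c') \<in> r\<^sup>*" by (auto simp: D_def)
    then have "(c, c') \<in> r\<^sup>* \<or> (c', c) \<in> r\<^sup>*" by (rule single_valued_confluent[OF sv])
    then show False using aux[of c e c'] aux[of c' e c] c by auto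
  qed
  have sumD: "(\<Sum>d\<in>D e. F d) = F e + (\<Sum>c\<in>C e. \<Sum>d\<in>D c. F d)" if e: "e \<in> X" for e and F :: "'e \<Rightarrow> real"
  proof -
    have "(\<Sum>d\<in>D e. F d) = F e + (\<Sum>d\<in>(\<Union>c\<in>C e. D c). F d)"
      unfolding Dun[OF e] using eD finD by (subst sum.insert) auto
    also have "(\<Sum>d\<in>(\<Union>c\<in>C e. D c). F d) = (\<Sum>c\<in>C e. \<Sum>d\<in>D c. F d)"
      using finD disj by (intro sum.UNION_disjoint) auto
    finally show ?thesis .
  qed
  have reach: "\<exists>q\<in>Rt. (e, q) \<in> r\<^sup>* \<and> grp q = grp e" if "e \<in> X" for e
    using that
  proof (induction "depth e" arbitrary: e rule: less_induct)
    case less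
    show ?case
    proof (cases "e \<in> Rt")
      case False
      then have e: "e \<in> X - Rt" using less.prems by simp
      obtain q where "q \<in> Rt" "(par e, q) \<in> r\<^sup>*" "grp q = grp (par e)"
        using less.hyps[OF par(2)[OF e] par(1)[OF e]] by auto
      moreover have "(e, par e) \<in> r" using e by (auto simp: r_def)
      ultimately show ?thesis using grp[OF e] by (metis converse_rtrancl_into_rtrancl)
    qed auto
  qed
  have grpr: "grp x = grp y" if "(x, y) \<in> r\<^sup>*" for x y
    using that
  proof (induction rule: rtrancl_induct)
    case (step y z)
    then show ?case using grp[of y] by (auto simp: r_def)
  qed simp
  \<comment> \<open>The tree of a root is its whole group. Its total weight is therefore integral by
    assumption, and nothing has to leave the root.\<close>
  have Droot: "D q = {e\<in>X. grp e = grp q}" if q: "q \<in> Rt" for q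
  proof (intro set_eqI iffI)
    fix e assume "e \<in> {e\<in>X. grp e = grp q}"
    then obtain q' where "q' \<in> Rt" "(e, q') \<in> r\<^sup>*" "grp q' = grp q" "e \<in> X"
      using reach[of e] by auto
    then show "e \<in> D q" using root[of q' q] q by (auto simp: D_def)
  qed (use grpr in \<open>auto simp: D_def\<close>)
  have fr: "x - frac x \<in> \<int>" for x :: real by (simp add: frac_def)
  show ?thesis
  proof (intro exI[of _ D] conjI ballI allI impI)
    fix F :: "'e \<Rightarrow> real" and e
    assume F: "\<forall>h. (\<Sum>e\<in>{e\<in>X. grp e = h}. F e) \<in> \<int>" and e: "e \<in> X"
    define A where "A e = (\<Sum>d\<in>D e. F d)" for e
    have A: "A e = F e + (\<Sum>c\<in>C e. A c)" using sumD[OF e] by (simp add: A_def)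
    have 1: "(\<Sum>c\<in>C e. A c - frac (A c)) \<in> \<int>" by (intro Ints_sum fr)
    have 2: "A e - (if e \<in> Rt then 0 else frac (A e)) \<in> \<int>"
      using fr F Droot[of e] by (auto simp: A_def)
    have "F e + (\<Sum>c\<in>C e. frac (A c)) - (if e \<in> Rt then 0 else frac (A e)) =
       (A e - (if e \<in> Rt then 0 else frac (A e))) - (\<Sum>c\<in>C e. A c - frac (A c))"
      using A by (simp add: sum_subtractf)
    then have "F e + (\<Sum>c\<in>C e. frac (A c)) - (if e \<in> Rt then 0 else frac (A e)) \<in> \<int>"
      using Ints_diff[OF 2 1] by (simp only:)
    then show "F e + (\<Sum>c\<in>{c\<in>X - Rt. par c = e}. frac (\<Sum>d\<in>D c. F d)) -
                 (if e \<in> Rt then 0 else frac (\<Sum>d\<in>D e. F d)) \<in> \<int>"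
      unfolding C_def A_def .
  qed (auto simp: D_def)
qed

text \<open>The group \<open>Z^m\<close> is modelled by the functions that vanish from index
  \<open>m\<close> on, because the rank \<open>m\<close> is only found in the course of the proof.
  The box is half open.\<close>

definition cube :: "nat \<Rightarrow> int \<Rightarrow> int \<Rightarrow> (nat \<Rightarrow> int) set" where
  "cube m l h = {a. (\<forall>i<m. l \<le> a i \<and> a i < h) \<and> (\<forall>i\<ge>m. a i = 0)}"

definition unit_vec :: "nat \<Rightarrow> int \<Rightarrow> nat \<Rightarrow> int" where
  "unit_vec i c = (\<lambda>j. if j = i then c else 0)"

definition adjacent :: "nat \<Rightarrow> (nat \<Rightarrow> int) set \<Rightarrow> (nat \<Rightarrow> int) \<Rightarrow> (nat \<Rightarrow> int) \<Rightarrow> bool" where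
  "adjacent m A x y \<longleftrightarrow> x \<in> A \<and> y \<in> A \<and> (\<exists>i<m. y - x = unit_vec i 1 \<or> y - x = unit_vec i (- 1))"

lemma uminus_unit_vec: "- unit_vec i c = unit_vec i (- c)"
  by (auto simp: unit_vec_def fun_eq_iff)

lemma adjacent_sym: "adjacent m A x y \<Longrightarrow> adjacent m A y x"
proof -
  have "y - x = unit_vec i c \<Longrightarrow> x - y = unit_vec i (- c)" for i c
    by (metis minus_diff_eq uminus_unit_vec)
  then show "adjacent m A x y \<Longrightarrow> adjacent m A y x"
    unfolding adjacent_def by (metis minus_minus)
qed

lemma adjacent_star_sym: "(adjacent m A)\<^sup>*\<^sup>* x y \<Longrightarrow> (adjacent m A)\<^sup>*\<^sup>* y x"
  by (metis adjacent_sym symp_def symp_rtranclp)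

lemma adjacent_line:
  assumes "k < m" "\<And>c. min v w \<le> c \<Longrightarrow> c \<le> max v w \<Longrightarrow> x(k := c) \<in> A"
  shows "(adjacent m A)\<^sup>*\<^sup>* (x(k := v)) (x(k := w))"
proof -
  have *: "(\<forall>c. v \<le> c \<longrightarrow> c \<le> w \<longrightarrow> x(k := c) \<in> A) \<longrightarrow> (adjacent m A)\<^sup>*\<^sup>* (x(k := v)) (x(k := w))"
    if "v \<le> w" for v w :: int
    using that
  proof (induction w rule: int_ge_induct)
    case (step w)
    show ?case
    proof
      assume A: "\<forall>c. v \<le> c \<longrightarrow> c \<le> w + 1 \<longrightarrow> x(k := c) \<in> A"
      have "\<forall>c. v \<le> c \<longrightarrow> c \<le> w \<longrightarrow> x(k := c) \<in> A"
        by (intro allI impI, rule A[rule_format]) linarith+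
      then have "(adjacent m A)\<^sup>*\<^sup>* (x(k := v)) (x(k := w))" using step by blast
      moreover have "x(k := w + 1) - x(k := w) = unit_vec k 1"
        by (auto simp: fun_eq_iff unit_vec_def)
      then have "adjacent m A (x(k := w)) (x(k := w + 1))"
        unfolding adjacent_def by (intro conjI exI[of _ k] A[rule_format] assms disjI1) (use step in linarith)+
      ultimately show "(adjacent m A)\<^sup>*\<^sup>* (x(k := v)) (x(k := w + 1))" by (meson rtranclp.rtrancl_into_rtrancl)
    qed
  qed simp
  show ?thesis
  proof (cases "v \<le> w")
    case True
    then show ?thesis using *[OF True] assms(2) by (simp only: min_absorb1 max_absorb2) blast
  next
    case False
    then have "w \<le> v" by simp
    then show ?thesis using *[of w v] assms(2) adjacent_star_sym
      by (simp only: min_absorb2 max_absorb1) blast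
  qed
qed

text \<open>The coordinates of \<open>x\<close> are turned into those of \<open>y\<close> one at a
  time in increasing order; the second assumption lists the points met while coordinate
  \<open>k\<close> moves.\<close>

lemma adjacent_staircase:
  assumes "\<And>i. i \<ge> m \<Longrightarrow> x i = y i"
    and A: "\<And>k c. k < m \<Longrightarrow> min (x k) (y k) \<le> c \<Longrightarrow> c \<le> max (x k) (y k) \<Longrightarrow>
       (\<lambda>i. if i < k then y i else if i = k then c else x i) \<in> A"
  shows "(adjacent m A)\<^sup>*\<^sup>* x y"
proof -
  have "k \<le> m \<Longrightarrow> (adjacent m A)\<^sup>*\<^sup>* x (\<lambda>i. if i < k then y i else x i)" for k
  proof (induction k)
    case (Suc k)
    let ?g = "\<lambda>i. if i < k then y i else x i"
    have "(adjacent m A)\<^sup>*\<^sup>* (?g(k := x k)) (?g(k := y k))"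
    proof (rule adjacent_line)
      fix c assume "min (x k) (y k) \<le> c" "c \<le> max (x k) (y k)"
      then have "(\<lambda>i. if i < k then y i else if i = k then c else x i) \<in> A" using A Suc by auto
      moreover have "?g(k := c) = (\<lambda>i. if i < k then y i else if i = k then c else x i)"
        by auto
      ultimately show "?g(k := c) \<in> A" by simp
    qed (use Suc in simp)
    moreover have "?g(k := x k) = ?g" by auto
    moreover have "?g(k := y k) = (\<lambda>i. if i < Suc k then y i else x i)" by (auto simp: fun_eq_iff less_Suc_eq)
    ultimately show ?case using Suc by (metis (no_types, lifting) Suc_leD rtranclp_trans)
  qed simp
  then have "(adjacent m A)\<^sup>*\<^sup>* x (\<lambda>i. if i < m then y i else x i)" by simp
  moreover have "(\<lambda>i. if i < m then y i else x i) = y" using assms(1) by (auto simp: fun_eq_iff)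
  ultimately show ?thesis by simp
qed


text \<open>The direction in which all crossing flow is collected. One direction is enough unless
  \<open>m = 1\<close>: then the two ends of an interval cannot be joined near the boundary, and the
  sign of the step is kept.\<close>

definition base_vec :: "nat \<Rightarrow> (nat \<Rightarrow> int) \<Rightarrow> nat \<Rightarrow> int" where
  "base_vec m s = unit_vec 0 (if m = 1 \<and> s 0 < 0 then - 1 else 1)"

definition box_crossing :: "nat \<Rightarrow> (nat \<Rightarrow> int) set \<Rightarrow> int \<Rightarrow> ((nat \<Rightarrow> int) \<times> (nat \<Rightarrow> int)) set" where
  "box_crossing m S n = {(p, s). p \<in> cube m 0 n \<and> s \<in> S \<and> p + s \<notin> cube m 0 n}"

definition box_shell :: "nat \<Rightarrow> int \<Rightarrow> int \<Rightarrow> (nat \<Rightarrow> int) set" where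
  "box_shell m R n = cube m (- R) (n + R) - cube m R (n - R)"

lemma finite_cube: "finite (cube m l h)"
proof -
  have "cube m l h \<subseteq> {f. \<forall>x. (x \<in> {..<m} \<longrightarrow> f x \<in> {l..<h}) \<and> (x \<notin> {..<m} \<longrightarrow> f x = 0)}"
    by (auto simp: cube_def)
  then show ?thesis by (rule finite_subset) (intro finite_set_of_finite_funs; simp)
qed

lemma finite_box_crossing: "finite S \<Longrightarrow> finite (box_crossing m S n)"
  by (rule finite_subset[of _ "cube m 0 n \<times> S"]) (auto simp: box_crossing_def finite_cube)

lemma in_cubeI: "(\<And>i. i < m \<Longrightarrow> l \<le> a i \<and> a i < h) \<Longrightarrow> (\<And>i. i \<ge> m \<Longrightarrow> a i = 0) \<Longrightarrow> a \<in> cube m l h"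
  by (simp add: cube_def)

lemma in_cubeD: "a \<in> cube m l h \<Longrightarrow> i < m \<Longrightarrow> l \<le> a i \<and> a i < h" "a \<in> cube m l h \<Longrightarrow> i \<ge> m \<Longrightarrow> a i = 0"
  by (simp_all add: cube_def)

lemma not_in_cubeI: "i < m \<Longrightarrow> a i < l \<or> h \<le> a i \<Longrightarrow> a \<notin> cube m l h"
  by (auto simp: cube_def)

lemma not_in_cubeE:
  assumes "a \<notin> cube m l h" "\<And>i. i \<ge> m \<Longrightarrow> a i = 0"
  obtains i where "i < m" "a i < l \<or> h \<le> a i"
  using assms by (auto simp: cube_def not_le not_less)

section \<open>Circulations near the boundary of one box\<close>

locale box_setup =
  fixes m :: nat and S :: "(nat \<Rightarrow> int) set" and R n :: int
  assumes finS: "finite S" and symS: "\<And>s. s \<in> S \<Longrightarrow> - s \<in> S" and S0: "0 \<notin> S"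
    and Sm: "\<And>s i. s \<in> S \<Longrightarrow> i \<ge> m \<Longrightarrow> s i = 0"
    and SR: "\<And>s i. s \<in> S \<Longrightarrow> \<bar>s i\<bar> \<le> R" and units: "\<And>i. i < m \<Longrightarrow> unit_vec i 1 \<in> S"
    and R1: "R \<ge> 1" and nR: "n > 2 * R"
begin

abbreviation "B \<equiv> cube m 0 n"
abbreviation "X \<equiv> box_crossing m S n"
text \<open>The inner and the outer collar are kept apart: connecting paths stay in one of them, so
  they never use an edge that leaves the box.\<close>

definition "Ain = B - cube m R (n - R)"
definition "Aout = cube m (- R) (n + R) - B"

lemma units': "i < m \<Longrightarrow> c = 1 \<or> c = - 1 \<Longrightarrow> unit_vec i c \<in> S"
  using units[of i] symS[of "unit_vec i 1"] by (auto simp: uminus_unit_vec)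

lemma S_nonzero: assumes "s \<in> S" obtains i where "i < m" "s i \<noteq> 0"
proof -
  have "s \<noteq> 0" using assms S0 by auto
  then obtain i where "s i \<noteq> 0" by (auto simp: fun_eq_iff)
  then show ?thesis using that Sm[OF assms, of i] by (metis not_le)
qed

text \<open>The corner of the box towards which \<open>s\<close> points, with ties going up. A
  nonzero coordinate of \<open>s\<close> makes \<open>kap s + s\<close> leave the box. The
  corresponding corner of the enlarged box is \<open>hat s\<close>.\<close>

definition "kap s = (\<lambda>i. if i < m then (if s i < 0 then 0 else n - 1) else (0::int))"
definition "hat s = (\<lambda>i. if i < m then (if s i < 0 then - R else n + R - 1) else (0::int))"

lemma kap_B: "kap s \<in> B" using R1 nR by (auto simp: kap_def cube_def)

lemma m_pos: "s \<in> S \<Longrightarrow> 0 < m" by (elim S_nonzero) auto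

lemma base_S: "s \<in> S \<Longrightarrow> base_vec m s \<in> S"
  unfolding base_vec_def by (rule units') (auto dest: m_pos)

lemma base_base: "base_vec m (base_vec m s) = base_vec m s"
  by (auto simp: base_vec_def unit_vec_def)

lemma base_sign: "m = 1 \<Longrightarrow> s \<in> S \<Longrightarrow> (base_vec m s 0 < 0 \<longleftrightarrow> s 0 < 0)"
  by (auto simp: base_vec_def unit_vec_def)

lemma kap_X: assumes "s \<in> S" shows "(kap s, s) \<in> X"
proof -
  obtain i where i: "i < m" "s i \<noteq> 0" using S_nonzero[OF assms] .
  have "kap s + s \<notin> B" by (rule not_in_cubeI[OF i(1)]) (use i in \<open>auto simp: kap_def\<close>)
  then show ?thesis using kap_B assms by (simp add: box_crossing_def)
qed

lemma X_D: assumes "(p, s) \<in> X"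
  shows "p \<in> B" "s \<in> S" "p + s \<notin> B" "p \<in> Ain" "p + s \<in> Aout"
proof -
  show p: "p \<in> B" and s: "s \<in> S" and ps: "p + s \<notin> B" using assms by (auto simp: box_crossing_def)
  have z: "i \<ge> m \<Longrightarrow> (p + s) i = 0" for i using in_cubeD(2)[OF p] Sm[OF s] by simp
  obtain i where i: "i < m" "(p + s) i < 0 \<or> n \<le> (p + s) i" using not_in_cubeE[OF ps] z by blast
  have "p \<notin> cube m R (n - R)"
    by (rule not_in_cubeI[OF i(1)]) (use i SR[OF s, of i] in auto)
  then show "p \<in> Ain" using p by (simp add: Ain_def)
  have "p + s \<in> cube m (- R) (n + R)"
  proof (rule in_cubeI)
    fix j assume "j < m"
    then show "- R \<le> (p + s) j \<and> (p + s) j < n + R" using in_cubeD(1)[OF p, of j] SR[OF s, of j] by auto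
  qed (rule z)
  then show "p + s \<in> Aout" using ps by (simp add: Aout_def)
qed

lemma core_sub: "cube m R (n - R) \<subseteq> B" using R1 by (force simp: cube_def)

lemma A_shell: "Ain \<subseteq> box_shell m R n" "Aout \<subseteq> box_shell m R n"
  using R1 core_sub unfolding Ain_def Aout_def box_shell_def by (auto simp: cube_def)

text \<open>The crossing edges become a forest. An edge slides, keeping its step \<open>s\<close>,
  towards the corner \<open>kap s\<close>, always along the first coordinate that is not yet right;
  from the corner it jumps to the corner edge of \<open>base_vec m s\<close>. The roots are the
  corner edges in base directions.\<close>

definition "dir e = (LEAST i. fst e i \<noteq> kap (snd e) i)"
definition "stp e = unit_vec (dir e) (sgn (kap (snd e) (dir e) - fst e (dir e)))"
definition "par e = (if fst e \<noteq> kap (snd e) then (fst e + stp e, snd e)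
   else (kap (base_vec m (snd e)), base_vec m (snd e)))"
definition "Rt = {e\<in>X. fst e = kap (snd e) \<and> base_vec m (snd e) = snd e}"
text \<open>The extra 1 pays for the jump between corners, which leaves the distance to the corner
  at 0.\<close>

definition "dep e = (\<Sum>i<m. nat \<bar>fst e i - kap (snd e) i\<bar>) + (if base_vec m (snd e) = snd e then 0 else (1::nat))"

lemma dir: assumes "(p, s) \<in> X" "p \<noteq> kap s"
  shows "dir (p, s) < m" "p (dir (p, s)) \<noteq> kap s (dir (p, s))"
proof -
  have ex: "\<exists>i. p i \<noteq> kap s i" using assms(2) by (auto simp: fun_eq_iff)
  then show d: "p (dir (p, s)) \<noteq> kap s (dir (p, s))"
    unfolding dir_def fst_conv snd_conv by (rule LeastI_ex)
  show "dir (p, s) < m"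
    using d in_cubeD(2)[OF X_D(1)[OF assms(1)]] by (metis kap_def not_le)
qed

lemma stp_S: "(p, s) \<in> X \<Longrightarrow> p \<noteq> kap s \<Longrightarrow> stp (p, s) \<in> S"
  unfolding stp_def by (rule units') (auto simp: dir sgn_if dest: dir(2))

lemma stp_apply: "stp (p, s) i = (if i = dir (p, s) then sgn (kap s i - p i) else 0)"
  by (simp add: stp_def unit_vec_def)

text \<open>A slide never brings \<open>p + s\<close> back into the box: in a coordinate where it
  has left, \<open>s\<close> is nonzero and the corner lies at the face that was crossed, so the
  slide can only move it further out.\<close>

lemma par_X: assumes "e \<in> X" shows "par e \<in> X"
proof -
  obtain p s where e: "e = (p, s)" by (cases e)
  show ?thesis
  proof (cases "p = kap s")
    case True
    then show ?thesis using e kap_X base_S X_D(2) assms by (auto simp: par_def)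
  next
    case False
    have ps: "(p, s) \<in> X" using assms e by simp
    note p = X_D(1)[OF ps] and s = X_D(2)[OF ps] and d = dir[OF ps False]
    let ?u = "stp (p, s)"
    have kB: "0 \<le> kap s i \<and> kap s i < n" if "i < m" for i using in_cubeD(1)[OF kap_B that] .
    have z: "i \<ge> m \<Longrightarrow> ?u i = 0" for i using d(1) by (auto simp: stp_apply)
    have "p + ?u \<in> B"
    proof (rule in_cubeI)
      fix i assume i: "i < m"
      then show "0 \<le> (p + ?u) i \<and> (p + ?u) i < n"
        using in_cubeD(1)[OF p i] kB[OF i] by (auto simp: stp_apply sgn_if)
    next
      fix i assume i: "m \<le> i" then show "(p + ?u) i = 0" using z in_cubeD(2)[OF p i] by simp
    qed
    moreover have "p + ?u + s \<notin> B"
    proof -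
      have "i \<ge> m \<Longrightarrow> (p + s) i = 0" for i using in_cubeD(2)[OF p] Sm[OF s] by simp
      then obtain j where j: "j < m" "(p + s) j < 0 \<or> n \<le> (p + s) j" using not_in_cubeE[OF X_D(3)[OF ps]] by blast
      show ?thesis
        by (rule not_in_cubeI[OF j(1)])
           (use j in_cubeD(1)[OF p j(1)] in \<open>auto simp: stp_apply sgn_if kap_def split: if_splits\<close>)
    qed
    ultimately show ?thesis using e s False by (auto simp: par_def box_crossing_def)
  qed
qed

lemma par_dep: assumes "e \<in> X - Rt" shows "dep (par e) < dep e"
proof -
  obtain p s where e: "e = (p, s)" by (cases e)
  have ps: "(p, s) \<in> X" using assms e by simp
  show ?thesis
  proof (cases "p = kap s")
    case True
    then have "base_vec m s \<noteq> s" using assms e by (auto simp: Rt_def)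
    then show ?thesis using True e by (simp add: par_def dep_def base_base)
  next
    case False
    note d = dir[OF ps False]
    have "(\<Sum>i<m. nat \<bar>(p + stp (p, s)) i - kap s i\<bar>) < (\<Sum>i<m. nat \<bar>p i - kap s i\<bar>)"
    proof (rule sum_strict_mono_ex1)
      show "\<forall>i\<in>{..<m}. nat \<bar>(p + stp (p, s)) i - kap s i\<bar> \<le> nat \<bar>p i - kap s i\<bar>"
        by (auto simp: stp_apply sgn_if)
      show "\<exists>i\<in>{..<m}. nat \<bar>(p + stp (p, s)) i - kap s i\<bar> < nat \<bar>p i - kap s i\<bar>"
        using d by (intro bexI[of _ "dir (p, s)"]) (auto simp: stp_apply sgn_if)
    qed simp
    then show ?thesis using False e by (simp add: par_def dep_def)
  qed
qed

lemma adjacent_S: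
  assumes "adjacent m A x y" shows "y - x \<in> S \<and> x - y \<in> S \<and> x \<in> A \<and> y \<in> A"
proof -
  obtain i where i: "i < m" "y - x = unit_vec i 1 \<or> y - x = unit_vec i (- 1)" "x \<in> A" "y \<in> A"
    using assms by (auto simp: adjacent_def)
  then have "y - x \<in> S" using units' by auto
  then show ?thesis using symS[of "y - x"] i by simp
qed

lemma other_coordinate: assumes "k < m" "2 \<le> m" obtains j where "j < m" "j \<noteq> k"
  using assms by (cases "k = 0") (auto intro: that[of 1] that[of 0])

text \<open>With two or more coordinates, another one stays extreme while coordinate
  \<open>k\<close> moves, so the path keeps to the faces. For \<open>m = 1\<close> both corners
  coincide, since \<open>base_vec\<close> keeps the sign.\<close>

lemma inner_path: assumes s: "s \<in> S" shows "(adjacent m Ain)\<^sup>*\<^sup>* (kap s) (kap (base_vec m s))"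
proof (rule adjacent_staircase)
  fix k c assume k: "k < m" and c: "min (kap s k) (kap (base_vec m s) k) \<le> c" "c \<le> max (kap s k) (kap (base_vec m s) k)"
  let ?x = "\<lambda>i. if i < k then kap (base_vec m s) i else if i = k then c else kap s i"
  have kB: "0 \<le> kap t i \<and> kap t i < n" if "i < m" for i t using in_cubeD(1)[OF kap_B that] .
  have "?x \<in> B"
  proof (rule in_cubeI)
    fix i assume i: "i < m"
    show "0 \<le> ?x i \<and> ?x i < n" using c kB[OF i, of s] kB[OF i, of "base_vec m s"] by auto
  qed (use k in \<open>auto simp: kap_def\<close>)
  moreover have "?x \<notin> cube m R (n - R)"
  proof (cases "2 \<le> m")
    case True
    then obtain j where j: "j < m" "j \<noteq> k" using other_coordinate k by blast
    show ?thesis by (rule not_in_cubeI[OF j(1)]) (use j R1 in \<open>auto simp: kap_def\<close>)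
  next
    case False
    then have m: "m = 1" "k = 0" using k by auto
    then have "kap s 0 = kap (base_vec m s) 0" unfolding kap_def using base_sign[OF m(1) s] by simp
    then have "c = kap s 0" using c m by auto
    then show ?thesis using not_in_cubeI[of 0 m ?x R "n - R"] m R1 kap_def[of s] by (auto split: if_splits)
  qed
  ultimately show "?x \<in> Ain" by (simp add: Ain_def)
qed (simp add: kap_def)

lemma hat_path: assumes s: "s \<in> S" shows "(adjacent m Aout)\<^sup>*\<^sup>* (hat s) (hat (base_vec m s))"
proof (rule adjacent_staircase)
  fix k c assume k: "k < m" and c: "min (hat s k) (hat (base_vec m s) k) \<le> c" "c \<le> max (hat s k) (hat (base_vec m s) k)"
  let ?x = "\<lambda>i. if i < k then hat (base_vec m s) i else if i = k then c else hat s i"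
  have kB: "- R \<le> hat t i \<and> hat t i < n + R" if "i < m" for i t using that R1 nR by (auto simp: hat_def)
  have "?x \<in> cube m (- R) (n + R)"
  proof (rule in_cubeI)
    fix i assume i: "i < m"
    show "- R \<le> ?x i \<and> ?x i < n + R" using c kB[OF i, of s] kB[OF i, of "base_vec m s"] by auto
  qed (use k in \<open>auto simp: hat_def\<close>)
  moreover have "?x \<notin> B"
  proof (cases "2 \<le> m")
    case True
    then obtain j where j: "j < m" "j \<noteq> k" using other_coordinate k by blast
    show ?thesis by (rule not_in_cubeI[OF j(1)]) (use j R1 in \<open>auto simp: hat_def\<close>)
  next
    case False
    then have m: "m = 1" "k = 0" using k by auto
    then have "hat s 0 = hat (base_vec m s) 0" unfolding hat_def using base_sign[OF m(1) s] by simp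
    then have "c = hat s 0" using c m by auto
    then show ?thesis using not_in_cubeI[of 0 m ?x 0 n] m R1 hat_def[of s] by (auto split: if_splits)
  qed
  ultimately show "?x \<in> Aout" by (simp add: Aout_def)
qed (simp add: hat_def)

text \<open>A coordinate with \<open>s i \<noteq> 0\<close> lies beyond the same face at both ends
  of the path, hence all along it.\<close>

lemma corner_path: assumes s: "s \<in> S" shows "(adjacent m Aout)\<^sup>*\<^sup>* (kap s + s) (hat s)"
proof (rule adjacent_staircase)
  fix k c assume k: "k < m" and c: "min ((kap s + s) k) (hat s k) \<le> c" "c \<le> max ((kap s + s) k) (hat s k)"
  let ?x = "\<lambda>i. if i < k then hat s i else if i = k then c else (kap s + s) i"
  have kB: "- R \<le> hat s i \<and> hat s i < n + R" "- R \<le> (kap s + s) i \<and> (kap s + s) i < n + R" if "i < m" for i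
    using that R1 nR SR[OF s, of i] by (auto simp: hat_def kap_def)
  have "?x \<in> cube m (- R) (n + R)"
  proof (rule in_cubeI)
    fix i assume i: "i < m"
    show "- R \<le> ?x i \<and> ?x i < n + R" using c kB[OF i] by auto
  qed (use k Sm[OF s] in \<open>auto simp: hat_def kap_def\<close>)
  moreover have "?x \<notin> B"
  proof -
    obtain i where i: "i < m" "s i \<noteq> 0" using S_nonzero[OF s] .
    show ?thesis
      by (rule not_in_cubeI[OF i(1)]) (use i c R1 SR[OF s, of i] in \<open>auto simp: hat_def kap_def split: if_splits\<close>)
  qed
  ultimately show "?x \<in> Aout" by (simp add: Aout_def)
qed (use Sm[OF s] in \<open>simp add: hat_def kap_def\<close>)

lemma outer_path: assumes s: "s \<in> S"
  shows "(adjacent m Aout)\<^sup>*\<^sup>* (kap (base_vec m s) + base_vec m s) (kap s + s)"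
proof -
  have "(adjacent m Aout)\<^sup>*\<^sup>* (kap s + s) (hat (base_vec m s))"
    using corner_path[OF s] hat_path[OF s] by (rule rtranclp_trans)
  moreover have "(adjacent m Aout)\<^sup>*\<^sup>* (hat (base_vec m s)) (kap (base_vec m s) + base_vec m s)"
    using corner_path[OF base_S[OF s]] by (rule adjacent_star_sym)
  ultimately show ?thesis using adjacent_star_sym rtranclp_trans by metis
qed

text \<open>Each edge other than a root gets a circulation that takes one unit off it and puts one
  on its parent, closed up inside the two collars. Adding it with the fractional part of the total
  weight below the edge as coefficient carries out the forest rounding, so all crossing values
  become integral. The bound does not involve the side \<open>n\<close>, which is what allows boxes
  of unbounded size later.\<close>

lemma boundary_circulations:
  "\<exists>(I :: ((nat \<Rightarrow> int) \<times> (nat \<Rightarrow> int)) set) D z. finite I \<and> (\<forall>k\<in>I. D k \<subseteq> X) \<and>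
   (\<forall>k\<in>I. antisymmetric_flow (z k) \<and> (\<forall>b. (\<Sum>t\<in>S. z k b t) = 0) \<and>
      (\<forall>b t. z k b t \<noteq> 0 \<longrightarrow> t \<in> S \<and> b \<in> box_shell m R n \<and> b + t \<in> box_shell m R n)) \<and>
   (\<forall>b t. (\<Sum>k\<in>I. \<bar>z k b t\<bar>) \<le> 12 * real (card S)) \<and>
   (\<forall>F. (\<forall>h. (\<Sum>e\<in>{e\<in>X. base_vec m (snd e) = h}. F e) \<in> \<int>) \<longrightarrow>
     (\<forall>b t. (b, t) \<in> X \<longrightarrow> F (b, t) + (\<Sum>k\<in>I. frac (\<Sum>e\<in>D k. F e) * z k b t) \<in> \<int>))"
proof -
  have finX: "finite X" using finite_box_crossing[OF finS] .
  have "\<forall>s\<in>S. \<exists>P. antisymmetric_flow P \<and> (\<forall>b. (\<Sum>t\<in>S. P b t) = of_bool (b = kap s) - of_bool (b = kap (base_vec m s))) \<and>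
     (\<forall>b t. P b t \<noteq> 0 \<longrightarrow> t \<in> S \<and> b \<in> Ain \<and> b + t \<in> Ain) \<and> (\<forall>b t. \<bar>P b t\<bar> \<le> 1)"
    using path_flow[OF inner_path finS adjacent_S] X_D(4)[OF kap_X] by blast
  then obtain Pin where Pin: "\<And>s. s \<in> S \<Longrightarrow> antisymmetric_flow (Pin s)"
     "\<And>s b. s \<in> S \<Longrightarrow> (\<Sum>t\<in>S. Pin s b t) = of_bool (b = kap s) - of_bool (b = kap (base_vec m s))"
     "\<And>s b t. s \<in> S \<Longrightarrow> Pin s b t \<noteq> 0 \<Longrightarrow> t \<in> S \<and> b \<in> Ain \<and> b + t \<in> Ain" "\<And>s b t. s \<in> S \<Longrightarrow> \<bar>Pin s b t\<bar> \<le> 1"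
    by metis
  have "\<forall>s\<in>S. \<exists>P. antisymmetric_flow P \<and> (\<forall>b. (\<Sum>t\<in>S. P b t) = of_bool (b = kap (base_vec m s) + base_vec m s) - of_bool (b = kap s + s)) \<and>
     (\<forall>b t. P b t \<noteq> 0 \<longrightarrow> t \<in> S \<and> b \<in> Aout \<and> b + t \<in> Aout) \<and> (\<forall>b t. \<bar>P b t\<bar> \<le> 1)"
    using path_flow[OF outer_path finS adjacent_S] X_D(5)[OF kap_X[OF base_S]] by blast
  then obtain Pout where Pout: "\<And>s. s \<in> S \<Longrightarrow> antisymmetric_flow (Pout s)"
     "\<And>s b. s \<in> S \<Longrightarrow> (\<Sum>t\<in>S. Pout s b t) = of_bool (b = kap (base_vec m s) + base_vec m s) - of_bool (b = kap s + s)"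
     "\<And>s b t. s \<in> S \<Longrightarrow> Pout s b t \<noteq> 0 \<Longrightarrow> t \<in> S \<and> b \<in> Aout \<and> b + t \<in> Aout" "\<And>s b t. s \<in> S \<Longrightarrow> \<bar>Pout s b t\<bar> \<le> 1"
    by metis
  \<comment> \<open>The connecting part. A slide is closed by one step inside and the opposite step
    outside; a jump between corners by a path in each collar.\<close>
  define w where "w e = (\<lambda>b t. if fst e \<noteq> kap (snd e) then edge_flow (fst e) (stp e) b t - edge_flow (fst e + snd e) (stp e) b t
     else Pin (snd e) b t + Pout (snd e) b t)" for e
  define z where "z e = (\<lambda>b t. (edge_flow (fst (par e)) (snd (par e)) b t - edge_flow (fst e) (snd e) b t) + w e b t)" for e
  have z_anti: "antisymmetric_flow (z e)" if "e \<in> X" for e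
  proof -
    have s: "snd e \<in> S" using X_D(2)[of "fst e" "snd e"] that by simp
    have "antisymmetric_flow (w e)"
      unfolding w_def using Pin(1)[OF s] Pout(1)[OF s]
      by (cases "fst e = kap (snd e)") (auto intro: antisymmetric_flow_add antisymmetric_flow_diff antisymmetric_edge_flow)
    then show ?thesis unfolding z_def
      by (intro antisymmetric_flow_add antisymmetric_flow_diff antisymmetric_edge_flow)
  qed
  have z_div: "(\<Sum>t\<in>S. z e b t) = 0" if e: "e \<in> X" for e b
  proof -
    obtain p s where ps: "e = (p, s)" by (cases e)
    have X: "(p, s) \<in> X" using e ps by simp
    have s: "s \<in> S" "- s \<in> S" using X_D(2)[OF X] symS by auto
    have bs: "base_vec m s \<in> S" "- base_vec m s \<in> S" using base_S[OF s(1)] symS by auto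
    show ?thesis
    proof (cases "p = kap s")
      case True
      then show ?thesis unfolding z_def w_def ps par_def
        by (simp add: sum.distrib sum_subtractf edge_flow_divergence[OF finS s] edge_flow_divergence[OF finS bs] Pin(2)[OF s(1)] Pout(2)[OF s(1)])
    next
      case False
      have u: "stp (p, s) \<in> S" "- stp (p, s) \<in> S" using stp_S[OF X False] symS by auto
      show ?thesis using False unfolding z_def w_def ps par_def
        by (simp add: sum.distrib sum_subtractf edge_flow_divergence[OF finS s] edge_flow_divergence[OF finS u] add_ac)
    qed
  qed
  have w_sup: "t \<in> S \<and> (b \<in> Ain \<and> b + t \<in> Ain \<or> b \<in> Aout \<and> b + t \<in> Aout)" if e: "e \<in> X" and nz: "w e b t \<noteq> 0" for e b t
  proof -
    obtain p s where ps: "e = (p, s)" by (cases e)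
    have X: "(p, s) \<in> X" using e ps by simp
    show ?thesis
    proof (cases "p = kap s")
      case True
      then have "Pin s b t \<noteq> 0 \<or> Pout s b t \<noteq> 0" using nz by (auto simp: w_def ps)
      then show ?thesis using Pin(3) Pout(3) X_D(2)[OF X] by blast
    next
      case False
      let ?u = "stp (p, s)"
      have u: "?u \<in> S" "- ?u \<in> S" using stp_S[OF X False] symS by auto
      have X': "(p + ?u, s) \<in> X" using par_X[OF X] False by (simp add: par_def)
      have in1: "p \<in> Ain" "p + ?u \<in> Ain" using X_D(4)[OF X] X_D(4)[OF X'] by auto
      have out1: "p + s \<in> Aout" "p + s + ?u \<in> Aout" using X_D(5)[OF X] X_D(5)[OF X'] by (auto simp: add_ac)
      have "edge_flow p ?u b t \<noteq> 0 \<or> edge_flow (p + s) ?u b t \<noteq> 0"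
        using nz False by (auto simp: w_def ps)
      then show ?thesis
      proof
        assume "edge_flow p ?u b t \<noteq> 0"
        from edge_flow_nonzero[OF this] show ?thesis using u in1 by auto
      next
        assume "edge_flow (p + s) ?u b t \<noteq> 0"
        from edge_flow_nonzero[OF this] show ?thesis using u out1 by auto
      qed
    qed
  qed
  have e_sup: "t \<in> S \<and> b \<in> box_shell m R n \<and> b + t \<in> box_shell m R n" if "(p, s) \<in> X" "edge_flow p s b t \<noteq> 0" for p s b t
    using edge_flow_nonzero[OF that(2)] X_D(2,4,5)[OF that(1)] symS A_shell by auto
  have z_sup: "t \<in> S \<and> b \<in> box_shell m R n \<and> b + t \<in> box_shell m R n" if e: "e \<in> X" and nz: "z e b t \<noteq> 0" for e b t
  proof -
    have "edge_flow (fst (par e)) (snd (par e)) b t \<noteq> 0 \<or> edge_flow (fst e) (snd e) b t \<noteq> 0 \<or> w e b t \<noteq> 0"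
      using nz by (auto simp: z_def)
    then show ?thesis
      using e_sup[of "fst e" "snd e" b t] e_sup[of "fst (par e)" "snd (par e)" b t] w_sup[OF e, of b t] e par_X[OF e] A_shell by auto
  qed
  have e_cross: "edge_flow p s b t = of_bool ((p, s) = (b, t))" if "(p, s) \<in> X" "(b, t) \<in> X" for p s b t
  proof -
    have "b \<noteq> p + s" using X_D(3)[OF that(1)] X_D(1)[OF that(2)] by auto
    then show ?thesis by (auto simp: edge_flow_def)
  qed
  \<comment> \<open>The connecting part lives in the collars and is invisible on crossing edges, so
    only the edge and its parent remain.\<close>
  have z_cross: "z e b t = of_bool (par e = (b, t)) - of_bool (e = (b, t))" if e: "e \<in> X" and b: "(b, t) \<in> X" for e b t
  proof -
    have "w e b t = 0" using w_sup[OF e, of b t] X_D(1,3)[OF b] by (auto simp: Ain_def Aout_def)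
    then show ?thesis using e_cross[of "fst e" "snd e" b t] e_cross[of "fst (par e)" "snd (par e)" b t] e par_X[OF e] b
      by (simp add: z_def)
  qed
  \<comment> \<open>The three kinds of edges contribute at most \<open>4 * card S\<close> (parents),
    2 (the edges themselves) and \<open>6 * card S\<close> (connections); the 2 is absorbed because
    \<open>S\<close> is nonempty when there are crossing edges.\<close>
  have z_bound: "(\<Sum>k\<in>X - Rt. \<bar>z k b t\<bar>) \<le> 12 * real (card S)" for b t
  proof (cases "X = {}")
    case False
    then have "S \<noteq> {}" using X_D(2) by fastforce
    then have S1: "1 \<le> real (card S)" using finS by (simp add: Suc_leI card_gt_0_iff)
    let ?b2 = "\<lambda>P Q. of_bool P + (of_bool Q :: real)"
    have 1: "(\<Sum>k\<in>X. \<bar>edge_flow (fst k) (snd k) b t\<bar>) \<le> 2"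
    proof -
      have "(\<Sum>k\<in>X. \<bar>edge_flow (fst k) (snd k) b t\<bar>) \<le> (\<Sum>k\<in>X. ?b2 (fst k = b \<and> snd k = t) (fst k = b + t \<and> snd k = - t))"
        by (intro sum_mono edge_flow_bound)
      also have "\<dots> \<le> real (card {(b, t)}) + real (card {(b + t, - t)})"
        unfolding sum.distrib by (intro add_mono sum_of_bool_le_card finX) auto
      finally show ?thesis by simp
    qed
    \<comment> \<open>At most \<open>card S\<close> children of an edge arise by sliding, one for
      each last step, and at most \<open>card S\<close> by jumping, one for each corner
      edge.\<close>
    have chil: "(\<Sum>k\<in>X. of_bool (fst (par k) = c \<and> snd (par k) = u) :: real) \<le> 2 * real (card S)" for c u
    proof -
      let ?B = "(\<lambda>v. (c - v, u)) ` S \<union> (\<lambda>s. (kap s, s)) ` S"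
      have "(\<Sum>k\<in>X. of_bool (fst (par k) = c \<and> snd (par k) = u) :: real) \<le> card ?B"
      proof (rule sum_of_bool_le_card)
        fix e assume e: "e \<in> X" "fst (par e) = c \<and> snd (par e) = u"
        obtain p s where ps: "e = (p, s)" by (cases e)
        have X: "(p, s) \<in> X" using e ps by simp
        show "e \<in> ?B"
        proof (cases "p = kap s")
          case True then show ?thesis using ps X_D(2)[OF X] by auto
        next
          case False
          then have "c = p + stp (p, s)" "u = s" using e ps by (auto simp: par_def)
          then show ?thesis using stp_S[OF X False] ps by (intro UnI1 image_eqI[of _ _ "stp (p, s)"]) auto
        qed
      qed (use finX finS in auto)
      also have "\<dots> \<le> real (card S + card S)"
        unfolding of_nat_le_iff by (rule order_trans[OF card_Un_le]) (intro add_mono card_image_le finS)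
      finally show ?thesis by simp
    qed
    have 2: "(\<Sum>k\<in>X. \<bar>edge_flow (fst (par k)) (snd (par k)) b t\<bar>) \<le> 4 * real (card S)"
    proof -
      have "(\<Sum>k\<in>X. \<bar>edge_flow (fst (par k)) (snd (par k)) b t\<bar>) \<le>
         (\<Sum>k\<in>X. ?b2 (fst (par k) = b \<and> snd (par k) = t) (fst (par k) = b + t \<and> snd (par k) = - t))"
        by (intro sum_mono edge_flow_bound)
      also have "\<dots> \<le> 2 * real (card S) + 2 * real (card S)"
        unfolding sum.distrib by (intro add_mono chil)
      finally show ?thesis by simp
    qed
    have img: "(\<Sum>k\<in>X. of_bool (P k) :: real) \<le> real (card S)"
      if "\<And>p s. (p, s) \<in> X \<Longrightarrow> P (p, s) \<Longrightarrow> p = g s" for P and g :: "(nat \<Rightarrow> int) \<Rightarrow> nat \<Rightarrow> int"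
    proof -
      have "(\<Sum>k\<in>X. of_bool (P k) :: real) \<le> card ((\<lambda>s. (g s, s)) ` S)"
        using that X_D(2) by (intro sum_of_bool_le_card finX finite_imageI finS) force
      also have "\<dots> \<le> real (card S)" using card_image_le[OF finS] by simp
      finally show ?thesis .
    qed
    let ?T = "\<lambda>k. ?b2 (fst k = b) (fst k = b + t) + ?b2 (fst k = b - snd k) (fst k = b + t - snd k) + 2 * of_bool (fst k = kap (snd k))"
    have wT: "\<bar>w k b t\<bar> \<le> ?T k" if k: "k \<in> X" for k
    proof (cases "fst k = kap (snd k)")
      case True
      have s: "snd k \<in> S" using X_D(2)[of "fst k" "snd k"] k by simp
      then have "\<bar>w k b t\<bar> \<le> 1 + 1" using Pin(4)[OF s, of b t] Pout(4)[OF s, of b t] True by (simp add: w_def)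
      then show ?thesis using True by (simp add: add_increasing)
    next
      case False
      have w3: "\<bar>w k b t\<bar> \<le> \<bar>edge_flow (fst k) (stp k) b t\<bar> + \<bar>edge_flow (fst k + snd k) (stp k) b t\<bar>"
        using False by (simp add: w_def)
      have w1: "\<bar>edge_flow (fst k) (stp k) b t\<bar> \<le> ?b2 (fst k = b) (fst k = b + t)"
        by (rule order_trans[OF edge_flow_bound]) (intro add_mono; simp)
      have w2: "\<bar>edge_flow (fst k + snd k) (stp k) b t\<bar> \<le> ?b2 (fst k = b - snd k) (fst k = b + t - snd k)"
        by (rule order_trans[OF edge_flow_bound]) (intro add_mono; auto simp: eq_diff_eq)
      have "(0::real) \<le> 2 * of_bool (fst k = kap (snd k))" by simp
      then show ?thesis using w1 w2 w3 by linarith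
    qed
    have 3: "(\<Sum>k\<in>X. \<bar>w k b t\<bar>) \<le> 6 * real (card S)"
    proof -
      have "(\<Sum>k\<in>X. \<bar>w k b t\<bar>) \<le> (\<Sum>k\<in>X. ?T k)" by (intro sum_mono wT)
      also have "\<dots> \<le> (real (card S) + real (card S)) + (real (card S) + real (card S)) + 2 * real (card S)"
        unfolding sum.distrib sum_distrib_left[symmetric]
        using img[of "\<lambda>k. fst k = b" "\<lambda>_. b"] img[of "\<lambda>k. fst k = b + t" "\<lambda>_. b + t"]
          img[of "\<lambda>k. fst k = b - snd k" "\<lambda>s. b - s"] img[of "\<lambda>k. fst k = b + t - snd k" "\<lambda>s. b + t - s"]
          img[of "\<lambda>k. fst k = kap (snd k)" kap]
        by (intro add_mono mult_left_mono) auto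
      finally show ?thesis by simp
    qed
    have "(\<Sum>k\<in>X - Rt. \<bar>z k b t\<bar>) \<le> (\<Sum>k\<in>X. \<bar>z k b t\<bar>)" using finX by (intro sum_mono2) auto
    also have "\<dots> \<le> (\<Sum>k\<in>X. \<bar>edge_flow (fst (par k)) (snd (par k)) b t\<bar> + \<bar>edge_flow (fst k) (snd k) b t\<bar> + \<bar>w k b t\<bar>)"
      unfolding z_def by (intro sum_mono) linarith
    also have "\<dots> \<le> 4 * real (card S) + 2 + 6 * real (card S)"
      unfolding sum.distrib by (intro add_mono 1 2 3)
    also have "\<dots> \<le> 12 * real (card S)" using S1 by simp
    finally show ?thesis .
  qed simp
  \<comment> \<open>The groups are the base directions: neither a slide nor a jump changes
    \<open>base_vec m (snd e)\<close>, and a root is determined by its group.\<close>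
  have "\<exists>D. (\<forall>e\<in>X. D e \<subseteq> X) \<and>
    (\<forall>F :: (nat \<Rightarrow> int) \<times> (nat \<Rightarrow> int) \<Rightarrow> real. (\<forall>h. (\<Sum>e\<in>{e\<in>X. base_vec m (snd e) = h}. F e) \<in> \<int>) \<longrightarrow>
      (\<forall>e\<in>X. F e + (\<Sum>c\<in>{c\<in>X - Rt. par c = e}. frac (\<Sum>d\<in>D c. F d)) -
                 (if e \<in> Rt then 0 else frac (\<Sum>d\<in>D e. F d)) \<in> \<int>))"
  proof (rule forest_rounding[where depth = dep])
    show "r = r'" if "r \<in> Rt" "r' \<in> Rt" "base_vec m (snd r) = base_vec m (snd r')" for r r'
      using that by (auto simp: Rt_def prod_eq_iff)
    show "base_vec m (snd (par e)) = base_vec m (snd e)" if "e \<in> X - Rt" for e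
      by (simp add: par_def base_base)
  qed (use finX par_X par_dep in \<open>auto simp: Rt_def\<close>)
  then obtain D where D: "\<forall>e\<in>X. D e \<subseteq> X" and DF: "\<And>F e. (\<forall>h. (\<Sum>e\<in>{e\<in>X. base_vec m (snd e) = h}. F e) \<in> \<int>) \<Longrightarrow> e \<in> X \<Longrightarrow>
      F e + (\<Sum>c\<in>{c\<in>X - Rt. par c = e}. frac (\<Sum>d\<in>D c. F d)) - (if e \<in> Rt then 0 else frac (\<Sum>d\<in>D e. F d :: real)) \<in> \<int>"
    by blast
  have final: "F (b, t) + (\<Sum>k\<in>X - Rt. frac (\<Sum>e\<in>D k. F e) * z k b t) \<in> \<int>"
    if F: "\<forall>h. (\<Sum>e\<in>{e\<in>X. base_vec m (snd e) = h}. F e) \<in> \<int>" and bt: "(b, t) \<in> X" for F b t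
  proof -
    let ?t = "\<lambda>k. frac (\<Sum>e\<in>D k. F e)"
    have "(\<Sum>k\<in>X - Rt. ?t k * z k b t) = (\<Sum>k\<in>X - Rt. (if par k = (b, t) then ?t k else 0) - (if k = (b, t) then ?t k else 0))"
      using bt by (intro sum.cong refl) (auto simp: z_cross)
    also have "\<dots> = (\<Sum>k\<in>{c\<in>X - Rt. par c = (b, t)}. ?t k) - (if (b, t) \<in> Rt then 0 else ?t (b, t))"
    proof -
      have "(\<Sum>k\<in>X - Rt. if par k = (b, t) then ?t k else 0) = (\<Sum>k\<in>{c\<in>X - Rt. par c = (b, t)}. ?t k)"
        using finX by (intro sum.inter_filter[symmetric]) auto
      moreover have "(\<Sum>k\<in>X - Rt. if k = (b, t) then ?t k else 0) = (if (b, t) \<in> Rt then 0 else ?t (b, t))"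
        using finX bt by simp
      ultimately show ?thesis by (simp only: sum_subtractf)
    qed
    finally show ?thesis using DF[OF F bt] by (simp add: add_diff_eq)
  qed
  show ?thesis
    by (rule exI[of _ "X - Rt"], rule exI[of _ D], rule exI[of _ z])
       (use finX D z_anti z_div z_sup z_bound final in auto)
qed

end

section \<open>Nested regions for actions of free abelian groups\<close>

lemma card_cube: assumes "l \<le> h" shows "card (cube m l h) = nat (h - l) ^ m"
proof -
  have "bij_betw (\<lambda>a. restrict a {..<m}) (cube m l h) (\<Pi>\<^sub>E i\<in>{..<m}. {l..<h})"
  proof (rule bij_betw_byWitness[where f' = "\<lambda>g i. if i < m then g i else 0"])
    show "\<forall>a\<in>cube m l h. (\<lambda>i. if i < m then restrict a {..<m} i else 0) = a"
      by (auto simp: cube_def fun_eq_iff)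
    show "\<forall>g\<in>\<Pi>\<^sub>E i\<in>{..<m}. {l..<h}. restrict (\<lambda>i. if i < m then g i else 0) {..<m} = g"
      by (auto simp: fun_eq_iff PiE_def extensional_def)
    show "(\<lambda>a. restrict a {..<m}) ` cube m l h \<subseteq> (\<Pi>\<^sub>E i\<in>{..<m}. {l..<h})"
      by (rule image_subsetI) (simp add: cube_def restrict_PiE_iff)
    show "(\<lambda>g i. if i < m then g i else 0) ` (\<Pi>\<^sub>E i\<in>{..<m}. {l..<h}) \<subseteq> cube m l h"
    proof (rule image_subsetI)
      fix g assume g: "g \<in> (\<Pi>\<^sub>E i\<in>{..<m}. {l..<h})"
      show "(\<lambda>i. if i < m then g i else 0) \<in> cube m l h"
        using PiE_mem[OF g] by (intro in_cubeI) auto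
    qed
  qed
  then have "card (cube m l h) = card (\<Pi>\<^sub>E i\<in>{..<m}. {l..<h})" by (rule bij_betw_same_card)
  then show ?thesis by (simp add: card_PiE)
qed

text \<open>Because \<open>1 / 2 \<le> r\<close>, the error of each step is at most
  \<open>r ^ j \<le> 2 * r ^ Suc j\<close>; the accumulated errors cost only a factor linear in
  \<open>j\<close>.\<close>

lemma recurrence_tendsto_0:
  fixes y :: "nat \<Rightarrow> real"
  assumes "\<And>j. 0 \<le> y j" "\<And>j. y (Suc j) \<le> r * y j + (1 / 2) ^ j" "r < 1" "1 / 2 \<le> r"
  shows "y \<longlonglongrightarrow> 0"
proof -
  have bnd: "y j \<le> (y 0 + 2 * real j) * r ^ j" for j
  proof (induction j)
    case (Suc j)
    have "y (Suc j) \<le> r * ((y 0 + 2 * real j) * r ^ j) + r ^ j"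
      using assms(2)[of j] mult_left_mono[OF Suc, of r] power_mono[of "1/2" r j] assms(4) by linarith
    also have "\<dots> \<le> r * ((y 0 + 2 * real j) * r ^ j) + 2 * r * r ^ j"
    proof -
      have "1 * r ^ j \<le> (2 * r) * r ^ j" using assms(4) by (intro mult_right_mono) auto
      then show ?thesis by simp
    qed
    also have "\<dots> = (y 0 + 2 * real (Suc j)) * r ^ Suc j" by (simp add: algebra_simps)
    finally show ?case .
  qed simp
  have "(\<lambda>j. y 0 * r ^ j + 2 * (real j * r ^ j)) \<longlonglongrightarrow> y 0 * 0 + 2 * 0"
    using assms(3,4) by (intro tendsto_intros LIMSEQ_realpow_zero powser_times_n_limit_0) auto
  then have "(\<lambda>j. (y 0 + 2 * real j) * r ^ j) \<longlonglongrightarrow> 0" by (simp add: algebra_simps)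
  then show ?thesis
    by (rule tendsto_sandwich[OF _ _ tendsto_const, rotated 2]) (use assms(1) bnd in auto)
qed

text \<open>The assumption \<open>marker\<close> provides measurable sets that are maximal separated
  along all orbits: distinct points of \<open>U\<close> on an orbit are at least \<open>N\<close>
  apart in some coordinate, and every point has one of them within less than \<open>N\<close>. The
  index set is the symmetric cube of the integers of modulus below \<open>N\<close>.\<close>

locale zm_action = finite_measure M for M :: "'a measure" +
  fixes T :: "(nat \<Rightarrow> int) \<Rightarrow> 'a \<Rightarrow> 'a" and m :: nat
  assumes space_UNIV: "space M = UNIV"
    and T_0: "T 0 x = x" and T_add: "T (a + b) x = T a (T b x)"
    and T_measurable: "T a \<in> measurable M M"
    and T_preserving: "A \<in> sets M \<Longrightarrow> measure M (T a -` A) = measure M A"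
    and marker: "1 \<le> N \<Longrightarrow> \<exists>U\<in>sets M. (\<forall>x\<in>U. \<forall>a\<in>cube m (1 - N) N. T a x \<in> U \<longrightarrow> a = 0) \<and>
                      (\<forall>x. \<exists>a\<in>cube m (1 - N) N. T a x \<in> U)"
begin

lemma T_vimage_sets: "A \<in> sets M \<Longrightarrow> {x. T a x \<in> A} \<in> sets M"
  using measurable_sets[OF T_measurable, of A a] by (simp add: vimage_def space_UNIV)

lemma T_preserving': "A \<in> sets M \<Longrightarrow> measure M {x. T a x \<in> A} = measure M A"
  using T_preserving by (simp add: vimage_def)

text \<open>Convention for all that follows: \<open>T (- a) x \<in> U\<close> says that
  \<open>x\<close> has position \<open>a\<close> in a box whose lowest corner is a point of
  \<open>U\<close>.\<close>

definition box_cover :: "int \<Rightarrow> 'a set \<Rightarrow> 'a set" where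
  "box_cover n U = (\<Union>a\<in>cube m 0 n. {x. T (- a) x \<in> U})"

definition box_rim :: "int \<Rightarrow> int \<Rightarrow> 'a set \<Rightarrow> 'a set" where
  "box_rim n W U = (\<Union>a\<in>cube m (- W) (n + W) - cube m W (n - W). {x. T (- a) x \<in> U})"

text \<open>Boxes based at points of \<open>U\<close> stay disjoint even after enlargement by
  \<open>R\<close> on all sides, so their shells do not meet either.\<close>

definition separated :: "int \<Rightarrow> int \<Rightarrow> 'a set \<Rightarrow> bool" where
  "separated R n U \<longleftrightarrow> (\<forall>x a b. a \<in> cube m (- R) (n + R) \<longrightarrow> b \<in> cube m (- R) (n + R) \<longrightarrow>
     T (- a) x \<in> U \<longrightarrow> T (- b) x \<in> U \<longrightarrow> a = b)"

lemma box_cover_sets: "U \<in> sets M \<Longrightarrow> box_cover n U \<in> sets M"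
  unfolding box_cover_def by (intro sets.finite_UN finite_cube T_vimage_sets)

lemma box_rim_sets: "U \<in> sets M \<Longrightarrow> box_rim n W U \<in> sets M"
  unfolding box_rim_def by (intro sets.finite_UN T_vimage_sets) (auto simp: finite_cube)

lemma separated_base_measure:
  assumes U: "U \<in> sets M" "separated R n U" and "0 \<le> R" "0 \<le> n"
  shows "real_of_int n ^ m * measure M U \<le> measure M UNIV"
proof -
  have sub: "cube m 0 n \<subseteq> cube m (- R) (n + R)" using assms(3) by (force simp: cube_def)
  have "(\<Sum>a\<in>cube m 0 n. measure M {x. T (- a) x \<in> U}) = measure M (\<Union>a\<in>cube m 0 n. {x. T (- a) x \<in> U})"
    using U sub by (intro finite_measure_finite_Union[symmetric] finite_cube)
      (auto simp: T_vimage_sets disjoint_family_on_def separated_def)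
  also have "\<dots> \<le> measure M UNIV"
    using sets.top[of M] space_UNIV by (intro finite_measure_mono) auto
  finally show ?thesis using U assms(4) by (simp add: T_preserving' card_cube)
qed

lemma box_rim_measure:
  assumes U: "U \<in> sets M" and "0 \<le> W" "2 * W \<le> n"
  shows "measure M (box_rim n W U) \<le> (real_of_int (n + 2 * W) ^ m - real_of_int (n - 2 * W) ^ m) * measure M U"
proof -
  have sub: "cube m W (n - W) \<subseteq> cube m (- W) (n + W)" using assms(2) by (force simp: cube_def)
  have "measure M (box_rim n W U) \<le> (\<Sum>a\<in>cube m (- W) (n + W) - cube m W (n - W). measure M {x. T (- a) x \<in> U})"
    unfolding box_rim_def
    by (intro finite_measure_subadditive_finite) (auto simp: finite_cube T_vimage_sets U)
  also have "\<dots> = real (card (cube m (- W) (n + W) - cube m W (n - W))) * measure M U"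
    using U by (simp add: T_preserving')
  also have "real (card (cube m (- W) (n + W) - cube m W (n - W))) = real_of_int (n + 2 * W) ^ m - real_of_int (n - 2 * W) ^ m"
  proof -
    have "card (cube m (- W) (n + W) - cube m W (n - W)) = card (cube m (- W) (n + W)) - card (cube m W (n - W))"
      by (intro card_Diff_subset finite_cube sub)
    moreover have "card (cube m W (n - W)) \<le> card (cube m (- W) (n + W))" by (intro card_mono finite_cube sub)
    ultimately show ?thesis using assms(2,3) by (simp add: of_nat_diff card_cube add.commute)
  qed
  finally show ?thesis .
qed

text \<open>An averaging argument. Each point is covered for at least \<open>n ^ m\<close> of the
  \<open>(4 * N) ^ m\<close> shifts in \<open>?Q\<close>, and \<open>4 * N \<le> 8 * n\<close>;
  hence some shift covers a proportion \<open>1 / 8 ^ m\<close> of \<open>A\<close>. The boxes alone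
  need not cover anything in particular, since they are smaller than the gaps of
  \<open>U\<close>.\<close>

lemma shifted_cover:
  assumes U: "U \<in> sets M" "\<forall>x. \<exists>a\<in>cube m (1 - N) N. T a x \<in> U" and A: "A \<in> sets M"
    and n: "0 < n" "n \<le> N" "N \<le> 2 * n"
  shows "\<exists>t. measure M (A - box_cover n {x. T (- t) x \<in> U}) \<le> (1 - 1 / 8 ^ m) * measure M A"
proof -
  let ?C = "\<lambda>t. box_cover n {x. T (- t) x \<in> U}"
  let ?Q = "cube m (- 2 * N) (2 * N)"
  have Cs: "?C t \<in> sets M" for t using U by (intro box_cover_sets T_vimage_sets)
  have many: "real_of_int n ^ m \<le> (\<Sum>t\<in>?Q. indicator (?C t) x)" for x :: 'a
  proof -
    obtain d where d: "d \<in> cube m (1 - N) N" "T d x \<in> U" using U(2) by blast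
    have sub: "(\<lambda>a. - d - a) ` cube m 0 n \<subseteq> {t\<in>?Q. x \<in> ?C t}"
    proof
      fix t assume "t \<in> (\<lambda>a. - d - a) ` cube m 0 n"
      then obtain a where a: "a \<in> cube m 0 n" "t = - d - a" by auto
      have "T (- t) (T (- a) x) = T d x" unfolding a(2) by (simp flip: T_add)
      then have "T (- t) (T (- a) x) \<in> U" using d(2) by (simp only:)
      then have "x \<in> ?C t" using a(1) unfolding box_cover_def by blast
      moreover have "t \<in> ?Q"
      proof (rule in_cubeI)
        fix i assume i: "i < m"
        show "- 2 * N \<le> t i \<and> t i < 2 * N" using in_cubeD(1)[OF a(1) i] in_cubeD(1)[OF d(1) i] n a(2) by auto
      qed (use in_cubeD(2)[OF a(1)] in_cubeD(2)[OF d(1)] a(2) in auto)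
      ultimately show "t \<in> {t\<in>?Q. x \<in> ?C t}" by simp
    qed
    have "nat n ^ m = card ((\<lambda>a. - d - a) ` cube m 0 n)"
      using n by (subst card_image) (auto simp: inj_on_def card_cube)
    also have "\<dots> \<le> card {t\<in>?Q. x \<in> ?C t}" using sub by (intro card_mono) (auto simp: finite_cube)
    finally have "real (nat n ^ m) \<le> real (card {t\<in>?Q. x \<in> ?C t})" by (simp only: of_nat_le_iff)
    also have "\<dots> = (\<Sum>t\<in>?Q. indicator (?C t) x)"
      by (simp add: indicator_def sum.If_cases finite_cube Int_def)
    finally show ?thesis using n by simp
  qed
  have "real_of_int n ^ m * measure M A = (\<integral>x. real_of_int n ^ m * indicator A x \<partial>M)"
    using A by (simp add: space_UNIV)
  also have "\<dots> \<le> (\<integral>x. (\<Sum>t\<in>?Q. indicator (A \<inter> ?C t) x) \<partial>M)"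
  proof (rule integral_mono)
    show "integrable M (\<lambda>x. real_of_int n ^ m * indicator A x :: real)" using A by (simp add: emeasure_eq_measure)
    show "integrable M (\<lambda>x. \<Sum>t\<in>?Q. indicator (A \<inter> ?C t) x :: real)"
      using A Cs by (intro Bochner_Integration.integrable_sum) (simp add: emeasure_eq_measure)
    show "real_of_int n ^ m * indicator A x \<le> (\<Sum>t\<in>?Q. indicator (A \<inter> ?C t) x)" for x
      using many[of x] by (cases "x \<in> A") (auto simp: indicator_def intro!: sum_nonneg)
  qed
  also have "\<dots> = (\<Sum>t\<in>?Q. measure M (A \<inter> ?C t))"
    using A Cs by (subst Bochner_Integration.integral_sum) (auto simp: emeasure_eq_measure space_UNIV)
  finally have le: "real_of_int n ^ m * measure M A \<le> (\<Sum>t\<in>?Q. measure M (A \<inter> ?C t))" .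
  have "\<exists>t\<in>?Q. measure M A / 8 ^ m \<le> measure M (A \<inter> ?C t)"
  proof (rule ccontr)
    assume "\<not> ?thesis"
    then have lt: "\<forall>t\<in>?Q. measure M (A \<inter> ?C t) < measure M A / 8 ^ m" by auto
    have "0 \<in> ?Q" using n by (auto simp: cube_def)
    then have "(\<Sum>t\<in>?Q. measure M (A \<inter> ?C t)) < (\<Sum>t\<in>?Q. measure M A / 8 ^ m)"
      using lt by (intro sum_strict_mono finite_cube) auto
    also have "\<dots> = real (nat (4 * N)) ^ m / 8 ^ m * measure M A"
      using n by (simp add: card_cube)
    also have "real (nat (4 * N)) = real_of_int (4 * N)" using n by simp
    also have "real_of_int (4 * N) ^ m / 8 ^ m * measure M A = (real_of_int (4 * N) / 8) ^ m * measure M A"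
      by (simp only: power_divide)
    also have "\<dots> \<le> real_of_int n ^ m * measure M A"
      using n by (intro mult_right_mono power_mono) auto
    finally show False by (rule notE[OF leD[OF le]])
  qed
  then obtain t where t: "measure M A / 8 ^ m \<le> measure M (A \<inter> ?C t)" by blast
  have "measure M (A - ?C t) = measure M A - measure M (A \<inter> ?C t)"
    using A Cs by (intro finite_measure_Diff')
  then show ?thesis using t by (intro exI[of _ t]) (simp add: algebra_simps)
qed

text \<open>Boxes that are large compared with \<open>W\<close> have rims of small measure, while
  the proportion of \<open>A\<close> that they cover does not depend on their size.\<close>

lemma toast_level:
  assumes R: "0 \<le> R" and W: "0 \<le> W" and e: "0 < e" and A: "A \<in> sets M"
  shows "\<exists>n U. n > W \<and> n > 2 * R \<and> U \<in> sets M \<and> separated R n U \<and> measure M (box_rim n W U) \<le> e \<and>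
     measure M (A - box_cover n U) \<le> (1 - 1 / 8 ^ m) * measure M A"
proof -
  define c where "c = real_of_int (2 * W)"
  \<comment> \<open>The volume of the rim relative to a box of side \<open>k\<close>; it tends to 0
    because \<open>W\<close> is fixed.\<close>
  have "(\<lambda>k. ((1 + c / real k) ^ m - (1 - c / real k) ^ m) * measure M UNIV) \<longlonglongrightarrow> ((1 + 0) ^ m - (1 - 0) ^ m) * measure M UNIV"
    by (intro tendsto_intros lim_const_over_n)
  then have lim: "eventually (\<lambda>k. ((1 + c / real k) ^ m - (1 - c / real k) ^ m) * measure M UNIV < e) sequentially"
    using e by (intro order_tendstoD(2)) auto
  have "eventually (\<lambda>k. ((1 + c / real k) ^ m - (1 - c / real k) ^ m) * measure M UNIV < e \<and> nat (2 * W) + nat (2 * R) < k) sequentially"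
    by (intro eventually_conj lim eventually_gt_at_top)
  then obtain k where k: "((1 + c / real k) ^ m - (1 - c / real k) ^ m) * measure M UNIV < e" "nat (2 * W) + nat (2 * R) < k"
    unfolding eventually_sequentially by blast
  define n where "n = int k"
  have n: "n > 2 * W" "n > 2 * R" "0 < n" using k(2) W R by (auto simp: n_def)
  \<comment> \<open>Positions in an enlarged box differ by less than \<open>n + 2 * R\<close> in
    each coordinate, so \<open>N\<close>-separated bases give disjoint enlarged boxes. From
    \<open>n > 2 * R\<close> one has \<open>N \<le> 2 * n\<close>, as \<open>shifted_cover\<close>
    requires.\<close>
  define N where "N = n + 2 * R"
  have N1: "1 \<le> N" using n R by (simp add: N_def)
  obtain U0 where U0: "U0 \<in> sets M" "\<forall>x\<in>U0. \<forall>a\<in>cube m (1 - N) N. T a x \<in> U0 \<longrightarrow> a = 0"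
    "\<forall>x. \<exists>a\<in>cube m (1 - N) N. T a x \<in> U0" 
    using marker[OF N1] by (elim bexE conjE) (rule that)
  have N: "n \<le> N" "N \<le> 2 * n" using n R by (auto simp: N_def)
  obtain t where t: "measure M (A - box_cover n {x. T (- t) x \<in> U0}) \<le> (1 - 1 / 8 ^ m) * measure M A"
    using shifted_cover[OF U0(1,3) A n(3) N] by blast
  define U where "U = {x. T (- t) x \<in> U0}"
  have U: "U \<in> sets M" unfolding U_def by (intro T_vimage_sets U0)
  have sep: "separated R n U"
    unfolding separated_def
  proof (intro allI impI)
    fix x a b assume a: "a \<in> cube m (- R) (n + R)" and b: "b \<in> cube m (- R) (n + R)" and ab: "T (- a) x \<in> U" "T (- b) x \<in> U"
    define y where "y = T (- t) (T (- a) x)"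
    have y: "y \<in> U0" using ab by (simp add: y_def U_def)
    have "T (a - b) y = T (- t) (T (- b) x)" unfolding y_def by (simp flip: T_add add: algebra_simps)
    then have "T (a - b) y \<in> U0" using ab by (simp add: U_def)
    moreover have "a - b \<in> cube m (1 - N) N"
    proof (rule in_cubeI)
      fix i assume i: "i < m"
      show "1 - N \<le> (a - b) i \<and> (a - b) i < N" using in_cubeD(1)[OF a i] in_cubeD(1)[OF b i] by (auto simp: N_def)
    qed (use in_cubeD(2)[OF a] in_cubeD(2)[OF b] in auto)
    ultimately have "a - b = 0" using U0(2) y by blast
    then show "a = b" by simp
  qed
  have "measure M (box_rim n W U) \<le> (real_of_int (n + 2 * W) ^ m - real_of_int (n - 2 * W) ^ m) * measure M U"
    using n W by (intro box_rim_measure U) auto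
  also have "\<dots> = ((1 + c / real k) ^ m - (1 - c / real k) ^ m) * (real_of_int n ^ m * measure M U)"
  proof -
    have "real_of_int (n + 2 * W) = (1 + c / real k) * real_of_int n" "real_of_int (n - 2 * W) = (1 - c / real k) * real_of_int n"
      using n by (auto simp: n_def c_def field_simps)
    then show ?thesis by (simp only: power_mult_distrib) (simp add: algebra_simps)
  qed
  also have "\<dots> \<le> ((1 + c / real k) ^ m - (1 - c / real k) ^ m) * measure M UNIV"
  proof (rule mult_left_mono)
    show "real_of_int n ^ m * measure M U \<le> measure M UNIV"
      using n R by (intro separated_base_measure[OF U sep]) auto
    have "(1 - c / real k) ^ m \<le> (1 + c / real k) ^ m"
      using n W by (intro power_mono) (auto simp: c_def n_def field_simps)
    then show "0 \<le> (1 + c / real k) ^ m - (1 - c / real k) ^ m" by simp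
  qed
  also have "\<dots> \<le> e" using k by simp
  finally have "measure M (box_rim n W U) \<le> e" .
  then show ?thesis using n W U sep t unfolding U_def by (intro exI[of _ n] exI[of _ "{x. T (- t) x \<in> U0}"]) auto
qed

text \<open>A base is discarded when its enlarged box meets the shell of a later level, which makes
  shells of different levels disjoint. The rims are thin enough for Borel-Cantelli to leave almost
  every point in a box that survives. Boxes of different levels may be nested, but their boundaries
  keep apart.\<close>

theorem toast_exists:
  assumes R: "1 \<le> R"
  shows "\<exists>(n :: nat \<Rightarrow> int) V. (\<forall>j. n j > 2 * R \<and> V j \<in> sets M \<and> separated R (n j) (V j)) \<and>
     (\<forall>x i j a b. a \<in> box_shell m R (n j) \<longrightarrow> b \<in> box_shell m R (n i) \<longrightarrow> T (- a) x \<in> V j \<longrightarrow> T (- b) x \<in> V i \<longrightarrow> i = j) \<and>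
     (AE x in M. \<exists>j. x \<in> box_cover (n j) (V j))"
proof -
  define P :: "nat \<Rightarrow> int \<times> 'a set \<times> 'a set \<Rightarrow> bool" where
    "P j st = (case st of (n, U, Y) \<Rightarrow> n > 2 * R \<and> U \<in> sets M \<and> separated R n U \<and> Y \<in> sets M \<and> (j = 0 \<longrightarrow> Y = {}))" for j st
  \<comment> \<open>In a state \<open>(n, U, Y)\<close> the set \<open>Y\<close> collects the points
    that are covered and not spoiled since. A new level spoils the rim of width
    \<open>n + 2 * R\<close>: if an old enlarged box meets the new shell, its points are at most
    this far from the new boundary.\<close>
  define Q :: "nat \<Rightarrow> int \<times> 'a set \<times> 'a set \<Rightarrow> int \<times> 'a set \<times> 'a set \<Rightarrow> bool" where
    "Q j st st' = (case st of (n, U, Y) \<Rightarrow> case st' of (n', U', Y') \<Rightarrow> n < n' \<and>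
       measure M (box_rim n' (n + 2 * R) U') \<le> (1 / 2) ^ j \<and>
       Y' = (Y - box_rim n' (n + 2 * R) U') \<union> box_cover n' U' \<and>
       measure M ((UNIV - Y) - box_cover n' U') \<le> (1 - 1 / 8 ^ m) * measure M (UNIV - Y))" for j st st'
  have "\<exists>st. \<forall>j. P j (st j) \<and> Q j (st j) (st (Suc j))"
  proof (rule dependent_nat_choice)
    show "\<exists>st. P 0 st"
      using R by (intro exI[of _ "(2 * R + 1, {}, {})"]) (simp add: P_def separated_def)
    fix st j assume "P j st"
    then obtain n U Y where st: "st = (n, U, Y)" "n > 2 * R" "Y \<in> sets M" by (auto simp: P_def split: prod.splits)
    have "UNIV - Y \<in> sets M" using sets.compl_sets[OF st(3)] by (simp add: space_UNIV)
    from toast_level[OF _ _ _ this, of R "n + 2 * R" "(1 / 2) ^ j"] obtain n' U' where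
      n': "n' > n + 2 * R" "n' > 2 * R" "U' \<in> sets M" "separated R n' U'" "measure M (box_rim n' (n + 2 * R) U') \<le> (1 / 2) ^ j"
         "measure M ((UNIV - Y) - box_cover n' U') \<le> (1 - 1 / 8 ^ m) * measure M (UNIV - Y)"
      using R st by auto
    have "(Y - box_rim n' (n + 2 * R) U') \<union> box_cover n' U' \<in> sets M"
      using n' st by (intro sets.Un sets.Diff box_cover_sets box_rim_sets)
    then show "\<exists>st'. P (Suc j) st' \<and> Q j st st'"
      using n' st R
      by (intro exI[of _ "(n', U', (Y - box_rim n' (n + 2 * R) U') \<union> box_cover n' U')"])
         (auto simp: P_def Q_def box_cover_sets box_rim_sets)
  qed
  then obtain st where st: "\<And>j. P j (st j)" "\<And>j. Q j (st j) (st (Suc j))" by blast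
  define n where "n j = fst (st j)" for j
  define U where "U j = fst (snd (st j))" for j
  define Y where "Y j = snd (snd (st j))" for j
  define Bad where "Bad j = box_rim (n (Suc j)) (n j + 2 * R) (U (Suc j))" for j
  have n: "n j > 2 * R" and U: "U j \<in> sets M" "separated R (n j) (U j)" and Ys: "Y j \<in> sets M" for j
    using st(1)[of j] by (auto simp: P_def n_def U_def Y_def split: prod.splits)
  have nmono: "n j < n (Suc j)" and Bad: "measure M (Bad j) \<le> (1 / 2) ^ j"
    and Y: "Y (Suc j) = (Y j - Bad j) \<union> box_cover (n (Suc j)) (U (Suc j))"
    and Yc: "measure M ((UNIV - Y j) - box_cover (n (Suc j)) (U (Suc j))) \<le> (1 - 1 / 8 ^ m) * measure M (UNIV - Y j)" for j
    using st(2)[of j] by (auto simp: Q_def n_def U_def Y_def Bad_def split: prod.splits)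
  have n_le: "n i \<le> n j" if "i \<le> j" for i j
    using that by (rule lift_Suc_mono_le[rotated]) (use nmono in \<open>simp add: less_imp_le\<close>)
  have Bads: "Bad j \<in> sets M" for j unfolding Bad_def by (intro box_rim_sets U)
  have Covs: "box_cover (n j) (U j) \<in> sets M" for j by (intro box_cover_sets U)
  define y where "y j = measure M (UNIV - Y j)" for j
  have compl: "UNIV - B \<in> sets M" if "B \<in> sets M" for B using sets.compl_sets[OF that] by (simp add: space_UNIV)
  have "y \<longlonglongrightarrow> 0"
  proof (rule recurrence_tendsto_0)
    let ?r = "max (1 / 2) (1 - 1 / 8 ^ m :: real)"
    show "?r < 1" "1 / 2 \<le> ?r" by auto
    show "y (Suc j) \<le> ?r * y j + (1 / 2) ^ j" for j
    proof -
      have "UNIV - Y (Suc j) \<subseteq> ((UNIV - Y j) - box_cover (n (Suc j)) (U (Suc j))) \<union> Bad j" unfolding Y by auto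
      then have "y (Suc j) \<le> measure M (((UNIV - Y j) - box_cover (n (Suc j)) (U (Suc j))) \<union> Bad j)"
        unfolding y_def using compl[OF Ys] Covs Bads by (intro finite_measure_mono) auto
      also have "\<dots> \<le> measure M ((UNIV - Y j) - box_cover (n (Suc j)) (U (Suc j))) + measure M (Bad j)"
        using compl[OF Ys] Covs Bads by (intro measure_Un_le) auto
      also have "\<dots> \<le> (1 - 1 / 8 ^ m) * y j + (1 / 2) ^ j"
        using Yc[of j] Bad[of j] by (simp add: y_def)
      also have "\<dots> \<le> ?r * y j + (1 / 2) ^ j"
        by (intro add_right_mono mult_right_mono) (auto simp: y_def)
      finally show ?thesis .
    qed
  qed (simp add: y_def)
  have Y0: "Y 0 = {}" using st(1)[of 0] by (auto simp: P_def Y_def split: prod.splits)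
  have inY: "\<exists>i\<le>j. x \<in> box_cover (n i) (U i) \<and> (\<forall>k. i \<le> k \<longrightarrow> k < j \<longrightarrow> x \<notin> Bad k)" if "x \<in> Y j" for x j
    using that
  proof (induction j)
    case (Suc j)
    show ?case
    proof (cases "x \<in> box_cover (n (Suc j)) (U (Suc j))")
      case True then show ?thesis by (intro exI[of _ "Suc j"]) auto
    next
      case False
      then have x: "x \<in> Y j" "x \<notin> Bad j" using Suc.prems Y[of j] by auto
      then obtain i where "i \<le> j" "x \<in> box_cover (n i) (U i)" "\<forall>k. i \<le> k \<longrightarrow> k < j \<longrightarrow> x \<notin> Bad k"
        using Suc.IH by blast
      then show ?thesis using x(2) by (intro exI[of _ i]) (auto simp: less_Suc_eq)
    qed
  qed (simp add: Y0)
  \<comment> \<open>The surviving bases: the enlarged box, with positions \<open>c\<close>, avoids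
    every later shell, with positions \<open>a\<close>.\<close>
  define V where "V i = {v\<in>U i. \<forall>k. \<forall>c\<in>cube m (- R) (n i + R). \<forall>a\<in>box_shell m R (n k). i < k \<longrightarrow> T (c - a) v \<notin> U k}" for i
  have Vs: "V i \<in> sets M" for i
  proof -
    have fin: "finite (box_shell m R l)" for l by (simp add: box_shell_def finite_cube)
    have "V i = U i \<inter> (\<Inter>k. UNIV - (\<Union>c\<in>cube m (- R) (n i + R). \<Union>a\<in>box_shell m R (n k). if i < k then {v. T (c - a) v \<in> U k} else {}))"
      unfolding V_def by (auto split: if_splits)
    moreover have "(\<Union>c\<in>cube m (- R) (n i + R). \<Union>a\<in>box_shell m R (n k). if i < k then {v. T (c - a) v \<in> U k} else {}) \<in> sets M" for k
      by (intro sets.finite_UN finite_cube fin) (auto simp: T_vimage_sets U)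
    ultimately show ?thesis using U compl by auto
  qed
  have VU: "V i \<subseteq> U i" for i by (auto simp: V_def)
  have shell: "i = j" if a: "a \<in> box_shell m R (n j)" and b: "b \<in> box_shell m R (n i)" and x: "T (- a) x \<in> V j" "T (- b) x \<in> V i" for x i j a b
  proof -
    have *: False if "i < j" "a \<in> box_shell m R (n j)" "b \<in> box_shell m R (n i)" "T (- a) x \<in> V j" "T (- b) x \<in> V i" for a b i j
    proof -
      have "b \<in> cube m (- R) (n i + R)" using that by (simp add: box_shell_def)
      then have "T (b - a) (T (- b) x) \<notin> U j" using that by (auto simp: V_def)
      moreover have "T (b - a) (T (- b) x) = T (- a) x" by (simp flip: T_add)
      ultimately show False using that VU by auto
    qed
    show ?thesis using *[of i j a b] *[of j i b a] a b x by (cases i j rule: linorder_cases) auto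
  qed
  have sep: "separated R (n j) (V j)" for j
    using U(2)[of j] VU[of j] unfolding separated_def by blast
  have cover: "AE x in M. \<exists>j. x \<in> box_cover (n j) (V j)"
  proof -
    \<comment> \<open>Almost every point is spoiled finitely often, and it is in \<open>Y j\<close>
      for arbitrarily large \<open>j\<close>. Some box around it is then never spoiled.\<close>
    have "AE x in M. eventually (\<lambda>k. x \<in> space M - Bad k) sequentially"
    proof (rule borel_cantelli_AE1)
      show "summable (\<lambda>k. measure M (Bad k))"
        using Bad by (intro summable_comparison_test[OF _ summable_geometric[of "1/2 :: real"]]) auto
    qed (use Bads in \<open>auto simp: emeasure_eq_measure\<close>)
    moreover have "AE x in M. \<forall>J. \<exists>j\<ge>J. x \<in> Y j"
      unfolding AE_all_countable
    proof
      fix J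
      let ?Z = "\<Inter>j\<in>{J..}. UNIV - Y j"
      have Z: "?Z \<in> sets M" using compl Ys sets.top[of M] unfolding space_UNIV by (intro sets.countable_INT'') auto
      have "measure M ?Z \<le> y j" if "j \<ge> J" for j
        unfolding y_def using that compl Ys Z by (intro finite_measure_mono) auto
      then have "measure M ?Z \<le> 0"
        using \<open>y \<longlonglongrightarrow> 0\<close> by (intro LIMSEQ_le_const[of y]) auto
      then have "measure M ?Z = 0" using measure_nonneg[of M ?Z] by (rule antisym)
      then have "?Z \<in> null_sets M" using Z by (intro null_setsI) (simp_all only: emeasure_eq_measure ennreal_0)
      then show "AE x in M. \<exists>j\<ge>J. x \<in> Y j" by (rule AE_I'[where N = ?Z]) auto
    qed
    ultimately show ?thesis
    proof eventually_elim
      fix x assume "eventually (\<lambda>k. x \<in> space M - Bad k) sequentially" and inf: "\<forall>J. \<exists>j\<ge>J. x \<in> Y j"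
      then obtain J where J: "\<And>k. k \<ge> J \<Longrightarrow> x \<notin> Bad k" by (auto simp: eventually_sequentially)
      obtain j where j: "j \<ge> J" "x \<in> Y j" using inf by auto
      obtain i where i: "i \<le> j" "x \<in> box_cover (n i) (U i)" "\<forall>k. i \<le> k \<longrightarrow> k < j \<longrightarrow> x \<notin> Bad k"
        using inY[OF j(2)] by auto
      have nb: "x \<notin> Bad k" if "k \<ge> i" for k using that i(3) J[of k] j(1) by (cases "k < j") auto
      obtain b where b: "b \<in> cube m 0 (n i)" "T (- b) x \<in> U i" using i(2) by (auto simp: box_cover_def)
      have "T (- b) x \<in> V i"
        unfolding V_def mem_Collect_eq
      proof (intro conjI b(2) allI ballI impI notI)
        fix k c a assume c: "c \<in> cube m (- R) (n i + R)" and a: "a \<in> box_shell m R (n k)" and k: "i < k" and bad: "T (c - a) (T (- b) x) \<in> U k"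
        obtain k' where k': "k = Suc k'" "i \<le> k'" using k by (cases k) auto
        \<comment> \<open>The position of \<open>x\<close> itself in the later box. Both
          \<open>b\<close> and \<open>c\<close> are positions in the enlarged old box, so
          \<open>?a\<close> is off the shell position \<open>a\<close> by at most
          \<open>n i + R\<close>; the shell itself has width \<open>R\<close>, whence the rim width
          \<open>n k' + 2 * R\<close>.\<close>
        let ?a = "a + b - c"
        have "T (- ?a) x \<in> U k" using bad by (simp flip: T_add add: algebra_simps)
        moreover have "?a \<in> cube m (- (n k' + 2 * R)) (n k + (n k' + 2 * R)) - cube m (n k' + 2 * R) (n k - (n k' + 2 * R))"
        proof -
          have a1: "a \<in> cube m (- R) (n k + R)" "a \<notin> cube m R (n k - R)" using a by (auto simp: box_shell_def)
          have ni: "n i \<le> n k'" using n_le k' by simp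
          have "?a \<in> cube m (- (n k' + 2 * R)) (n k + (n k' + 2 * R))"
          proof (rule in_cubeI)
            fix l assume l: "l < m"
            show "- (n k' + 2 * R) \<le> ?a l \<and> ?a l < n k + (n k' + 2 * R)"
              using in_cubeD(1)[OF a1(1) l] in_cubeD(1)[OF b(1) l] in_cubeD(1)[OF c l] ni by auto
          qed (use in_cubeD(2)[OF a1(1)] in_cubeD(2)[OF b(1)] in_cubeD(2)[OF c] in auto)
          moreover obtain l where l: "l < m" "a l < R \<or> n k - R \<le> a l"
            using not_in_cubeE[OF a1(2)] in_cubeD(2)[OF a1(1)] by blast
          have "?a \<notin> cube m (n k' + 2 * R) (n k - (n k' + 2 * R))"
            using l(2) in_cubeD(1)[OF b(1) l(1)] in_cubeD(1)[OF c l(1)] ni by (intro not_in_cubeI[OF l(1)]) auto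
          ultimately show ?thesis by blast
        qed
        ultimately have "x \<in> Bad k'" unfolding Bad_def box_rim_def k'(1) by blast
        then show False using nb k'(2) by simp
      qed
      then show "\<exists>j. x \<in> box_cover (n j) (V j)" using b(1) by (auto simp: box_cover_def)
    qed
  qed
  show ?thesis
    by (rule exI[of _ n], rule exI[of _ V], intro conjI allI impI n Vs sep cover, rule shell)
qed

end

section \<open>Integral flows for measure preserving actions\<close>

lemma measurable_countable_cases:
  fixes E :: "'i \<Rightarrow> 'a set"
  assumes "countable J" "space M = UNIV" "\<And>i. i \<in> J \<Longrightarrow> E i \<in> sets M" "(\<Union>i\<in>J. E i) = UNIV"
    and "\<And>i. i \<in> J \<Longrightarrow> g i \<in> measurable M N" "\<And>i x. i \<in> J \<Longrightarrow> x \<in> E i \<Longrightarrow> f x = g i x"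
  shows "f \<in> measurable M N"
proof (rule measurableI)
  fix x assume "x \<in> space M"
  obtain i where "i \<in> J" "x \<in> E i" using assms(4) by blast
  then show "f x \<in> space N" using assms(5)[THEN measurable_space] assms(2,6) by fastforce
next
  fix A assume A: "A \<in> sets N"
  have "f -` A \<inter> space M = (\<Union>i\<in>J. E i \<inter> (g i -` A \<inter> space M))"
    using assms(2,4,6) by fastforce
  also have "\<dots> \<in> sets M"
    using assms A by (intro sets.countable_UN'' sets.Int measurable_sets) auto
  finally show "f -` A \<inter> space M \<in> sets M" .
qed

text \<open>The function \<open>G\<close> is arbitrary because the data take only countably many
  values. Choices made by \<open>SOME\<close> are thus measurable when they depend on finitely many
  integers.\<close>

lemma measurable_finite_countable_data:
  fixes q :: "'i \<Rightarrow> 'a \<Rightarrow> 'c::countable" and G :: "('i \<Rightarrow> 'c) \<Rightarrow> 'b"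
  assumes "finite I" "space M = UNIV" "\<And>i. i \<in> I \<Longrightarrow> q i \<in> measurable M (count_space UNIV)"
  shows "(\<lambda>x. G (\<lambda>i\<in>I. q i x)) \<in> measurable M (count_space UNIV)"
proof (rule measurable_countable_cases[where J = "\<Pi>\<^sub>E i\<in>I. UNIV" and E = "\<lambda>d. {x. (\<lambda>i\<in>I. q i x) = d}" and g = "\<lambda>d x. G d"])
  show "countable (\<Pi>\<^sub>E i\<in>I. (UNIV :: 'c set))" using assms(1) by (intro countable_PiE) auto
  show "(\<Union>d\<in>\<Pi>\<^sub>E i\<in>I. UNIV. {x. (\<lambda>i\<in>I. q i x) = d}) = UNIV" by auto
  fix d assume d: "d \<in> (\<Pi>\<^sub>E i\<in>I. (UNIV :: 'c set))"
  have "{x. (\<lambda>i\<in>I. q i x) = d} = {x\<in>space M. \<forall>i\<in>I. q i x \<in> {d i}}"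
    using d assms(2) by (auto simp: PiE_def extensional_def fun_eq_iff restrict_def)
  also have "\<dots> \<in> sets M"
  proof (rule sets.sets_Collect_finite_All[OF _ assms(1)])
    fix i assume "i \<in> I"
    then have "q i -` {d i} \<inter> space M \<in> sets M" by (intro measurable_sets[OF assms(3)]) auto
    moreover have "q i -` {d i} \<inter> space M = {x \<in> space M. q i x \<in> {d i}}" by auto
    ultimately show "{x \<in> space M. q i x \<in> {d i}} \<in> sets M" by simp
  qed
  finally show "{x. (\<lambda>i\<in>I. q i x) = d} \<in> sets M" .
qed (use assms in auto)

context zm_action
begin

lemma AE_T: assumes "AE x in M. P x" shows "AE x in M. P (T s x)"
proof -
  obtain N where N: "N \<in> null_sets M" "{x. \<not> P x} \<subseteq> N"
    using AE_E[OF assms] space_UNIV by (metis (no_types, lifting) Collect_cong UNIV_I null_setsI)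
  have Ns: "N \<in> sets M" using N by auto
  have "measure M {x. T s x \<in> N} = 0"
    using T_preserving'[OF Ns] N by (simp add: measure_eq_0_null_sets)
  then have "{x. T s x \<in> N} \<in> null_sets M"
    using T_vimage_sets[OF Ns] by (intro null_setsI) (auto simp: emeasure_eq_measure)
  then show ?thesis by (rule AE_I') (use N in auto)
qed

lemma T_minus: "T (- a) (T a x) = x" "T a (T (- a) x) = x"
  using T_add[of "- a" a x] T_add[of a "- a" x] T_0 by auto

text \<open>In each surviving box the flow is first corrected by circulations in the shell, which
  makes it integral on the edges leaving the box, and is then rounded inside. Disjointness of the
  shells lets all corrections be made at once. The assumption \<open>grp\<close> is the condition
  under which they exist.\<close>

theorem integral_flow_exists:
  fixes S :: "(nat \<Rightarrow> int) set" and R :: int and f :: "(nat \<Rightarrow> int) \<Rightarrow> 'a \<Rightarrow> real"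
  assumes finS: "finite S" and symS: "\<And>s. s \<in> S \<Longrightarrow> - s \<in> S" and S0: "0 \<notin> S"
    and Sm: "\<And>s i. s \<in> S \<Longrightarrow> i \<ge> m \<Longrightarrow> s i = 0"
    and SR: "\<And>s i. s \<in> S \<Longrightarrow> \<bar>s i\<bar> \<le> R" and units: "\<And>i. i < m \<Longrightarrow> unit_vec i 1 \<in> S" and R1: "R \<ge> 1"
    and f: "\<And>s. s \<in> S \<Longrightarrow> f s \<in> borel_measurable M"
    and anti: "\<And>s x. s \<in> S \<Longrightarrow> f (- s) (T s x) = - f s x"
    and div: "\<And>x. (\<Sum>s\<in>S. f s x) \<in> \<int>"
    and grp: "\<And>n x h. n > 2 * R \<Longrightarrow> (\<Sum>e\<in>{e\<in>box_crossing m S n. base_vec m (snd e) = h}. f (snd e) (T (fst e) x)) \<in> \<int>"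
  shows "\<exists>g :: (nat \<Rightarrow> int) \<Rightarrow> 'a \<Rightarrow> int. (\<forall>s\<in>S. g s \<in> measurable M (count_space UNIV)) \<and>
    (AE x in M. (\<forall>s\<in>S. g (- s) (T s x) = - g s x \<and> \<bar>real_of_int (g s x) - f s x\<bar> \<le> 12 * real (card S) + 1) \<and>
       real_of_int (\<Sum>s\<in>S. g s x) = (\<Sum>s\<in>S. f s x))"
proof -
  obtain n :: "nat \<Rightarrow> int" and V where t1: "\<forall>j. n j > 2 * R \<and> V j \<in> sets M \<and> separated R (n j) (V j)"
    and t2: "\<forall>x i j a b. a \<in> box_shell m R (n j) \<longrightarrow> b \<in> box_shell m R (n i) \<longrightarrow> T (- a) x \<in> V j \<longrightarrow> T (- b) x \<in> V i \<longrightarrow> i = j"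
    and cover: "AE x in M. \<exists>j. x \<in> box_cover (n j) (V j)"
    using toast_exists[OF R1] by (elim exE conjE) (rule that)
  note nV = t1[THEN spec, THEN conjunct1] t1[THEN spec, THEN conjunct2, THEN conjunct1] t1[THEN spec, THEN conjunct2, THEN conjunct2]
  note shells = t2[rule_format]
  have bs: "box_setup m S R (n j)" for j
    using finS symS S0 Sm SR units R1 nV(1) by unfold_locales auto
  have "\<forall>j. \<exists>(I :: ((nat \<Rightarrow> int) \<times> (nat \<Rightarrow> int)) set) D z. finite I \<and> (\<forall>k\<in>I. D k \<subseteq> box_crossing m S (n j)) \<and>
   (\<forall>k\<in>I. antisymmetric_flow (z k) \<and> (\<forall>b. (\<Sum>t\<in>S. z k b t) = 0) \<and>
      (\<forall>b t. z k b t \<noteq> 0 \<longrightarrow> t \<in> S \<and> b \<in> box_shell m R (n j) \<and> b + t \<in> box_shell m R (n j))) \<and>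
   (\<forall>b t. (\<Sum>k\<in>I. \<bar>z k b t\<bar>) \<le> 12 * real (card S)) \<and>
   (\<forall>F. (\<forall>h. (\<Sum>e\<in>{e\<in>box_crossing m S (n j). base_vec m (snd e) = h}. F e) \<in> \<int>) \<longrightarrow>
     (\<forall>b t. (b, t) \<in> box_crossing m S (n j) \<longrightarrow> F (b, t) + (\<Sum>k\<in>I. frac (\<Sum>e\<in>D k. F e) * z k b t) \<in> \<int>))"
    using box_setup.boundary_circulations[OF bs] by (intro allI)
  from choice[OF this] obtain I :: "nat \<Rightarrow> ((nat \<Rightarrow> int) \<times> (nat \<Rightarrow> int)) set" where
    "\<forall>j. \<exists>D z. finite (I j) \<and> (\<forall>k\<in>I j. D k \<subseteq> box_crossing m S (n j)) \<and>
   (\<forall>k\<in>I j. antisymmetric_flow (z k) \<and> (\<forall>b. (\<Sum>t\<in>S. z k b t) = 0) \<and>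
      (\<forall>b t. z k b t \<noteq> 0 \<longrightarrow> t \<in> S \<and> b \<in> box_shell m R (n j) \<and> b + t \<in> box_shell m R (n j))) \<and>
   (\<forall>b t. (\<Sum>k\<in>I j. \<bar>z k b t\<bar>) \<le> 12 * real (card S)) \<and>
   (\<forall>F. (\<forall>h. (\<Sum>e\<in>{e\<in>box_crossing m S (n j). base_vec m (snd e) = h}. F e) \<in> \<int>) \<longrightarrow>
     (\<forall>b t. (b, t) \<in> box_crossing m S (n j) \<longrightarrow> F (b, t) + (\<Sum>k\<in>I j. frac (\<Sum>e\<in>D k. F e) * z k b t) \<in> \<int>))" ..
  from choice[OF this] obtain D where
    "\<forall>j. \<exists>z. finite (I j) \<and> (\<forall>k\<in>I j. D j k \<subseteq> box_crossing m S (n j)) \<and>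
   (\<forall>k\<in>I j. antisymmetric_flow (z k) \<and> (\<forall>b. (\<Sum>t\<in>S. z k b t) = 0) \<and>
      (\<forall>b t. z k b t \<noteq> 0 \<longrightarrow> t \<in> S \<and> b \<in> box_shell m R (n j) \<and> b + t \<in> box_shell m R (n j))) \<and>
   (\<forall>b t. (\<Sum>k\<in>I j. \<bar>z k b t\<bar>) \<le> 12 * real (card S)) \<and>
   (\<forall>F. (\<forall>h. (\<Sum>e\<in>{e\<in>box_crossing m S (n j). base_vec m (snd e) = h}. F e) \<in> \<int>) \<longrightarrow>
     (\<forall>b t. (b, t) \<in> box_crossing m S (n j) \<longrightarrow> F (b, t) + (\<Sum>k\<in>I j. frac (\<Sum>e\<in>D j k. F e) * z k b t) \<in> \<int>))" ..
  from choice[OF this] obtain z where zz: "\<forall>j. finite (I j) \<and> (\<forall>k\<in>I j. D j k \<subseteq> box_crossing m S (n j)) \<and>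
   (\<forall>k\<in>I j. antisymmetric_flow (z j k) \<and> (\<forall>b. (\<Sum>t\<in>S. z j k b t) = 0) \<and>
      (\<forall>b t. z j k b t \<noteq> 0 \<longrightarrow> t \<in> S \<and> b \<in> box_shell m R (n j) \<and> b + t \<in> box_shell m R (n j))) \<and>
   (\<forall>b t. (\<Sum>k\<in>I j. \<bar>z j k b t\<bar>) \<le> 12 * real (card S)) \<and>
   (\<forall>F. (\<forall>h. (\<Sum>e\<in>{e\<in>box_crossing m S (n j). base_vec m (snd e) = h}. F e) \<in> \<int>) \<longrightarrow>
     (\<forall>b t. (b, t) \<in> box_crossing m S (n j) \<longrightarrow> F (b, t) + (\<Sum>k\<in>I j. frac (\<Sum>e\<in>D j k. F e) * z j k b t) \<in> \<int>))" ..
  have I: "finite (I j)" for j using spec[OF zz, of j] by (elim conjE)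
  have DX: "\<forall>k\<in>I j. D j k \<subseteq> box_crossing m S (n j)" for j using spec[OF zz, of j] by (elim conjE)
  have z123: "\<forall>k\<in>I j. antisymmetric_flow (z j k) \<and> (\<forall>b. (\<Sum>t\<in>S. z j k b t) = 0) \<and>
      (\<forall>b t. z j k b t \<noteq> 0 \<longrightarrow> t \<in> S \<and> b \<in> box_shell m R (n j) \<and> b + t \<in> box_shell m R (n j))" for j
    using spec[OF zz, of j] by (elim conjE)
  have z4: "\<forall>b t. (\<Sum>k\<in>I j. \<bar>z j k b t\<bar>) \<le> 12 * real (card S)" for j
    using spec[OF zz, of j] by (elim conjE)
  have z5: "\<forall>F. (\<forall>h. (\<Sum>e\<in>{e\<in>box_crossing m S (n j). base_vec m (snd e) = h}. F e) \<in> \<int>) \<longrightarrow>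
     (\<forall>b t. (b, t) \<in> box_crossing m S (n j) \<longrightarrow> F (b, t) + (\<Sum>k\<in>I j. frac (\<Sum>e\<in>D j k. F e) * z j k b t) \<in> \<int>)" for j
    using spec[OF zz, of j] by (elim conjE)
  note DX = bspec[OF DX]
  note z = bspec[OF z123, THEN conjunct1] bspec[OF z123, THEN conjunct2, THEN conjunct1, THEN spec]
    bspec[OF z123, THEN conjunct2, THEN conjunct2, THEN spec, THEN spec, THEN mp] z4[THEN spec, THEN spec]
  note zF = z5[THEN spec, THEN mp, THEN spec, THEN spec, THEN mp]
  \<comment> \<open>The correction at position \<open>a\<close> of a level \<open>j\<close> box with
    base \<open>u\<close>. The coefficients lie between 0 and 1, so it inherits the bound of the
    circulations.\<close>
  define \<Delta> where "\<Delta> j u a s = (\<Sum>k\<in>I j. frac (\<Sum>e\<in>D j k. f (snd e) (T (fst e) u)) * z j k a s)" for j u a s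
  have \<Delta>_anti: "\<Delta> j u (a + s) (- s) = - \<Delta> j u a s" for j u a s
    unfolding \<Delta>_def by (simp add: antisymmetric_flowD[OF z(1)] sum_negf)
  have \<Delta>_div: "(\<Sum>s\<in>S. \<Delta> j u a s) = 0" for j u a
    unfolding \<Delta>_def by (subst sum.swap) (simp add: z(2) flip: sum_distrib_left)
  have \<Delta>_sup: "a + s \<in> box_shell m R (n j)" if nz: "\<Delta> j u a s \<noteq> 0" for j u a s
  proof (rule ccontr)
    assume "a + s \<notin> box_shell m R (n j)"
    then have "z j k a s = 0" if "k \<in> I j" for k using z(3)[OF that, of a s] by auto
    then show False using nz by (simp add: \<Delta>_def)
  qed
  have \<Delta>_bound: "\<bar>\<Delta> j u a s\<bar> \<le> 12 * real (card S)" for j u a s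
  proof -
    have "\<bar>\<Delta> j u a s\<bar> \<le> (\<Sum>k\<in>I j. \<bar>frac (\<Sum>e\<in>D j k. f (snd e) (T (fst e) u)) * z j k a s\<bar>)"
      unfolding \<Delta>_def by (rule sum_abs)
    also have "\<dots> \<le> (\<Sum>k\<in>I j. \<bar>z j k a s\<bar>)"
      by (intro sum_mono) (auto simp: abs_mult intro!: mult_left_le_one_le less_imp_le[OF frac_lt_1])
    also have "\<dots> \<le> 12 * real (card S)" by (rule z(4))
    finally show ?thesis .
  qed
  have \<Delta>_meas: "(\<lambda>u. \<Delta> j u a s) \<in> borel_measurable M" for j a s
  proof -
    have "(\<lambda>u. f (snd e) (T (fst e) u)) \<in> borel_measurable M" if "k \<in> I j" "e \<in> D j k" for e k
      using DX[OF that(1)] that(2) by (intro measurable_compose[OF T_measurable f]) (auto simp: box_crossing_def)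
    then have h: "(\<lambda>u. \<Sum>e\<in>D j k. f (snd e) (T (fst e) u)) \<in> borel_measurable M" if "k \<in> I j" for k
      using that by (intro borel_measurable_sum)
    have fm: "(frac :: real \<Rightarrow> real) \<in> borel_measurable borel" unfolding frac_def[abs_def] by measurable
    show ?thesis unfolding \<Delta>_def
      by (intro borel_measurable_sum borel_measurable_times borel_measurable_const measurable_compose[OF h fm])
  qed
  let ?sh = "\<lambda>j. box_shell m R (n j)"
  have sh_unique: "i = j \<and> a = b" if "a \<in> ?sh j" "b \<in> ?sh i" "T (- a) x \<in> V j" "T (- b) x \<in> V i" for a b i j x
  proof -
    have ij: "i = j" using that by (rule shells)
    have "a \<in> cube m (- R) (n j + R)" "b \<in> cube m (- R) (n j + R)" using that ij by (simp_all add: box_shell_def)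
    then have "a = b" using that(3,4) unfolding ij by (rule nV(3)[unfolded separated_def, rule_format])
    then show ?thesis using ij by simp
  qed
  define insh where "insh x p \<longleftrightarrow> snd p \<in> ?sh (fst p) \<and> T (- snd p) x \<in> V (fst p)" for x p
  have insh_unique: "p = q" if "insh x p" "insh x q" for x p q
    using sh_unique[of "snd p" "fst p" "snd q" "fst q" x] that by (auto simp: insh_def prod_eq_iff)
  \<comment> \<open>A point lies in at most one shell, at one position, so \<open>THE\<close> is
    determined whenever it is used.\<close>
  define fs where "fs s x = (if \<exists>p. insh x p then f s x + (let p = THE p. insh x p in \<Delta> (fst p) (T (- snd p) x) (snd p) s) else f s x)" for s x
  have fs_in: "fs s x = f s x + \<Delta> j (T (- a) x) a s" if "insh x (j, a)" for s x j a
  proof -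
    have "(THE p. insh x p) = (j, a)" using that insh_unique by blast
    then show ?thesis using that by (auto simp: fs_def Let_def)
  qed
  have fs_out: "fs s x = f s x" if "\<nexists>p. insh x p" for s x using that by (simp add: fs_def)
  have fs_bound: "\<bar>fs s x - f s x\<bar> \<le> 12 * real (card S)" for s x
  proof (cases "\<exists>p. insh x p")
    case True
    then obtain j a where "insh x (j, a)" by auto
    then show ?thesis using \<Delta>_bound by (simp add: fs_in)
  qed (simp add: fs_out)
  have insh_step: "insh (T s x) (j, a + s)" if "insh x (j, a)" "a + s \<in> ?sh j" for s x j a
  proof -
    have "T (- (a + s)) (T s x) = T (- a) x" by (simp flip: T_add)
    then show ?thesis using that by (simp add: insh_def)
  qed
  have fs_anti: "fs (- s) (T s x) = - fs s x" if s: "s \<in> S" for s x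
  proof (cases "\<exists>p. insh x p")
    case True
    then obtain j a where ja: "insh x (j, a)" by auto
    show ?thesis
    proof (cases "a + s \<in> ?sh j")
      case True
      have "T (- (a + s)) (T s x) = T (- a) x" by (simp flip: T_add)
      then show ?thesis
        using fs_in[OF insh_step[OF ja True], of "- s"] fs_in[OF ja, of s] anti[OF s, of x] \<Delta>_anti[of j "T (- a) x" a s] by simp
    next
      case False
      then have fsx: "fs s x = f s x" using fs_in[OF ja, of s] \<Delta>_sup[of j "T (- a) x" a s] by fastforce
      have "fs (- s) (T s x) = f (- s) (T s x)"
      proof (cases "\<exists>p. insh (T s x) p")
        case True
        then obtain i b where ib: "insh (T s x) (i, b)" by auto
        have "b + - s \<notin> ?sh i"
        proof
          assume "b + - s \<in> ?sh i"
          then have "insh (T (- s) (T s x)) (i, b + - s)" using ib by (rule insh_step[rotated])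
          then have "insh x (i, b + - s)" by (simp add: T_minus)
          then have "(j, a) = (i, b + - s)" by (rule insh_unique[OF ja])
          then have "i = j" "b = a + s" by auto
          then show False using ib False by (simp add: insh_def)
        qed
        then show ?thesis using fs_in[OF ib, of "- s"] \<Delta>_sup[of i "T (- b) (T s x)" b "- s"] by fastforce
      qed (simp add: fs_out)
      then show ?thesis using fsx anti[OF s] by simp
    qed
  next
    case no: False
    have "fs (- s) (T s x) = f (- s) (T s x)"
    proof (cases "\<exists>p. insh (T s x) p")
      case True
      then obtain i b where ib: "insh (T s x) (i, b)" by auto
      have "b + - s \<notin> ?sh i"
      proof
        assume "b + - s \<in> ?sh i"
        then have "insh (T (- s) (T s x)) (i, b + - s)" using ib by (rule insh_step[rotated])
        then have "insh x (i, b + - s)" by (simp add: T_minus)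
        then show False using no by blast
      qed
      then show ?thesis using fs_in[OF ib, of "- s"] \<Delta>_sup[of i "T (- b) (T s x)" b "- s"] by fastforce
    qed (simp add: fs_out)
    then show ?thesis using fs_out[OF no] anti[OF s] by simp
  qed
  have fs_div: "(\<Sum>s\<in>S. fs s x) = (\<Sum>s\<in>S. f s x)" for x
  proof (cases "\<exists>p. insh x p")
    case True
    then obtain j a where "insh x (j, a)" by auto
    then show ?thesis by (simp add: fs_in sum.distrib \<Delta>_div)
  qed (simp add: fs_out)
  \<comment> \<open>The start of a crossing edge lies in the shell of its own box, hence in no other
    shell, and receives only the correction designed for that box.\<close>
  have fs_cross: "fs s x \<in> \<int>" if x: "T (- a) x \<in> V j" and as: "(a, s) \<in> box_crossing m S (n j)" for a s x j
  proof -
    interpret box_setup m S R "n j" by (rule bs)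
    have "a \<in> ?sh j" using X_D(4)[OF as] A_shell by auto
    then have ja: "insh x (j, a)" using x by (simp add: insh_def)
    let ?F = "\<lambda>e. f (snd e) (T (fst e) (T (- a) x))"
    have "?F (a, s) + (\<Sum>k\<in>I j. frac (\<Sum>e\<in>D j k. ?F e) * z j k a s) \<in> \<int>"
      by (rule zF) (use grp[OF nV(1)] as in auto)
    then show ?thesis by (simp add: fs_in[OF ja] \<Delta>_def T_minus)
  qed
  have insh_sets: "{x. insh x p} \<in> sets M" for p
  proof (cases "snd p \<in> ?sh (fst p)")
    case True
    then have "{x. insh x p} = {x. T (- snd p) x \<in> V (fst p)}" by (auto simp: insh_def)
    then show ?thesis using T_vimage_sets[OF nV(2)] by simp
  qed (auto simp: insh_def)
  have shc: "countable (\<Union>j. {j} \<times> ?sh j)"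
    by (intro countable_UN countable_SIGMA) (auto simp: box_shell_def finite_cube countable_finite)
  have fs_meas: "fs s \<in> borel_measurable M" if s: "s \<in> S" for s
  proof (rule measurable_countable_cases[where J = "insert None (Some ` (\<Union>j. {j} \<times> ?sh j))"
        and E = "\<lambda>o'. case o' of None \<Rightarrow> UNIV - (\<Union>p\<in>(\<Union>j. {j} \<times> ?sh j). {x. insh x p}) | Some p \<Rightarrow> {x. insh x p}"
        and g = "\<lambda>o' x. case o' of None \<Rightarrow> f s x | Some p \<Rightarrow> f s x + \<Delta> (fst p) (T (- snd p) x) (snd p) s"])
    show "countable (insert None (Some ` (\<Union>j. {j} \<times> ?sh j)))" using shc by auto
    have U: "(\<Union>p\<in>(\<Union>j. {j} \<times> ?sh j). {x. insh x p}) \<in> sets M" by (intro sets.countable_UN'' shc insh_sets)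
    show "(case i of None \<Rightarrow> UNIV - (\<Union>p\<in>(\<Union>j. {j} \<times> ?sh j). {x. insh x p}) | Some p \<Rightarrow> {x. insh x p}) \<in> sets M" for i
      using sets.compl_sets[OF U] insh_sets by (auto simp: space_UNIV split: option.split)
    show "(\<lambda>x. case i of None \<Rightarrow> f s x | Some p \<Rightarrow> f s x + \<Delta> (fst p) (T (- snd p) x) (snd p) s) \<in> borel_measurable M" for i
      using f[OF s] by (cases i) (auto intro!: borel_measurable_add measurable_compose[OF T_measurable \<Delta>_meas])
    show "(\<Union>i\<in>insert None (Some ` (\<Union>j. {j} \<times> ?sh j)). case i of None \<Rightarrow> UNIV - (\<Union>p\<in>(\<Union>j. {j} \<times> ?sh j). {x. insh x p}) | Some p \<Rightarrow> {x. insh x p}) = UNIV"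
      by auto
    show "fs s x = (case i of None \<Rightarrow> f s x | Some p \<Rightarrow> f s x + \<Delta> (fst p) (T (- snd p) x) (snd p) s)"
      if "i \<in> insert None (Some ` (\<Union>j. {j} \<times> ?sh j))" "x \<in> (case i of None \<Rightarrow> UNIV - (\<Union>p\<in>(\<Union>j. {j} \<times> ?sh j). {x. insh x p}) | Some p \<Rightarrow> {x. insh x p})" for i x
    proof (cases i)
      case None
      then have "\<nexists>p. insh x p" using that by (auto simp: insh_def)
      then show ?thesis using None by (simp add: fs_out)
    next
      case (Some p)
      then show ?thesis using that fs_in[of x "fst p" "snd p" s] by simp
    qed
  qed (simp add: space_UNIV)
  let ?B = "\<lambda>j. cube m 0 (n j)"
  \<comment> \<open>The integers on which the rounding in a box depends: floors (index 0), ceilings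
    (index 1) and divergences (index 2) of the corrected flow at all positions.\<close>
  define q :: "((nat \<Rightarrow> int) \<times> (nat \<Rightarrow> int)) \<times> nat \<Rightarrow> 'a \<Rightarrow> int" where
    "q i u = (if snd i = 0 then \<lfloor>fs (snd (fst i)) (T (fst (fst i)) u)\<rfloor> else if snd i = 1 then \<lceil>fs (snd (fst i)) (T (fst (fst i)) u)\<rceil>
       else \<lfloor>\<Sum>t\<in>S. fs t (T (fst (fst i)) u)\<rfloor>)" for i u
  let ?J = "\<lambda>j. (?B j \<times> S) \<times> {0, 1, 2::nat}"
  have q_meas: "q i \<in> measurable M (count_space UNIV)" if i: "i \<in> ?J j" for i j
  proof -
    have 1: "(\<lambda>u. fs t (T a u)) \<in> borel_measurable M" if "t \<in> S" for t a
      by (rule measurable_compose[OF T_measurable fs_meas[OF that]])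
    have 2: "(\<lambda>u. \<Sum>t\<in>S. fs t (T a u)) \<in> borel_measurable M" for a by (intro borel_measurable_sum 1)
    have s: "snd (fst i) \<in> S" using i by auto
    note 3 = 1[OF s, of "fst (fst i)"]
    have "(\<lambda>u. \<lfloor>fs (snd (fst i)) (T (fst (fst i)) u)\<rfloor>) \<in> measurable M (count_space UNIV)"
      "(\<lambda>u. \<lceil>fs (snd (fst i)) (T (fst (fst i)) u)\<rceil>) \<in> measurable M (count_space UNIV)"
      "(\<lambda>u. \<lfloor>\<Sum>t\<in>S. fs t (T (fst (fst i)) u)\<rfloor>) \<in> measurable M (count_space UNIV)"
      using 3 2 by measurable
    then show ?thesis unfolding q_def[abs_def] by (cases "snd i = 0"; cases "snd i = 1") simp_all
  qed
  define P where "P j d H \<longleftrightarrow> (\<forall>a\<in>?B j. \<forall>s\<in>S. d ((a, s), 0) \<le> H a s \<and> H a s \<le> d ((a, s), 1) \<and>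
      (\<Sum>t\<in>S. H a t) = d ((a, s), 2) \<and> (a + s \<in> ?B j \<longrightarrow> H (a + s) (- s) = - H a s))"
    for j and d :: "((nat \<Rightarrow> int) \<times> (nat \<Rightarrow> int)) \<times> nat \<Rightarrow> int" and H :: "(nat \<Rightarrow> int) \<Rightarrow> (nat \<Rightarrow> int) \<Rightarrow> int"
  \<comment> \<open>The selection sees only the integer data \<open>d\<close>, not the point of the
    space; this is what makes \<open>g\<close> measurable.\<close>
  define Hs where "Hs j d = (SOME H. P j d H)" for j d
  define data where "data j u = (\<lambda>i\<in>?J j. q i u)" for j u
  have PH: "P j (data j u) (Hs j (data j u))" if u: "u \<in> V j" for j u
  proof -
    have "\<exists>H :: (nat \<Rightarrow> int) \<Rightarrow> (nat \<Rightarrow> int) \<Rightarrow> int.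
        (\<forall>a\<in>?B j. \<forall>s\<in>S. \<lfloor>fs s (T a u)\<rfloor> \<le> H a s \<and> H a s \<le> \<lceil>fs s (T a u)\<rceil>) \<and>
        (\<forall>a\<in>?B j. \<forall>s\<in>S. a + s \<in> ?B j \<longrightarrow> H (a + s) (- s) = - H a s) \<and>
        (\<forall>a\<in>?B j. of_int (\<Sum>s\<in>S. H a s) = (\<Sum>s\<in>S. fs s (T a u)))"
    proof (rule integral_flow_rounding[OF finite_cube finS symS S0])
      fix a s assume s: "s \<in> S"
      have "T (a + s) u = T s (T a u)" by (metis T_add add.commute)
      then show "fs (- s) (T (a + s) u) = - fs s (T a u)" using fs_anti[OF s] by simp
    next
      fix a s assume "a \<in> ?B j" "s \<in> S" "a + s \<notin> ?B j"
      then have "(a, s) \<in> box_crossing m S (n j)" by (simp add: box_crossing_def)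
      then show "fs s (T a u) \<in> \<int>" using u by (intro fs_cross[of a "T a u" j s]) (auto simp: T_minus)
    next
      fix a show "(\<Sum>s\<in>S. fs s (T a u)) \<in> \<int>" using div by (simp add: fs_div)
    qed
    then obtain H :: "(nat \<Rightarrow> int) \<Rightarrow> (nat \<Rightarrow> int) \<Rightarrow> int" where
      H1: "\<forall>a\<in>?B j. \<forall>s\<in>S. \<lfloor>fs s (T a u)\<rfloor> \<le> H a s \<and> H a s \<le> \<lceil>fs s (T a u)\<rceil>" and
      H2: "\<forall>a\<in>?B j. \<forall>s\<in>S. a + s \<in> ?B j \<longrightarrow> H (a + s) (- s) = - H a s" and
      H3: "\<forall>a\<in>?B j. of_int (\<Sum>s\<in>S. H a s) = (\<Sum>s\<in>S. fs s (T a u))" by (elim exE conjE)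
    have "P j (data j u) H"
      unfolding P_def
    proof (intro ballI)
      fix a s assume as: "a \<in> ?B j" "s \<in> S"
      have d: "data j u ((a, s), 0) = \<lfloor>fs s (T a u)\<rfloor>" "data j u ((a, s), 1) = \<lceil>fs s (T a u)\<rceil>"
        "data j u ((a, s), 2) = \<lfloor>\<Sum>t\<in>S. fs t (T a u)\<rfloor>" using as by (simp_all add: data_def q_def)
      have "(\<Sum>t\<in>S. H a t) = \<lfloor>\<Sum>t\<in>S. fs t (T a u)\<rfloor>"
        unfolding H3[rule_format, OF as(1), symmetric] by (rule floor_of_int[symmetric])
      then show "data j u ((a, s), 0) \<le> H a s \<and> H a s \<le> data j u ((a, s), 1) \<and>
        (\<Sum>t\<in>S. H a t) = data j u ((a, s), 2) \<and> (a + s \<in> ?B j \<longrightarrow> H (a + s) (- s) = - H a s)"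
        unfolding d using H1[rule_format, OF as] H2[rule_format, OF as] by blast
    qed
    then show ?thesis unfolding Hs_def using someI[of "P j (data j u)" H] by simp
  qed
  define inbox where "inbox x p \<longleftrightarrow> snd p \<in> ?B (fst p) \<and> T (- snd p) x \<in> V (fst p)" for x p
  have inbox_unique: "a = b" if ab: "inbox x (j, a)" "inbox x (j, b)" for x j a b
  proof -
    have sub: "?B j \<subseteq> cube m (- R) (n j + R)" using R1 by (force simp: cube_def)
    have "a \<in> cube m (- R) (n j + R)" "b \<in> cube m (- R) (n j + R)" "T (- a) x \<in> V j" "T (- b) x \<in> V j"
      using ab sub by (auto simp: inbox_def)
    then show ?thesis by (rule nV(3)[unfolded separated_def, rule_format])
  qed
  \<comment> \<open>Boxes of different levels can be nested, and each point uses the lowest level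
    that covers it.\<close>
  define lev where "lev x = (LEAST j. \<exists>a. inbox x (j, a))" for x
  define pos where "pos x = (THE a. inbox x (lev x, a))" for x
  define cov where "cov x \<longleftrightarrow> (\<exists>j a. inbox x (j, a))" for x
  have lp: "inbox x (lev x, pos x)" if x: "cov x" for x
  proof -
    have "\<exists>a. inbox x (lev x, a)" unfolding lev_def by (rule LeastI_ex) (use x in \<open>simp add: cov_def\<close>)
    then obtain a where a: "inbox x (lev x, a)" by (rule exE)
    then have "pos x = a" unfolding pos_def by (intro the_equality inbox_unique[OF _ a])
    then show ?thesis using a by simp
  qed
  have lev_le: "lev x \<le> j" if "inbox x (j, a)" for x j a
    unfolding lev_def by (rule Least_le) (rule exI[of _ a], rule that)
  have pos_eq: "pos x = a" if "inbox x (lev x, a)" for x a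
    by (rule inbox_unique[OF lp that]) (use that in \<open>auto simp: cov_def\<close>)
  define g where "g s x = (if cov x then Hs (lev x) (data (lev x) (T (- pos x) x)) (pos x) s else 0)" for s x
  have inbox_sets: "{x. inbox x p} \<in> sets M" for p
  proof (cases "snd p \<in> ?B (fst p)")
    case True
    then have "{x. inbox x p} = {x. T (- snd p) x \<in> V (fst p)}" by (auto simp: inbox_def)
    then show ?thesis using T_vimage_sets[OF nV(2)] by simp
  qed (auto simp: inbox_def)
  let ?JJ = "\<Union>j. {j} \<times> ?B j"
  have JJc: "countable ?JJ"
    by (intro countable_UN countable_SIGMA) (auto simp: finite_cube countable_finite)
  have lev_sets: "{x. cov x \<and> lev x = j} \<in> sets M" for j
  proof -
    have C: "{x. \<exists>a. inbox x (j, a)} \<in> sets M" for j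
    proof -
      have "{x. \<exists>a. inbox x (j, a)} = (\<Union>a\<in>?B j. {x. inbox x (j, a)})" by (auto simp: inbox_def)
      then show ?thesis using sets.finite_UN[OF finite_cube inbox_sets] by simp
    qed
    have "{x. cov x \<and> lev x = j} = {x. \<exists>a. inbox x (j, a)} - (\<Union>i<j. {x. \<exists>a. inbox x (i, a)})"
    proof (intro set_eqI iffI)
      fix x assume x: "x \<in> {x. cov x \<and> lev x = j}"
      then have "inbox x (j, pos x)" using lp[of x] by simp
      moreover have "\<not> inbox x (i, a)" if "i < j" for i a using lev_le[of x i a] that x by auto
      ultimately show "x \<in> {x. \<exists>a. inbox x (j, a)} - (\<Union>i<j. {x. \<exists>a. inbox x (i, a)})" by auto
    next
      fix x assume "x \<in> {x. \<exists>a. inbox x (j, a)} - (\<Union>i<j. {x. \<exists>a. inbox x (i, a)})"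
      then obtain a where a: "inbox x (j, a)" and no: "\<And>i a. i < j \<Longrightarrow> \<not> inbox x (i, a)" by auto
      have "cov x" using a by (auto simp: cov_def)
      moreover have "lev x = j" using lev_le[OF a] no[of "lev x" "pos x"] lp[OF \<open>cov x\<close>] by (cases "lev x < j") auto
      ultimately show "x \<in> {x. cov x \<and> lev x = j}" by simp
    qed
    then show ?thesis using C by auto
  qed
  have cov_sets: "{x. \<not> cov x} \<in> sets M"
  proof -
    have "{x. \<not> cov x} = space M - (\<Union>j. {x. cov x \<and> lev x = j})" by (auto simp: space_UNIV)
    then show ?thesis using lev_sets by auto
  qed
  have g_meas: "g s \<in> measurable M (count_space UNIV)" for s
  proof (rule measurable_countable_cases[where J = "insert None (Some ` ?JJ)"
        and E = "\<lambda>o'. case o' of None \<Rightarrow> {x. \<not> cov x} | Some p \<Rightarrow> {x. inbox x p} \<inter> {x. cov x \<and> lev x = fst p}"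
        and g = "\<lambda>o' x. case o' of None \<Rightarrow> 0 | Some p \<Rightarrow> Hs (fst p) (data (fst p) (T (- snd p) x)) (snd p) s"])
    show "countable (insert None (Some ` ?JJ))" using JJc by auto
    show "(case i of None \<Rightarrow> {x. \<not> cov x} | Some p \<Rightarrow> {x. inbox x p} \<inter> {x. cov x \<and> lev x = fst p}) \<in> sets M" for i
      using cov_sets sets.Int[OF inbox_sets lev_sets] by (auto split: option.split)
    show "(\<lambda>x. case i of None \<Rightarrow> 0 | Some p \<Rightarrow> Hs (fst p) (data (fst p) (T (- snd p) x)) (snd p) s) \<in> measurable M (count_space UNIV)" for i
    proof (cases i)
      case (Some p)
      have "finite (?J (fst p))" using finS by (auto simp: finite_cube)
      then have "(\<lambda>u. Hs (fst p) (data (fst p) u) (snd p) s) \<in> measurable M (count_space UNIV)"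
        unfolding data_def by (rule measurable_finite_countable_data[where G = "\<lambda>d. Hs (fst p) d (snd p) s", OF _ space_UNIV q_meas])
      from measurable_compose[OF T_measurable this, of "- snd p"] show ?thesis using Some by simp
    qed simp
    show "(\<Union>i\<in>insert None (Some ` ?JJ). case i of None \<Rightarrow> {x. \<not> cov x} | Some p \<Rightarrow> {x. inbox x p} \<inter> {x. cov x \<and> lev x = fst p}) = UNIV"
    proof (intro set_eqI iffI UNIV_I)
      fix x
      show "x \<in> (\<Union>i\<in>insert None (Some ` ?JJ). case i of None \<Rightarrow> {x. \<not> cov x} | Some p \<Rightarrow> {x. inbox x p} \<inter> {x. cov x \<and> lev x = fst p})"
      proof (cases "cov x")
        case True
        then have "(lev x, pos x) \<in> ?JJ" using lp[OF True] by (auto simp: inbox_def)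
        then show ?thesis using lp[OF True] True by (intro UN_I[of "Some (lev x, pos x)"]) auto
      qed auto
    qed
    show "g s x = (case i of None \<Rightarrow> 0 | Some p \<Rightarrow> Hs (fst p) (data (fst p) (T (- snd p) x)) (snd p) s)"
      if "x \<in> (case i of None \<Rightarrow> {x. \<not> cov x} | Some p \<Rightarrow> {x. inbox x p} \<inter> {x. cov x \<and> lev x = fst p})" for i x
    proof (cases i)
      case None
      then show ?thesis using that by (simp add: g_def)
    next
      case (Some p)
      then have p: "inbox x p" "cov x" "lev x = fst p" using that by auto
      then have "pos x = snd p" by (intro pos_eq) simp
      then show ?thesis using p Some by (simp add: g_def)
    qed
  qed (simp add: space_UNIV)
  have PHx: "\<lfloor>fs s x\<rfloor> \<le> g s x" "g s x \<le> \<lceil>fs s x\<rceil>" "(\<Sum>t\<in>S. g t x) = \<lfloor>\<Sum>t\<in>S. fs t x\<rfloor>"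
    "pos x + s \<in> ?B (lev x) \<Longrightarrow> Hs (lev x) (data (lev x) (T (- pos x) x)) (pos x + s) (- s) = - g s x"
    if x: "cov x" and s: "s \<in> S" for x s
  proof -
    let ?u = "T (- pos x) x"
    have ib: "pos x \<in> ?B (lev x)" "?u \<in> V (lev x)" using lp[OF x] by (auto simp: inbox_def)
    have d: "data (lev x) ?u ((pos x, s), 0) = \<lfloor>fs s x\<rfloor>" "data (lev x) ?u ((pos x, s), 1) = \<lceil>fs s x\<rceil>"
        "data (lev x) ?u ((pos x, s), 2) = \<lfloor>\<Sum>t\<in>S. fs t x\<rfloor>" using ib s by (simp_all add: data_def q_def T_minus)
    have g: "g t x = Hs (lev x) (data (lev x) ?u) (pos x) t" for t using x by (simp add: g_def)
    note p = PH[OF ib(2), unfolded P_def, rule_format, OF ib(1) s, unfolded d, folded g]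
    show "\<lfloor>fs s x\<rfloor> \<le> g s x" "g s x \<le> \<lceil>fs s x\<rceil>" using p by auto
    show "(\<Sum>t\<in>S. g t x) = \<lfloor>\<Sum>t\<in>S. fs t x\<rfloor>" using p unfolding g by auto
    show "pos x + s \<in> ?B (lev x) \<Longrightarrow> Hs (lev x) (data (lev x) ?u) (pos x + s) (- s) = - g s x" using p by auto
  qed
  have g_int: "real_of_int (g s x) = fs s x" if x: "cov x" and s: "s \<in> S" and i: "fs s x \<in> \<int>" for x s
  proof -
    obtain k where k: "fs s x = of_int k" using i by (auto elim: Ints_cases)
    then show ?thesis using PHx(1,2)[OF x s] by simp
  qed
  have key: "(\<forall>s\<in>S. g (- s) (T s x) = - g s x \<and> \<bar>real_of_int (g s x) - f s x\<bar> \<le> 12 * real (card S) + 1) \<and>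
       real_of_int (\<Sum>s\<in>S. g s x) = (\<Sum>s\<in>S. f s x)" if x: "cov x" and xs: "\<And>s. s \<in> S \<Longrightarrow> cov (T s x)" for x
  proof (intro conjI ballI)
    show "real_of_int (\<Sum>s\<in>S. g s x) = (\<Sum>s\<in>S. f s x)"
    proof (cases "S = {}")
      case False
      then obtain s where s: "s \<in> S" by auto
      obtain k where k: "(\<Sum>s\<in>S. f s x) = of_int k" using div[of x] by (auto elim: Ints_cases)
      show ?thesis unfolding PHx(3)[OF x s] fs_div k by simp
    qed simp
    fix s assume s: "s \<in> S"
    have "\<bar>real_of_int (g s x) - fs s x\<bar> \<le> 1" using PHx(1,2)[OF x s] by linarith
    then show "\<bar>real_of_int (g s x) - f s x\<bar> \<le> 12 * real (card S) + 1" using fs_bound[of s x] by linarith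
    let ?y = "T s x"
    have y: "cov ?y" and ms: "- s \<in> S" using xs s symS by auto
    have ibx: "pos x \<in> ?B (lev x)" "T (- pos x) x \<in> V (lev x)" using lp[OF x] by (auto simp: inbox_def)
    have iby: "pos ?y \<in> ?B (lev ?y)" "T (- pos ?y) ?y \<in> V (lev ?y)" using lp[OF y] by (auto simp: inbox_def)
    have int: "g (- s) ?y = - g s x" if "fs s x \<in> \<int>"
    proof -
      have "fs (- s) ?y \<in> \<int>" using that fs_anti[OF s] by simp
      then have "real_of_int (g (- s) ?y) = - real_of_int (g s x)"
        using g_int[OF y ms] g_int[OF x s that] fs_anti[OF s, of x] by simp
      then show ?thesis by linarith
    qed
    \<comment> \<open>An edge that leaves the box chosen for one of its ends carries an integral
      value of \<open>fs\<close>, and floor and ceiling leave integers alone, so both ends agree.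
      Otherwise each end lies in the box chosen for the other; minimality makes the levels equal,
      and a single rounding serves both ends.\<close>
    consider "pos x + s \<notin> ?B (lev x)" | "pos ?y + - s \<notin> ?B (lev ?y)"
      | "pos x + s \<in> ?B (lev x)" "pos ?y + - s \<in> ?B (lev ?y)" by blast
    then show "g (- s) ?y = - g s x"
    proof cases
      case 1
      then have "(pos x, s) \<in> box_crossing m S (n (lev x))" using ibx s by (simp add: box_crossing_def)
      then show ?thesis using fs_cross[OF ibx(2)] int by blast
    next
      case 2
      then have "(pos ?y, - s) \<in> box_crossing m S (n (lev ?y))" using iby ms by (simp add: box_crossing_def)
      then have "fs (- s) ?y \<in> \<int>" by (rule fs_cross[OF iby(2)])
      then have "fs s x \<in> \<int>" using fs_anti[OF s, of x] by (simp add: minus_in_Ints_iff)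
      then show ?thesis by (rule int)
    next
      case 3
      have e1: "T (- (pos x + s)) ?y = T (- pos x) x" by (simp flip: T_add)
      have i1: "inbox ?y (lev x, pos x + s)" using 3(1) ibx(2) e1 by (simp add: inbox_def)
      have "T (- (pos ?y + - s)) x = T (- pos ?y) ?y" by (simp flip: T_add)
      then have i2: "inbox x (lev ?y, pos ?y + - s)" using 3(2) iby(2) by (simp add: inbox_def)
      have lev: "lev ?y = lev x" using lev_le[OF i1] lev_le[OF i2] by simp
      then have pos: "pos ?y = pos x + s" using i1 by (intro pos_eq) simp
      have "g (- s) ?y = Hs (lev x) (data (lev x) (T (- pos x) x)) (pos x + s) (- s)"
        unfolding g_def lev pos e1 using y by (simp only: if_True)
      then show ?thesis using PHx(4)[OF x s 3(1)] by simp
    qed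
  qed
  have AEc: "AE x in M. cov x"
    using cover by eventually_elim (auto simp: cov_def inbox_def box_cover_def)
  have "AE x in M. cov x \<and> (\<forall>s\<in>S. cov (T s x))"
    using AEc AE_T[OF AEc] finS by (simp add: AE_finite_all)
  then have "AE x in M. (\<forall>s\<in>S. g (- s) (T s x) = - g s x \<and> \<bar>real_of_int (g s x) - f s x\<bar> \<le> 12 * real (card S) + 1) \<and>
       real_of_int (\<Sum>s\<in>S. g s x) = (\<Sum>s\<in>S. f s x)"
    by eventually_elim (rule key, auto)
  then show ?thesis using g_meas by (intro exI[of _ g] conjI ballI)
qed

end

section \<open>Lattices\<close>

definition subgroup_vec :: "'a::ab_group_add set \<Rightarrow> bool" where
  "subgroup_vec G \<longleftrightarrow> 0 \<in> G \<and> (\<forall>x\<in>G. \<forall>y\<in>G. x + y \<in> G) \<and> (\<forall>x\<in>G. - x \<in> G)"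

lemma subgroup_vecD:
  assumes "subgroup_vec G"
  shows "0 \<in> G" "x \<in> G \<Longrightarrow> y \<in> G \<Longrightarrow> x + y \<in> G" "x \<in> G \<Longrightarrow> - x \<in> G" "x \<in> G \<Longrightarrow> y \<in> G \<Longrightarrow> x - y \<in> G"
  using assms unfolding subgroup_vec_def by (auto, metis diff_conv_add_uminus)

lemma subgroup_vec_sum: "subgroup_vec G \<Longrightarrow> (\<And>i. i \<in> I \<Longrightarrow> f i \<in> G) \<Longrightarrow> sum f I \<in> G"
  by (induction I rule: infinite_finite_induct) (auto simp: subgroup_vecD)

lemma subgroup_vec_nat_scale:
  fixes G :: "'a::real_vector set"
  assumes "subgroup_vec G" "x \<in> G" shows "real k *\<^sub>R x \<in> G"
  by (induction k) (auto simp: subgroup_vecD[OF assms(1)] assms(2) scaleR_add_left)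

lemma subgroup_vec_int_scale:
  fixes G :: "'a::real_vector set"
  assumes "subgroup_vec G" "x \<in> G" shows "real_of_int k *\<^sub>R x \<in> G"
proof (cases "k \<ge> 0")
  case True
  then show ?thesis using subgroup_vec_nat_scale[OF assms, of "nat k"] by simp
next
  case False
  then show ?thesis using subgroup_vecD(3)[OF assms(1) subgroup_vec_nat_scale[OF assms, of "nat (- k)"]] by simp
qed

lemma is_lattice_subgroup: "is_lattice L \<Longrightarrow> subgroup_vec L"
  by (simp add: is_lattice_def subgroup_vec_def)

lemma is_lattice_uniform_discrete: assumes "is_lattice L" shows "uniform_discrete L"
proof -
  note sg = subgroup_vecD[OF is_lattice_subgroup[OF assms]]
  have "0 isolated_in L" using assms sg(1) by (auto simp: is_lattice_def discrete_def)
  then obtain e where e: "e > 0" "\<And>y. y \<in> L \<Longrightarrow> dist 0 y < e \<Longrightarrow> y = 0"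
    unfolding isolated_in_dist_Ex_iff by blast
  have "x = y" if "x \<in> L" "y \<in> L" "dist x y < e" for x y
    using e(2)[of "x - y"] that sg(4) by (simp add: dist_norm norm_minus_commute)
  then show ?thesis using e(1) by (auto simp: uniform_discrete_def)
qed

lemma is_lattice_finite_bounded: assumes "is_lattice L" "bounded K" shows "finite (L \<inter> K)"
  using is_lattice_uniform_discrete[OF assms(1)] assms(2) uniform_discrete_finite_iff[of "L \<inter> K"] bounded_subset[OF assms(2), of "L \<inter> K"]
  by (meson inf_le1 inf_le2 uniform_discrete_subset)

section \<open>Matrices generating a lattice\<close>

definition rounded :: "real ^ 'n \<Rightarrow> real ^ 'n" where
  "rounded y = (\<chi> i. of_int \<lfloor>y $ i + 1 / 2\<rfloor>)"

text \<open>Centred at the origin, so that the fundamental domains made from it contain a ball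
  around 0.\<close>

definition centered_cube :: "(real ^ 'n) set" where
  "centered_cube = {y. \<forall>i. - 1 / 2 \<le> y $ i \<and> y $ i < 1 / 2}"

lemma rounded_int: "rounded y \<in> int_vectors"
  by (simp add: rounded_def int_vectors_def)

lemma minus_rounded: "y - rounded y \<in> centered_cube"
  unfolding centered_cube_def rounded_def by (auto simp: algebra_simps) linarith+

lemma centered_cube_unique:
  assumes "z \<in> int_vectors" "y - z \<in> centered_cube" shows "z = rounded y"
proof -
  have "z $ i = of_int \<lfloor>y $ i + 1 / 2\<rfloor>" for i
  proof -
    obtain k where k: "z $ i = of_int k" using assms(1) by (auto simp: int_vectors_def elim: Ints_cases)
    have "- 1 / 2 \<le> y $ i - z $ i" "y $ i - z $ i < 1 / 2" using assms(2) by (auto simp: centered_cube_def)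
    then have "\<lfloor>y $ i + 1 / 2\<rfloor> = k" using k by (intro floor_unique) auto
    then show ?thesis using k by simp
  qed
  then show ?thesis by (simp add: rounded_def vec_eq_iff)
qed

lemma centered_cube_bounded: "bounded (centered_cube :: (real ^ 'n) set)"
proof -
  have "norm y \<le> (\<Sum>i\<in>(UNIV :: 'n set). 1)" if y: "y \<in> centered_cube" for y :: "real ^ 'n"
  proof -
    have "\<bar>y $ i\<bar> \<le> 1" for i
    proof -
      have "- 1 / 2 \<le> y $ i" "y $ i < 1 / 2" using y by (auto simp: centered_cube_def)
      then show ?thesis by linarith
    qed
    then show ?thesis by (intro order_trans[OF norm_le_l1_cart] sum_mono)
  qed
  then show ?thesis by (auto simp: bounded_iff)
qed

lemma det_nonzero_inverse:
  fixes A :: "real ^ 'n ^ 'n"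
  assumes "det A \<noteq> 0"
  obtains B where "A ** B = mat 1" "B ** A = mat 1"
  using assms by (metis invertible_def invertible_det_nz)

lemma int_vectors_subgroup: "subgroup_vec (int_vectors :: (real ^ 'n) set)"
  by (auto simp: subgroup_vec_def int_vectors_def minus_in_Ints_iff)

lemma matrix_lattice_subgroup: "subgroup_vec (matrix_lattice A)"
  unfolding subgroup_vec_def matrix_lattice_def
proof (intro conjI ballI)
  note sg = subgroup_vecD[OF int_vectors_subgroup]
  show "0 \<in> (*v) A ` int_vectors" by (rule image_eqI[of _ _ 0]) (auto simp: sg)
  fix x assume "x \<in> (*v) A ` int_vectors"
  then obtain z where z: "x = A *v z" "z \<in> int_vectors" by auto
  show "- x \<in> (*v) A ` int_vectors"
    by (rule image_eqI[of _ _ "- z"]) (use z sg in \<open>auto simp: linear_neg[OF matrix_vector_mul_linear]\<close>)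
  fix y assume "y \<in> (*v) A ` int_vectors"
  then obtain w where w: "y = A *v w" "w \<in> int_vectors" by auto
  show "x + y \<in> (*v) A ` int_vectors"
    by (rule image_eqI[of _ _ "z + w"]) (use z w sg in \<open>auto simp: matrix_vector_right_distrib\<close>)
qed

lemma matrix_lattice_subset:
  assumes G: "subgroup_vec G" and col: "\<And>j. column j A \<in> G"
  shows "matrix_lattice A \<subseteq> G"
proof
  fix x assume "x \<in> matrix_lattice A"
  then obtain z where z: "z \<in> int_vectors" "x = A *v z" by (auto simp: matrix_lattice_def)
  have "z $ j *\<^sub>R column j A \<in> G" for j
  proof -
    obtain k where "z $ j = of_int k" using z(1) by (auto simp: int_vectors_def elim: Ints_cases)
    then show ?thesis using subgroup_vec_int_scale[OF G col] by simp
  qed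
  then have "(\<Sum>j\<in>UNIV. z $ j *\<^sub>R column j A) \<in> G" by (intro subgroup_vec_sum[OF G])
  then show "x \<in> G" by (simp add: z(2) matrix_mult_sum scalar_mult_eq_scaleR)
qed

lemma independent_columns_matrix:
  fixes G :: "(real ^ 'n) set"
  assumes "span G = UNIV"
  obtains A :: "real ^ 'n ^ 'n" where "det A \<noteq> 0" "\<And>j. column j A \<in> G"
proof -
  obtain B where B: "B \<subseteq> G" "independent B" "G \<subseteq> span B" "card B = dim G" using basis_exists[of G] by blast
  have dim: "dim G = CARD('n)" by (metis assms dim_UNIV dim_span DIM_cart DIM_real mult.right_neutral)
  have spB: "span B = UNIV" using B(3) assms span_mono[of G "span B"] by (auto simp: span_span)
  have "finite B" using B(2) by (rule independent_imp_finite)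
  then obtain b where b: "bij_betw b (UNIV :: 'n set) B"
    using B(4) dim by (metis finite_same_card_bij finite_class.finite_UNIV)
  define A :: "real ^ 'n ^ 'n" where "A = (\<chi> i j. b j $ i)"
  have col: "column j A = b j" for j by (simp add: A_def column_def vec_eq_iff)
  have "columns A = B" using b by (auto simp: columns_def col bij_betw_def)
  then have "vec.span (columns A) = UNIV" using spB by (simp add: span_vec_eq)
  then have "\<exists>C. A ** C = mat 1" by (simp only: matrix_right_invertible_span_columns)
  then have "det A \<noteq> 0" by (simp add: invertible_right_inverse flip: invertible_det_nz)
  moreover have "column j A \<in> G" for j using b B(1) by (auto simp: col bij_betw_def)
  ultimately show ?thesis by (rule that)
qed

text \<open>Pigeonhole: reduced modulo the sublattice, the multiples of \<open>x\<close> fall into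
  the finite set \<open>L \<inter> ?P\<close>, so two of the first \<open>N + 1\<close> agree and
  some \<open>k \<le> N\<close> brings \<open>x\<close> into the sublattice. The factorial of
  \<open>N\<close> is a multiple of every such \<open>k\<close>.\<close>

lemma lattice_multiple:
  assumes L: "is_lattice L" and A: "det A \<noteq> 0" "\<And>j. column j A \<in> L"
  obtains q :: nat where "q > 0" "\<And>x. x \<in> L \<Longrightarrow> real q *\<^sub>R x \<in> matrix_lattice A"
proof -
  note sg = is_lattice_subgroup[OF L]
  obtain B where AB: "A ** B = mat 1" "B ** A = mat 1" using det_nonzero_inverse[OF A(1)] .
  let ?P = "(*v) A ` centered_cube"
  have "bounded ?P" by (intro bounded_linear_image centered_cube_bounded matrix_vector_mul_bounded_linear)
  then have fin: "finite (L \<inter> ?P)" by (rule is_lattice_finite_bounded[OF L])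
  define N where "N = card (L \<inter> ?P)"
  have "\<exists>k\<in>{1..N}. real k *\<^sub>R x \<in> matrix_lattice A" if x: "x \<in> L" for x
  proof -
    define r where "r k = real k *\<^sub>R x - A *v rounded (B *v (real k *\<^sub>R x))" for k :: nat
    have r: "r k \<in> L \<inter> ?P" for k
    proof -
      have "A *v rounded (B *v (real k *\<^sub>R x)) \<in> L"
        using matrix_lattice_subset[OF sg A(2)] rounded_int by (auto simp: matrix_lattice_def)
      then have "r k \<in> L" unfolding r_def by (intro subgroup_vecD(4)[OF sg] subgroup_vec_nat_scale[OF sg x])
      moreover have "r k = A *v (B *v (real k *\<^sub>R x) - rounded (B *v (real k *\<^sub>R x)))"
        by (simp add: r_def matrix_vector_mult_diff_distrib matrix_vector_mul_assoc AB)
      then have "r k \<in> ?P" using minus_rounded by blast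
      ultimately show ?thesis by simp
    qed
    have "\<not> inj_on r {0..N}"
    proof
      assume "inj_on r {0..N}"
      then have "card {0..N} \<le> card (L \<inter> ?P)" using r fin by (intro card_inj_on_le[of r]) auto
      then show False by (simp add: N_def)
    qed
    then obtain k l where kl: "k < l" "l \<le> N" "r k = r l" unfolding inj_on_def by (metis atLeastAtMost_iff linorder_neqE_nat)
    have "real (l - k) *\<^sub>R x = A *v (rounded (B *v (real l *\<^sub>R x)) - rounded (B *v (real k *\<^sub>R x)))"
      using kl by (simp add: r_def matrix_vector_mult_diff_distrib of_nat_diff scaleR_left_diff_distrib algebra_simps)
    then have "real (l - k) *\<^sub>R x \<in> matrix_lattice A"
      unfolding matrix_lattice_def using subgroup_vecD(4)[OF int_vectors_subgroup rounded_int rounded_int] by blast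
    then show ?thesis using kl by (intro bexI[of _ "l - k"]) auto
  qed
  then have "real (fact N) *\<^sub>R x \<in> matrix_lattice A" if "x \<in> L" for x
  proof -
    obtain k where k: "k \<in> {1..N}" "real k *\<^sub>R x \<in> matrix_lattice A" using \<open>x \<in> L\<close> \<open>\<And>x. x \<in> L \<Longrightarrow> \<exists>k\<in>{1..N}. _ k x\<close> by blast
    then have "k dvd fact N" by (intro dvd_fact) auto
    then obtain c where c: "fact N = k * c" by (auto simp: dvd_def)
    then have "real (fact N) *\<^sub>R x = real c *\<^sub>R (real k *\<^sub>R x)" by (simp add: mult.commute)
    then show ?thesis using subgroup_vec_nat_scale[OF matrix_lattice_subgroup k(2), of c] by (simp only:)
  qed
  then show ?thesis by (intro that[of "fact N"]) auto
qed

text \<open>Independent vectors of \<open>L\<close> with the least determinant form a basis: a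
  vector of \<open>L\<close> with a fractional coordinate could replace a column and reduce the
  determinant.\<close>

theorem is_lattice_matrix:
  fixes L :: "(real ^ 'n) set"
  assumes L: "is_lattice L"
  obtains A where "det A \<noteq> 0" "L = matrix_lattice A"
proof -
  note sg = is_lattice_subgroup[OF L]
  obtain A0 :: "real ^ 'n ^ 'n" where A0: "det A0 \<noteq> 0" "\<And>j. column j A0 \<in> L"
    using independent_columns_matrix[of L] L by (auto simp: is_lattice_def)
  obtain q where q: "q > 0" "\<And>x. x \<in> L \<Longrightarrow> real q *\<^sub>R x \<in> matrix_lattice A0"
    using lattice_multiple[OF L A0] by metis
  define W where "W = {A :: real ^ 'n ^ 'n. det A \<noteq> 0 \<and> (\<forall>j. column j A \<in> L)}"
  \<comment> \<open>The determinant, scaled so that it is an integer on \<open>W\<close>: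
    multiplication by \<open>q\<close> moves \<open>L\<close> into the lattice of \<open>A0\<close>.
    Integrality guarantees that the minimum is attained.\<close>
  define v where "v A = \<bar>det A\<bar> * real q ^ CARD('n) / \<bar>det A0\<bar>" for A :: "real ^ 'n ^ 'n"
  have vint: "v A \<in> \<int>" if "A \<in> W" for A
  proof -
    have "\<exists>z. z \<in> int_vectors \<and> real q *\<^sub>R column j A = A0 *v z" for j
      using q(2)[of "column j A"] that by (auto simp: W_def matrix_lattice_def)
    then obtain z where z: "\<And>j. z j \<in> int_vectors" "\<And>j. real q *\<^sub>R column j A = A0 *v z j" by metis
    define U :: "real ^ 'n ^ 'n" where "U = (\<chi> i j. z j $ i)"
    have "real q * A $ i $ j = (A0 ** U) $ i $ j" for i j
      using arg_cong[OF z(2)[of j], of "\<lambda>v. v $ i"]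
      by (simp add: column_def matrix_matrix_mult_def matrix_vector_mult_def U_def)
    then have eq: "(\<chi> i. real q *s (A $ i)) = A0 ** U" by (simp add: vec_eq_iff)
    have "real q ^ CARD('n) * det A = det A0 * det U"
      using det_rows_mul[of "\<lambda>_. real q" "\<lambda>i. A $ i"] by (simp add: eq det_mul)
    then have "\<bar>real q ^ CARD('n) * det A\<bar> = \<bar>det A0\<bar> * \<bar>det U\<bar>" by (simp add: abs_mult)
    then have "v A = \<bar>det U\<bar>" using A0(1) by (simp add: v_def abs_mult field_simps)
    moreover have "det U \<in> \<int>" unfolding det_def
      using z(1) by (intro Ints_sum Ints_mult Ints_prod) (auto simp: U_def int_vectors_def)
    ultimately show ?thesis by (simp add: Ints_abs)
  qed
  have "A0 \<in> W" using A0 by (simp add: W_def)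
  then obtain A where A: "A \<in> W" "\<And>C. C \<in> W \<Longrightarrow> nat \<lfloor>v A\<rfloor> \<le> nat \<lfloor>v C\<rfloor>"
    using ex_has_least_nat[of "\<lambda>A. A \<in> W" A0 "\<lambda>A. nat \<lfloor>v A\<rfloor>"] by blast
  have dA: "det A \<noteq> 0" and cA: "\<And>j. column j A \<in> L" using A(1) by (auto simp: W_def)
  obtain B where AB: "A ** B = mat 1" "B ** A = mat 1" using det_nonzero_inverse[OF dA] .
  have "x \<in> matrix_lattice A" if x: "x \<in> L" for x
  proof -
    define c where "c = B *v x - (\<chi> i. of_int \<lfloor>(B *v x) $ i\<rfloor>)"
    have fl: "(\<chi> i. of_int \<lfloor>(B *v x) $ i\<rfloor>) \<in> (int_vectors :: (real ^ 'n) set)" by (simp add: int_vectors_def)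
    have xA: "A *v c = x - A *v (\<chi> i. of_int \<lfloor>(B *v x) $ i\<rfloor>)"
      by (simp add: c_def matrix_vector_mult_diff_distrib matrix_vector_mul_assoc AB)
    have "A *v (\<chi> i. of_int \<lfloor>(B *v x) $ i\<rfloor>) \<in> L"
      using matrix_lattice_subset[OF sg cA] fl by (auto simp: matrix_lattice_def)
    then have xL: "A *v c \<in> L" unfolding xA by (intro subgroup_vecD(4)[OF sg] x)
    have "c $ k = 0" for k
    proof (rule ccontr)
      assume "c $ k \<noteq> 0"
      then have ck: "0 < c $ k" "c $ k < 1" by (auto simp: c_def less_le) linarith+
      \<comment> \<open>By Cramer's rule, putting \<open>A *v c\<close> into column \<open>k\<close>
        multiplies the determinant by \<open>c $ k\<close>, which lies strictly between 0 and
        1.\<close>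
      define A' :: "real ^ 'n ^ 'n" where "A' = (\<chi> i j. if j = k then (A *v c) $ i else A $ i $ j)"
      have det: "det A' = c $ k * det A" unfolding A'_def by (rule cramer_lemma)
      have "column j A' = (if j = k then A *v c else column j A)" for j
        by (auto simp: A'_def column_def vec_eq_iff)
      then have W': "A' \<in> W" using det ck dA cA xL by (simp add: W_def)
      have v': "v A' = c $ k * v A" using ck by (simp add: v_def det abs_mult)
      have "v A > 0" using dA q A0 by (simp add: v_def)
      then have "v A' < v A" using ck by (simp add: v')
      moreover have "0 \<le> v A'" by (simp add: v_def)
      moreover obtain a a' where "v A = of_int a" "v A' = of_int a'" using vint A(1) W' by (meson Ints_cases)
      ultimately show False using A(2)[OF W'] by simp
    qed
    then have "c = 0" by (simp add: vec_eq_iff)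
    then show ?thesis using xA fl by (auto simp: matrix_lattice_def)
  qed
  then have "L = matrix_lattice A" using matrix_lattice_subset[OF sg cA] by auto
  then show ?thesis using that dA by blast
qed

section \<open>Fundamental domains\<close>

definition fundamental_domain :: "(real ^ 'n) set \<Rightarrow> (real ^ 'n) set \<Rightarrow> bool" where
  "fundamental_domain L D \<longleftrightarrow> D \<in> sets borel \<and> bounded D \<and> (\<forall>x. \<exists>!l. l \<in> L \<and> x - l \<in> D)"

lemma fundamental_domain_lmeasurable: "fundamental_domain L D \<Longrightarrow> D \<in> lmeasurable"
  unfolding fundamental_domain_def
  by (intro bounded_set_imp_lmeasurable) (auto simp: sets_completionI_sets)

lemma centered_cube_borel: "centered_cube \<in> sets (borel :: (real ^ 'n) measure)"
proof -
  have eq: "centered_cube = (\<Inter>i. {y :: real ^ 'n. - 1 / 2 \<le> y $ i} \<inter> {y. y $ i < 1 / 2})"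
    by (auto simp: centered_cube_def)
  have 1: "{y :: real ^ 'n. - 1 / 2 \<le> y $ i} \<in> sets borel" for i
    by (intro borel_closed closed_Collect_le continuous_intros)
  have 2: "{y :: real ^ 'n. y $ i < 1 / 2} \<in> sets borel" for i
    by (intro borel_open open_Collect_less continuous_intros)
  show ?thesis unfolding eq by (intro sets.countable_INT'' sets.Int 1 2) auto
qed

lemma centered_cube_lmeasurable: "centered_cube \<in> lmeasurable"
  using centered_cube_borel centered_cube_bounded
  by (intro bounded_set_imp_lmeasurable) (auto simp: sets_completionI_sets)

lemma measure_centered_cube: "measure lebesgue (centered_cube :: (real ^ 'n) set) = 1"
proof -
  let ?a = "\<chi> i. - (1 / 2) :: real ^ 'n" and ?b = "\<chi> i. 1 / 2 :: real ^ 'n"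
  have ip: "?a \<bullet> i = - (1 / 2)" "?b \<bullet> i = 1 / 2" if "i \<in> Basis" for i :: "real ^ 'n"
    using that by (auto simp: Basis_vec_def inner_axis)
  have m: "measure lebesgue (cbox ?a ?b) = 1" "measure lebesgue (box ?a ?b) = 1"
    by (simp_all add: measure_completion measure_lborel_cbox_eq measure_lborel_box_eq ip inner_diff_left)
  have sub: "box ?a ?b \<subseteq> centered_cube" "centered_cube \<subseteq> cbox ?a ?b"
    by (auto simp: centered_cube_def mem_box_cart less_imp_le)
  have "measure lebesgue (box ?a ?b) \<le> measure lebesgue (centered_cube :: (real ^ 'n) set)"
    by (rule measure_mono_fmeasurable[OF sub(1) _ centered_cube_lmeasurable]) simp
  moreover have "measure lebesgue (centered_cube :: (real ^ 'n) set) \<le> measure lebesgue (cbox ?a ?b)"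
    by (rule measure_mono_fmeasurable[OF sub(2)]) (use centered_cube_lmeasurable in auto)
  ultimately show ?thesis unfolding m by (intro antisym)
qed

text \<open>The rule \<open>measure_shear_interval\<close> wants a nonnegative lower bound in
  coordinate \<open>n\<close>. Translating by \<open>v\<close> moves this bound to 0, and the shear,
  being additive, turns the translation of the box into one of its image.\<close>

lemma measure_shear_cbox:
  fixes a b :: "real ^ 'n"
  assumes mn: "m \<noteq> n"
  defines "h \<equiv> \<lambda>v :: real ^ 'n. \<chi> i. if i = m then v $ m + v $ n else v $ i"
  shows "measure lebesgue (h ` cbox a b) = measure lebesgue (cbox a b)"
proof (cases "cbox a b = {}")
  case False
  define v :: "real ^ 'n" where "v = axis n (- a $ n)"
  have h_add: "h (x + y) = h x + h y" for x y by (simp add: h_def vec_eq_iff)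
  have "h ` cbox a b = (+) (- h v) ` h ` cbox (v + a) (v + b)"
    unfolding cbox_translation image_image by (simp add: h_add)
  then have "measure lebesgue (h ` cbox a b) = measure lebesgue (h ` cbox (v + a) (v + b))"
    by (simp only: measure_translation)
  also have "\<dots> = measure lebesgue (cbox (v + a) (v + b))"
    unfolding h_def
  proof (rule measure_shear_interval[OF mn])
    show "cbox (v + a) (v + b) \<noteq> {}" using False by (simp add: cbox_translation)
    show "0 \<le> (v + a) $ n" by (simp add: v_def)
  qed
  also have "\<dots> = measure lebesgue (cbox a b)"
    unfolding cbox_translation by (rule measure_translation)
  finally show ?thesis .
qed simp

text \<open>The library states this for well-ordered index types only.\<close>

lemma linear_image_measure:
  fixes f :: "real ^ 'n \<Rightarrow> real ^ 'n"
  assumes "linear f"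
  shows "\<forall>S\<in>lmeasurable. f ` S \<in> lmeasurable \<and> measure lebesgue (f ` S) = \<bar>det (matrix f)\<bar> * measure lebesgue S"
    (is "?P f")
proof -
  have comp: "?P (f \<circ> g)" if "linear f" "linear g" "?P f" "?P g" for f g :: "real ^ 'n \<Rightarrow> real ^ 'n"
  proof
    fix S :: "(real ^ 'n) set" assume S: "S \<in> lmeasurable"
    have fg: "(f \<circ> g) ` S = f ` (g ` S)" by (simp only: image_comp)
    have gS: "g ` S \<in> lmeasurable" "measure lebesgue (g ` S) = \<bar>det (matrix g)\<bar> * measure lebesgue S"
      using that(4) S by auto
    show "(f \<circ> g) ` S \<in> lmeasurable \<and> measure lebesgue ((f \<circ> g) ` S) = \<bar>det (matrix (f \<circ> g))\<bar> * measure lebesgue S"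
      unfolding fg matrix_compose[OF that(2,1)] det_mul abs_mult using that(3) gS by auto
  qed
  have const: "?P (\<lambda>x. \<chi> i. c i * x $ i)" for c :: "'n \<Rightarrow> real"
    by (auto simp: measurable_stretch measure_stretch axis_def matrix_def det_diagonal)
  have linc: "linear (\<lambda>x. \<chi> i. c i * x $ i)" for c :: "'n \<Rightarrow> real"
    by (rule linearI) (auto simp: vec_eq_iff algebra_simps)
  let ?h = "\<lambda>m n. \<lambda>x :: real ^ 'n. \<chi> i. if i = m then x $ m + x $ n else x $ i"
  have linh: "linear (?h m n)" for m n
    by (rule linearI) (auto simp: vec_eq_iff algebra_simps)
  have shear: "?P (?h m n)" if mn: "m \<noteq> n" for m n
  proof -
    have "matrix (?h m n) = (\<chi> k. if k = m then row m (mat 1) + 1 *s row n (mat 1) else row k (mat 1))"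
      by (auto simp: matrix_def row_def mat_def axis_def vec_eq_iff)
    then have det: "det (matrix (?h m n)) = 1"
      using det_row_operation[OF mn, of "mat 1 :: real ^ 'n ^ 'n" 1] by (simp only: det_I)
    show ?thesis
    proof
      fix S :: "(real ^ 'n) set" assume S: "S \<in> lmeasurable"
      have "?h m n ` S \<in> lmeasurable \<and> 1 * measure lebesgue S = measure lebesgue (?h m n ` S)"
        by (rule measure_linear_sufficient[OF linh S]) (simp only: mult_1 measure_shear_cbox[OF mn])
      then show "?h m n ` S \<in> lmeasurable \<and> measure lebesgue (?h m n ` S) = \<bar>det (matrix (?h m n))\<bar> * measure lebesgue S"
        unfolding det by (simp only: abs_one mult_1)
    qed
  qed
  show ?thesis
  proof (rule induct_linear_elementary[OF assms])
    fix f :: "real ^ 'n \<Rightarrow> real ^ 'n" and i assume f: "linear f" and 0: "\<And>x. f x $ i = 0"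
    have ninj: "\<not> inj f"
    proof
      assume "inj f"
      then have "surj f" using f by (simp add: linear_injective_imp_surjective)
      then obtain x where "f x = 1" by (metis surjD)
      then show False using 0[of x] by simp
    qed
    then have "det (matrix f) = 0" using det_nz_iff_inj[OF f] by blast
    moreover have "negligible (f ` S)" for S using negligible_linear_singular_image[OF f ninj] .
    ultimately show "?P f" by (auto simp: negligible_imp_measurable negligible_imp_measure0)
  next
    fix m n :: 'n assume mn: "m \<noteq> n"
    let ?c = "\<lambda>k. \<lambda>x :: real ^ 'n. \<chi> i. (if i = k then - 1 else 1) * x $ i"
    \<comment> \<open>A swap of two coordinates is a product of three shears and three sign
      changes.\<close>
    have "(\<lambda>x :: real ^ 'n. \<chi> i. x $ Transposition.transpose m n i) =
       ?c n \<circ> (?h m n \<circ> (?c m \<circ> (?h n m \<circ> (?c m \<circ> ?h m n))))"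
      using mn by (auto simp: fun_eq_iff vec_eq_iff Transposition.transpose_def)
    moreover have "?P (?c n \<circ> (?h m n \<circ> (?c m \<circ> (?h n m \<circ> (?c m \<circ> ?h m n)))))"
      using mn by (intro comp linear_compose linc linh const shear) auto
    ultimately show "?P (\<lambda>x. \<chi> i. x $ Transposition.transpose m n i)" by (simp only:)
  qed (use comp const shear in blast)+
qed

lemma matrix_lattice_domain:
  fixes A :: "real ^ 'n ^ 'n"
  assumes A: "det A \<noteq> 0"
  shows "fundamental_domain (matrix_lattice A) ((*v) A ` centered_cube)"
    "measure lebesgue ((*v) A ` centered_cube) = \<bar>det A\<bar>"
    "\<exists>r>0. ball 0 r \<subseteq> (*v) A ` centered_cube"
proof -
  let ?D = "(*v) A ` centered_cube"
  obtain B where AB: "A ** B = mat 1" "B ** A = mat 1" using det_nonzero_inverse[OF A] .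
  have BA: "B *v (A *v x) = x" "A *v (B *v x) = x" for x by (simp_all add: matrix_vector_mul_assoc AB)
  have D: "x \<in> ?D \<longleftrightarrow> B *v x \<in> centered_cube" for x
    using BA by (metis image_iff)
  have cont: "continuous_on UNIV ((*v) B)" by (simp add: linear_continuous_on matrix_vector_mul_bounded_linear)
  have "?D = (*v) B -` centered_cube" using D by auto
  then have borel: "?D \<in> sets borel"
    using measurable_sets_borel[OF borel_measurable_continuous_onI[OF cont] centered_cube_borel] by simp
  have bdd: "bounded ?D" by (intro bounded_linear_image centered_cube_bounded matrix_vector_mul_bounded_linear)
  have "\<exists>!l. l \<in> matrix_lattice A \<and> x - l \<in> ?D" for x
  proof (rule ex1I[of _ "A *v rounded (B *v x)"])
    show "A *v rounded (B *v x) \<in> matrix_lattice A \<and> x - A *v rounded (B *v x) \<in> ?D"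
      using rounded_int minus_rounded[of "B *v x"] by (auto simp: matrix_lattice_def D matrix_vector_mult_diff_distrib BA)
    fix l assume l: "l \<in> matrix_lattice A \<and> x - l \<in> ?D"
    then obtain z where z: "z \<in> int_vectors" "l = A *v z" by (auto simp: matrix_lattice_def)
    have "B *v x - z \<in> centered_cube" using l by (simp add: D z matrix_vector_mult_diff_distrib BA)
    then show "l = A *v rounded (B *v x)" using centered_cube_unique[OF z(1)] z(2) by simp
  qed
  then show "fundamental_domain (matrix_lattice A) ?D" using borel bdd by (simp add: fundamental_domain_def)
  show "measure lebesgue ?D = \<bar>det A\<bar>"
    using bspec[OF linear_image_measure[OF matrix_vector_mul_linear] centered_cube_lmeasurable, of A] by (simp add: measure_centered_cube)
  have "isCont ((*v) B) 0" using cont by (simp add: continuous_on_eq_continuous_at)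
  then obtain r where r: "r > 0" "\<And>x. dist x 0 < r \<Longrightarrow> dist (B *v x) (B *v 0) < 1 / 2"
    unfolding continuous_at_eps_delta by (metis half_gt_zero zero_less_one)
  have "x \<in> ?D" if "x \<in> ball 0 r" for x
  proof -
    have n: "norm (B *v x) < 1 / 2" using r(2)[of x] that by (simp add: dist_norm)
    have "- 1 / 2 \<le> (B *v x) $ i \<and> (B *v x) $ i < 1 / 2" for i
      using component_le_norm_cart[of "B *v x" i] n by linarith
    then have "B *v x \<in> centered_cube" unfolding centered_cube_def by blast
    then show ?thesis unfolding D .
  qed
  then show "\<exists>r>0. ball 0 r \<subseteq> ?D" using r(1) by blast
qed

lemma is_lattice_domain:
  fixes L :: "(real ^ 'n) set"
  assumes "is_lattice L"
  obtains D r where "fundamental_domain L D" "measure lebesgue D = lattice_volume L" "r > 0" "ball 0 r \<subseteq> D"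
proof -
  obtain A where A: "det A \<noteq> 0" "L = matrix_lattice A" using is_lattice_matrix[OF assms] .
  show ?thesis using matrix_lattice_domain[OF A(1)] A that lattice_volume_matrix_lattice[OF A(1)] by metis
qed

section \<open>Volumes cut up by the translates of a domain\<close>

lemma tile_sum:
  fixes K :: "(real ^ 'n) set"
  assumes D: "fundamental_domain L D" and K: "K \<in> lmeasurable" and F: "finite F" "F \<subseteq> L"
    and cov: "\<And>x l. x \<in> K \<Longrightarrow> l \<in> L \<Longrightarrow> x - l \<in> D \<Longrightarrow> l \<in> F"
  shows "measure lebesgue K = (\<Sum>l\<in>F. measure lebesgue {x\<in>K. x - l \<in> D})"
proof -
  have un: "\<exists>!l. l \<in> L \<and> x - l \<in> D" for x using D by (simp add: fundamental_domain_def)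
  have meas: "{x\<in>K. x - l \<in> D} \<in> lmeasurable" for l
  proof -
    have eq: "{x\<in>K. x - l \<in> D} = K \<inter> (+) l ` D"
    proof (intro set_eqI iffI)
      fix x assume "x \<in> {x\<in>K. x - l \<in> D}"
      then show "x \<in> K \<inter> (+) l ` D" by (intro IntI image_eqI[of _ _ "x - l"]) auto
    qed auto
    show ?thesis unfolding eq by (intro fmeasurable.Int K measurable_translation fundamental_domain_lmeasurable[OF D])
  qed
  have uniq: "l = l'" if "l \<in> L" "l' \<in> L" "x - l \<in> D" "x - l' \<in> D" for l l' x
    using un[of x] that by (elim ex1E) blast
  have "K \<subseteq> (\<Union>l\<in>F. {x\<in>K. x - l \<in> D})"
  proof
    fix x assume x: "x \<in> K"
    obtain l where l: "l \<in> L" "x - l \<in> D" using un[of x] by (elim ex1E conjE)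
    then show "x \<in> (\<Union>l\<in>F. {x\<in>K. x - l \<in> D})" using x cov[OF x l] by auto
  qed
  then have "K = (\<Union>l\<in>F. {x\<in>K. x - l \<in> D})" by auto
  then have "measure lebesgue K = measure lebesgue (\<Union>l\<in>F. {x\<in>K. x - l \<in> D})" by simp
  also have "\<dots> = (\<Sum>l\<in>F. measure lebesgue {x\<in>K. x - l \<in> D})"
  proof (rule measure_finite_Union)
    show "disjoint_family_on (\<lambda>l. {x\<in>K. x - l \<in> D}) F"
      using uniq F(2) unfolding disjoint_family_on_def by (auto simp: subset_iff)
    show "emeasure lebesgue {x\<in>K. x - l \<in> D} \<noteq> \<infinity>" if "l \<in> F" for l
      using meas[of l] by (auto simp: fmeasurable_def)
  qed (use F meas in auto)
  finally show ?thesis .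
qed

lemma finite_tiles_meeting:
  assumes L: "is_lattice L" and "bounded D" "bounded K"
  shows "finite {l\<in>L. \<exists>x\<in>K. x - l \<in> D}"
proof -
  obtain a b where a: "\<And>x. x \<in> K \<Longrightarrow> norm x \<le> a" and b: "\<And>x. x \<in> D \<Longrightarrow> norm x \<le> b"
    using assms(2,3) unfolding bounded_iff by auto
  have "norm l \<le> a + b" if "x \<in> K" "x - l \<in> D" for x l
    using a[OF that(1)] b[OF that(2)] norm_triangle_ineq4[of x "x - l"] by simp
  then have "{l\<in>L. \<exists>x\<in>K. x - l \<in> D} \<subseteq> L \<inter> cball 0 (a + b)" by auto
  then show ?thesis by (rule finite_subset) (intro is_lattice_finite_bounded[OF L] bounded_cball)
qed

text \<open>Each of the two sets is cut by the translates of the other domain; by invariance of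
  \<open>A\<close>, translation by \<open>l\<close> matches the resulting pieces one by one.\<close>

lemma tile_swap:
  fixes A :: "(real ^ 'n) set"
  assumes L: "is_lattice L" and D1: "fundamental_domain L D1" and D2: "fundamental_domain L D2"
    and A: "A \<in> sets borel" and inv: "\<And>x l. l \<in> L \<Longrightarrow> x + l \<in> A \<longleftrightarrow> x \<in> A"
  shows "measure lebesgue (A \<inter> D1) = measure lebesgue (A \<inter> D2)"
proof -
  have bdd: "bounded D1" "bounded D2" using D1 D2 by (auto simp: fundamental_domain_def)
  have lm: "A \<inter> D1 \<in> lmeasurable" "A \<inter> D2 \<in> lmeasurable"
    using A D1 D2 by (auto intro!: bounded_set_imp_lmeasurable sets_completionI_sets simp: fundamental_domain_def bounded_Int)
  define F where "F = {l\<in>L. \<exists>x\<in>D1. x - l \<in> D2} \<union> uminus ` {l\<in>L. \<exists>x\<in>D2. x - l \<in> D1}"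
  have F: "finite F" "F \<subseteq> L"
    using finite_tiles_meeting[OF L bdd(2,1)] finite_tiles_meeting[OF L bdd] subgroup_vecD(3)[OF is_lattice_subgroup[OF L]]
    by (auto simp: F_def)
  have mF: "uminus ` F \<subseteq> L" using F subgroup_vecD(3)[OF is_lattice_subgroup[OF L]] by auto
  have "measure lebesgue (A \<inter> D1) = (\<Sum>l\<in>F. measure lebesgue {x\<in>A \<inter> D1. x - l \<in> D2})"
    by (rule tile_sum[OF D2 lm(1) F]) (auto simp: F_def)
  also have "\<dots> = (\<Sum>l\<in>F. measure lebesgue {x\<in>A \<inter> D2. x - - l \<in> D1})"
  proof (intro sum.cong refl)
    fix l assume "l \<in> F"
    then have l: "l \<in> L" using F by auto
    have eq: "(+) l ` {x\<in>A \<inter> D2. x - - l \<in> D1} = {x\<in>A \<inter> D1. x - l \<in> D2}"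
    proof (intro set_eqI iffI)
      fix y assume "y \<in> {x\<in>A \<inter> D1. x - l \<in> D2}"
      then have "y - l \<in> {x\<in>A \<inter> D2. x - - l \<in> D1}" using inv[OF l, of "y - l"] by auto
      then show "y \<in> (+) l ` {x\<in>A \<inter> D2. x - - l \<in> D1}" by (intro image_eqI[of _ _ "y - l"]) auto
    qed (use inv[OF l] in \<open>auto simp: add.commute\<close>)
    show "measure lebesgue {x\<in>A \<inter> D1. x - l \<in> D2} = measure lebesgue {x\<in>A \<inter> D2. x - - l \<in> D1}"
      unfolding eq[symmetric] by (rule measure_translation)
  qed
  also have "\<dots> = (\<Sum>l\<in>uminus ` F. measure lebesgue {x\<in>A \<inter> D2. x - l \<in> D1})"
    by (simp add: sum.reindex)
  also have "\<dots> = measure lebesgue (A \<inter> D2)"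
  proof (rule tile_sum[OF D1 lm(2) _ mF, symmetric])
    fix x l assume "x \<in> A \<inter> D2" "l \<in> L" "x - l \<in> D1"
    then have "- l \<in> F" unfolding F_def by blast
    then show "l \<in> uminus ` F" by (intro image_eqI[of _ _ "- l"]) simp_all
  qed (use F in simp)
  finally show ?thesis .
qed

text \<open>The classes of \<open>\<gamma> 0\<close>, ..., \<open>\<gamma> (k - 1)\<close> generate
  the quotient of \<open>G\<close> by \<open>P\<close>.\<close>

definition generates :: "'a::real_vector set \<Rightarrow> 'a set \<Rightarrow> nat \<Rightarrow> (nat \<Rightarrow> 'a) \<Rightarrow> bool" where
  "generates G P k \<gamma> \<longleftrightarrow> (\<forall>i<k. \<gamma> i \<in> G) \<and> (\<forall>g\<in>G. \<exists>p\<in>P. \<exists>a :: nat \<Rightarrow> int. g = p + (\<Sum>i<k. of_int (a i) *\<^sub>R \<gamma> i))"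

lemma sum_shear:
  fixes \<gamma> :: "nat \<Rightarrow> 'a::real_vector" and b :: "nat \<Rightarrow> int"
  assumes "i < k" "j < k" "i \<noteq> j"
  shows "(\<Sum>l<k. of_int ((b(i := b i - e * b j)) l) *\<^sub>R ((\<gamma>(j := \<gamma> j + of_int e *\<^sub>R \<gamma> i)) l)) = (\<Sum>l<k. of_int (b l) *\<^sub>R \<gamma> l)"
proof -
  have split: "(\<Sum>l<k. h l) = h i + (h j + (\<Sum>l\<in>{..<k} - {i} - {j}. h l))" for h :: "nat \<Rightarrow> 'a"
    using assms by (simp add: sum.remove[of "{..<k}" i] sum.remove[of "{..<k} - {i}" j])
  have "(\<Sum>l\<in>{..<k} - {i} - {j}. of_int ((b(i := b i - e * b j)) l) *\<^sub>R ((\<gamma>(j := \<gamma> j + of_int e *\<^sub>R \<gamma> i)) l)) =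
      (\<Sum>l\<in>{..<k} - {i} - {j}. of_int (b l) *\<^sub>R \<gamma> l)" by (intro sum.cong) auto
  then show ?thesis unfolding split using assms(3) by (simp add: algebra_simps)
qed

text \<open>A pure subgroup of a finitely generated torsion-free group has a free complement: a relation
  among a minimal number of generators with least coefficient sum could be shortened by a shear.\<close>

lemma pure_subgroup_complement:
  fixes G P :: "'a::real_vector set"
  assumes G: "subgroup_vec G" and P: "subgroup_vec P" "P \<subseteq> G"
    and pure: "\<And>x k. x \<in> G \<Longrightarrow> k \<noteq> 0 \<Longrightarrow> of_int k *\<^sub>R x \<in> P \<Longrightarrow> x \<in> P"
    and gen: "generates G P N \<gamma>0"
  shows "\<exists>k\<le>N. \<exists>\<gamma>. generates G P k \<gamma> \<and> (\<forall>a :: nat \<Rightarrow> int. (\<Sum>i<k. of_int (a i) *\<^sub>R \<gamma> i) \<in> P \<longrightarrow> (\<forall>i<k. a i = 0))"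
proof -
  define k where "k = (LEAST k. \<exists>\<gamma>. generates G P k \<gamma>)"
  have ex: "\<exists>\<gamma>. generates G P k \<gamma>" unfolding k_def by (rule LeastI_ex) (use gen in blast)
  have least: "k \<le> k'" if "generates G P k' \<gamma>" for k' \<gamma> unfolding k_def by (rule Least_le) (use that in blast)
  show ?thesis
  proof (rule ccontr)
    assume no: "\<not> ?thesis"
    define ok where "ok x \<longleftrightarrow> generates G P k (fst x) \<and> (\<Sum>i<k. of_int (snd x i) *\<^sub>R fst x i) \<in> P \<and> (\<exists>i<k. snd x i \<noteq> 0)"
      for x :: "(nat \<Rightarrow> 'a) \<times> (nat \<Rightarrow> int)"
    obtain \<gamma>1 where \<gamma>1: "generates G P k \<gamma>1" using ex by (rule exE)
    have "\<not> (\<forall>a :: nat \<Rightarrow> int. (\<Sum>i<k. of_int (a i) *\<^sub>R \<gamma>1 i) \<in> P \<longrightarrow> (\<forall>i<k. a i = 0))"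
    proof
      assume ind: "\<forall>a :: nat \<Rightarrow> int. (\<Sum>i<k. of_int (a i) *\<^sub>R \<gamma>1 i) \<in> P \<longrightarrow> (\<forall>i<k. a i = 0)"
      have "\<exists>k\<le>N. \<exists>\<gamma>. generates G P k \<gamma> \<and> (\<forall>a :: nat \<Rightarrow> int. (\<Sum>i<k. of_int (a i) *\<^sub>R \<gamma> i) \<in> P \<longrightarrow> (\<forall>i<k. a i = 0))"
        by (rule exI[of _ k], intro conjI exI[of _ \<gamma>1]) (rule least[OF gen] \<gamma>1 ind)+
      with no show False by (rule notE)
    qed
    then obtain a1 :: "nat \<Rightarrow> int" where "(\<Sum>i<k. of_int (a1 i) *\<^sub>R \<gamma>1 i) \<in> P" "\<exists>i<k. a1 i \<noteq> 0" by auto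
    then have "ok (\<gamma>1, a1)" using \<gamma>1 by (simp add: ok_def)
    from ex_has_least_nat[of ok, OF this, of "\<lambda>x. nat (\<Sum>i<k. \<bar>snd x i\<bar>)"]
    obtain x where x: "ok x" and min: "\<forall>y. ok y \<longrightarrow> nat (\<Sum>i<k. \<bar>snd x i\<bar>) \<le> nat (\<Sum>i<k. \<bar>snd y i\<bar>)"
      by (elim exE conjE)
    define \<gamma> a where "\<gamma> = fst x" and "a = snd x"
    have g: "generates G P k \<gamma>" and rel: "(\<Sum>i<k. of_int (a i) *\<^sub>R \<gamma> i) \<in> P" and nz: "\<exists>i<k. a i \<noteq> 0"
      using x by (auto simp: ok_def \<gamma>_def a_def)
    show False
    proof (cases "\<exists>i<k. \<exists>j<k. i \<noteq> j \<and> a i \<noteq> 0 \<and> a j \<noteq> 0")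
      case True
      then obtain i j where ij: "i < k" "j < k" "i \<noteq> j" "a i \<noteq> 0" "a j \<noteq> 0" "\<bar>a j\<bar> \<le> \<bar>a i\<bar>"
        by (metis linear)
      \<comment> \<open>The sign for which subtracting \<open>e * a j\<close> brings
        \<open>a i\<close> closer to 0; this works because
        \<open>\<bar>a j\<bar> \<le> \<bar>a i\<bar>\<close>.\<close>
      define e where "e = sgn (a i) * sgn (a j)"
      define \<gamma>' where "\<gamma>' = \<gamma>(j := \<gamma> j + of_int e *\<^sub>R \<gamma> i)"
      define a' where "a' = a(i := a i - e * a j)"
      have "generates G P k \<gamma>'"
        unfolding generates_def
      proof (intro conjI allI impI ballI)
        fix l assume "l < k"
        then show "\<gamma>' l \<in> G" using g ij subgroup_vecD(2)[OF G] subgroup_vec_int_scale[OF G]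
          by (auto simp: \<gamma>'_def generates_def)
      next
        fix y assume "y \<in> G"
        then obtain p and b :: "nat \<Rightarrow> int" where "p \<in> P" "y = p + (\<Sum>i<k. of_int (b i) *\<^sub>R \<gamma> i)"
          using g by (auto simp: generates_def)
        then show "\<exists>p\<in>P. \<exists>b :: nat \<Rightarrow> int. y = p + (\<Sum>i<k. of_int (b i) *\<^sub>R \<gamma>' i)"
          unfolding \<gamma>'_def
          by (intro bexI[of _ p] exI[of _ "b(i := b i - e * b j)"]) (simp_all only: sum_shear[OF ij(1-3)])
      qed
      moreover have "(\<Sum>l<k. of_int (a' l) *\<^sub>R \<gamma>' l) \<in> P"
        unfolding a'_def \<gamma>'_def sum_shear[OF ij(1-3)] by (rule rel)
      moreover have "\<exists>l<k. a' l \<noteq> 0" using ij by (intro exI[of _ j]) (simp add: a'_def)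
      ultimately have "ok (\<gamma>', a')" by (simp add: ok_def)
      then have le: "nat (\<Sum>i<k. \<bar>a i\<bar>) \<le> nat (\<Sum>i<k. \<bar>a' i\<bar>)" using min by (simp add: a_def)
      have lt: "(\<Sum>l<k. \<bar>a' l\<bar>) < (\<Sum>l<k. \<bar>a l\<bar>)"
      proof (rule sum_strict_mono_ex1)
        have 1: "\<bar>a i - e * a j\<bar> < \<bar>a i\<bar>"
          using ij(4-6) by (auto simp: e_def sgn_if split: if_splits)
        then show "\<forall>l\<in>{..<k}. \<bar>a' l\<bar> \<le> \<bar>a l\<bar>" by (simp add: a'_def)
        show "\<exists>l\<in>{..<k}. \<bar>a' l\<bar> < \<bar>a l\<bar>" using 1 ij(1) by (intro bexI[of _ i]) (auto simp: a'_def)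
      qed simp
      have "0 \<le> (\<Sum>l<k. \<bar>a' l\<bar>)" by (simp add: sum_nonneg)
      then have "nat (\<Sum>l<k. \<bar>a' l\<bar>) < nat (\<Sum>l<k. \<bar>a l\<bar>)" using lt by (simp only: nat_less_eq_zless)
      then show False using le by linarith
    next
      case False
      obtain i where i: "i < k" "a i \<noteq> 0" using nz by auto
      then have others: "a j = 0" if "j < k" "j \<noteq> i" for j using False that by auto
      have "(\<Sum>l<k. of_int (a l) *\<^sub>R \<gamma> l) = of_int (a i) *\<^sub>R \<gamma> i"
        using i others by (subst sum.remove[of _ i]) (auto intro!: sum.neutral)
      then have \<gamma>P: "\<gamma> i \<in> P" using rel pure[of "\<gamma> i" "a i"] g i by (simp add: generates_def)
      obtain k' where k': "k = Suc k'" using i by (cases k) auto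
      define h where "h l = (if l = i then k' else l)" for l
      have bij: "bij_betw h {..<k'} ({..<k} - {i})"
      proof (rule bij_betw_byWitness[where f' = "\<lambda>l. if l = k' then i else l"])
      qed (use i k' in \<open>auto simp: h_def\<close>)
      have "generates G P k' (\<lambda>l. \<gamma> (h l))"
        unfolding generates_def
      proof (intro conjI allI impI ballI)
        fix l assume "l < k'"
        then show "\<gamma> (h l) \<in> G" using g k' by (auto simp: generates_def h_def)
      next
        fix y assume "y \<in> G"
        then obtain p and b :: "nat \<Rightarrow> int" where pb: "p \<in> P" "y = p + (\<Sum>i<k. of_int (b i) *\<^sub>R \<gamma> i)"
          using g by (auto simp: generates_def)
        have "(\<Sum>l<k. of_int (b l) *\<^sub>R \<gamma> l) = of_int (b i) *\<^sub>R \<gamma> i + (\<Sum>l\<in>{..<k} - {i}. of_int (b l) *\<^sub>R \<gamma> l)"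
          using i by (simp add: sum.remove)
        also have "(\<Sum>l\<in>{..<k} - {i}. of_int (b l) *\<^sub>R \<gamma> l) = (\<Sum>l<k'. of_int (b (h l)) *\<^sub>R \<gamma> (h l))"
          by (rule sum.reindex_bij_betw[OF bij, symmetric])
        finally have "y = (p + of_int (b i) *\<^sub>R \<gamma> i) + (\<Sum>l<k'. of_int (b (h l)) *\<^sub>R \<gamma> (h l))"
          using pb(2) by simp
        moreover have "p + of_int (b i) *\<^sub>R \<gamma> i \<in> P"
          using pb(1) \<gamma>P by (intro subgroup_vecD(2)[OF P(1)] subgroup_vec_int_scale[OF P(1)])
        ultimately show "\<exists>p\<in>P. \<exists>b :: nat \<Rightarrow> int. y = p + (\<Sum>l<k'. of_int (b l) *\<^sub>R \<gamma> (h l))"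
          by (intro bexI[of _ "p + of_int (b i) *\<^sub>R \<gamma> i"] exI[of _ "\<lambda>l. b (h l)"])
      qed
      then show False using least k' by fastforce
    qed
  qed
qed

section \<open>Fine pure sublattices\<close>

lemma matrix_lattice_small:
  fixes A :: "real ^ 'n ^ 'n"
  assumes A: "det A \<noteq> 0"
  obtains e where "e > 0" "\<And>x. x \<in> matrix_lattice A \<Longrightarrow> norm x < e \<Longrightarrow> x = 0"
proof -
  obtain D r where D: "fundamental_domain (matrix_lattice A) D" "r > 0" "ball 0 r \<subseteq> D"
    using matrix_lattice_domain(1,3)[OF A] by (elim exE conjE) (rule that)
  have "x = 0" if x: "x \<in> matrix_lattice A" "norm x < r" for x
  proof -
    have "x - x \<in> D" "x - 0 \<in> D" using D(2,3) x by (auto simp: subset_iff)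
    moreover have "\<exists>!l. l \<in> matrix_lattice A \<and> x - l \<in> D" using D(1) by (simp add: fundamental_domain_def)
    ultimately show ?thesis using x(1) subgroup_vecD(1)[OF matrix_lattice_subgroup[of A]] by (elim ex1E) blast
  qed
  then show ?thesis using that D(2) by blast
qed

text \<open>Subspaces are closed, so the span of the short elements contains the whole ball in which
  they are dense.\<close>

lemma span_dense_near_0:
  fixes G :: "'a::euclidean_space set"
  assumes "closure G = UNIV" "r > 0"
  shows "span (G \<inter> ball 0 r) = UNIV"
proof -
  have "ball 0 r \<inter> closure G \<subseteq> closure (ball 0 r \<inter> G)" by (intro open_Int_closure_subset open_ball)
  also have "\<dots> \<subseteq> closure (span (G \<inter> ball 0 r))" by (intro closure_mono) (auto intro: span_base)
  also have "\<dots> = span (G \<inter> ball 0 r)" by (intro closure_closed closed_subspace subspace_span)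
  finally have sub: "ball 0 r \<subseteq> span (G \<inter> ball 0 r)" using assms(1) by simp
  have "x \<in> span (G \<inter> ball 0 r)" for x
  proof -
    define c where "c = r / (norm x + 1)"
    have p: "norm x + 1 > 0" using norm_ge_zero[of x] by linarith
    have c: "c > 0" using assms(2) p by (simp add: c_def)
    have "norm (c *\<^sub>R x) = r * (norm x / (norm x + 1))" unfolding norm_scaleR abs_of_pos[OF c] by (simp add: c_def)
    also have "\<dots> < r * 1" using assms(2) p by (intro mult_strict_left_mono) simp_all
    finally have "norm (c *\<^sub>R x) < r" by simp
    then have "c *\<^sub>R x \<in> span (G \<inter> ball 0 r)" using sub by auto
    then have "(1 / c) *\<^sub>R (c *\<^sub>R x) \<in> span (G \<inter> ball 0 r)" by (rule span_scale)
    then show ?thesis using c by simp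
  qed
  then show ?thesis by blast
qed

lemma matrix_lattice_generated:
  fixes A :: "real ^ 'n ^ 'n"
  assumes e: "bij_betw e {..<CARD('n)} (UNIV :: 'n set)" and x: "x \<in> matrix_lattice A"
  obtains a :: "nat \<Rightarrow> int" where "x = (\<Sum>i<CARD('n). of_int (a i) *\<^sub>R column (e i) A)"
proof -
  obtain z where z: "z \<in> int_vectors" "x = A *v z" using x by (auto simp: matrix_lattice_def)
  have zi: "of_int \<lfloor>z $ j\<rfloor> = z $ j" for j using z(1) by (simp add: int_vectors_def)
  have "x = (\<Sum>j\<in>UNIV. of_int \<lfloor>z $ j\<rfloor> *\<^sub>R column j A)" by (simp add: z(2) matrix_mult_sum scalar_mult_eq_scaleR zi)
  also have "\<dots> = (\<Sum>i<CARD('n). of_int \<lfloor>z $ e i\<rfloor> *\<^sub>R column (e i) A)"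
    by (rule sum.reindex_bij_betw[OF e, symmetric])
  finally show ?thesis by (rule that[of "\<lambda>i. \<lfloor>z $ e i\<rfloor>"])
qed

lemma sum_lessThan_add:
  fixes h :: "nat \<Rightarrow> 'a::comm_monoid_add"
  shows "(\<Sum>i<m + n. h i) = (\<Sum>i<m. h i) + (\<Sum>i<n. h (m + i))"
  by (induction n) (simp_all add: add.assoc)

lemma lattice_sum_generated:
  fixes L M :: "(real ^ 'n) set"
  assumes L: "is_lattice L" and M: "is_lattice M" and P: "0 \<in> P"
  shows "\<exists>\<gamma>. generates {l + m | l m. l \<in> L \<and> m \<in> M} P (CARD('n) + CARD('n)) \<gamma>"
proof -
  let ?n = "CARD('n)" and ?G = "{l + m | l m. l \<in> L \<and> m \<in> M}"
  obtain A where A: "det A \<noteq> 0" "L = matrix_lattice A" using is_lattice_matrix[OF L] .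
  obtain B where B: "det B \<noteq> 0" "M = matrix_lattice B" using is_lattice_matrix[OF M] .
  obtain e where e: "bij_betw e {..<?n} (UNIV :: 'n set)"
    using ex_bij_betw_nat_finite[of "UNIV :: 'n set"] by (auto simp: atLeast0LessThan)
  define \<gamma> where "\<gamma> i = (if i < ?n then column (e i) A else column (e (i - ?n)) B)" for i
  have col: "column j C \<in> matrix_lattice C" for j and C :: "real ^ 'n ^ 'n"
  proof -
    have "axis j 1 \<in> (int_vectors :: (real ^ 'n) set)" by (auto simp: int_vectors_def axis_def)
    then show ?thesis unfolding matrix_lattice_def by (intro image_eqI[of _ _ "axis j 1"]) (simp_all add: matrix_vector_mult_basis)
  qed
  have "\<gamma> i \<in> ?G" for i
  proof (cases "i < ?n")
    case True
    then have "\<gamma> i = column (e i) A + 0" by (simp add: \<gamma>_def)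
    then show ?thesis using col A(2) subgroup_vecD(1)[OF is_lattice_subgroup[OF M]] by blast
  next
    case False
    then have "\<gamma> i = 0 + column (e (i - ?n)) B" by (simp add: \<gamma>_def)
    then show ?thesis using col B(2) subgroup_vecD(1)[OF is_lattice_subgroup[OF L]] by blast
  qed
  moreover have "\<exists>p\<in>P. \<exists>a :: nat \<Rightarrow> int. g = p + (\<Sum>i<?n + ?n. of_int (a i) *\<^sub>R \<gamma> i)" if gG: "g \<in> ?G" for g
  proof -
    obtain l m where lm: "g = l + m" "l \<in> matrix_lattice A" "m \<in> matrix_lattice B" using gG A(2) B(2) by blast
    obtain a :: "nat \<Rightarrow> int" where a: "l = (\<Sum>i<?n. of_int (a i) *\<^sub>R column (e i) A)"
      using matrix_lattice_generated[OF e lm(2)] .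
    obtain b :: "nat \<Rightarrow> int" where b: "m = (\<Sum>i<?n. of_int (b i) *\<^sub>R column (e i) B)"
      using matrix_lattice_generated[OF e lm(3)] .
    define c where "c i = (if i < ?n then a i else b (i - ?n))" for i
    have "(\<Sum>i<?n + ?n. of_int (c i) *\<^sub>R \<gamma> i) = (\<Sum>i<?n. of_int (c i) *\<^sub>R \<gamma> i) + (\<Sum>i<?n. of_int (c (?n + i)) *\<^sub>R \<gamma> (?n + i))"
      by (rule sum_lessThan_add)
    also have "\<dots> = l + m" by (simp add: a b c_def \<gamma>_def)
    finally show ?thesis using lm(1) P by (intro bexI[of _ 0] exI[of _ c]) simp_all
  qed
  ultimately show ?thesis unfolding generates_def by (intro exI[of _ \<gamma>] conjI allI impI ballI)
qed

lemma lattice_sum_subgroup: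
  assumes "is_lattice L" "is_lattice M"
  shows "subgroup_vec {l + m | l m. l \<in> L \<and> m \<in> M}"
proof -
  note l = subgroup_vecD[OF is_lattice_subgroup[OF assms(1)]] and m = subgroup_vecD[OF is_lattice_subgroup[OF assms(2)]]
  show ?thesis unfolding subgroup_vec_def
  proof (intro conjI ballI)
    show "0 \<in> {l + m | l m. l \<in> L \<and> m \<in> M}" using l(1) m(1) by (intro CollectI exI[of _ 0]) auto
  next
    fix x y assume "x \<in> {l + m | l m. l \<in> L \<and> m \<in> M}" "y \<in> {l + m | l m. l \<in> L \<and> m \<in> M}"
    then obtain a b c d where "x = a + b" "y = c + d" "a \<in> L" "b \<in> M" "c \<in> L" "d \<in> M" by blast
    then show "x + y \<in> {l + m | l m. l \<in> L \<and> m \<in> M}"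
      using l(2) m(2) by (intro CollectI exI[of _ "a + c"] exI[of _ "b + d"]) auto
  next
    fix x assume "x \<in> {l + m | l m. l \<in> L \<and> m \<in> M}"
    then obtain a b where "x = a + b" "a \<in> L" "b \<in> M" by blast
    then show "- x \<in> {l + m | l m. l \<in> L \<and> m \<in> M}"
      using l(3) m(3) by (intro CollectI exI[of _ "- a"] exI[of _ "- b"]) auto
  qed
qed

text \<open>The lattice is the set of all elements of \<open>L + M\<close> having a nonzero multiple in the lattice
  spanned by short independent vectors; it is a direct summand of \<open>L + M\<close>, hence finitely generated
  and therefore discrete.\<close>

theorem fine_pure_sublattice:
  fixes L M :: "(real ^ 'n) set"
  defines "G \<equiv> {l + m | l m. l \<in> L \<and> m \<in> M}"
  assumes L: "is_lattice L" and M: "is_lattice M" and dense: "closure G = UNIV" and r: "r > 0"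
  shows "\<exists>\<Lambda> k \<gamma>. is_lattice \<Lambda> \<and> \<Lambda> \<subseteq> G \<and> (\<forall>x. \<exists>l\<in>\<Lambda>. norm (x - l) < r) \<and> k \<le> CARD('n) + CARD('n) \<and>
    generates G \<Lambda> k \<gamma> \<and> (\<forall>a :: nat \<Rightarrow> int. (\<Sum>i<k. of_int (a i) *\<^sub>R \<gamma> i) \<in> \<Lambda> \<longrightarrow> (\<forall>i<k. a i = 0))"
proof -
  let ?n = "CARD('n)" and ?N = "CARD('n) + CARD('n)"
  have sG: "subgroup_vec G" unfolding G_def by (rule lattice_sum_subgroup[OF L M])
  \<comment> \<open>The residue of a point has coordinates of modulus at most \<open>1 / 2\<close>
    with respect to \<open>?n\<close> columns shorter than \<open>\<rho>\<close>, which leaves a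
    distance of at most \<open>r / 2\<close>.\<close>
  define \<rho> where "\<rho> = r / real ?n"
  have \<rho>: "\<rho> > 0" using r by (simp add: \<rho>_def)
  obtain A :: "real ^ 'n ^ 'n" where A: "det A \<noteq> 0" "\<And>j. column j A \<in> G \<inter> ball 0 \<rho>"
    using independent_columns_matrix[OF span_dense_near_0[OF dense \<rho>]] by metis
  have colG: "\<And>j. column j A \<in> G" using A(2) by auto
  let ?L0 = "matrix_lattice A"
  have L0G: "?L0 \<subseteq> G" by (rule matrix_lattice_subset[OF sG colG])
  have sL0: "subgroup_vec ?L0" by (rule matrix_lattice_subgroup)
  define \<Lambda> where "\<Lambda> = {g\<in>G. \<exists>k :: int. k \<noteq> 0 \<and> of_int k *\<^sub>R g \<in> ?L0}"
  have \<Lambda>G: "\<Lambda> \<subseteq> G" by (auto simp: \<Lambda>_def)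
  have L0\<Lambda>: "?L0 \<subseteq> \<Lambda>"
  proof
    fix x assume "x \<in> ?L0"
    then show "x \<in> \<Lambda>" using L0G unfolding \<Lambda>_def by (intro CollectI conjI exI[of _ "1 :: int"]) auto
  qed
  have s\<Lambda>: "subgroup_vec \<Lambda>"
    unfolding subgroup_vec_def
  proof (intro conjI ballI)
    show "0 \<in> \<Lambda>" using L0\<Lambda> subgroup_vecD(1)[OF sL0] by auto
  next
    fix x y assume "x \<in> \<Lambda>" "y \<in> \<Lambda>"
    then obtain j k :: int where jk: "j \<noteq> 0" "k \<noteq> 0" "of_int j *\<^sub>R x \<in> ?L0" "of_int k *\<^sub>R y \<in> ?L0" "x \<in> G" "y \<in> G"
      by (auto simp: \<Lambda>_def)
    have "of_int (j * k) *\<^sub>R (x + y) = of_int k *\<^sub>R (of_int j *\<^sub>R x) + of_int j *\<^sub>R (of_int k *\<^sub>R y)"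
      by (simp add: scaleR_add_right mult.commute)
    also have "\<dots> \<in> ?L0" by (intro subgroup_vecD(2)[OF sL0] subgroup_vec_int_scale[OF sL0] jk)
    finally have "of_int (j * k) *\<^sub>R (x + y) \<in> ?L0" .
    moreover have "j * k \<noteq> 0" using jk by simp
    ultimately show "x + y \<in> \<Lambda>" unfolding \<Lambda>_def using subgroup_vecD(2)[OF sG jk(5,6)] by blast
  next
    fix x assume "x \<in> \<Lambda>"
    then obtain j :: int where j: "j \<noteq> 0" "of_int j *\<^sub>R x \<in> ?L0" "x \<in> G" by (auto simp: \<Lambda>_def)
    have "of_int j *\<^sub>R (- x) \<in> ?L0" using subgroup_vecD(3)[OF sL0 j(2)] by simp
    then show "- x \<in> \<Lambda>" unfolding \<Lambda>_def using j(1) subgroup_vecD(3)[OF sG j(3)] by blast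
  qed
  have pure: "x \<in> \<Lambda>" if x: "x \<in> G" "k \<noteq> 0" "of_int k *\<^sub>R x \<in> \<Lambda>" for x and k :: int
  proof -
    obtain j :: int where j: "j \<noteq> 0" "of_int j *\<^sub>R (of_int k *\<^sub>R x) \<in> ?L0" using x(3) by (auto simp: \<Lambda>_def)
    then have "of_int (j * k) *\<^sub>R x \<in> ?L0" "j * k \<noteq> 0" using x(2) by simp_all
    then show ?thesis unfolding \<Lambda>_def using x(1) by blast
  qed
  obtain \<gamma>0 where \<gamma>0: "generates G {0} ?N \<gamma>0" using lattice_sum_generated[OF L M, of "{0}"] by (auto simp: G_def)
  have gen0: "generates G \<Lambda> ?N \<gamma>0"
    unfolding generates_def
  proof (intro conjI ballI)
    show "\<forall>i<?N. \<gamma>0 i \<in> G" using \<gamma>0 by (simp add: generates_def)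
    fix g assume "g \<in> G"
    then obtain b :: "nat \<Rightarrow> int" where "g = 0 + (\<Sum>i<?N. of_int (b i) *\<^sub>R \<gamma>0 i)"
      using \<gamma>0 unfolding generates_def by blast
    then show "\<exists>p\<in>\<Lambda>. \<exists>a :: nat \<Rightarrow> int. g = p + (\<Sum>i<?N. of_int (a i) *\<^sub>R \<gamma>0 i)"
      using subgroup_vecD(1)[OF s\<Lambda>] by (intro bexI[of _ 0] exI[of _ b])
  qed
  have "\<exists>k\<le>?N. \<exists>\<gamma>. generates G \<Lambda> k \<gamma> \<and> (\<forall>a :: nat \<Rightarrow> int. (\<Sum>i<k. of_int (a i) *\<^sub>R \<gamma> i) \<in> \<Lambda> \<longrightarrow> (\<forall>i<k. a i = 0))"
    by (rule pure_subgroup_complement[OF sG s\<Lambda> \<Lambda>G _ gen0]) (rule pure)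
  then obtain k \<gamma> where k: "k \<le> ?N" and gen: "generates G \<Lambda> k \<gamma>"
    and ind: "\<forall>a :: nat \<Rightarrow> int. (\<Sum>i<k. of_int (a i) *\<^sub>R \<gamma> i) \<in> \<Lambda> \<longrightarrow> (\<forall>i<k. a i = 0)" by (elim exE conjE)
  \<comment> \<open>The \<open>\<Lambda>\<close>-components \<open>p i\<close> of the generators of
    \<open>G\<close> generate \<open>\<Lambda>\<close>, as it is a direct summand. A common multiple
    \<open>q\<close> of their denominators then maps \<open>\<Lambda>\<close> into
    \<open>?L0\<close>, and discreteness carries over.\<close>
  have "\<forall>i. \<exists>p. \<exists>a :: nat \<Rightarrow> int. i < ?N \<longrightarrow> p \<in> \<Lambda> \<and> \<gamma>0 i = p + (\<Sum>l<k. of_int (a l) *\<^sub>R \<gamma> l)"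
    using gen \<gamma>0 unfolding generates_def by meson
  from choice[OF this] obtain p where "\<forall>i. \<exists>a :: nat \<Rightarrow> int. i < ?N \<longrightarrow> p i \<in> \<Lambda> \<and> \<gamma>0 i = p i + (\<Sum>l<k. of_int (a l) *\<^sub>R \<gamma> l)" ..
  from choice[OF this] obtain a :: "nat \<Rightarrow> nat \<Rightarrow> int" where
    pa: "\<And>i. i < ?N \<Longrightarrow> p i \<in> \<Lambda>" "\<And>i. i < ?N \<Longrightarrow> \<gamma>0 i = p i + (\<Sum>l<k. of_int (a i l) *\<^sub>R \<gamma> l)" by auto
  have "\<forall>i. \<exists>c :: int. i < ?N \<longrightarrow> c \<noteq> 0 \<and> of_int c *\<^sub>R p i \<in> ?L0" using pa(1) by (auto simp: \<Lambda>_def)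
  from choice[OF this] obtain c :: "nat \<Rightarrow> int" where c: "\<And>i. i < ?N \<Longrightarrow> c i \<noteq> 0" "\<And>i. i < ?N \<Longrightarrow> of_int (c i) *\<^sub>R p i \<in> ?L0" by auto
  define q where "q = (\<Prod>i<?N. c i)"
  have q0: "q \<noteq> 0" using c(1) by (simp add: q_def)
  have qp: "of_int q *\<^sub>R p i \<in> ?L0" if i: "i < ?N" for i
  proof -
    have "q = (\<Prod>j\<in>{..<?N} - {i}. c j) * c i" using i by (simp add: q_def prod.remove[of "{..<?N}" i] mult.commute)
    then have "of_int q *\<^sub>R p i = of_int (\<Prod>j\<in>{..<?N} - {i}. c j) *\<^sub>R (of_int (c i) *\<^sub>R p i)" by simp
    also have "\<dots> \<in> ?L0" by (intro subgroup_vec_int_scale[OF sL0] c(2) i)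
    finally show ?thesis .
  qed
  have q\<Lambda>: "of_int q *\<^sub>R x \<in> ?L0" if x: "x \<in> \<Lambda>" for x
  proof -
    obtain b :: "nat \<Rightarrow> int" where "x = 0 + (\<Sum>i<?N. of_int (b i) *\<^sub>R \<gamma>0 i)"
      using \<gamma>0 x \<Lambda>G unfolding generates_def by blast
    then have "x = (\<Sum>i<?N. of_int (b i) *\<^sub>R (p i + (\<Sum>l<k. of_int (a i l) *\<^sub>R \<gamma> l)))" using pa(2) by simp
    also have "\<dots> = (\<Sum>i<?N. of_int (b i) *\<^sub>R p i) + (\<Sum>i<?N. \<Sum>l<k. of_int (b i * a i l) *\<^sub>R \<gamma> l)"
      by (simp add: scaleR_add_right sum.distrib scaleR_sum_right)
    also have "(\<Sum>i<?N. \<Sum>l<k. of_int (b i * a i l) *\<^sub>R \<gamma> l) = (\<Sum>l<k. of_int (\<Sum>i<?N. b i * a i l) *\<^sub>R \<gamma> l)"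
      by (subst sum.swap) (simp add: scaleR_sum_left)
    finally have xe: "x = (\<Sum>i<?N. of_int (b i) *\<^sub>R p i) + (\<Sum>l<k. of_int (\<Sum>i<?N. b i * a i l) *\<^sub>R \<gamma> l)" .
    have sp: "(\<Sum>i<?N. of_int (b i) *\<^sub>R p i) \<in> \<Lambda>" by (intro subgroup_vec_sum[OF s\<Lambda>] subgroup_vec_int_scale[OF s\<Lambda>] pa(1)) simp
    have "(\<Sum>l<k. of_int (\<Sum>i<?N. b i * a i l) *\<^sub>R \<gamma> l) = x - (\<Sum>i<?N. of_int (b i) *\<^sub>R p i)" using xe by simp
    then have "(\<Sum>l<k. of_int (\<Sum>i<?N. b i * a i l) *\<^sub>R \<gamma> l) \<in> \<Lambda>" using subgroup_vecD(4)[OF s\<Lambda> x sp] by (simp only:)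
    \<comment> \<open>Since \<open>x\<close> and its \<open>p\<close>-part lie in
      \<open>\<Lambda>\<close>, so does the remaining combination of the \<open>\<gamma> l\<close>,
      and independence modulo \<open>\<Lambda>\<close> makes its coefficients vanish.\<close>
    then have "\<forall>l<k. (\<Sum>i<?N. b i * a i l) = 0" by (rule ind[THEN spec, THEN mp])
    then have "(\<Sum>l<k. of_int (\<Sum>i<?N. b i * a i l) *\<^sub>R \<gamma> l) = 0" by (intro sum.neutral) (simp del: of_int_sum)
    then have "x = (\<Sum>i<?N. of_int (b i) *\<^sub>R p i)" using xe by simp
    then have "of_int q *\<^sub>R x = (\<Sum>i<?N. of_int (b i) *\<^sub>R (of_int q *\<^sub>R p i))" by (simp add: scaleR_sum_right mult.commute)
    also have "\<dots> \<in> ?L0" by (intro subgroup_vec_sum[OF sL0] subgroup_vec_int_scale[OF sL0] qp) simp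
    finally show ?thesis .
  qed
  obtain e where e: "e > 0" "\<And>x. x \<in> ?L0 \<Longrightarrow> norm x < e \<Longrightarrow> x = 0" using matrix_lattice_small[OF A(1)] by blast
  have "uniform_discrete \<Lambda>"
    unfolding uniform_discrete_def
  proof (intro exI[of _ "e / \<bar>real_of_int q\<bar>"] conjI ballI impI)
    show "0 < e / \<bar>real_of_int q\<bar>" using e(1) q0 by simp
    fix x y assume xy: "x \<in> \<Lambda>" "y \<in> \<Lambda>" "dist x y < e / \<bar>real_of_int q\<bar>"
    have "norm (of_int q *\<^sub>R (x - y)) < e"
      using xy(3) q0 unfolding norm_scaleR by (simp add: dist_norm field_simps)
    then have "of_int q *\<^sub>R (x - y) = 0" using e(2) q\<Lambda> subgroup_vecD(4)[OF s\<Lambda> xy(1,2)] by blast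
    then show "x = y" using q0 by simp
  qed
  moreover have "span \<Lambda> = UNIV"
  proof -
    obtain B where AB: "A ** B = mat 1" "B ** A = mat 1" using det_nonzero_inverse[OF A(1)] .
    have colL0: "column j A \<in> \<Lambda>" for j
    proof -
      have "axis j 1 \<in> (int_vectors :: (real ^ 'n) set)" by (auto simp: int_vectors_def axis_def)
      then have "column j A \<in> ?L0" unfolding matrix_lattice_def by (intro image_eqI[of _ _ "axis j 1"]) (simp_all add: matrix_vector_mult_basis)
      then show ?thesis using L0\<Lambda> by auto
    qed
    have "x \<in> span \<Lambda>" for x
    proof -
      have "x = A *v (B *v x)" by (simp add: matrix_vector_mul_assoc AB)
      also have "\<dots> = (\<Sum>j\<in>UNIV. (B *v x) $ j *\<^sub>R column j A)" by (simp add: matrix_mult_sum scalar_mult_eq_scaleR)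
      also have "\<dots> \<in> span \<Lambda>" by (intro span_sum span_scale span_base colL0)
      finally show ?thesis .
    qed
    then show ?thesis by blast
  qed
  ultimately have lat: "is_lattice \<Lambda>"
    using s\<Lambda> by (simp add: is_lattice_def subgroup_vec_def uniform_discrete_imp_discrete)
  have near: "\<exists>l\<in>\<Lambda>. norm (x - l) < r" for x
  proof -
    obtain B where AB: "A ** B = mat 1" "B ** A = mat 1" using det_nonzero_inverse[OF A(1)] .
    let ?c = "B *v x - rounded (B *v x)"
    have "A *v rounded (B *v x) \<in> \<Lambda>" using rounded_int L0\<Lambda> unfolding matrix_lattice_def by blast
    moreover have "x - A *v rounded (B *v x) = (\<Sum>j\<in>UNIV. ?c $ j *\<^sub>R column j A)"
    proof -
      have "x - A *v rounded (B *v x) = A *v ?c" by (simp add: matrix_vector_mult_diff_distrib matrix_vector_mul_assoc AB)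
      then show ?thesis by (simp add: matrix_mult_sum scalar_mult_eq_scaleR)
    qed
    moreover have "norm (\<Sum>j\<in>UNIV. ?c $ j *\<^sub>R column j A) < r"
    proof -
      have c: "\<bar>?c $ j\<bar> \<le> 1 / 2" for j
      proof -
        have "- 1 / 2 \<le> ?c $ j \<and> ?c $ j < 1 / 2" using minus_rounded[of "B *v x"] unfolding centered_cube_def by blast
        then show ?thesis by linarith
      qed
      have "norm (?c $ j *\<^sub>R column j A) \<le> 1 / 2 * \<rho>" for j
        using A(2)[of j] c[of j] unfolding norm_scaleR by (intro mult_mono) auto
      then have "norm (\<Sum>j\<in>UNIV. ?c $ j *\<^sub>R column j A) \<le> (\<Sum>j\<in>(UNIV :: 'n set). 1 / 2 * \<rho>)"
        by (rule sum_norm_le)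
      also have "\<dots> = r / 2" by (simp add: \<rho>_def)
      finally show ?thesis using r by simp
    qed
    ultimately show ?thesis by (intro bexI[of _ "A *v rounded (B *v x)"]) simp_all
  qed
  show ?thesis
    by (rule exI[of _ \<Lambda>], rule exI[of _ k], rule exI[of _ \<gamma>]) (intro conjI lat \<Lambda>G allI near k gen ind[THEN spec])
qed

section \<open>Integrality of the crossing flows\<close>

context zm_action
begin

text \<open>The discrete divergence theorem: edges inside the box cancel in pairs, so the flow
  through the boundary is the sum of the divergences in the box.\<close>

lemma crossing_total_int:
  fixes S :: "(nat \<Rightarrow> int) set" and f :: "(nat \<Rightarrow> int) \<Rightarrow> 'a \<Rightarrow> real"
  assumes finS: "finite S" and symS: "\<And>s. s \<in> S \<Longrightarrow> - s \<in> S"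
    and anti: "\<And>s x. s \<in> S \<Longrightarrow> f (- s) (T s x) = - f s x"
    and div: "\<And>x. (\<Sum>s\<in>S. f s x) \<in> \<int>"
  shows "(\<Sum>e\<in>box_crossing m S n. f (snd e) (T (fst e) x)) \<in> \<int>"
proof -
  let ?B = "cube m 0 n" and ?F = "\<lambda>e. f (snd e) (T (fst e) x)"
  define Y where "Y = {e\<in>?B \<times> S. fst e + snd e \<in> ?B}"
  have fin: "finite (?B \<times> S)" using finS by (simp add: finite_cube)
  have Y: "finite Y" unfolding Y_def using fin by (rule rev_finite_subset) auto
  have "sum ?F Y = (\<Sum>e\<in>Y. - ?F e)"
  proof (rule sum.reindex_bij_witness[of _ "\<lambda>e. (fst e + snd e, - snd e)" "\<lambda>e. (fst e + snd e, - snd e)"])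
    fix e assume e: "e \<in> Y"
    then have s: "snd e \<in> S" by (auto simp: Y_def)
    show "(fst (fst e + snd e, - snd e) + snd (fst e + snd e, - snd e), - snd (fst e + snd e, - snd e)) = e" by simp
    then show "(fst (fst e + snd e, - snd e) + snd (fst e + snd e, - snd e), - snd (fst e + snd e, - snd e)) = e" .
    show "(fst e + snd e, - snd e) \<in> Y" using e symS[OF s] by (auto simp: Y_def)
    then show "(fst e + snd e, - snd e) \<in> Y" .
    have "T (fst e + snd e) x = T (snd e) (T (fst e) x)" unfolding add.commute[of "fst e"] by (rule T_add)
    then show "- ?F (fst e + snd e, - snd e) = ?F e" using anti[OF s, of "T (fst e) x"] by simp
  qed
  then have Y0: "sum ?F Y = 0" by (simp add: sum_negf)
  have "box_crossing m S n = ?B \<times> S - Y" by (auto simp: box_crossing_def Y_def)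
  then have "sum ?F (box_crossing m S n) = sum ?F (?B \<times> S) - sum ?F Y"
    using fin by (simp add: sum_diff Y_def subset_iff)
  also have "\<dots> = (\<Sum>a\<in>?B. \<Sum>s\<in>S. f s (T a x))"
    unfolding Y0 by (simp add: sum.cartesian_product case_prod_beta)
  also have "\<dots> \<in> \<int>" by (intro Ints_sum div)
  finally show ?thesis .
qed

lemma frac_eq_of_diff_Ints: assumes "x - y \<in> \<int>" shows "frac x = frac (y :: real)"
proof -
  obtain k where "x - y = of_int k" using assms by (auto elim: Ints_cases)
  then have "x = y + of_int k" by simp
  then show ?thesis by (simp add: frac_def)
qed

text \<open>Disposes of the assumption \<open>grp\<close>. For \<open>m \<noteq> 1\<close> all
  crossing edges form a single group and \<open>crossing_total_int\<close> applies. For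
  \<open>m = 1\<close> the two ends of the interval are separate groups; a flow that is constant
  along each orbit is removed first, which raises the error bound by 1.\<close>

theorem integral_flow_exists':
  fixes S :: "(nat \<Rightarrow> int) set" and R :: int and f :: "(nat \<Rightarrow> int) \<Rightarrow> 'a \<Rightarrow> real"
  assumes finS: "finite S" and symS: "\<And>s. s \<in> S \<Longrightarrow> - s \<in> S" and S0: "0 \<notin> S"
    and Sm: "\<And>s i. s \<in> S \<Longrightarrow> i \<ge> m \<Longrightarrow> s i = 0"
    and SR: "\<And>s i. s \<in> S \<Longrightarrow> \<bar>s i\<bar> \<le> R" and units: "\<And>i. i < m \<Longrightarrow> unit_vec i 1 \<in> S" and R1: "R \<ge> 1"
    and f: "\<And>s. s \<in> S \<Longrightarrow> f s \<in> borel_measurable M"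
    and anti: "\<And>s x. s \<in> S \<Longrightarrow> f (- s) (T s x) = - f s x"
    and div: "\<And>x. (\<Sum>s\<in>S. f s x) \<in> \<int>"
  shows "\<exists>g :: (nat \<Rightarrow> int) \<Rightarrow> 'a \<Rightarrow> int. (\<forall>s\<in>S. g s \<in> measurable M (count_space UNIV)) \<and>
    (AE x in M. (\<forall>s\<in>S. g (- s) (T s x) = - g s x \<and> \<bar>real_of_int (g s x) - f s x\<bar> \<le> 12 * real (card S) + 2) \<and>
       real_of_int (\<Sum>s\<in>S. g s x) = (\<Sum>s\<in>S. f s x))"
proof (cases "m = 1")
  case False
  have grp0: "(\<Sum>e\<in>{e\<in>box_crossing m S n. base_vec m (snd e) = h}. f (snd e) (T (fst e) x)) \<in> \<int>" for n x h
  proof (cases "h = unit_vec 0 1")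
    case True
    then have "{e\<in>box_crossing m S n. base_vec m (snd e) = h} = box_crossing m S n"
      using False by (auto simp: base_vec_def)
    then show ?thesis using crossing_total_int[OF finS symS anti div] by simp
  next
    case h: False
    then have "{e\<in>box_crossing m S n. base_vec m (snd e) = h} = {}"
      using False by (auto simp: base_vec_def)
    then show ?thesis by (simp only: sum.empty Ints_0)
  qed
  have "\<exists>g :: (nat \<Rightarrow> int) \<Rightarrow> 'a \<Rightarrow> int. (\<forall>s\<in>S. g s \<in> measurable M (count_space UNIV)) \<and>
    (AE x in M. (\<forall>s\<in>S. g (- s) (T s x) = - g s x \<and> \<bar>real_of_int (g s x) - f s x\<bar> \<le> 12 * real (card S) + 1) \<and>
       real_of_int (\<Sum>s\<in>S. g s x) = (\<Sum>s\<in>S. f s x))"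
    by (rule integral_flow_exists[where f = f and S = S and R = R])
       (erule symS | erule (1) Sm | erule SR | erule units | erule f | erule anti | rule grp0 | rule finS S0 R1 div)+
  then obtain g :: "(nat \<Rightarrow> int) \<Rightarrow> 'a \<Rightarrow> int" where g: "\<forall>s\<in>S. g s \<in> measurable M (count_space UNIV)" and
    ae: "AE x in M. (\<forall>s\<in>S. g (- s) (T s x) = - g s x \<and> \<bar>real_of_int (g s x) - f s x\<bar> \<le> 12 * real (card S) + 1) \<and>
       real_of_int (\<Sum>s\<in>S. g s x) = (\<Sum>s\<in>S. f s x)" by (elim exE conjE)
  have "AE x in M. (\<forall>s\<in>S. g (- s) (T s x) = - g s x \<and> \<bar>real_of_int (g s x) - f s x\<bar> \<le> 12 * real (card S) + 2) \<and>
       real_of_int (\<Sum>s\<in>S. g s x) = (\<Sum>s\<in>S. f s x)"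
    using ae by eventually_elim force
  then show ?thesis using g by (intro exI[of _ g] conjI)
next
  case m1: True
  let ?u = "unit_vec 0" and ?e = "unit_vec 0 1"
  have u_add: "?u a + ?u b = ?u (a + b)" for a b by (auto simp: unit_vec_def fun_eq_iff)
  have Su: "s = ?u (s 0)" if "s \<in> S" for s
    using Sm[OF that] m1 by (auto simp: unit_vec_def fun_eq_iff)
  have Bu: "a = ?u (a 0)" if "a \<in> cube m l h" for a l h
    using that m1 by (auto simp: unit_vec_def fun_eq_iff cube_def)
  have eS: "?e \<in> S" "- ?e \<in> S" using units[of 0] m1 symS by auto
  have s0: "s 0 \<noteq> 0" if "s \<in> S" for s
  proof
    assume "s 0 = 0"
    then have "s = 0" using Su[OF that] by (simp add: unit_vec_def fun_eq_iff)
    then show False using that S0 by simp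
  qed
  have ee: "?e \<noteq> - ?e"
  proof
    assume "?e = - ?e"
    then have "?e 0 = (- ?e) 0" by (rule arg_cong)
    then show False by (simp add: unit_vec_def)
  qed
  define Pos where "Pos = {s\<in>S. s 0 > 0}"
  have Pos: "finite Pos" "Pos \<subseteq> S" using finS by (auto simp: Pos_def)
  \<comment> \<open>The net flow through the cut just below \<open>y\<close> on its orbit: an edge
    with positive step \<open>s\<close> passes the cut when it starts 1 to \<open>s 0\<close> places
    below \<open>y\<close>.\<close>
  define \<Psi> where "\<Psi> h y = (\<Sum>s\<in>Pos. \<Sum>i\<in>{1..s 0}. h s (T (?u (- i)) y))" for h :: "(nat \<Rightarrow> int) \<Rightarrow> 'a \<Rightarrow> real" and y
  define \<theta> where "\<theta> y = frac (\<Psi> f y)" for y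
  \<comment> \<open>Flows through neighbouring cuts differ by the divergence of the point between
    them, which is an integer. Hence their fractional part \<open>\<theta>\<close> is
    invariant.\<close>
  have step: "\<Psi> f (T ?e y) - \<Psi> f y = (\<Sum>s\<in>S. f s y)" for y
  proof -
    have inner: "(\<Sum>i\<in>{1..s 0}. f s (T (?u (- i)) (T ?e y))) - (\<Sum>i\<in>{1..s 0}. f s (T (?u (- i)) y)) = f s y + f (- s) y"
      if s: "s \<in> Pos" for s
    proof -
      define F where "F i = f s (T (?u (- i)) y)" for i
      have pos: "s 0 > 0" and sS: "s \<in> S" using s by (auto simp: Pos_def)
      have "T (?u (- i)) (T ?e y) = T (?u (- (i - 1))) y" for i
        unfolding T_add[symmetric] u_add by (simp add: algebra_simps)
      then have "(\<Sum>i\<in>{1..s 0}. f s (T (?u (- i)) (T ?e y))) = (\<Sum>i\<in>{1..s 0}. F (i - 1))"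
        by (simp only: F_def)
      also have "\<dots> = (\<Sum>i\<in>{0..s 0 - 1}. F i)"
        by (rule sum.reindex_bij_witness[of _ "\<lambda>i. i + 1" "\<lambda>i. i - 1"]) auto
      also have "{0..s 0 - 1} = insert 0 {1..s 0 - 1}" using pos by auto
      also have "(\<Sum>i\<in>insert 0 {1..s 0 - 1}. F i) = F 0 + (\<Sum>i\<in>{1..s 0 - 1}. F i)" by simp
      finally have 1: "(\<Sum>i\<in>{1..s 0}. f s (T (?u (- i)) (T ?e y))) = F 0 + (\<Sum>i\<in>{1..s 0 - 1}. F i)" .
      have "{1..s 0} = insert (s 0) {1..s 0 - 1}" using pos by auto
      then have 2: "(\<Sum>i\<in>{1..s 0}. F i) = F (s 0) + (\<Sum>i\<in>{1..s 0 - 1}. F i)" by simp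
      have "?u (- s 0) = - s" using Su[OF sS] by (metis uminus_unit_vec)
      then have "F (s 0) = f s (T (- s) y)" by (simp only: F_def)
      also have "\<dots> = - f (- s) y" using anti[OF sS, of "T (- s) y"] by (simp add: T_minus)
      finally have 3: "F (s 0) = - f (- s) y" .
      have "?u (- 0) = 0" by (auto simp: unit_vec_def fun_eq_iff)
      then have 4: "F 0 = f s y" unfolding F_def by (simp add: T_0)
      show ?thesis using 1 2 3 4 by (simp add: F_def)
    qed
    have "\<Psi> f (T ?e y) - \<Psi> f y = (\<Sum>s\<in>Pos. f s y + f (- s) y)"
      unfolding \<Psi>_def sum_subtractf[symmetric] by (intro sum.cong refl) (simp only: sum_subtractf inner)
    also have "\<dots> = (\<Sum>s\<in>Pos. f s y) + (\<Sum>s\<in>uminus ` Pos. f s y)"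
      by (simp add: sum.distrib sum.reindex)
    also have "\<dots> = (\<Sum>s\<in>Pos \<union> uminus ` Pos. f s y)"
      using Pos by (intro sum.union_disjoint[symmetric]) (auto simp: Pos_def)
    also have "Pos \<union> uminus ` Pos = S"
    proof (intro set_eqI iffI)
      fix s assume s: "s \<in> S"
      show "s \<in> Pos \<union> uminus ` Pos"
      proof (cases "s 0 > 0")
        case False
        then have "- s \<in> Pos" using s0[OF s] symS[OF s] by (simp add: Pos_def)
        then show ?thesis by (intro UnI2 image_eqI[of _ _ "- s"]) simp_all
      qed (use s in \<open>simp add: Pos_def\<close>)
    qed (use Pos symS in auto)
    finally show ?thesis .
  qed
  have \<theta>e: "\<theta> (T ?e y) = \<theta> y" for y
    unfolding \<theta>_def by (rule frac_eq_of_diff_Ints) (simp add: step div)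
  have \<theta>e': "\<theta> (T (- ?e) y) = \<theta> y" for y using \<theta>e[of "T (- ?e) y"] by (simp add: T_minus)
  \<comment> \<open>Sends \<open>\<theta>\<close> back along the unit steps of each orbit. The flow
    removed is constant on the orbit, hence free of divergence, and afterwards every cut carries an
    integral flow.\<close>
  define f' where "f' s y = f s y + (if s = - ?e then \<theta> y else 0) - (if s = ?e then \<theta> y else 0)" for s y
  have \<theta>01: "0 \<le> \<theta> y" "\<theta> y < 1" for y by (simp_all add: \<theta>_def frac_lt_1)
  have f'f: "\<bar>f' s y - f s y\<bar> \<le> 1" for s y using \<theta>01[of y] ee by (auto simp: f'_def)
  have \<theta>m: "\<theta> \<in> borel_measurable M"
  proof -
    have "(\<lambda>y. \<Psi> f y) \<in> borel_measurable M"
      unfolding \<Psi>_def using Pos(2) by (intro borel_measurable_sum measurable_compose[OF T_measurable f]) auto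
    moreover have "(frac :: real \<Rightarrow> real) \<in> borel_measurable borel" unfolding frac_def[abs_def] by measurable
    ultimately show ?thesis unfolding \<theta>_def by (rule measurable_compose)
  qed
  have f'm: "f' s \<in> borel_measurable M" if "s \<in> S" for s
    unfolding f'_def[abs_def] using f[OF that] \<theta>m by (cases "s = ?e"; cases "s = - ?e") auto
  have f'anti: "f' (- s) (T s x) = - f' s x" if s: "s \<in> S" for s x
  proof -
    have "- s = - ?e \<longleftrightarrow> s = ?e" by simp
    moreover have "- s = ?e \<longleftrightarrow> s = - ?e" by (metis minus_minus)
    ultimately show ?thesis using anti[OF s, of x] \<theta>e[of x] \<theta>e'[of x] unfolding f'_def
      by (cases "s = ?e"; cases "s = - ?e") auto
  qed
  have f'div: "(\<Sum>s\<in>S. f' s x) = (\<Sum>s\<in>S. f s x)" for x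
    using finS eS by (simp add: f'_def sum.distrib sum_subtractf)
  have right: "(\<Sum>e\<in>{e\<in>box_crossing m S n. base_vec m (snd e) = ?e}. f' (snd e) (T (fst e) x)) \<in> \<int>" if n: "n > 2 * R" for n x
  proof -
    \<comment> \<open>The edges leaving the box upwards are those through the cut just below
      position \<open>n\<close>; since no step exceeds \<open>R\<close>, all of them start inside
      the box.\<close>
    define y where "y = T (?u n) x"
    have "(\<Sum>e\<in>{e\<in>box_crossing m S n. base_vec m (snd e) = ?e}. f' (snd e) (T (fst e) x)) =
       (\<Sum>p\<in>(SIGMA s:Pos. {1..s 0}). f' (fst p) (T (?u (- snd p)) y))"
    proof (rule sum.reindex_bij_witness[of _ "\<lambda>p. (?u (n - snd p), fst p)" "\<lambda>e. (snd e, n - fst e 0)"])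
      fix e assume e: "e \<in> {e\<in>box_crossing m S n. base_vec m (snd e) = ?e}"
      then have a: "fst e \<in> cube m 0 n" "snd e \<in> S" "fst e + snd e \<notin> cube m 0 n" and b: "base_vec m (snd e) = ?e"
        by (auto simp: box_crossing_def)
      have au: "?u (fst e 0) = fst e" using Bu[OF a(1)] by simp
      have pos: "snd e 0 > 0"
      proof (rule ccontr)
        assume "\<not> snd e 0 > 0"
        then have "snd e 0 < 0" using s0[OF a(2)] by simp
        then have "base_vec m (snd e) 0 = - 1" using m1 by (simp add: base_vec_def unit_vec_def)
        then show False unfolding b by (simp add: unit_vec_def)
      qed
      have rng: "0 \<le> fst e 0" "fst e 0 < n" using in_cubeD(1)[OF a(1), of 0] m1 by auto
      have out: "n \<le> fst e 0 + snd e 0"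
      proof (rule ccontr)
        assume "\<not> n \<le> fst e 0 + snd e 0"
        then have "fst e + snd e \<in> cube m 0 n"
          using rng pos m1 in_cubeD(2)[OF a(1)] Sm[OF a(2)] by (intro in_cubeI) auto
        then show False using a(3) by simp
      qed
      show "(?u (n - snd (snd e, n - fst e 0)), fst (snd e, n - fst e 0)) = e" using au by simp
      show "(snd e, n - fst e 0) \<in> (SIGMA s:Pos. {1..s 0})" using a(2) pos rng out by (auto simp: Pos_def)
      have "T (?u (- (n - fst e 0))) y = T (fst e) x"
        unfolding y_def T_add[symmetric] u_add by (simp add: au)
      then show "f' (fst (snd e, n - fst e 0)) (T (?u (- snd (snd e, n - fst e 0))) y) = f' (snd e) (T (fst e) x)" by simp
    next
      fix p assume p: "p \<in> (SIGMA s:Pos. {1..s 0})"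
      then have s: "fst p \<in> S" "fst p 0 > 0" "1 \<le> snd p" "snd p \<le> fst p 0" by (auto simp: Pos_def)
      show "(snd (?u (n - snd p), fst p), n - fst (?u (n - snd p), fst p) 0) = p" by (simp add: unit_vec_def)
      have "snd p < n" using s SR[OF s(1), of 0] n R1 by linarith
      then have "?u (n - snd p) \<in> cube m 0 n" using s m1 by (intro in_cubeI) (auto simp: unit_vec_def)
      moreover have "?u (n - snd p) + fst p \<notin> cube m 0 n"
        using s m1 by (intro not_in_cubeI[of 0]) (auto simp: unit_vec_def)
      ultimately show "(?u (n - snd p), fst p) \<in> {e\<in>box_crossing m S n. base_vec m (snd e) = ?e}"
        using s by (simp add: box_crossing_def base_vec_def)
    qed
    also have "\<dots> = \<Psi> f' y"
      unfolding \<Psi>_def using Pos(1) by (subst sum.Sigma) (auto simp: case_prod_beta)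
    also have "\<Psi> f' y = \<Psi> f y - \<theta> y"
    proof -
      have eP: "?e \<in> Pos" using eS by (simp add: Pos_def unit_vec_def)
      have ne: "- ?e \<notin> Pos" by (simp add: Pos_def unit_vec_def)
      have "\<Psi> f' y = (\<Sum>s\<in>Pos. (\<Sum>i\<in>{1..s 0}. f s (T (?u (- i)) y)) - (if s = ?e then \<theta> y else 0))"
        unfolding \<Psi>_def
      proof (intro sum.cong refl)
        fix s assume s: "s \<in> Pos"
        have sne: "s \<noteq> - ?e" using s ne by auto
        show "(\<Sum>i\<in>{1..s 0}. f' s (T (?u (- i)) y)) = (\<Sum>i\<in>{1..s 0}. f s (T (?u (- i)) y)) - (if s = ?e then \<theta> y else 0)"
        proof (cases "s = ?e")
          case True
          have "{1..s 0} = {1::int}" using True by (auto simp: unit_vec_def)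
          moreover have "?u (- 1) = - ?e" by (simp add: uminus_unit_vec)
          ultimately show ?thesis using True sne \<theta>e'[of y] by (simp add: f'_def)
        next
          case False
          then show ?thesis using sne by (simp add: f'_def)
        qed
      qed
      also have "\<dots> = \<Psi> f y - \<theta> y" using Pos(1) eP by (simp add: sum_subtractf \<Psi>_def)
      finally show ?thesis .
    qed
    also have "\<dots> \<in> \<int>" by (simp add: \<theta>_def frac_def)
    finally show ?thesis .
  qed
  have grp: "(\<Sum>e\<in>{e\<in>box_crossing m S n. base_vec m (snd e) = h}. f' (snd e) (T (fst e) x)) \<in> \<int>" if n: "n > 2 * R" for n x h
  proof -
    let ?F = "\<lambda>e. f' (snd e) (T (fst e) x)" and ?X = "box_crossing m S n"
    have fin: "finite ?X" by (rule finite_box_crossing[OF finS])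
    have bv: "base_vec m s = ?e \<or> base_vec m s = - ?e" for s by (auto simp: base_vec_def uminus_unit_vec)
    consider "h = ?e" | "h = - ?e" | "h \<noteq> ?e" "h \<noteq> - ?e" by blast
    then show ?thesis
    proof cases
      case 1
      then show ?thesis using right[OF n, of x] by simp
    next
      case 2
      \<comment> \<open>What leaves through the lower end is the total minus what leaves through the
        upper end.\<close>
      have "{e\<in>?X. base_vec m (snd e) = - ?e} = ?X - {e\<in>?X. base_vec m (snd e) = ?e}"
      proof -
        have "base_vec m s = - ?e \<longleftrightarrow> \<not> base_vec m s = ?e" for s
          using bv[of s] ee by (elim disjE) simp_all
        then show ?thesis by (simp only:) blast
      qed
      then have "sum ?F {e\<in>?X. base_vec m (snd e) = - ?e} = sum ?F ?X - sum ?F {e\<in>?X. base_vec m (snd e) = ?e}"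
        using fin by (simp add: sum_diff)
      moreover have "sum ?F ?X \<in> \<int>"
        by (rule crossing_total_int[where f = f']) (erule symS | erule f'anti | rule finS | simp add: f'div div)+
      ultimately show ?thesis using right[OF n, of x] 2 by simp
    next
      case 3
      have "base_vec m s \<noteq> h" for s using bv[of s] 3 by (elim disjE) simp_all
      then have "{e\<in>?X. base_vec m (snd e) = h} = {}" by simp
      then show ?thesis by (simp only: sum.empty Ints_0)
    qed
  qed
  have div': "(\<Sum>s\<in>S. f' s x) \<in> \<int>" for x using div by (simp add: f'div)
  have "\<exists>g :: (nat \<Rightarrow> int) \<Rightarrow> 'a \<Rightarrow> int. (\<forall>s\<in>S. g s \<in> measurable M (count_space UNIV)) \<and>
    (AE x in M. (\<forall>s\<in>S. g (- s) (T s x) = - g s x \<and> \<bar>real_of_int (g s x) - f' s x\<bar> \<le> 12 * real (card S) + 1) \<and>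
       real_of_int (\<Sum>s\<in>S. g s x) = (\<Sum>s\<in>S. f' s x))"
    by (rule integral_flow_exists[where f = f' and S = S and R = R])
       (erule symS | erule (1) Sm | erule SR | erule units | erule f'm | erule f'anti | erule grp | rule finS S0 R1 div')+
  then obtain g :: "(nat \<Rightarrow> int) \<Rightarrow> 'a \<Rightarrow> int" where g: "\<forall>s\<in>S. g s \<in> measurable M (count_space UNIV)" and
    ae: "AE x in M. (\<forall>s\<in>S. g (- s) (T s x) = - g s x \<and> \<bar>real_of_int (g s x) - f' s x\<bar> \<le> 12 * real (card S) + 1) \<and>
       real_of_int (\<Sum>s\<in>S. g s x) = (\<Sum>s\<in>S. f' s x)" by (elim exE conjE)
  have "AE x in M. (\<forall>s\<in>S. g (- s) (T s x) = - g s x \<and> \<bar>real_of_int (g s x) - f s x\<bar> \<le> 12 * real (card S) + 2) \<and>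
       real_of_int (\<Sum>s\<in>S. g s x) = (\<Sum>s\<in>S. f s x)"
    using ae
  proof eventually_elim
    case (elim x)
    have "\<bar>real_of_int (g s x) - f s x\<bar> \<le> 12 * real (card S) + 2" if "s \<in> S" for s
    proof -
      have "\<bar>real_of_int (g s x) - f' s x\<bar> \<le> 12 * real (card S) + 1" using elim that by (elim conjE) (drule (1) bspec, simp)
      then show ?thesis using f'f[of s x] by linarith
    qed
    then show ?case using elim by (simp add: f'div)
  qed
  then show ?thesis using g by (intro exI[of _ g] conjI)
qed

end

section \<open>Common domains from coset counts\<close>

definition residue :: "(real ^ 'n) set \<Rightarrow> (real ^ 'n) set \<Rightarrow> real ^ 'n \<Rightarrow> real ^ 'n" where
  "residue L D x = x - (THE l. l \<in> L \<and> x - l \<in> D)"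

lemma residue:
  assumes "fundamental_domain L D"
  shows "residue L D x \<in> D" "x - residue L D x \<in> L" "l \<in> L \<Longrightarrow> x - l \<in> D \<Longrightarrow> residue L D x = x - l"
proof -
  have ex1: "\<exists>!l. l \<in> L \<and> x - l \<in> D" using assms by (simp add: fundamental_domain_def)
  from theI'[OF ex1] show "residue L D x \<in> D" "x - residue L D x \<in> L" by (simp_all add: residue_def)
  assume "l \<in> L" "x - l \<in> D"
  then have "(THE l. l \<in> L \<and> x - l \<in> D) = l" using ex1 by (intro the1_equality) auto
  then show "residue L D x = x - l" by (simp add: residue_def)
qed

lemma residue_add:
  assumes D: "fundamental_domain L D" and L: "subgroup_vec L" and l: "l \<in> L"
  shows "residue L D (x + l) = residue L D x"
proof -
  have "x + l - (x - residue L D x + l) \<in> D" using residue(1)[OF D, of x] by (simp add: algebra_simps)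
  moreover have "x - residue L D x + l \<in> L" using residue(2)[OF D] l by (intro subgroup_vecD(2)[OF L])
  ultimately have "residue L D (x + l) = x + l - (x - residue L D x + l)" by (intro residue(3)[OF D])
  then show ?thesis by simp
qed

lemma is_lattice_countable: assumes "is_lattice L" shows "countable L"
proof -
  have "L = (\<Union>k :: nat. L \<inter> cball 0 (real k))"
  proof (intro set_eqI iffI)
    fix x assume x: "x \<in> L"
    obtain k :: nat where "norm x \<le> real k" using real_arch_simple by blast
    then show "x \<in> (\<Union>k :: nat. L \<inter> cball 0 (real k))" using x by auto
  qed auto
  moreover have "countable (\<Union>k :: nat. L \<inter> cball 0 (real k))"
    by (rule countable_UN) (simp_all add: countable_finite[OF is_lattice_finite_bounded[OF assms bounded_cball]])
  ultimately show ?thesis by simp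
qed

lemma borel_translate: "D \<in> sets borel \<Longrightarrow> {x :: real ^ 'n. x - l \<in> D} \<in> sets borel"
  using measurable_sets_borel[of "\<lambda>x. x - l" borel D] by (simp add: vimage_def)

lemma residue_borel:
  assumes L: "is_lattice L" and D: "fundamental_domain L D"
  shows "residue L D \<in> borel_measurable borel"
proof (rule measurable_countable_cases[where J = L and E = "\<lambda>l. {x. x - l \<in> D}" and g = "\<lambda>l x. x - l"])
  show "countable L" by (rule is_lattice_countable[OF L])
  show "{x. x - l \<in> D} \<in> sets borel" for l using D by (intro borel_translate) (simp add: fundamental_domain_def)
  show "(\<Union>l\<in>L. {x. x - l \<in> D}) = UNIV"
  proof (intro set_eqI iffI UNIV_I)
    fix x show "x \<in> (\<Union>l\<in>L. {x. x - l \<in> D})"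
      using residue(1,2)[OF D, of x] by (intro UN_I[of "x - residue L D x"]) simp_all
  qed
  show "residue L D x = x - l" if "l \<in> L" "x \<in> {x. x - l \<in> D}" for l x using residue(3)[OF D] that by simp
qed simp_all

lemma has_sum_indicator_unique:
  assumes "\<exists>!l. l \<in> L \<and> x - l \<in> E"
  shows "((\<lambda>l. indicat_real E (x - l)) has_sum 1) L"
proof -
  obtain l where l: "l \<in> L" "x - l \<in> E" and u: "\<And>l'. l' \<in> L \<Longrightarrow> x - l' \<in> E \<Longrightarrow> l' = l"
    using assms by (elim ex1E conjE) blast
  have "indicat_real E (x - l') = 0" if "l' \<in> L - {l}" for l' using u[of l'] that by (auto simp: indicator_def)
  then show ?thesis using l by (intro has_sum_finite_neutralI[of "{l}"]) simp_all
qed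

text \<open>Points of the two domains lying in one coset are labelled by pairs \<open>(s, i)\<close> with \<open>i < b s\<close>; equal labels
  in cosets that differ by \<open>v s\<close> are matched, and each matching translation is split into its \<open>L\<close>- and
  \<open>M\<close>-part.\<close>

theorem common_domain_from_counts:
  fixes L M \<Lambda> DL DM Z :: "(real ^ 'n) set" and v :: "'s \<Rightarrow> real ^ 'n" and b :: "'s \<Rightarrow> real ^ 'n \<Rightarrow> nat"
  assumes L: "is_lattice L" and M: "is_lattice M" and \<Lambda>: "is_lattice \<Lambda>"
    and DL: "fundamental_domain L DL" and DM: "fundamental_domain M DM" and S: "finite S"
    and vG: "\<And>s. s \<in> S \<Longrightarrow> \<exists>l\<in>L. \<exists>m\<in>M. v s = l + m" and \<Lambda>G: "\<And>x. x \<in> \<Lambda> \<Longrightarrow> \<exists>l\<in>L. \<exists>m\<in>M. x = l + m"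
    and bm: "\<And>s. s \<in> S \<Longrightarrow> b s \<in> measurable borel (count_space UNIV)"
    and binv: "\<And>s x l. s \<in> S \<Longrightarrow> l \<in> \<Lambda> \<Longrightarrow> b s (x + l) = b s x"
    and Z: "Z \<in> null_sets lebesgue" and Zinv: "\<And>x l m. x \<notin> Z \<Longrightarrow> l \<in> L \<Longrightarrow> m \<in> M \<Longrightarrow> x + l + m \<notin> Z"
    and cL: "\<And>x. x \<notin> Z \<Longrightarrow> (\<Sum>s\<in>S. b s x) = card {l\<in>\<Lambda>. x + l \<in> DL}"
    and cM: "\<And>x. x \<notin> Z \<Longrightarrow> (\<Sum>s\<in>S. b s (x - v s)) = card {l\<in>\<Lambda>. x + l \<in> DM}"
  shows "\<exists>E. bounded E \<and> E \<in> sets lebesgue \<and> (AE x in lebesgue. ((\<lambda>l. indicat_real E (x - l)) has_sum 1) L) \<and>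
           (AE x in lebesgue. ((\<lambda>m. indicat_real E (x - m)) has_sum 1) M)"
proof -
  note sL = subgroup_vecD[OF is_lattice_subgroup[OF L]] and sM = subgroup_vecD[OF is_lattice_subgroup[OF M]]
    and s\<Lambda> = subgroup_vecD[OF is_lattice_subgroup[OF \<Lambda>]]
  obtain P0 where P0: "fundamental_domain \<Lambda> P0" using is_lattice_domain[OF \<Lambda>] by metis
  have DLb: "DL \<in> sets borel" "bounded DL" and DMb: "DM \<in> sets borel" "bounded DM" and P0b: "bounded P0"
    using DL DM P0 by (auto simp: fundamental_domain_def)
  define rep where "rep = residue \<Lambda> P0"
  have rep: "rep x \<in> P0" "x - rep x \<in> \<Lambda>" for x using residue[OF P0] by (auto simp: rep_def)
  have rep_add: "rep (x + l) = rep x" if "l \<in> \<Lambda>" for x l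
    unfolding rep_def by (rule residue_add[OF P0 is_lattice_subgroup[OF \<Lambda>] that])
  have rep_borel: "rep \<in> borel_measurable borel" unfolding rep_def by (rule residue_borel[OF \<Lambda> P0])
  have Z_G: "x + g \<notin> Z" if x: "x \<notin> Z" and g: "\<exists>l\<in>L. \<exists>m\<in>M. g = l + m" for x g
  proof -
    obtain l m where "l \<in> L" "m \<in> M" "g = l + m" using g by blast
    then show ?thesis using Zinv[OF x, of l m] by (simp add: add.assoc)
  qed
  have Z_minus: "x - g \<notin> Z" if x: "x \<notin> Z" and g: "\<exists>l\<in>L. \<exists>m\<in>M. g = l + m" for x g
  proof -
    obtain l m where "l \<in> L" "m \<in> M" "g = l + m" using g by blast
    then show ?thesis using Zinv[OF x, of "- l" "- m"] sL(3) sM(3) by (simp add: algebra_simps)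
  qed
  have Z_rep: "rep x \<notin> Z" if "x \<notin> Z" for x
    using Z_minus[OF that \<Lambda>G[OF rep(2)[of x]]] by simp
  have b_rep: "b s (rep x + c) = b s (x + c)" if "s \<in> S" for s x c
    using binv[OF that rep(2)[of x], of "rep x + c"] by (simp add: add_ac)
  have b_rep': "b s (rep x) = b s x" if "s \<in> S" for s x using b_rep[OF that, of x 0] by simp
  define Q where "Q D x = {l\<in>\<Lambda>. rep x + l \<in> D}" for D x
  define \<Gamma>L where "\<Gamma>L x = (SIGMA s:S. {..<b s x})" for x
  define \<Gamma>M where "\<Gamma>M x = (SIGMA s:S. {..<b s (x - v s)})" for x
  \<comment> \<open>The bijection is selected from the two finite sets alone. All points of a coset
    share these sets, so they agree on the labelling, and it depends on finitely many
    integers.\<close>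
  define \<beta> :: "(real ^ 'n) set \<Rightarrow> ('s \<times> nat) set \<Rightarrow> real ^ 'n \<Rightarrow> 's \<times> nat" where "\<beta> q c = (SOME f. bij_betw f q c)" for q c
  define labL where "labL y = \<beta> (Q DL y) (\<Gamma>L y) (y - rep y)" for y
  define labM where "labM y = \<beta> (Q DM y) (\<Gamma>M y) (y - rep y)" for y
  define F where "F = {l\<in>\<Lambda>. \<exists>x\<in>DL \<union> DM. x - l \<in> P0}"
  have F: "finite F" unfolding F_def by (rule finite_tiles_meeting[OF \<Lambda> P0b]) (use DLb DMb in simp)
  have QF: "Q D x = {l\<in>F. rep x + l \<in> D}" if "D \<subseteq> DL \<union> DM" for D x
  proof (intro set_eqI iffI)
    fix l assume "l \<in> Q D x"
    then have l: "l \<in> \<Lambda>" "rep x + l \<in> D" by (auto simp: Q_def)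
    have "rep x + l - l \<in> P0" using rep(1) by simp
    then have "l \<in> F" unfolding F_def using l that by (intro CollectI conjI bexI[of _ "rep x + l"]) auto
    then show "l \<in> {l\<in>F. rep x + l \<in> D}" using l by simp
  qed (auto simp: Q_def F_def)
  have finQ: "finite (Q D x)" if "D \<subseteq> DL \<union> DM" for D x using F by (simp add: QF[OF that])
  have bij: "bij_betw (\<beta> q c) q c" if "finite q" "finite c" "card q = card c" for q c
    unfolding \<beta>_def using finite_same_card_bij[OF that] by (rule someI_ex)
  have bijL: "bij_betw (\<beta> (Q DL x) (\<Gamma>L x)) (Q DL x) (\<Gamma>L x)" if x: "x \<notin> Z" for x
  proof (rule bij)
    show "finite (Q DL x)" by (rule finQ) simp
    show "finite (\<Gamma>L x)" using S by (simp add: \<Gamma>L_def)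
    have "card (\<Gamma>L x) = (\<Sum>s\<in>S. b s (rep x))" using S by (simp add: \<Gamma>L_def b_rep')
    also have "\<dots> = card (Q DL x)" unfolding Q_def by (rule cL[OF Z_rep[OF x]])
    finally show "card (Q DL x) = card (\<Gamma>L x)" by simp
  qed
  have bijM: "bij_betw (\<beta> (Q DM x) (\<Gamma>M x)) (Q DM x) (\<Gamma>M x)" if x: "x \<notin> Z" for x
  proof (rule bij)
    show "finite (Q DM x)" by (rule finQ) simp
    show "finite (\<Gamma>M x)" using S by (simp add: \<Gamma>M_def)
    have "card (\<Gamma>M x) = (\<Sum>s\<in>S. b s (x - v s))" using S by (simp add: \<Gamma>M_def)
    also have "\<dots> = (\<Sum>s\<in>S. b s (rep x - v s))" using b_rep[of _ x "- v _"] by (intro sum.cong) auto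
    also have "\<dots> = card (Q DM x)" unfolding Q_def by (rule cM[OF Z_rep[OF x]])
    finally show "card (Q DM x) = card (\<Gamma>M x)" by simp
  qed
  have Q_inv: "Q D (x + l) = Q D x" if "l \<in> \<Lambda>" for D x l by (simp add: Q_def rep_add[OF that])
  have \<Gamma>L_inv: "\<Gamma>L (x + l) = \<Gamma>L x" if "l \<in> \<Lambda>" for x l
    unfolding \<Gamma>L_def by (rule Sigma_cong) (simp_all add: binv[OF _ that])
  have \<Gamma>M_inv: "\<Gamma>M (x + l) = \<Gamma>M x" if l: "l \<in> \<Lambda>" for x l
    unfolding \<Gamma>M_def
  proof (rule Sigma_cong)
    fix s assume "s \<in> S"
    from binv[OF this l, of "x - v s"] show "{..<b s (x + l - v s)} = {..<b s (x - v s)}" by (simp add: algebra_simps)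
  qed simp
  have point: "\<exists>y. y - x \<in> \<Lambda> \<and> y \<in> D \<and> \<beta> (Q D x) c (y - rep x) = t \<and>
       (\<forall>y'. y' - x \<in> \<Lambda> \<longrightarrow> y' \<in> D \<longrightarrow> \<beta> (Q D x) c (y' - rep x) = t \<longrightarrow> y' = y)"
    if b: "bij_betw (\<beta> (Q D x) c) (Q D x) c" and t: "t \<in> c" for D x c t
  proof -
    have "t \<in> \<beta> (Q D x) c ` Q D x" using b t by (simp add: bij_betw_def)
    then obtain l where l: "l \<in> Q D x" "\<beta> (Q D x) c l = t" by (metis imageE)
    have "l \<in> \<Lambda>" using l(1) by (simp add: Q_def)
    from s\<Lambda>(4)[OF this rep(2)[of x]] have in\<Lambda>: "l + rep x - x \<in> \<Lambda>" by (simp add: algebra_simps)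
    have uniq: "y' = l + rep x" if "y' - x \<in> \<Lambda>" "y' \<in> D" "\<beta> (Q D x) c (y' - rep x) = t" for y'
    proof -
      have "y' - rep x = (y' - x) + (x - rep x)" by simp
      then have "y' - rep x \<in> \<Lambda>" using s\<Lambda>(2)[OF that(1) rep(2)[of x]] by simp
      then have "y' - rep x \<in> Q D x" using that(2) by (simp add: Q_def)
      then have "y' - rep x = l" using b l that(3) by (auto simp: bij_betw_def inj_on_def)
      then show ?thesis by (simp add: algebra_simps)
    qed
    show ?thesis
    proof (intro exI[of _ "l + rep x"] conjI allI impI)
      show "l + rep x \<in> D" using l(1) by (simp add: Q_def add.commute)
      show "\<beta> (Q D x) c (l + rep x - rep x) = t" using l(2) by simp
    qed (rule in\<Lambda>, rule uniq)
  qed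
  have labL_in: "labL y \<in> \<Gamma>L y" if "y \<in> DL" "y \<notin> Z" for y
  proof -
    have "y - rep y \<in> Q DL y" using that rep(2) by (simp add: Q_def)
    then show ?thesis using bijL[OF that(2)] unfolding labL_def by (rule bij_betwE[THEN bspec, rotated])
  qed
  have labM_in: "labM y \<in> \<Gamma>M y" if "y \<in> DM" "y \<notin> Z" for y
  proof -
    have "y - rep y \<in> Q DM y" using that rep(2) by (simp add: Q_def)
    then show ?thesis using bijM[OF that(2)] unfolding labM_def by (rule bij_betwE[THEN bspec, rotated])
  qed
  have lab_shift: "labL y = \<beta> (Q DL x) (\<Gamma>L x) (y - rep x)" "labM y = \<beta> (Q DM x) (\<Gamma>M x) (y - rep x)" if "y - x \<in> \<Lambda>" for x y
    using Q_inv[OF that, of _ x] \<Gamma>L_inv[OF that, of x] \<Gamma>M_inv[OF that, of x] rep_add[OF that, of x]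
    by (simp_all add: labL_def labM_def)
  \<comment> \<open>The points of \<open>DL\<close> whose partner in \<open>DM\<close> is reached by
    the translation \<open>v (fst p) + snd p\<close>. Each point has one such \<open>p\<close>
    (\<open>U1\<close>), and each point of \<open>DM\<close> is reached from one point
    (\<open>U2\<close>).\<close>
  define A where "A p = {y\<in>DL. y + v (fst p) + snd p \<in> DM \<and> labL y = labM (y + v (fst p) + snd p) \<and> fst (labL y) = fst p}" for p
  have U1: "\<exists>!p. p \<in> S \<times> \<Lambda> \<and> y \<in> A p" if y: "y \<in> DL" "y \<notin> Z" for y
  proof -
    obtain s i where si: "labL y = (s, i)" by (cases "labL y")
    have s: "s \<in> S" "i < b s y" using labL_in[OF y] si by (auto simp: \<Gamma>L_def)
    let ?x = "y + v s"
    have x: "?x \<notin> Z" by (rule Z_G[OF y(2) vG[OF s(1)]])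
    have "(s, i) \<in> \<Gamma>M ?x" using s by (simp add: \<Gamma>M_def)
    from point[OF bijM[OF x] this] obtain z where z: "z - ?x \<in> \<Lambda>" "z \<in> DM" "\<beta> (Q DM ?x) (\<Gamma>M ?x) (z - rep ?x) = (s, i)"
      and uz: "\<And>z'. z' - ?x \<in> \<Lambda> \<Longrightarrow> z' \<in> DM \<Longrightarrow> \<beta> (Q DM ?x) (\<Gamma>M ?x) (z' - rep ?x) = (s, i) \<Longrightarrow> z' = z" by blast
    show ?thesis
    proof (rule ex1I[of _ "(s, z - ?x)"])
      show "(s, z - ?x) \<in> S \<times> \<Lambda> \<and> y \<in> A (s, z - ?x)"
        using s z y si lab_shift(2)[OF z(1)] by (simp add: A_def)
      fix p assume p: "p \<in> S \<times> \<Lambda> \<and> y \<in> A p"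
      then have fp: "fst p = s" and l: "snd p \<in> \<Lambda>" using si by (auto simp: A_def)
      let ?z = "?x + snd p"
      have "?z \<in> DM" "labM ?z = (s, i)" using p fp si by (auto simp: A_def)
      moreover have "?z - ?x \<in> \<Lambda>" using l by simp
      ultimately have "?z = z" using lab_shift(2)[of ?z ?x] by (intro uz) simp_all
      then have "snd p = z - ?x" by (simp add: algebra_simps)
      then show "p = (s, z - ?x)" using fp by (simp add: prod_eq_iff)
    qed
  qed
  have U2: "\<exists>!p. p \<in> S \<times> \<Lambda> \<and> z - v (fst p) - snd p \<in> A p" if z: "z \<in> DM" "z \<notin> Z" for z
  proof -
    obtain s i where si: "labM z = (s, i)" by (cases "labM z")
    have s: "s \<in> S" "i < b s (z - v s)" using labM_in[OF z] si by (auto simp: \<Gamma>M_def)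
    let ?x = "z - v s"
    have x: "?x \<notin> Z" by (rule Z_minus[OF z(2) vG[OF s(1)]])
    have "(s, i) \<in> \<Gamma>L ?x" using s by (simp add: \<Gamma>L_def)
    from point[OF bijL[OF x] this] obtain y where y: "y - ?x \<in> \<Lambda>" "y \<in> DL" "\<beta> (Q DL ?x) (\<Gamma>L ?x) (y - rep ?x) = (s, i)"
      and uy: "\<And>y'. y' - ?x \<in> \<Lambda> \<Longrightarrow> y' \<in> DL \<Longrightarrow> \<beta> (Q DL ?x) (\<Gamma>L ?x) (y' - rep ?x) = (s, i) \<Longrightarrow> y' = y" by blast
    have ly: "labL y = (s, i)" using lab_shift(1)[OF y(1)] y(3) by simp
    show ?thesis
    proof (rule ex1I[of _ "(s, ?x - y)"])
      have "?x - y \<in> \<Lambda>" using s\<Lambda>(3)[OF y(1)] by simp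
      then show "(s, ?x - y) \<in> S \<times> \<Lambda> \<and> z - v (fst (s, ?x - y)) - snd (s, ?x - y) \<in> A (s, ?x - y)"
        using s y z si ly by (simp add: A_def)
      fix p assume p: "p \<in> S \<times> \<Lambda> \<and> z - v (fst p) - snd p \<in> A p"
      let ?y = "z - v (fst p) - snd p"
      have py: "?y \<in> DL" "labL ?y = labM z" "fst (labL ?y) = fst p" using p by (auto simp: A_def)
      then have fp: "fst p = s" and l: "snd p \<in> \<Lambda>" using si p by auto
      have d: "?y - ?x \<in> \<Lambda>" using s\<Lambda>(3)[OF l] by (simp add: fp)
      have "?y = y" using py si lab_shift(1)[OF d] by (intro uy[OF d]) simp_all
      then have "snd p = ?x - y" by (auto simp: fp)
      then show "p = (s, ?x - y)" using fp by (simp add: prod_eq_iff)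
    qed
  qed
  \<comment> \<open>The sets \<open>Q D x\<close> and \<open>h x\<close> are encoded by finitely
    many natural numbers: the counts \<open>c s x\<close>, and for each \<open>l \<in> F\<close>
    whether \<open>rep x + l\<close> is in \<open>D\<close>.\<close>
  have Q_meas: "{x. \<beta> (Q D x) (h x) l = t} \<in> sets borel"
    if D: "D \<in> {DL, DM}" and h: "\<And>x. h x = (SIGMA s:S. {..<c s x})" and c: "\<And>s. s \<in> S \<Longrightarrow> c s \<in> measurable borel (count_space UNIV)"
    for D h l t and c :: "'s \<Rightarrow> real ^ 'n \<Rightarrow> nat"
  proof -
    define q where "q i x = (case i of Inl s \<Rightarrow> c s x | Inr l \<Rightarrow> of_bool (rep x + l \<in> D))" for i :: "'s + real ^ 'n" and x
    define G where "G d = \<beta> {l\<in>F. d (Inr l) = 1} (SIGMA s:S. {..<d (Inl s)}) l" for d :: "'s + real ^ 'n \<Rightarrow> nat"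
    have fin: "finite (Inl ` S \<union> Inr ` F)" using S F by simp
    have "(\<lambda>x. G (\<lambda>i\<in>Inl ` S \<union> Inr ` F. q i x)) \<in> measurable borel (count_space UNIV)"
    proof (rule measurable_finite_countable_data[OF fin])
      fix i assume "i \<in> Inl ` S \<union> Inr ` F"
      then consider s where "s \<in> S" "i = Inl s" | l where "l \<in> F" "i = Inr l" by blast
      then show "q i \<in> measurable borel (count_space UNIV)"
      proof cases
        case 1
        then show ?thesis using c by (simp add: q_def[abs_def])
      next
        case 2
        have Db: "D \<in> sets borel" using D DLb DMb by auto
        have "(\<lambda>x. rep x + l) \<in> borel_measurable borel" using rep_borel by simp
        from measurable_sets_borel[OF this Db] have "{x. rep x + l \<in> D} \<in> sets borel" by (simp add: vimage_def)
        then have "(\<lambda>x. of_bool (rep x + l \<in> D) :: nat) \<in> measurable borel (count_space UNIV)"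
          unfolding of_bool_def by (intro measurable_If) auto
        then show ?thesis using 2 by (simp add: q_def[abs_def])
      qed
    qed simp
    moreover have "G (\<lambda>i\<in>Inl ` S \<union> Inr ` F. q i x) = \<beta> (Q D x) (h x) l" for x
    proof -
      have "{l\<in>F. (\<lambda>i\<in>Inl ` S \<union> Inr ` F. q i x) (Inr l) = 1} = Q D x"
        using D by (subst QF) (auto simp: q_def)
      moreover have "(SIGMA s:S. {..<(\<lambda>i\<in>Inl ` S \<union> Inr ` F. q i x) (Inl s)}) = h x"
        unfolding h by (rule Sigma_cong) (simp_all add: q_def)
      ultimately show ?thesis by (simp add: G_def)
    qed
    ultimately have "(\<lambda>x. \<beta> (Q D x) (h x) l) \<in> measurable borel (count_space UNIV)" by simp
    from measurable_sets[OF this, of "{t}"] show ?thesis by (simp add: vimage_def)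
  qed
  have cut: "{y. y - rep y = l} \<in> sets borel" for l
  proof -
    have "(\<lambda>y. y - rep y) \<in> borel_measurable borel" using rep_borel by simp
    from measurable_sets_borel[OF this, of "{l}"] show ?thesis by (simp add: vimage_def)
  qed
  have lab_meas: "{y. labL y = t} \<in> sets borel" "{y. labM y = t} \<in> sets borel" for t
  proof -
    have "{y. labL y = t} = (\<Union>l\<in>\<Lambda>. {y. y - rep y = l} \<inter> {y. \<beta> (Q DL y) (\<Gamma>L y) l = t})"
      using rep(2) by (simp add: labL_def set_eq_iff)
    moreover have "{y. \<beta> (Q DL y) (\<Gamma>L y) l = t} \<in> sets borel" for l
      by (rule Q_meas[where c = b]) (auto simp: \<Gamma>L_def bm)
    ultimately show "{y. labL y = t} \<in> sets borel"
      using cut by (auto intro!: sets.countable_UN''[OF is_lattice_countable[OF \<Lambda>]])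
    have "{y. labM y = t} = (\<Union>l\<in>\<Lambda>. {y. y - rep y = l} \<inter> {y. \<beta> (Q DM y) (\<Gamma>M y) l = t})"
      using rep(2) by (simp add: labM_def set_eq_iff)
    moreover have "{y. \<beta> (Q DM y) (\<Gamma>M y) l = t} \<in> sets borel" for l
    proof (rule Q_meas[where c = "\<lambda>s x. b s (x - v s)"])
      show "(\<lambda>x. b s (x - v s)) \<in> measurable borel (count_space UNIV)" if "s \<in> S" for s
        by (rule measurable_compose[OF _ bm[OF that]]) simp
    qed (auto simp: \<Gamma>M_def)
    ultimately show "{y. labM y = t} \<in> sets borel"
      using cut by (auto intro!: sets.countable_UN''[OF is_lattice_countable[OF \<Lambda>]])
  qed
  have shift: "{y. y + c \<in> B} \<in> sets borel" if "B \<in> sets borel" for B and c :: "real ^ 'n"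
    using borel_translate[OF that, of "- c"] by simp
  define A' where "A' p = {y\<in>DL. y + v (fst p) + snd p \<in> DM} \<inter> (\<Union>t\<in>{fst p} \<times> UNIV. {y. labL y = t} \<inter> {y. y + (v (fst p) + snd p) \<in> {z. labM z = t}})" for p
  have AA': "A p = A' p" for p
  proof (intro set_eqI iffI)
    fix y assume "y \<in> A p"
    then have y: "y \<in> DL" "y + v (fst p) + snd p \<in> DM" and l1: "labL y = labM (y + v (fst p) + snd p)"
      and l2: "fst (labL y) = fst p" by (auto simp: A_def)
    have "labL y \<in> {fst p} \<times> UNIV" using l2 by (cases "labL y") simp
    moreover have "y \<in> {x. labL x = labL y} \<inter> {x. x + (v (fst p) + snd p) \<in> {z. labM z = labL y}}"
      unfolding l1 by (simp add: add.assoc l1[unfolded add.assoc])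
    ultimately show "y \<in> A' p" unfolding A'_def using y by (intro IntI UN_I[of "labL y"]) simp_all
  next
    fix y assume "y \<in> A' p"
    then show "y \<in> A p" unfolding A_def A'_def by (auto simp: add.assoc)
  qed
  have A_borel: "A p \<in> sets borel" for p
  proof -
    have "{y\<in>DL. y + v (fst p) + snd p \<in> DM} = DL \<inter> {y. y + (v (fst p) + snd p) \<in> DM}" by (auto simp: add.assoc)
    moreover have "countable ({fst p} \<times> (UNIV :: nat set))" by (intro countable_SIGMA) auto
    ultimately show ?thesis unfolding AA' A'_def
      by (simp only:) (intro sets.Int DLb shift DMb sets.countable_UN'' lab_meas)
  qed
  have "\<forall>p. \<exists>l m. p \<in> S \<times> \<Lambda> \<longrightarrow> l \<in> L \<and> m \<in> M \<and> v (fst p) + snd p = l + m"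
  proof
    fix p
    show "\<exists>l m. p \<in> S \<times> \<Lambda> \<longrightarrow> l \<in> L \<and> m \<in> M \<and> v (fst p) + snd p = l + m"
    proof (cases "p \<in> S \<times> \<Lambda>")
      case True
      then obtain l m l' m' where "l \<in> L" "m \<in> M" "v (fst p) = l + m" "l' \<in> L" "m' \<in> M" "snd p = l' + m'"
        using vG[of "fst p"] \<Lambda>G[of "snd p"] by (auto simp: mem_Times_iff)
      then show ?thesis using sL(2) sM(2) by (intro exI[of _ "l + l'"] exI[of _ "m + m'"]) (auto simp: algebra_simps)
    qed simp
  qed
  from choice[OF this] obtain el where "\<forall>p. \<exists>m. p \<in> S \<times> \<Lambda> \<longrightarrow> el p \<in> L \<and> m \<in> M \<and> v (fst p) + snd p = el p + m" ..
  from choice[OF this] obtain em where em: "\<forall>p. p \<in> S \<times> \<Lambda> \<longrightarrow> el p \<in> L \<and> em p \<in> M \<and> v (fst p) + snd p = el p + em p" ..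
  \<comment> \<open>Each piece \<open>A p\<close> is moved only by the \<open>L\<close>-part of its
    matching translation. Modulo \<open>L\<close> the pieces reassemble to \<open>DL\<close>; modulo
    \<open>M\<close> the remaining part \<open>em p\<close> does not count, and they reassemble to
    \<open>DM\<close>.\<close>
  define E where "E = (\<Union>p\<in>{p\<in>S \<times> \<Lambda>. A p \<noteq> {}}. {x. x - el p \<in> A p})"
  \<comment> \<open>Bounded domains meet under finitely many translations only. Thus
    \<open>E\<close> is a finite union of bounded Borel sets, and in particular bounded.\<close>
  have finP: "finite {p\<in>S \<times> \<Lambda>. A p \<noteq> {}}"
  proof (rule finite_subset)
    show "{p\<in>S \<times> \<Lambda>. A p \<noteq> {}} \<subseteq> (SIGMA s:S. {l\<in>\<Lambda>. \<exists>x\<in>DM. x - l \<in> (+) (v s) ` DL})"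
    proof
      fix p assume "p \<in> {p\<in>S \<times> \<Lambda>. A p \<noteq> {}}"
      then obtain y where p: "p \<in> S \<times> \<Lambda>" "y \<in> A p" by auto
      have "y + v (fst p) + snd p - snd p \<in> (+) (v (fst p)) ` DL"
        using p by (intro image_eqI[of _ _ y]) (auto simp: A_def)
      moreover have "y + v (fst p) + snd p \<in> DM" using p by (auto simp: A_def)
      ultimately have "\<exists>x\<in>DM. x - snd p \<in> (+) (v (fst p)) ` DL" by (intro bexI[of _ "y + v (fst p) + snd p"])
      moreover obtain s l where sl: "p = (s, l)" by (cases p)
      ultimately have "\<exists>x\<in>DM. x - l \<in> (+) (v s) ` DL" by (simp only: fst_conv snd_conv)
      then show "p \<in> (SIGMA s:S. {l\<in>\<Lambda>. \<exists>x\<in>DM. x - l \<in> (+) (v s) ` DL})"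
        using p(1) unfolding sl by (simp only: mem_Sigma_iff mem_Collect_eq simp_thms)
    qed
    show "finite (SIGMA s:S. {l\<in>\<Lambda>. \<exists>x\<in>DM. x - l \<in> (+) (v s) ` DL})"
      using S by (intro finite_SigmaI finite_tiles_meeting[OF \<Lambda>] bounded_translation DLb DMb)
  qed
  have E_iff: "x \<in> E \<longleftrightarrow> (\<exists>p. p \<in> S \<times> \<Lambda> \<and> x - el p \<in> A p)" for x
    by (auto simp: E_def)
  have bE: "bounded E"
    unfolding E_def
  proof (rule bounded_UN[OF finP ballI])
    fix p
    have "{x. x - el p \<in> A p} \<subseteq> (+) (el p) ` DL"
    proof
      fix x assume "x \<in> {x. x - el p \<in> A p}"
      then show "x \<in> (+) (el p) ` DL" by (intro image_eqI[of _ _ "x - el p"]) (auto simp: A_def)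
    qed
    then show "bounded {x. x - el p \<in> A p}" by (rule bounded_subset[OF bounded_translation[OF DLb(2)]])
  qed
  have sE: "E \<in> sets lebesgue"
  proof -
    have "E \<in> sets borel" unfolding E_def by (intro sets.finite_UN[OF finP] borel_translate A_borel)
    then show ?thesis by (simp add: sets_completionI_sets)
  qed
  have uL: "\<exists>!l. l \<in> L \<and> x - l \<in> E" if x: "x \<notin> Z" for x
  proof -
    let ?y = "residue L DL x"
    have y: "?y \<in> DL" "x - ?y \<in> L" using residue[OF DL] by auto
    have yZ: "?y \<notin> Z" using Zinv[OF x sL(3)[OF y(2)] sM(1)] by simp
    obtain p where p: "p \<in> S \<times> \<Lambda>" "?y \<in> A p" and up: "\<And>p'. p' \<in> S \<times> \<Lambda> \<Longrightarrow> ?y \<in> A p' \<Longrightarrow> p' = p"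
      using U1[OF y(1) yZ] by (elim ex1E conjE) blast
    have elp: "el p \<in> L" using em p(1) by blast
    show ?thesis
    proof (rule ex1I[of _ "x - ?y - el p"])
      show "x - ?y - el p \<in> L \<and> x - (x - ?y - el p) \<in> E"
        using sL(4)[OF y(2) elp] p unfolding E_iff by (intro conjI exI[of _ p]) simp_all
      fix l assume l: "l \<in> L \<and> x - l \<in> E"
      then obtain p' where p': "p' \<in> S \<times> \<Lambda>" "x - l - el p' \<in> A p'" unfolding E_iff by blast
      have "l + el p' \<in> L" using l em p'(1) by (intro sL(2)) auto
      moreover have "x - (l + el p') \<in> DL" using p'(2) by (simp add: A_def algebra_simps)
      ultimately have eq: "?y = x - (l + el p')" by (rule residue(3)[OF DL])
      have "?y \<in> A p'" using p'(2) unfolding eq by (simp only: diff_diff_eq)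
      then have "p' = p" by (rule up[OF p'(1)])
      then show "l = x - ?y - el p" using eq by simp
    qed
  qed
  have uM: "\<exists>!l. l \<in> M \<and> x - l \<in> E" if x: "x \<notin> Z" for x
  proof -
    let ?z = "residue M DM x"
    have z: "?z \<in> DM" "x - ?z \<in> M" using residue[OF DM] by auto
    have zZ: "?z \<notin> Z" using Zinv[OF x sL(1) sM(3)[OF z(2)]] by simp
    obtain p where p: "p \<in> S \<times> \<Lambda>" "?z - v (fst p) - snd p \<in> A p"
      and up: "\<And>p'. p' \<in> S \<times> \<Lambda> \<Longrightarrow> ?z - v (fst p') - snd p' \<in> A p' \<Longrightarrow> p' = p"
      using U2[OF z(1) zZ] by (elim ex1E conjE) blast
    have emp: "em p \<in> M" "v (fst p) + snd p = el p + em p" using em p(1) by blast+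
    show ?thesis
    proof (rule ex1I[of _ "x - ?z + em p"])
      have eqp: "x - (x - ?z + em p) - el p = ?z - v (fst p) - snd p" using emp(2) by (simp add: algebra_simps)
      show "x - ?z + em p \<in> M \<and> x - (x - ?z + em p) \<in> E"
        unfolding E_iff by (intro conjI exI[of _ p] p(1) sM(2)[OF z(2) emp(1)]) (simp only: eqp p(2))
      fix l assume l: "l \<in> M \<and> x - l \<in> E"
      then obtain p' where p': "p' \<in> S \<times> \<Lambda>" "x - l - el p' \<in> A p'" unfolding E_iff by blast
      have em': "em p' \<in> M" "v (fst p') + snd p' = el p' + em p'" using em p'(1) by blast+
      have "l - em p' \<in> M" using l em'(1) by (intro sM(4)) auto
      moreover have zz: "x - (l - em p') = x - l - el p' + v (fst p') + snd p'" using em'(2) by (simp add: algebra_simps)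
      have "x - (l - em p') \<in> DM" unfolding zz using p'(2) by (simp add: A_def)
      ultimately have eq: "?z = x - (l - em p')" by (rule residue(3)[OF DM])
      have "?z - v (fst p') - snd p' = x - l - el p'" unfolding eq zz by simp
      then have "?z - v (fst p') - snd p' \<in> A p'" using p'(2) by simp
      then have "p' = p" by (rule up[OF p'(1)])
      then show "l = x - ?z + em p" using eq by simp
    qed
  qed
  have ae: "AE x in lebesgue. x \<notin> Z" by (rule AE_not_in[OF Z])
  show ?thesis
  proof (intro exI[of _ E] conjI bE sE)
    show "AE x in lebesgue. ((\<lambda>l. indicat_real E (x - l)) has_sum 1) L"
      using ae by (rule eventually_mono) (rule has_sum_indicator_unique[OF uL])
    show "AE x in lebesgue. ((\<lambda>m. indicat_real E (x - m)) has_sum 1) M"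
      using ae by (rule eventually_mono) (rule has_sum_indicator_unique[OF uM])
  qed
qed

section \<open>The translation action on a torus\<close>

text \<open>Independence modulo \<open>\<Lambda>\<close> is freeness of the action of
  \<open>Z^k\<close> by translations on the torus.\<close>

locale lattice_action =
  fixes \<Lambda> P0 :: "(real ^ 'n) set" and \<gamma> :: "nat \<Rightarrow> real ^ 'n" and k :: nat
  assumes \<Lambda>: "is_lattice \<Lambda>" and P0: "fundamental_domain \<Lambda> P0"
    and indep: "\<And>a i. (\<Sum>i<k. of_int (a i) *\<^sub>R \<gamma> i) \<in> \<Lambda> \<Longrightarrow> i < k \<Longrightarrow> a i = (0 :: int)"
begin

definition iota :: "(nat \<Rightarrow> int) \<Rightarrow> real ^ 'n" where
  "iota a = (\<Sum>i<k. of_int (a i) *\<^sub>R \<gamma> i)"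

abbreviation rep :: "real ^ 'n \<Rightarrow> real ^ 'n" where
  "rep \<equiv> residue \<Lambda> P0"

text \<open>The torus without a quotient type: the points are those of the full space, the
  measurable sets are the \<open>\<Lambda>\<close>-periodic Borel sets (\<open>sets_torus\<close>),
  and their measure is the volume of the part in \<open>P0\<close>. Functions on the torus are
  periodic functions.\<close>

definition torus :: "(real ^ 'n) measure" where
  "torus = distr (restrict_space lborel P0) (vimage_algebra UNIV rep borel) (\<lambda>x. x)"

lemma iota_add: "iota (a + b) = iota a + iota b"
  by (simp add: iota_def scaleR_add_left sum.distrib)

lemma iota_0: "iota 0 = 0"
  by (simp add: iota_def)

lemma iota_uminus: "iota (- a) = - iota a"
  by (simp add: iota_def sum_negf)

lemmas \<Lambda>_subgroup = subgroup_vecD[OF is_lattice_subgroup[OF \<Lambda>]]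

lemma rep: "rep x \<in> P0" "x - rep x \<in> \<Lambda>"
  by (rule residue[OF P0])+

lemma rep_add: "l \<in> \<Lambda> \<Longrightarrow> rep (x + l) = rep x"
  by (rule residue_add[OF P0 is_lattice_subgroup[OF \<Lambda>]])

lemma P0_borel: "P0 \<in> sets borel" "bounded P0"
  using P0 by (auto simp: fundamental_domain_def)

lemma space_torus: "space torus = UNIV"
  by (simp add: torus_def)

lemma sets_torus: "A \<in> sets torus \<longleftrightarrow> A \<in> sets borel \<and> (\<forall>x. \<forall>l\<in>\<Lambda>. x + l \<in> A \<longleftrightarrow> x \<in> A)"
proof -
  have "sets torus = {rep -` B \<inter> UNIV | B. B \<in> sets borel}"
    unfolding torus_def sets_distr by (rule sets_vimage_algebra2) simp
  moreover have "rep -` B \<in> sets borel" if "B \<in> sets borel" for B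
    using measurable_sets_borel[OF residue_borel[OF \<Lambda> P0] that] .
  moreover have "A = rep -` A" if "\<forall>x. \<forall>l\<in>\<Lambda>. x + l \<in> A \<longleftrightarrow> x \<in> A"
  proof (rule set_eqI)
    fix x
    show "x \<in> A \<longleftrightarrow> x \<in> rep -` A" using that[rule_format, OF rep(2)[of x], of "rep x"] by simp
  qed
  ultimately show ?thesis by (auto simp: rep_add)
qed

lemma torus_id: "(\<lambda>x. x) \<in> measurable (restrict_space lborel P0) (vimage_algebra UNIV rep borel)"
proof (rule measurableI)
  fix A assume "A \<in> sets (vimage_algebra UNIV rep borel)"
  then have "A \<in> sets torus" by (simp add: torus_def)
  then have "A \<in> sets borel" by (simp add: sets_torus)
  then show "(\<lambda>x. x) -` A \<inter> space (restrict_space lborel P0) \<in> sets (restrict_space lborel P0)"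
    using P0_borel by (simp add: space_restrict_space sets_restrict_space_iff)
qed simp

lemma emeasure_torus:
  assumes "A \<in> sets torus" shows "emeasure torus A = emeasure lborel (A \<inter> P0)"
proof -
  have "emeasure torus A = emeasure (restrict_space lborel P0) ((\<lambda>x. x) -` A \<inter> space (restrict_space lborel P0))"
    unfolding torus_def by (rule emeasure_distr[OF torus_id]) (use assms in \<open>simp add: torus_def\<close>)
  also have "(\<lambda>x. x) -` A \<inter> space (restrict_space lborel P0) = A \<inter> P0" by (simp add: space_restrict_space)
  also have "emeasure (restrict_space lborel P0) (A \<inter> P0) = emeasure lborel (A \<inter> P0)"
    using P0_borel by (intro emeasure_restrict_space) auto
  finally show ?thesis .
qed

lemma measure_torus:
  assumes "A \<in> sets torus" shows "measure torus A = measure lebesgue (A \<inter> P0)"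
proof -
  have "A \<inter> P0 \<in> sets lborel" using assms P0_borel by (simp add: sets_torus sets.Int)
  then have "measure lebesgue (A \<inter> P0) = measure lborel (A \<inter> P0)" by (rule measure_completion)
  then show ?thesis using emeasure_torus[OF assms] by (simp add: measure_def)
qed

lemma torus_translate: "A \<in> sets torus \<Longrightarrow> {x. x + c \<in> A} \<in> sets torus"
proof -
  assume A: "A \<in> sets torus"
  then have "{x. x - (- c) \<in> A} \<in> sets borel" by (intro borel_translate) (simp add: sets_torus)
  moreover have "x + l + c \<in> A \<longleftrightarrow> x + c \<in> A" if "l \<in> \<Lambda>" for x l
  proof -
    have "x + c + l \<in> A \<longleftrightarrow> x + c \<in> A" using A that by (simp add: sets_torus)
    then show ?thesis by (simp add: add_ac)
  qed
  ultimately show ?thesis by (simp add: sets_torus)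
qed

lemma translate_domain: "fundamental_domain \<Lambda> {x. x - c \<in> P0}"
  unfolding fundamental_domain_def
proof (intro conjI allI)
  show "{x. x - c \<in> P0} \<in> sets borel" by (rule borel_translate[OF P0_borel(1)])
  have "{x. x - c \<in> P0} \<subseteq> (+) c ` P0"
  proof
    fix x assume "x \<in> {x. x - c \<in> P0}"
    then show "x \<in> (+) c ` P0" by (intro image_eqI[of _ _ "x - c"]) simp_all
  qed
  then show "bounded {x. x - c \<in> P0}" by (rule bounded_subset[OF bounded_translation[OF P0_borel(2)]])
  fix x
  have "\<exists>!l. l \<in> \<Lambda> \<and> x - c - l \<in> P0" using P0 by (simp add: fundamental_domain_def)
  moreover have "x - c - l = x - l - c" for l by simp
  ultimately show "\<exists>!l. l \<in> \<Lambda> \<and> x - l \<in> {x. x - c \<in> P0}" by (simp only: mem_Collect_eq)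
qed

text \<open>Translating the set amounts to translating \<open>P0\<close>, which is again a
  fundamental domain of \<open>\<Lambda>\<close>; \<open>tile_swap\<close> compares the two.\<close>

lemma torus_translate_measure:
  assumes A: "A \<in> sets torus" shows "measure torus {x. x + c \<in> A} = measure torus A"
proof -
  have "A \<inter> {x. x - c \<in> P0} = (+) c ` ({x. x + c \<in> A} \<inter> P0)"
  proof (intro set_eqI iffI)
    fix x assume "x \<in> A \<inter> {x. x - c \<in> P0}"
    then show "x \<in> (+) c ` ({x. x + c \<in> A} \<inter> P0)" by (intro image_eqI[of _ _ "x - c"]) simp_all
  qed (auto simp: add.commute)
  then have "measure lebesgue ({x. x + c \<in> A} \<inter> P0) = measure lebesgue (A \<inter> {x. x - c \<in> P0})"
    by (simp only: measure_translation)
  also have "\<dots> = measure lebesgue (A \<inter> P0)"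
    by (rule tile_swap[OF \<Lambda> translate_domain P0]) (use A in \<open>simp_all add: sets_torus\<close>)
  finally show ?thesis using A torus_translate[OF A, of c] by (simp add: measure_torus)
qed

text \<open>The finitely many nonzero displacements \<open>iota a\<close> miss the closed set
  \<open>\<Lambda>\<close> by some \<open>\<delta>\<close>, so periodic families of balls of radius
  \<open>\<delta> / 2\<close> are separated. Countably many of them cover the space, and a greedy
  exhaustion makes a maximal separated set from them.\<close>

lemma torus_marker:
  assumes N: "1 \<le> N"
  shows "\<exists>U\<in>sets torus. (\<forall>x\<in>U. \<forall>a\<in>cube k (1 - N) N. x + iota a \<in> U \<longrightarrow> a = 0) \<and>
           (\<forall>x. \<exists>a\<in>cube k (1 - N) N. x + iota a \<in> U)"
proof -
  let ?C = "cube k (1 - N) N"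
  have C0: "0 \<in> ?C" using N by (simp add: cube_def)
  have Cneg: "- a \<in> ?C" if "a \<in> ?C" for a using that by (auto simp: cube_def)
  have "compact (iota ` (?C - {0}))" by (intro finite_imp_compact finite_imageI finite_Diff finite_cube)
  moreover have "closed \<Lambda>" by (intro uniform_discrete_imp_closed is_lattice_uniform_discrete \<Lambda>)
  moreover have "iota ` (?C - {0}) \<inter> \<Lambda> = {}"
  proof -
    have "iota a \<notin> \<Lambda>" if a: "a \<in> ?C" "a \<noteq> 0" for a
    proof
      assume "iota a \<in> \<Lambda>"
      then have "a i = 0" if "i < k" for i using indep[of a i] that by (simp add: iota_def)
      moreover have "a i = 0" if "i \<ge> k" for i using in_cubeD(2)[OF a(1) that] .
      ultimately have "a i = 0" for i by (cases "i < k") simp_all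
      then show False using a(2) by (simp add: fun_eq_iff)
    qed
    then show ?thesis by auto
  qed
  ultimately have "\<exists>\<delta>>0. \<forall>x\<in>iota ` (?C - {0}). \<forall>y\<in>\<Lambda>. \<delta> \<le> dist x y" by (rule separate_compact_closed)
  then obtain \<delta> where \<delta>: "\<delta> > 0" and sep0: "\<forall>x\<in>iota ` (?C - {0}). \<forall>y\<in>\<Lambda>. \<delta> \<le> dist x y"
    by (elim exE conjE)
  have sep: "a = 0" if "a \<in> ?C" "l \<in> \<Lambda>" "norm (iota a - l) < \<delta>" for a l
  proof (rule ccontr)
    assume "a \<noteq> 0"
    then have "iota a \<in> iota ` (?C - {0})" using that(1) by (intro imageI) simp
    then have "\<delta> \<le> dist (iota a) l" by (rule sep0[rule_format, OF _ that(2)])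
    then show False using that(3) by (simp add: dist_norm)
  qed
  obtain D :: "(real ^ 'n) set" where D: "countable D" "\<And>X. open X \<Longrightarrow> X \<noteq> {} \<Longrightarrow> \<exists>d\<in>D. d \<in> X"
    by (rule countable_dense_setE) blast
  define c where "c = from_nat_into D"
  define W where "W j = {x. \<exists>l\<in>\<Lambda>. norm (x - c j - l) < \<delta> / 2}" for j
  have W_sets: "W j \<in> sets torus" for j
    unfolding sets_torus
  proof (intro conjI allI ballI)
    have "W j = (\<Union>l\<in>\<Lambda>. ball (c j + l) (\<delta> / 2))"
      by (auto simp: W_def dist_norm norm_minus_commute diff_diff_eq)
    then show "W j \<in> sets borel" by (simp add: borel_open open_UN)
    fix x l assume l: "l \<in> \<Lambda>"
    have "x + l \<in> W j" if "x \<in> W j" "l \<in> \<Lambda>" for x l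
    proof -
      obtain l' where "l' \<in> \<Lambda>" "norm (x - c j - l') < \<delta> / 2" using \<open>x \<in> W j\<close> by (auto simp: W_def)
      then have l': "norm (x - c j - l') < \<delta> / 2" "l' + l \<in> \<Lambda>" using \<Lambda>_subgroup(2)[OF _ that(2), of l'] by simp_all
      have e: "x + l - c j - (l' + l) = x - c j - l'" by simp
      have "norm (x + l - c j - (l' + l)) < \<delta> / 2" unfolding e by (rule l'(1))
      with l'(2) show ?thesis unfolding W_def by (intro CollectI bexI[of _ "l' + l"])
    qed
    from this[of x l] this[of "x + l" "- l"] show "x + l \<in> W j \<longleftrightarrow> x \<in> W j" using l \<Lambda>_subgroup(3)[OF l] by auto
  qed
  have W_sep: "a = 0" if x: "x \<in> W j" "x + iota a \<in> W j" and a: "a \<in> ?C" for x a j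
  proof -
    obtain l l' where l: "l \<in> \<Lambda>" "norm (x - c j - l) < \<delta> / 2" "l' \<in> \<Lambda>" "norm (x + iota a - c j - l') < \<delta> / 2"
      using x by (auto simp: W_def)
    have "norm (iota a - (l' - l)) = norm ((x + iota a - c j - l') - (x - c j - l))" by (simp add: algebra_simps)
    also have "\<dots> < \<delta>" using norm_triangle_ineq4[of "x + iota a - c j - l'" "x - c j - l"] l by linarith
    finally show ?thesis by (rule sep[OF a \<Lambda>_subgroup(4)[OF l(3,1)]])
  qed
  have W_cover: "\<exists>j. x \<in> W j" for x
  proof -
    obtain d where d: "d \<in> D" "d \<in> ball x (\<delta> / 2)" using D(2)[of "ball x (\<delta> / 2)"] \<delta> by auto
    then obtain j where j: "c j = d" using from_nat_into_surj[OF D(1)] unfolding c_def by metis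
    have "norm (x - c j - 0) < \<delta> / 2" using d(2) j by (simp add: dist_norm)
    then show ?thesis unfolding W_def using \<Lambda>_subgroup(1) by blast
  qed
  \<comment> \<open>At stage \<open>j\<close> all points of \<open>W j\<close> that are not near an
    accepted point are accepted. They do not conflict with each other, since \<open>W j\<close> is
    itself separated.\<close>
  define Acc where "Acc = rec_nat {} (\<lambda>j A. A \<union> (W j - (\<Union>a\<in>?C. {x. x + iota a \<in> A})))"
  define B where "B j = (\<Union>a\<in>?C. {x. x + iota a \<in> Acc j})" for j
  have Acc_0: "Acc 0 = {}" and Acc_Suc: "Acc (Suc j) = Acc j \<union> (W j - B j)" for j
    by (simp_all add: Acc_def B_def)
  have B_I: "x \<in> B j" if "a \<in> ?C" "x + iota a \<in> Acc j" for x a j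
    unfolding B_def by (intro UN_I[OF that(1)] CollectI that(2))
  have Acc_sets: "Acc j \<in> sets torus" for j
  proof (induction j)
    case (Suc j)
    show ?case unfolding Acc_Suc B_def
      by (intro sets.Un sets.Diff sets.finite_UN finite_cube W_sets torus_translate Suc)
  qed (simp add: Acc_0)
  have Acc_mono: "Acc i \<subseteq> Acc j" if "i \<le> j" for i j
    using that by (rule lift_Suc_mono_le[rotated]) (simp add: Acc_Suc)
  have Acc_sep: "\<forall>x a. x \<in> Acc j \<longrightarrow> a \<in> ?C \<longrightarrow> x + iota a \<in> Acc j \<longrightarrow> a = 0" for j
  proof (induction j)
    case (Suc j)
    show ?case
    proof (intro allI impI)
      fix x a assume x: "x \<in> Acc (Suc j)" and a: "a \<in> ?C" and xa: "x + iota a \<in> Acc (Suc j)"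
      show "a = 0"
      proof (cases "x \<in> Acc j"; cases "x + iota a \<in> Acc j")
        assume "x \<in> Acc j" "x + iota a \<in> Acc j"
        then show ?thesis using a by (intro Suc[rule_format])
      next
        assume y: "x \<in> Acc j" "x + iota a \<notin> Acc j"
        then have "x + iota a \<notin> B j" using xa unfolding Acc_Suc by simp
        moreover have "x + iota a + iota (- a) \<in> Acc j" using y(1) by (simp add: iota_uminus)
        ultimately show ?thesis using B_I[OF Cneg[OF a]] by (simp only: simp_thms)
      next
        assume y: "x \<notin> Acc j" "x + iota a \<in> Acc j"
        then have "x \<notin> B j" using x unfolding Acc_Suc by simp
        then show ?thesis using B_I[OF a y(2)] by (simp only: simp_thms)
      next
        assume "x \<notin> Acc j" "x + iota a \<notin> Acc j"
        then have "x \<in> W j" "x + iota a \<in> W j" using x xa unfolding Acc_Suc by simp_all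
        then show ?thesis using a by (rule W_sep)
      qed
    qed
  qed (simp add: Acc_0)
  show ?thesis
  proof (intro bexI[of _ "\<Union>j. Acc j"] conjI ballI allI impI)
    show "(\<Union>j. Acc j) \<in> sets torus" using Acc_sets by (intro sets.countable_UN) auto
    fix x a assume "x \<in> (\<Union>j. Acc j)" and a: "a \<in> ?C" and "x + iota a \<in> (\<Union>j. Acc j)"
    then obtain i j where ij: "x \<in> Acc i" "x + iota a \<in> Acc j" by (elim UN_E)
    have "x \<in> Acc (max i j)" by (rule subsetD[OF Acc_mono ij(1)]) simp
    moreover have "x + iota a \<in> Acc (max i j)" by (rule subsetD[OF Acc_mono ij(2)]) simp
    ultimately show "a = 0" using a by (intro Acc_sep[rule_format])
  next
    fix x
    obtain j where j: "x \<in> W j" using W_cover[of x] by (elim exE)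
    show "\<exists>a\<in>?C. x + iota a \<in> (\<Union>j. Acc j)"
    proof (cases "x \<in> B j")
      case True
      then obtain a where "a \<in> ?C" "x + iota a \<in> Acc j" unfolding B_def by (elim UN_E CollectE)
      then show ?thesis by (intro bexI[of _ a] UN_I[of j] UNIV_I)
    next
      case False
      then have "x + iota 0 \<in> Acc (Suc j)" using j unfolding Acc_Suc iota_0 by simp
      then show ?thesis by (intro bexI[OF _ C0] UN_I[of "Suc j"] UNIV_I)
    qed
  qed
qed

sublocale zm_action torus "\<lambda>a x. x + iota a" k
proof (intro zm_action.intro zm_action_axioms.intro finite_measureI)
  have "UNIV \<in> sets torus" by (simp add: sets_torus)
  then have "emeasure torus (space torus) = emeasure lborel P0" by (simp add: space_torus emeasure_torus)
  then show "emeasure torus (space torus) \<noteq> \<infinity>"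
    using emeasure_bounded_finite[OF P0_borel(2)] by simp
  show "space torus = UNIV" by (rule space_torus)
  show "x + iota 0 = x" for x by (simp add: iota_0)
  show "x + iota (a + b) = x + iota b + iota a" for x a b by (simp add: iota_add add_ac)
  show "(\<lambda>x. x + iota a) \<in> measurable torus torus" for a
    by (rule measurableI) (simp_all add: space_torus vimage_def torus_translate)
  show "measure torus ((\<lambda>x. x + iota a) -` A) = measure torus A" if "A \<in> sets torus" for A a
    using torus_translate_measure[OF that] by (simp add: vimage_def)
qed (rule torus_marker)

text \<open>The exceptional set is saturated under the countable group \<open>G\<close>, so that
  statements off \<open>Z\<close> can be used along whole orbits. Every
  \<open>\<Lambda>\<close>-translate of its part in \<open>P0\<close> is null, hence so is the
  periodic set.\<close>

lemma torus_null:
  assumes ae: "AE x in torus. Q x" and G: "countable G" "subgroup_vec G"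
  shows "\<exists>Z\<in>null_sets lebesgue. \<forall>x. x \<notin> Z \<longrightarrow> Q x \<and> (\<forall>g\<in>G. x + g \<notin> Z)"
proof -
  obtain B where B: "{x\<in>space torus. \<not> Q x} \<subseteq> B" "emeasure torus B = 0" "B \<in> sets torus" using ae by (rule AE_E)
  have "B \<inter> P0 \<in> null_sets lborel"
    using B P0_borel by (intro null_setsI) (simp_all add: emeasure_torus sets_torus sets.Int)
  then have n1: "(\<Union>l\<in>\<Lambda>. {x. x - l \<in> B \<inter> P0}) \<in> null_sets lborel"
    by (intro null_sets_UN' is_lattice_countable[OF \<Lambda>] null_sets_translation)
  have sub: "B \<subseteq> (\<Union>l\<in>\<Lambda>. {x. x - l \<in> B \<inter> P0})"
  proof
    fix x assume x: "x \<in> B"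
    have "rep x + (x - rep x) \<in> B \<longleftrightarrow> rep x \<in> B" using B(3) rep(2)[of x] unfolding sets_torus by blast
    then show "x \<in> (\<Union>l\<in>\<Lambda>. {x. x - l \<in> B \<inter> P0})" using x rep[of x] by (intro UN_I[of "x - rep x"]) simp_all
  qed
  have "B \<in> sets lborel" using B(3) unfolding sets_torus sets_lborel by (rule conjunct1)
  then have "B \<in> null_sets lborel" by (rule null_sets_subset[OF n1 _ sub])
  then have "(\<Union>g\<in>G. {x. x - g \<in> B}) \<in> null_sets lborel"
    by (intro null_sets_UN' G null_sets_translation)
  then have Z: "(\<Union>g\<in>G. {x. x - g \<in> B}) \<in> null_sets lebesgue" by (rule null_sets_completionI)
  show ?thesis
  proof (rule bexI[OF _ Z], intro allI impI conjI ballI)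
    fix x assume x: "x \<notin> (\<Union>g\<in>G. {x. x - g \<in> B})"
    have "x \<notin> B" using x subgroup_vecD(1)[OF G(2)] by force
    then show "Q x" using B(1) by (auto simp: space_torus)
    fix g assume g: "g \<in> G"
    show "x + g \<notin> (\<Union>g\<in>G. {x. x - g \<in> B})"
    proof
      assume "x + g \<in> (\<Union>g\<in>G. {x. x - g \<in> B})"
      then obtain h where h: "h \<in> G" "x + g - h \<in> B" by blast
      have "x - (h - g) \<in> B" using h(2) by (simp add: algebra_simps)
      then show False using x subgroup_vecD(4)[OF G(2) h(1) g] by blast
    qed
  qed
qed

lemma torus_measurable:
  assumes "h \<in> measurable borel N" and "\<And>x l. l \<in> \<Lambda> \<Longrightarrow> h (x + l) = h x"
  shows "h \<in> measurable torus N"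
proof (rule measurableI)
  fix x show "h x \<in> space N" using measurable_space[OF assms(1)] by simp
next
  fix A assume "A \<in> sets N"
  then have "h -` A \<in> sets borel" using measurable_sets[OF assms(1)] by simp
  then show "h -` A \<inter> space torus \<in> sets torus" by (simp add: sets_torus space_torus assms(2))
qed

lemma torus_measurable_borel:
  assumes "h \<in> measurable torus N" shows "h \<in> measurable borel N"
proof (rule measurableI)
  fix x show "h x \<in> space N" using measurable_space[OF assms] by (simp add: space_torus)
next
  fix A assume "A \<in> sets N"
  from measurable_sets[OF assms this] show "h -` A \<inter> space borel \<in> sets borel" by (simp add: sets_torus space_torus)
qed

lemma torus_measurable_invariant:
  assumes "h \<in> measurable torus (count_space UNIV)" "l \<in> \<Lambda>" shows "h (x + l) = h x"
proof -
  have "h -` {h x} \<inter> space torus \<in> sets torus" by (rule measurable_sets[OF assms(1)]) simp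
  then have "h -` {h x} \<in> sets torus" by (simp add: space_torus)
  then have "x + l \<in> h -` {h x} \<longleftrightarrow> x \<in> h -` {h x}" using assms(2) unfolding sets_torus by blast
  then show ?thesis by simp
qed

end

section \<open>Fractional matchings\<close>

lemma measure_section_borel:
  fixes A B :: "(real ^ 'n) set"
  assumes A: "A \<in> sets borel" and B: "B \<in> sets borel"
  shows "(\<lambda>z. measure lebesgue {w\<in>A. w - z \<in> B}) \<in> borel_measurable borel"
proof -
  let ?Q = "{p :: (real ^ 'n) \<times> (real ^ 'n). snd p \<in> A} \<inter> {p. snd p - fst p \<in> B}"
  have prod: "sets (borel \<Otimes>\<^sub>M (lborel :: (real ^ 'n) measure)) = sets (borel :: ((real ^ 'n) \<times> (real ^ 'n)) measure)"
    by (simp add: borel_prod[symmetric] cong: sets_pair_measure_cong)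
  have "(snd :: (real ^ 'n) \<times> (real ^ 'n) \<Rightarrow> _) \<in> borel_measurable borel"
    "(\<lambda>p :: (real ^ 'n) \<times> (real ^ 'n). snd p - fst p) \<in> borel_measurable borel"
    by (intro borel_measurable_continuous_onI continuous_intros)+
  from measurable_sets_borel[OF this(1) A] measurable_sets_borel[OF this(2) B]
  have "?Q \<in> sets (borel \<Otimes>\<^sub>M (lborel :: (real ^ 'n) measure))" unfolding prod
    by (intro sets.Int) (simp_all add: vimage_def)
  from lborel.measurable_emeasure_Pair[OF this]
  have "(\<lambda>z. enn2real (emeasure lborel (Pair z -` ?Q))) \<in> borel_measurable borel" by simp
  moreover have "enn2real (emeasure lborel (Pair z -` ?Q)) = measure lebesgue {w\<in>A. w - z \<in> B}" for z
  proof -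
    have "Pair z -` ?Q = A \<inter> {w. w - z \<in> B}" by auto
    moreover have "A \<inter> {w. w - z \<in> B} \<in> sets lborel" using borel_translate[OF B] A by (simp add: sets.Int)
    moreover have "{w\<in>A. w - z \<in> B} = A \<inter> {w. w - z \<in> B}" by auto
    ultimately show ?thesis by (simp add: measure_def[symmetric] measure_completion)
  qed
  ultimately show ?thesis by simp
qed

lemma sum_indicator_unique:
  assumes "finite F" "\<exists>!l. l \<in> L \<and> P l" "F \<subseteq> L" "\<And>l. l \<in> L \<Longrightarrow> P l \<Longrightarrow> l \<in> F"
  shows "(\<Sum>l\<in>F. of_bool (P l)) = (1 :: real)"
proof -
  obtain l where l: "l \<in> L" "P l" and u: "\<And>l'. l' \<in> L \<Longrightarrow> P l' \<Longrightarrow> l' = l" using assms(2) by (elim ex1E conjE) blast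
  have "(\<Sum>l'\<in>F. of_bool (P l')) = (\<Sum>l'\<in>F. if l' = l then 1 else (0 :: real))"
  proof (rule sum.cong[OF refl])
    fix l' assume "l' \<in> F"
    then have "P l' \<longleftrightarrow> l' = l" using u[of l'] l assms(3) by blast
    then show "of_bool (P l') = (if l' = l then 1 else (0 :: real))" by simp
  qed
  then show ?thesis using assms(1) assms(4)[OF l] by simp
qed

text \<open>The mass at \<open>y\<close> is sent to \<open>y + l + m\<close> in proportion to the volume of \<open>DL \<inter> (DM + y + l)\<close>, where \<open>m\<close>
  brings \<open>y + l\<close> back into \<open>DM\<close>. Equality of the volumes makes both marginals uniform.\<close>

theorem lattice_transport:
  fixes L M DL DM :: "(real ^ 'n) set"
  assumes L: "is_lattice L" and M: "is_lattice M" and DL: "fundamental_domain L DL" and DM: "fundamental_domain M DM"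
    and vol: "measure lebesgue DL = measure lebesgue DM" and \<rho>: "\<rho> > 0" and ball: "ball 0 (2 * \<rho>) \<subseteq> DL \<inter> DM"
  obtains T :: "((real ^ 'n) \<times> (real ^ 'n)) set" and c :: "(real ^ 'n) \<times> (real ^ 'n) \<Rightarrow> real ^ 'n \<Rightarrow> real" and \<kappa> :: real
  where "finite T" "T \<subseteq> L \<times> M" "0 \<in> T" "\<kappa> > 0" "\<And>t. c t \<in> borel_measurable borel" "\<And>t y. c t y \<ge> 0"
    "\<And>t y. c t y \<noteq> 0 \<Longrightarrow> y \<in> DL"
    "\<And>y. (\<Sum>t\<in>T. c t y) = indicat_real DL y" "\<And>z. (\<Sum>t\<in>T. c t (z - (fst t + snd t))) = indicat_real DM z"
    "\<And>y. norm y < \<rho> \<Longrightarrow> c 0 y \<ge> \<kappa>"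
proof -
  note sL = subgroup_vecD[OF is_lattice_subgroup[OF L]] and sM = subgroup_vecD[OF is_lattice_subgroup[OF M]]
  have DLb: "DL \<in> sets borel" "bounded DL" and DMb: "DM \<in> sets borel" "bounded DM"
    using DL DM by (auto simp: fundamental_domain_def)
  have unL: "\<exists>!l. l \<in> L \<and> x - l \<in> DL" and unM: "\<exists>!l. l \<in> M \<and> x - l \<in> DM" for x
    using DL DM by (auto simp: fundamental_domain_def)
  let ?\<mu> = "measure lebesgue :: (real ^ 'n) set \<Rightarrow> real"
  define V where "V = ?\<mu> DL"
  \<comment> \<open>The share of the volume of \<open>DL\<close> that lies in the translate of
    \<open>DM\<close> by \<open>z\<close>. It vanishes outside the bounded difference set
    \<open>Zs\<close>, which is why finitely many lattice vectors suffice below.\<close>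
  define \<phi> where "\<phi> z = ?\<mu> {w\<in>DL. w - z \<in> DM} / V" for z
  define Zs where "Zs = {w - v | w v. w \<in> DL \<and> v \<in> DM}"
  define FL where "FL = {l\<in>L. \<exists>x\<in>Zs. x - l \<in> DL}"
  define FM where "FM = {m\<in>M. \<exists>x\<in>DM. x - m \<in> Zs}"
  have Zs: "bounded Zs"
  proof -
    obtain a b where a: "\<And>x. x \<in> DL \<Longrightarrow> norm x \<le> a" and b: "\<And>x. x \<in> DM \<Longrightarrow> norm x \<le> b"
      using DLb(2) DMb(2) unfolding bounded_iff by auto
    have "norm x \<le> a + b" if x: "x \<in> Zs" for x
    proof -
      obtain w v where "x = w - v" "w \<in> DL" "v \<in> DM" using x by (auto simp: Zs_def)
      then show ?thesis using a[of w] b[of v] norm_triangle_ineq4[of w v] by simp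
    qed
    then show ?thesis unfolding bounded_iff by blast
  qed
  have FL: "finite FL" "FL \<subseteq> L" unfolding FL_def using finite_tiles_meeting[OF L DLb(2) Zs] by auto
  have FM: "finite FM" "FM \<subseteq> M" unfolding FM_def using finite_tiles_meeting[OF M Zs DMb(2)] by auto
  have lm: "{w\<in>DL. w - z \<in> DM} \<in> lmeasurable" for z
  proof (rule bounded_set_imp_lmeasurable)
    show "bounded {w\<in>DL. w - z \<in> DM}" by (rule bounded_subset[OF DLb(2)]) auto
    have "{w\<in>DL. w - z \<in> DM} = DL \<inter> {w. w - z \<in> DM}" by auto
    then have "{w\<in>DL. w - z \<in> DM} \<in> sets borel" using borel_translate[OF DMb(1), of z] DLb(1) by (simp add: sets.Int)
    then show "{w\<in>DL. w - z \<in> DM} \<in> sets lebesgue" by (simp add: sets_completionI_sets)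
  qed
  have b_pos: "?\<mu> (ball 0 \<rho>) > 0" using content_ball_pos[OF \<rho>] by (simp add: measure_completion)
  have V: "V > 0"
  proof -
    have "ball 0 \<rho> \<subseteq> DL" using ball \<rho> by (auto simp: subset_eq)
    then have "?\<mu> (ball 0 \<rho>) \<le> V" unfolding V_def
      using fundamental_domain_lmeasurable[OF DL] by (intro measure_mono_fmeasurable) auto
    then show ?thesis using b_pos by linarith
  qed
  have \<phi>_Zs: "z \<in> Zs" if nz: "\<phi> z \<noteq> 0" for z
  proof -
    have "{w\<in>DL. w - z \<in> DM} \<noteq> {}"
    proof
      assume "{w\<in>DL. w - z \<in> DM} = {}"
      then have "\<phi> z = 0" unfolding \<phi>_def by (simp only: measure_empty div_0)
      then show False using nz by simp
    qed
    then obtain w where "w \<in> DL" "w - z \<in> DM" by blast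
    then show ?thesis unfolding Zs_def by (intro CollectI exI[of _ w] exI[of _ "w - z"]) simp
  qed
  have \<phi>_nonneg: "\<phi> z \<ge> 0" for z using V by (simp add: \<phi>_def)
  have \<phi>_borel: "\<phi> \<in> borel_measurable borel"
    unfolding \<phi>_def[abs_def] using measure_section_borel[OF DLb(1) DMb(1)] by simp
  \<comment> \<open>The translates of \<open>DL\<close> cut \<open>y + DM\<close> into pieces of
    total volume equal to that of \<open>DM\<close>. The assumption \<open>vol\<close> enters here:
    division by the volume of \<open>DL\<close> gives exactly 1.\<close>
  have sumL: "(\<Sum>l\<in>FL. \<phi> (y + l)) = 1" if y: "y \<in> DL" for y
  proof -
    let ?K = "(+) y ` DM"
    have K: "?K \<in> lmeasurable" using fundamental_domain_lmeasurable[OF DM] by (rule measurable_translation)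
    have Kx: "x \<in> ?K \<longleftrightarrow> x - y \<in> DM" for x
    proof
      assume "x - y \<in> DM"
      then show "x \<in> ?K" by (intro image_eqI[of _ _ "x - y"]) simp_all
    qed auto
    have "?\<mu> ?K = (\<Sum>l\<in>uminus ` FL. ?\<mu> {x\<in>?K. x - l \<in> DL})"
    proof (rule tile_sum[OF DL K])
      show "finite (uminus ` FL)" using FL by simp
      show "uminus ` FL \<subseteq> L" using FL sL(3) by auto
      fix x l assume x: "x \<in> ?K" "l \<in> L" "x - l \<in> DL"
      have "y - l = (x - l) - (x - y)" by simp
      then have "y - l \<in> Zs" using x Kx unfolding Zs_def by (intro CollectI exI[of _ "x - l"] exI[of _ "x - y"]) simp
      then have "- l \<in> FL" using x(2) y sL(3) unfolding FL_def by (intro CollectI conjI bexI[of _ "y - l"]) simp_all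
      then show "l \<in> uminus ` FL" by (intro image_eqI[of _ _ "- l"]) simp_all
    qed
    also have "\<dots> = (\<Sum>l\<in>FL. ?\<mu> {x\<in>?K. x + l \<in> DL})" by (subst sum.reindex) simp_all
    also have "\<dots> = (\<Sum>l\<in>FL. ?\<mu> {w\<in>DL. w - (y + l) \<in> DM})"
    proof (rule sum.cong[OF refl])
      fix l
      have "{w\<in>DL. w - (y + l) \<in> DM} = (+) l ` {x\<in>?K. x + l \<in> DL}"
      proof (intro set_eqI iffI)
        fix w assume w: "w \<in> {w\<in>DL. w - (y + l) \<in> DM}"
        have e: "w - l - y = w - (y + l)" by simp
        have "w - l \<in> ?K" unfolding Kx e using w by blast
        moreover have "w - l + l \<in> DL" using w by simp
        ultimately have "w - l \<in> {x\<in>?K. x + l \<in> DL}" by (intro CollectI conjI)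
        then show "w \<in> (+) l ` {x\<in>?K. x + l \<in> DL}" by (rule image_eqI[rotated]) simp
      next
        fix w assume "w \<in> (+) l ` {x\<in>?K. x + l \<in> DL}"
        then obtain x where x: "w = l + x" "x \<in> ?K" "x + l \<in> DL" by auto
        have "l + x - (y + l) = x - y" by simp
        then show "w \<in> {w\<in>DL. w - (y + l) \<in> DM}" using x by (simp only: Kx add.commute[of x l] mem_Collect_eq simp_thms)
      qed
      then show "?\<mu> {x\<in>?K. x + l \<in> DL} = ?\<mu> {w\<in>DL. w - (y + l) \<in> DM}" by (simp only: measure_translation)
    qed
    also have "\<dots> = V * (\<Sum>l\<in>FL. \<phi> (y + l))" using V by (simp add: \<phi>_def sum_distrib_left)
    finally have "V = V * (\<Sum>l\<in>FL. \<phi> (y + l))" using vol by (simp add: measure_translation V_def)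
    then show ?thesis using V by simp
  qed
  \<comment> \<open>Here the translates of \<open>DM\<close> cut a translate of \<open>DL\<close>,
    whose volume is \<open>V\<close> by definition.\<close>
  have sumM: "(\<Sum>m\<in>FM. \<phi> (z - m)) = 1" if z: "z \<in> DM" for z
  proof -
    let ?K = "(+) (- z) ` DL"
    have K: "?K \<in> lmeasurable" using fundamental_domain_lmeasurable[OF DL] by (rule measurable_translation)
    have Kx: "x \<in> ?K \<longleftrightarrow> x + z \<in> DL" for x
    proof
      assume "x + z \<in> DL"
      then show "x \<in> ?K" by (intro image_eqI[of _ _ "x + z"]) simp_all
    qed auto
    have "?\<mu> ?K = (\<Sum>m\<in>uminus ` FM. ?\<mu> {x\<in>?K. x - m \<in> DM})"
    proof (rule tile_sum[OF DM K])
      show "finite (uminus ` FM)" using FM by simp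
      show "uminus ` FM \<subseteq> M" using FM sM(3) by auto
      fix x m assume x: "x \<in> ?K" "m \<in> M" "x - m \<in> DM"
      have "z + m = (x + z) - (x - m)" by simp
      then have "z + m \<in> Zs" using x Kx unfolding Zs_def by (intro CollectI exI[of _ "x + z"] exI[of _ "x - m"]) simp
      then have "- m \<in> FM" using x(2) z sM(3) unfolding FM_def by (intro CollectI conjI bexI[of _ z]) simp_all
      then show "m \<in> uminus ` FM" by (intro image_eqI[of _ _ "- m"]) simp_all
    qed
    also have "\<dots> = (\<Sum>m\<in>FM. ?\<mu> {x\<in>?K. x + m \<in> DM})" by (subst sum.reindex) simp_all
    also have "\<dots> = (\<Sum>m\<in>FM. ?\<mu> {w\<in>DL. w - (z - m) \<in> DM})"
    proof (rule sum.cong[OF refl])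
      fix m
      have "{w\<in>DL. w - (z - m) \<in> DM} = (+) z ` {x\<in>?K. x + m \<in> DM}"
      proof (intro set_eqI iffI)
        fix w assume w: "w \<in> {w\<in>DL. w - (z - m) \<in> DM}"
        have e: "w - z + m = w - (z - m)" by simp
        have "w - z + m \<in> DM" unfolding e using w by blast
        moreover have "w - z \<in> ?K" unfolding Kx using w by simp
        ultimately have "w - z \<in> {x\<in>?K. x + m \<in> DM}" by (intro CollectI conjI)
        then show "w \<in> (+) z ` {x\<in>?K. x + m \<in> DM}" by (rule image_eqI[rotated]) simp
      next
        fix w assume "w \<in> (+) z ` {x\<in>?K. x + m \<in> DM}"
        then obtain x where x: "w = z + x" "x \<in> ?K" "x + m \<in> DM" by auto
        have "z + x - (z - m) = x + m" by simp
        then show "w \<in> {w\<in>DL. w - (z - m) \<in> DM}" using x by (simp only: Kx add.commute[of x z] mem_Collect_eq simp_thms)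
      qed
      then show "?\<mu> {x\<in>?K. x + m \<in> DM} = ?\<mu> {w\<in>DL. w - (z - m) \<in> DM}" by (simp only: measure_translation)
    qed
    also have "\<dots> = V * (\<Sum>m\<in>FM. \<phi> (z - m))" using V by (simp add: \<phi>_def sum_distrib_left)
    finally have "V = V * (\<Sum>m\<in>FM. \<phi> (z - m))" by (simp only: measure_translation V_def)
    then show ?thesis using V by simp
  qed
  \<comment> \<open>The vector \<open>l\<close> is weighted by the overlap, and \<open>m\<close> is
    then forced by the requirement of ending in \<open>DM\<close>.\<close>
  define c where "c t y = of_bool (y \<in> DL) * (\<phi> (y + fst t) * of_bool (y + fst t + snd t \<in> DM))" for t y
  have c_borel: "c t \<in> borel_measurable borel" for t
  proof -
    have "(\<lambda>y. \<phi> (y + fst t)) \<in> borel_measurable borel" by (rule measurable_compose[OF _ \<phi>_borel]) simp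
    moreover have ind: "(\<lambda>y. of_bool (y \<in> B) :: real) \<in> borel_measurable borel" if "B \<in> sets borel" for B :: "(real ^ 'n) set"
      using that unfolding of_bool_def by (intro measurable_If) auto
    moreover have "{y. y + fst t + snd t \<in> DM} \<in> sets borel"
      using measurable_sets_borel[of "\<lambda>y. y + fst t + snd t" borel DM] DMb(1) by (simp add: vimage_def)
    from ind[OF this] have "(\<lambda>y. of_bool (y + fst t + snd t \<in> DM) :: real) \<in> borel_measurable borel" by simp
    ultimately show ?thesis unfolding c_def[abs_def] using DLb(1) by (intro borel_measurable_times)
  qed
  have c_L: "(\<Sum>t\<in>FL \<times> FM. c t y) = indicat_real DL y" for y
  proof (cases "y \<in> DL")
    case True
    have "(\<Sum>t\<in>FL \<times> FM. c t y) = (\<Sum>l\<in>FL. \<Sum>m\<in>FM. \<phi> (y + l) * of_bool (y + l + m \<in> DM))"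
      using True by (simp add: sum.cartesian_product c_def case_prod_beta)
    also have "\<dots> = (\<Sum>l\<in>FL. \<phi> (y + l))"
    proof (rule sum.cong[OF refl])
      fix l
      show "(\<Sum>m\<in>FM. \<phi> (y + l) * of_bool (y + l + m \<in> DM)) = \<phi> (y + l)"
      proof (cases "\<phi> (y + l) = 0")
        case False
        have "(\<Sum>m\<in>FM. of_bool (y + l + m \<in> DM)) = (1 :: real)"
        proof (rule sum_indicator_unique[OF FM(1) _ FM(2)])
          obtain m where m: "m \<in> M" "y + l - m \<in> DM" and u: "\<And>m'. m' \<in> M \<Longrightarrow> y + l - m' \<in> DM \<Longrightarrow> m' = m"
            using unM[of "y + l"] by (elim ex1E conjE) blast
          show "\<exists>!m. m \<in> M \<and> y + l + m \<in> DM"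
          proof (rule ex1I[of _ "- m"])
            show "- m \<in> M \<and> y + l + - m \<in> DM" using m sM(3) by simp
            fix m' assume "m' \<in> M \<and> y + l + m' \<in> DM"
            then have "- m' = m" using sM(3) by (intro u) simp_all
            then show "m' = - m" by auto
          qed
          fix m' assume m': "m' \<in> M" "y + l + m' \<in> DM"
          show "m' \<in> FM" unfolding FM_def using m' \<phi>_Zs[OF False]
            by (intro CollectI conjI bexI[of _ "y + l + m'"]) simp_all
        qed
        then show ?thesis by (simp add: sum_distrib_left[symmetric] del: sum_of_bool_eq of_bool_eq_iff)
      qed simp
    qed
    also have "\<dots> = 1" by (rule sumL[OF True])
    finally show ?thesis using True by simp
  qed (simp add: c_def)
  have c_M: "(\<Sum>t\<in>FL \<times> FM. c t (z - (fst t + snd t))) = indicat_real DM z" for z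
  proof (cases "z \<in> DM")
    case True
    have e: "z - (l + m) + l = z - m" "z - (l + m) + l + m = z" for l m by simp_all
    have "(\<Sum>t\<in>FL \<times> FM. c t (z - (fst t + snd t))) = (\<Sum>l\<in>FL. \<Sum>m\<in>FM. \<phi> (z - m) * of_bool (z - m - l \<in> DL))"
      using True unfolding sum.cartesian_product
      by (intro sum.cong refl) (auto simp: c_def e diff_diff_eq add.commute[of "fst _"] mult.commute split: prod.splits)
    also have "\<dots> = (\<Sum>m\<in>FM. \<Sum>l\<in>FL. \<phi> (z - m) * of_bool (z - m - l \<in> DL))" by (rule sum.swap)
    also have "\<dots> = (\<Sum>m\<in>FM. \<phi> (z - m))"
    proof (rule sum.cong[OF refl])
      fix m
      show "(\<Sum>l\<in>FL. \<phi> (z - m) * of_bool (z - m - l \<in> DL)) = \<phi> (z - m)"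
      proof (cases "\<phi> (z - m) = 0")
        case False
        have "(\<Sum>l\<in>FL. of_bool (z - m - l \<in> DL)) = (1 :: real)"
        proof (rule sum_indicator_unique[OF FL(1) unL FL(2)])
          fix l assume "l \<in> L" "z - m - l \<in> DL"
          then show "l \<in> FL" unfolding FL_def using \<phi>_Zs[OF False] by (intro CollectI conjI bexI[of _ "z - m"])
        qed
        then show ?thesis by (simp add: sum_distrib_left[symmetric] del: sum_of_bool_eq of_bool_eq_iff)
      qed simp
    qed
    also have "\<dots> = 1" by (rule sumM[OF True])
    finally show ?thesis using True by simp
  next
    case False
    have "z - (fst t + snd t) + fst t + snd t = z" for t by simp
    then show ?thesis using False by (simp add: c_def)
  qed
  show thesis
  proof (rule that[of "FL \<times> FM" "?\<mu> (ball 0 \<rho>) / V" c])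
    have 0: "0 \<in> DL" "0 \<in> DM" using ball \<rho> by auto
    then have "0 \<in> Zs" unfolding Zs_def by (intro CollectI exI[of _ 0]) simp
    then show "0 \<in> FL \<times> FM" using 0 sL(1) sM(1) by (auto simp: FL_def FM_def zero_prod_def)
    show "FL \<times> FM \<subseteq> L \<times> M" "finite (FL \<times> FM)" using FL FM by auto
    show "?\<mu> (ball 0 \<rho>) / V > 0" using b_pos V by simp
    show "c t y \<ge> 0" for t y by (simp add: c_def \<phi>_nonneg)
    show "y \<in> DL" if "c t y \<noteq> 0" for t y using that by (auto simp: c_def)
    \<comment> \<open>Radius \<open>2 * \<rho>\<close> leaves room for a translation: for
      \<open>y\<close> shorter than \<open>\<rho>\<close>, the ball of radius \<open>\<rho>\<close>
      lies in \<open>DL\<close> as well as in \<open>DM\<close> translated by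
      \<open>y\<close>.\<close>
    show "?\<mu> (ball 0 \<rho>) / V \<le> c 0 y" if y: "norm y < \<rho>" for y
    proof -
      have yD: "y \<in> DL" "y \<in> DM" using y \<rho> ball by (auto simp: subset_eq)
      have "ball 0 \<rho> \<subseteq> {w\<in>DL. w - y \<in> DM}"
      proof
        fix w :: "real ^ 'n" assume w: "w \<in> ball 0 \<rho>"
        then have "norm (w - y) < 2 * \<rho>" using y norm_triangle_ineq4[of w y] by simp
        then have "w - y \<in> ball 0 (2 * \<rho>)" "w \<in> ball 0 (2 * \<rho>)" using w \<rho> by simp_all
        then show "w \<in> {w\<in>DL. w - y \<in> DM}" using ball by blast
      qed
      then have "?\<mu> (ball 0 \<rho>) \<le> ?\<mu> {w\<in>DL. w - y \<in> DM}" using lm by (intro measure_mono_fmeasurable) auto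
      then show ?thesis using yD V by (simp add: c_def \<phi>_def divide_right_mono)
    qed
  qed (rule c_borel c_L c_M)+
qed

section \<open>Common tiles\<close>

text \<open>Points at spacing \<open>2 * r\<close> on a segment from the origin, with
  \<open>r = \<rho> / (4 * n)\<close>, are approximated within \<open>r\<close> by elements of
  \<open>x + \<Lambda>\<close>. The spacing keeps these distinct, and \<open>n\<close> such points
  take up less than \<open>\<rho>\<close>.\<close>

lemma many_lattice_points:
  fixes \<Lambda> :: "(real ^ 'n) set" and x :: "real ^ 'n"
  assumes n: "n \<ge> 1" and \<rho>: "\<rho> > 0" and fine: "\<forall>x. \<exists>l\<in>\<Lambda>. norm (x - l) < \<rho> / (4 * real n)"
  shows "\<exists>Y. finite Y \<and> Y \<subseteq> \<Lambda> \<and> card Y = n \<and> (\<forall>l\<in>Y. norm (x + l) < \<rho>)"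
proof -
  define r where "r = \<rho> / (4 * real n)"
  have r: "r > 0" and \<rho>_eq: "\<rho> = 4 * (real n * r)" using \<rho> n by (simp_all add: r_def)
  obtain u :: "real ^ 'n" where u: "norm u = 1" using vector_choose_size[of 1] by auto
  define q where "q j = (real j * (2 * r)) *\<^sub>R u" for j
  have "\<forall>j. \<exists>l. l \<in> \<Lambda> \<and> norm (q j - x - l) < r" using fine[folded r_def] by blast
  from choice[OF this] obtain l where l: "\<And>j. l j \<in> \<Lambda>" "\<And>j. norm (q j - x - l j) < r" by blast
  have inj: "inj_on l {..<n}"
  proof (rule inj_onI)
    fix i j assume eq: "l i = l j"
    have "q i - q j = (q i - x - l i) - (q j - x - l j)" by (simp add: eq)
    then have "norm (q i - q j) \<le> norm (q i - x - l i) + norm (q j - x - l j)" by (simp only: norm_triangle_ineq4)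
    then have lt: "norm (q i - q j) < 2 * r" using l(2)[of i] l(2)[of j] by linarith
    have "q i - q j = ((real i - real j) * (2 * r)) *\<^sub>R u"
      by (simp only: q_def scaleR_left_diff_distrib left_diff_distrib)
    then have "norm (q i - q j) = \<bar>real i - real j\<bar> * (2 * r)" using u r by (simp add: abs_mult)
    with lt have "\<bar>real i - real j\<bar> * (2 * r) < 1 * (2 * r)" by linarith
    then have "\<bar>real i - real j\<bar> < 1" by (rule mult_right_less_imp_less) (use r in simp)
    then show "i = j" by linarith
  qed
  show ?thesis
  proof (intro exI[of _ "l ` {..<n}"] conjI ballI)
    show "l ` {..<n} \<subseteq> \<Lambda>" using l(1) by blast
    show "card (l ` {..<n}) = n" using inj by (simp add: card_image)
    fix y assume "y \<in> l ` {..<n}"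
    then obtain j where j: "j < n" "y = l j" by blast
    have "norm (q j) = real j * (2 * r)" using u r by (simp add: q_def abs_mult)
    also have "\<dots> \<le> (real n - 1) * (2 * r)" using j(1) r by (intro mult_right_mono) linarith+
    also have "\<dots> = 2 * (real n * r) - 2 * r" by (simp add: algebra_simps)
    finally have "norm (q j) \<le> 2 * (real n * r) - 2 * r" .
    moreover have "norm (x + l j) \<le> norm (q j) + norm (q j - x - l j)"
      using norm_triangle_ineq4[of "q j" "q j - x - l j"] by simp
    ultimately show "norm (x + y) < \<rho>" using l(2)[of j] \<rho> r \<rho>_eq unfolding j(2) by linarith
  qed simp
qed

lemma measurable_nat_of_real:
  assumes "(\<lambda>x. real (h x)) \<in> borel_measurable N" shows "h \<in> measurable N (count_space UNIV)"
proof -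
  have "(\<lambda>x. \<lfloor>real (h x)\<rfloor>) \<in> measurable N (count_space UNIV)" by (rule measurable_compose[OF assms measurable_real_floor])
  then have "(\<lambda>x. nat \<lfloor>real (h x)\<rfloor>) \<in> measurable N (count_space UNIV)" by (rule measurable_compose) simp
  then show ?thesis by simp
qed

section \<open>Sums over cosets and the rounded transport\<close>

context lattice_action
begin

text \<open>Total mass of \<open>h\<close> on the coset of \<open>p\<close>. Summing over the
  support keeps the sum finite for functions of bounded support.\<close>

definition coset_sum :: "(real ^ 'n \<Rightarrow> real) \<Rightarrow> real ^ 'n \<Rightarrow> real" where
  "coset_sum h p = (\<Sum>l\<in>{l\<in>\<Lambda>. h (p + l) \<noteq> 0}. h (p + l))"

lemma coset_sum_invariant: assumes "\<mu> \<in> \<Lambda>" shows "coset_sum h (p + \<mu>) = coset_sum h p"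
  unfolding coset_sum_def
proof (rule sum.reindex_bij_witness[where i = "\<lambda>l. l - \<mu>" and j = "\<lambda>l. l + \<mu>"])
  fix a assume "a \<in> {l\<in>\<Lambda>. h (p + \<mu> + l) \<noteq> 0}"
  then show "a + \<mu> \<in> {l\<in>\<Lambda>. h (p + l) \<noteq> 0}" using \<Lambda>_subgroup(2)[OF _ assms, of a] by (simp add: add_ac)
  show "h (p + (a + \<mu>)) = h (p + \<mu> + a)" by (simp add: add_ac)
next
  fix b assume "b \<in> {l\<in>\<Lambda>. h (p + l) \<noteq> 0}"
  then show "b - \<mu> \<in> {l\<in>\<Lambda>. h (p + \<mu> + l) \<noteq> 0}" using \<Lambda>_subgroup(4)[OF _ assms, of b] by simp
qed simp_all

lemma coset_sum_superset:
  assumes "finite Y" "Y \<subseteq> \<Lambda>" "\<And>l. l \<in> \<Lambda> \<Longrightarrow> h (p + l) \<noteq> 0 \<Longrightarrow> l \<in> Y"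
  shows "coset_sum h p = (\<Sum>l\<in>Y. h (p + l))"
  unfolding coset_sum_def by (rule sum.mono_neutral_left) (use assms in auto)

lemma coset_sum_shift: "coset_sum (\<lambda>x. h (x - w)) (p + w) = coset_sum h p"
proof -
  have "p + w + l - w = p + l" for l by simp
  then show ?thesis by (simp only: coset_sum_def)
qed

lemma coset_sum_nonneg: "(\<And>x. h x \<ge> 0) \<Longrightarrow> coset_sum h p \<ge> 0"
  unfolding coset_sum_def by (rule sum_nonneg) simp

lemma finite_coset_points: "bounded D \<Longrightarrow> finite {l\<in>\<Lambda>. p + l \<in> D}"
proof -
  assume "bounded D"
  have "{l\<in>\<Lambda>. p + l \<in> D} \<subseteq> \<Lambda> \<inter> (+) (- p) ` D"
  proof
    fix l assume "l \<in> {l\<in>\<Lambda>. p + l \<in> D}"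
    then show "l \<in> \<Lambda> \<inter> (+) (- p) ` D" by (intro IntI image_eqI[of _ _ "p + l"]) simp_all
  qed
  then show ?thesis
    by (rule finite_subset) (rule is_lattice_finite_bounded[OF \<Lambda> bounded_translation[OF \<open>bounded D\<close>]])
qed

lemma coset_sum_indicator:
  assumes "bounded D" shows "coset_sum (indicat_real D) p = real (card {l\<in>\<Lambda>. p + l \<in> D})"
proof -
  have "coset_sum (indicat_real D) p = (\<Sum>l\<in>{l\<in>\<Lambda>. p + l \<in> D}. indicat_real D (p + l))"
    by (rule coset_sum_superset[OF finite_coset_points[OF assms]]) (auto simp: indicator_def)
  then show ?thesis by simp
qed

lemma coset_sum_sum:
  assumes T: "finite T" and D: "bounded D" and h: "\<And>t x. t \<in> T \<Longrightarrow> h t x \<noteq> 0 \<Longrightarrow> x \<in> D"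
    and sum: "\<And>x. (\<Sum>t\<in>T. h t x) = indicat_real D x"
  shows "(\<Sum>t\<in>T. coset_sum (h t) p) = real (card {l\<in>\<Lambda>. p + l \<in> D})"
proof -
  have "(\<Sum>t\<in>T. coset_sum (h t) p) = (\<Sum>t\<in>T. \<Sum>l\<in>{l\<in>\<Lambda>. p + l \<in> D}. h t (p + l))"
    by (intro sum.cong refl coset_sum_superset[OF finite_coset_points[OF D]]) (auto dest: h)
  also have "\<dots> = (\<Sum>l\<in>{l\<in>\<Lambda>. p + l \<in> D}. \<Sum>t\<in>T. h t (p + l))" by (rule sum.swap)
  also have "\<dots> = real (card {l\<in>\<Lambda>. p + l \<in> D})" by (simp add: sum)
  finally show ?thesis .
qed

lemma coset_sum_borel:
  assumes D: "bounded D" and h: "\<And>x. h x \<noteq> 0 \<Longrightarrow> x \<in> D" and m: "h \<in> borel_measurable borel"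
  shows "coset_sum h \<in> borel_measurable torus"
proof (rule torus_measurable)
  define F where "F = {l\<in>\<Lambda>. \<exists>x\<in>D. x - l \<in> P0}"
  have F: "finite F" unfolding F_def by (rule finite_tiles_meeting[OF \<Lambda> P0_borel(2) D])
  have "coset_sum h p = (\<Sum>l\<in>F. h (rep p + l))" for p
  proof -
    have "coset_sum h p = coset_sum h (rep p)" using coset_sum_invariant[OF rep(2)[of p], of h "rep p"] by simp
    also have "\<dots> = (\<Sum>l\<in>F. h (rep p + l))"
    proof (rule coset_sum_superset[OF F])
      show "F \<subseteq> \<Lambda>" by (auto simp: F_def)
      fix l assume l: "l \<in> \<Lambda>" "h (rep p + l) \<noteq> 0"
      show "l \<in> F" unfolding F_def
        by (intro CollectI conjI l(1) bexI[of _ "rep p + l"] h[OF l(2)]) (simp add: rep(1))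
    qed
    finally show ?thesis .
  qed
  moreover have "(\<lambda>p. \<Sum>l\<in>F. h (rep p + l)) \<in> borel_measurable borel"
  proof (rule borel_measurable_sum)
    fix l
    have "(\<lambda>p. rep p + l) \<in> borel_measurable borel" using residue_borel[OF \<Lambda> P0] by simp
    then show "(\<lambda>p. h (rep p + l)) \<in> borel_measurable borel" by (rule measurable_compose[OF _ m])
  qed
  ultimately show "coset_sum h \<in> borel_measurable borel" by (simp cong: measurable_cong)
  show "coset_sum h (x + l) = coset_sum h x" if "l \<in> \<Lambda>" for x l by (rule coset_sum_invariant[OF that])
qed

text \<open>The transport, summed over cosets, becomes a flow for the action of \<open>Z^k\<close>;
  rounding it gives integral amounts, which are read as numbers of points to be moved. By
  \<open>big\<close>, the mass staying in place exceeds the total rounding error, so no coset is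
  asked to send away more points than it has.\<close>

theorem common_domain_of_transport:
  fixes L M DL DM :: "(real ^ 'n) set" and T :: "((real ^ 'n) \<times> (real ^ 'n)) set" and NS :: real
  assumes L: "is_lattice L" and M: "is_lattice M" and DL: "fundamental_domain L DL" and DM: "fundamental_domain M DM"
    and gen: "generates {l + m | l m. l \<in> L \<and> m \<in> M} \<Lambda> k \<gamma>" and \<Lambda>G: "\<Lambda> \<subseteq> {l + m | l m. l \<in> L \<and> m \<in> M}"
    and T: "finite T" "T \<subseteq> L \<times> M" "0 \<in> T" and c: "\<And>t. c t \<in> borel_measurable borel" and c0: "\<And>t y. c t y \<ge> 0"
    and csupp: "\<And>t y. c t y \<noteq> 0 \<Longrightarrow> y \<in> DL"
    and cL: "\<And>y. (\<Sum>t\<in>T. c t y) = indicat_real DL y"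
    and cM: "\<And>z. (\<Sum>t\<in>T. c t (z - (fst t + snd t))) = indicat_real DM z"
    and NS: "2 * real (card T) + 2 * real k \<le> NS" and big: "\<And>x. NS * (12 * NS + 2) \<le> coset_sum (c 0) x"
  shows "\<exists>E. bounded E \<and> E \<in> sets lebesgue \<and> (AE x in lebesgue. ((\<lambda>l. indicat_real E (x - l)) has_sum 1) L) \<and>
           (AE x in lebesgue. ((\<lambda>m. indicat_real E (x - m)) has_sum 1) M)"
proof -
  define G where "G = {l + m | l m. l \<in> L \<and> m \<in> M}"
  have sG: "subgroup_vec G" unfolding G_def by (rule lattice_sum_subgroup[OF L M])
  have Gsplit: "\<exists>l\<in>L. \<exists>m\<in>M. x = l + m" if "x \<in> G" for x using that by (auto simp: G_def)
  have Gc: "countable G"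
  proof -
    have "G = (\<lambda>(l, m). l + m) ` (L \<times> M)" by (auto simp: G_def)
    then show ?thesis using is_lattice_countable[OF L] is_lattice_countable[OF M] by simp
  qed
  have DLb: "bounded DL" "DL \<in> sets borel" and DMb: "bounded DM" using DL DM by (auto simp: fundamental_domain_def)
  define vv where "vv t = fst t + snd t" for t :: "(real ^ 'n) \<times> (real ^ 'n)"
  define wL where "wL x = card {l\<in>\<Lambda>. x + l \<in> DL}" for x
  define wM where "wM x = card {l\<in>\<Lambda>. x + l \<in> DM}" for x
  have iotaG: "iota a \<in> G" for a
    unfolding iota_def using gen
    by (intro subgroup_vec_sum[OF sG] subgroup_vec_int_scale[OF sG]) (simp add: generates_def G_def)
  \<comment> \<open>Modulo \<open>\<Lambda>\<close> the translation \<open>vv t\<close> acts as an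
    integer step \<open>\<pi> t\<close>; normalising it to vanish from index \<open>k\<close> on
    makes \<open>\<pi> 0 = 0\<close>.\<close>
  have "\<forall>t. \<exists>a. t \<in> T \<longrightarrow> (\<forall>i\<ge>k. a i = 0) \<and> vv t - iota a \<in> \<Lambda>"
  proof
    fix t
    show "\<exists>a. t \<in> T \<longrightarrow> (\<forall>i\<ge>k. a i = 0) \<and> vv t - iota a \<in> \<Lambda>"
    proof (cases "t \<in> T")
      case True
      then have "vv t \<in> G" using T(2) unfolding vv_def G_def by (intro CollectI exI[of _ "fst t"] exI[of _ "snd t"]) auto
      then have "\<exists>p\<in>\<Lambda>. \<exists>a :: nat \<Rightarrow> int. vv t = p + (\<Sum>i<k. of_int (a i) *\<^sub>R \<gamma> i)"
        using gen unfolding generates_def G_def by (elim conjE) (erule (1) bspec)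
      then obtain p and a :: "nat \<Rightarrow> int" where p: "p \<in> \<Lambda>" "vv t = p + (\<Sum>i<k. of_int (a i) *\<^sub>R \<gamma> i)" by (elim bexE exE)
      have "iota (\<lambda>i. if i < k then a i else 0) = (\<Sum>i<k. of_int (a i) *\<^sub>R \<gamma> i)"
        unfolding iota_def by (rule sum.cong) simp_all
      then show ?thesis using p by (intro exI[of _ "\<lambda>i. if i < k then a i else 0"]) simp
    qed simp
  qed
  from choice[OF this] obtain \<pi> where \<pi>0: "\<forall>t. t \<in> T \<longrightarrow> (\<forall>i\<ge>k. \<pi> t i = 0) \<and> vv t - iota (\<pi> t) \<in> \<Lambda>" by (elim exE)
  have \<pi>: "\<pi> t i = 0" if "t \<in> T" "i \<ge> k" for t i using \<pi>0[rule_format, OF that(1)] that(2) by (elim conjE) (erule (1) allE[THEN impE])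
  have \<pi>v: "vv t - iota (\<pi> t) \<in> \<Lambda>" if "t \<in> T" for t using \<pi>0[rule_format, OF that] by (rule conjunct2)
  have \<pi>_0: "\<pi> 0 = 0"
  proof (rule ext)
    fix i
    have "vv 0 = 0" by (simp add: vv_def)
    then have "- iota (\<pi> 0) \<in> \<Lambda>" using \<pi>v[OF T(3)] by simp
    then have "iota (\<pi> 0) \<in> \<Lambda>" using \<Lambda>_subgroup(3)[of "- iota (\<pi> 0)"] by simp
    then have "\<pi> 0 i = 0" if "i < k" using indep[of "\<pi> 0" i] that unfolding iota_def by (simp only:)
    then show "\<pi> 0 i = 0 i" using \<pi>[OF T(3), of i] by (cases "i < k") simp_all
  qed
  define U where "U = \<pi> ` T \<union> (\<lambda>i. unit_vec i 1) ` {..<k}"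
  \<comment> \<open>The steps used by the transport together with the unit vectors needed for
    rerouting, made symmetric. This doubling gives the bound \<open>2 * (card T + k)\<close> for its
    size.\<close>
  define S where "S = (U \<union> uminus ` U) - {0}"
  have finU: "finite U" using T(1) by (simp add: U_def)
  have finS: "finite S" using finU by (simp add: S_def)
  have S0: "0 \<notin> S" by (simp add: S_def)
  have symS: "- s \<in> S" if "s \<in> S" for s
  proof -
    have s: "s \<in> U \<or> s \<in> uminus ` U" "s \<noteq> 0" using that by (simp_all add: S_def)
    from s(1) have "- s \<in> U \<union> uminus ` U"
    proof
      assume "s \<in> uminus ` U"
      then obtain u where "u \<in> U" "s = - u" by (elim imageE)
      then show ?thesis by simp
    qed (rule UnI2, erule imageI)
    moreover have "- s \<noteq> 0" using s(2) by simp
    ultimately show ?thesis by (simp add: S_def)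
  qed
  have U_k: "u i = 0" if "u \<in> U" "i \<ge> k" for u i
    using that(1) unfolding U_def
  proof
    assume "u \<in> \<pi> ` T"
    then obtain t where "t \<in> T" "u = \<pi> t" by (elim imageE)
    then show ?thesis using \<pi> that(2) by simp
  next
    assume "u \<in> (\<lambda>i. unit_vec i 1) ` {..<k}"
    then obtain j where "j < k" "u = unit_vec j 1" by (elim imageE) simp
    then show ?thesis using that(2) by (simp add: unit_vec_def)
  qed
  have S_k: "s i = 0" if "s \<in> S" "i \<ge> k" for s i
  proof -
    have "s \<in> U \<or> s \<in> uminus ` U" using that(1) by (simp add: S_def)
    then show ?thesis
    proof
      assume "s \<in> uminus ` U"
      then obtain u where "u \<in> U" "s = - u" by (elim imageE)
      then show ?thesis using U_k that(2) by simp
    qed (rule U_k, assumption, rule that(2))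
  qed
  have units: "unit_vec i 1 \<in> S" if "i < k" for i
  proof -
    have "unit_vec i 1 \<in> U" unfolding U_def using that by (intro UnI2 imageI) simp
    moreover have "unit_vec i 1 i \<noteq> (0 :: nat \<Rightarrow> int) i" by (simp add: unit_vec_def)
    then have "unit_vec i 1 \<noteq> 0" by (intro notI) simp
    ultimately show ?thesis by (simp add: S_def)
  qed
  have cardS: "real (card S) \<le> NS"
  proof -
    have "card S \<le> card (U \<union> uminus ` U)" unfolding S_def using finU by (intro card_mono) simp_all
    also have "\<dots> \<le> card U + card (uminus ` U)" by (rule card_Un_le)
    also have "card (uminus ` U) \<le> card U" by (rule card_image_le[OF finU])
    also have "card U \<le> card (\<pi> ` T) + card ((\<lambda>i. unit_vec i 1) ` {..<k})" unfolding U_def by (rule card_Un_le)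
    also have "card (\<pi> ` T) \<le> card T" by (rule card_image_le[OF T(1)])
    also have "card ((\<lambda>i. unit_vec i 1) ` {..<k}) \<le> k" using card_image_le[of "{..<k}" "\<lambda>i. unit_vec i 1"] by simp
    finally have "real (card S) \<le> real (card T + k + (card T + k))" by (simp only: of_nat_le_iff)
    then show ?thesis using NS by simp
  qed
  define R where "R = 1 + (\<Sum>s\<in>S. \<Sum>i<k. \<bar>s i\<bar>)"
  have R1: "R \<ge> 1" unfolding R_def by (simp add: sum_nonneg)
  have SR: "\<bar>s i\<bar> \<le> R" if s: "s \<in> S" for s i
  proof (cases "i < k")
    case True
    have "\<bar>s i\<bar> \<le> (\<Sum>i<k. \<bar>s i\<bar>)" using True by (intro member_le_sum) simp_all
    also have "\<dots> \<le> (\<Sum>s\<in>S. \<Sum>i<k. \<bar>s i\<bar>)"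
      by (rule member_le_sum[where f = "\<lambda>s. \<Sum>i<k. \<bar>s i\<bar>"]) (simp_all add: s finS sum_nonneg)
    finally show ?thesis by (simp add: R_def)
  next
    case False
    then show ?thesis using S_k[OF s, of i] R1 by simp
  qed
  \<comment> \<open>The mass that the coset of \<open>p\<close> sends by the step \<open>s\<close>;
    several translations may induce the same step.\<close>
  define A where "A s p = (\<Sum>t\<in>{t\<in>T. \<pi> t = s}. coset_sum (c t) p)" for s p
  have A_nonneg: "A s p \<ge> 0" for s p unfolding A_def by (intro sum_nonneg coset_sum_nonneg c0)
  have A_meas: "A s \<in> borel_measurable torus" for s
    unfolding A_def[abs_def] by (intro borel_measurable_sum coset_sum_borel[OF DLb(1) _ c]) (erule csupp)
  have A_0: "NS * (12 * NS + 2) \<le> A 0 p" for p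
  proof -
    have "coset_sum (c 0) p \<le> A 0 p" unfolding A_def
      by (rule member_le_sum[where f = "\<lambda>t. coset_sum (c t) p"]) (simp_all add: T \<pi>_0 coset_sum_nonneg c0)
    then show ?thesis using big[of p] by linarith
  qed
  have \<pi>S: "\<pi> ` T \<subseteq> insert 0 S"
  proof
    fix s assume "s \<in> \<pi> ` T"
    then have "s \<in> U" unfolding U_def by (rule UnI1)
    then show "s \<in> insert 0 S" unfolding S_def by simp
  qed
  have sumA: "(\<Sum>s\<in>insert 0 S. A s p) = real (wL p)" for p
  proof -
    have "(\<Sum>s\<in>insert 0 S. A s p) = (\<Sum>t\<in>T. coset_sum (c t) p)"
      unfolding A_def by (rule sum.group[OF T(1) _ \<pi>S]) (simp add: finS)
    also have "\<dots> = real (wL p)" unfolding wL_def by (rule coset_sum_sum[OF T(1) DLb(1) csupp cL])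
    finally show ?thesis .
  qed
  have sumA': "(\<Sum>s\<in>insert 0 S. A s (p - iota s)) = real (wM p)" for p
  proof -
    have "(\<Sum>s\<in>insert 0 S. A s (p - iota s)) = (\<Sum>s\<in>insert 0 S. \<Sum>t\<in>{t\<in>T. \<pi> t = s}. coset_sum (c t) (p - iota (\<pi> t)))"
      unfolding A_def by (intro sum.cong refl) simp
    also have "\<dots> = (\<Sum>t\<in>T. coset_sum (c t) (p - iota (\<pi> t)))"
      by (rule sum.group[OF T(1) _ \<pi>S]) (simp add: finS)
    also have "\<dots> = (\<Sum>t\<in>T. coset_sum (\<lambda>x. c t (x - vv t)) p)"
    proof (rule sum.cong[OF refl])
      fix t assume t: "t \<in> T"
      have "coset_sum (c t) (p - iota (\<pi> t)) = coset_sum (c t) (p - vv t + (vv t - iota (\<pi> t)))" by simp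
      also have "\<dots> = coset_sum (c t) (p - vv t)" by (rule coset_sum_invariant[OF \<pi>v[OF t]])
      also have "\<dots> = coset_sum (\<lambda>x. c t (x - vv t)) p" using coset_sum_shift[of "c t" "vv t" "p - vv t"] by simp
      finally show "coset_sum (c t) (p - iota (\<pi> t)) = coset_sum (\<lambda>x. c t (x - vv t)) p" .
    qed
    also have "\<dots> = real (wM p)" unfolding wM_def
    proof (rule coset_sum_sum[OF T(1) DMb])
      fix x
      show s: "(\<Sum>t\<in>T. c t (x - vv t)) = indicat_real DM x" unfolding vv_def by (rule cM)
      show "x \<in> DM" if t: "t \<in> T" "c t (x - vv t) \<noteq> 0" for t
      proof (rule ccontr)
        assume "x \<notin> DM"
        then have "(\<Sum>t\<in>T. c t (x - vv t)) = 0" using s by simp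
        then have "\<forall>t\<in>T. c t (x - vv t) = 0" using sum_nonneg_eq_0_iff[OF T(1), of "\<lambda>t. c t (x - vv t)"] c0 by simp
        then show False using t by blast
      qed
    qed
    finally show ?thesis .
  qed
  \<comment> \<open>The net flow, with the mass coming back along the reversed edge subtracted. Its
    divergence is the difference of the two coset counts and hence an integer.\<close>
  define f where "f s p = A s p - A (- s) (p + iota s)" for s p
  have f_meas: "f s \<in> borel_measurable torus" for s
  proof -
    have "(\<lambda>p. A (- s) (p + iota s)) \<in> borel_measurable torus"
      by (rule measurable_compose[OF T_measurable A_meas])
    then show ?thesis unfolding f_def[abs_def] by (intro borel_measurable_diff A_meas)
  qed
  have f_anti: "f (- s) (p + iota s) = - f s p" for s p
    by (simp add: f_def iota_uminus)
  have bij: "bij_betw uminus S S"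
    by (rule bij_betwI[where g = uminus]) (auto intro: symS)
  have reflect: "(\<Sum>s\<in>S. h (- s)) = (\<Sum>s\<in>S. h s)" for h :: "(nat \<Rightarrow> int) \<Rightarrow> 'b :: comm_monoid_add"
    by (rule sum.reindex_bij_betw[OF bij])
  have f_div: "(\<Sum>s\<in>S. f s p) = real (wL p) - real (wM p)" for p
  proof -
    have "(\<Sum>s\<in>S. A (- s) (p + iota s)) = (\<Sum>s\<in>S. A s (p - iota s))"
      using reflect[of "\<lambda>s. A s (p - iota s)"] by (simp add: iota_uminus)
    then show ?thesis using sumA[of p] sumA'[of p] finS S0
      by (simp add: f_def sum_subtractf iota_0)
  qed
  have f_Ints: "(\<Sum>s\<in>S. f s p) \<in> \<int>" for p unfolding f_div by (intro Ints_diff Ints_of_nat)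
  have "\<exists>g :: (nat \<Rightarrow> int) \<Rightarrow> real ^ 'n \<Rightarrow> int. (\<forall>s\<in>S. g s \<in> measurable torus (count_space UNIV)) \<and>
    (AE x in torus. (\<forall>s\<in>S. g (- s) (x + iota s) = - g s x \<and> \<bar>real_of_int (g s x) - f s x\<bar> \<le> 12 * real (card S) + 2) \<and>
       real_of_int (\<Sum>s\<in>S. g s x) = (\<Sum>s\<in>S. f s x))"
    by (rule integral_flow_exists'[where f = f and S = S and R = R])
       (erule symS | erule (1) S_k | erule SR | erule units | rule finS S0 R1 f_Ints f_meas f_anti)+
  then obtain g :: "(nat \<Rightarrow> int) \<Rightarrow> real ^ 'n \<Rightarrow> int" where g: "\<forall>s\<in>S. g s \<in> measurable torus (count_space UNIV)" and
    ae: "AE x in torus. (\<forall>s\<in>S. g (- s) (x + iota s) = - g s x \<and> \<bar>real_of_int (g s x) - f s x\<bar> \<le> 12 * real (card S) + 2) \<and>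
       real_of_int (\<Sum>s\<in>S. g s x) = (\<Sum>s\<in>S. f s x)" by (elim exE conjE)
  obtain Z where Z: "Z \<in> null_sets lebesgue" and Zg: "\<forall>x. x \<notin> Z \<longrightarrow>
      ((\<forall>s\<in>S. g (- s) (x + iota s) = - g s x \<and> \<bar>real_of_int (g s x) - f s x\<bar> \<le> 12 * real (card S) + 2) \<and>
       real_of_int (\<Sum>s\<in>S. g s x) = (\<Sum>s\<in>S. f s x)) \<and> (\<forall>h\<in>G. x + h \<notin> Z)"
    using torus_null[OF ae Gc sG] by (elim bexE)
  have Z1: "g (- s) (x + iota s) = - g s x" if "x \<notin> Z" "s \<in> S" for x s
    using Zg[rule_format, OF that(1), THEN conjunct1, THEN conjunct1, rule_format, OF that(2)] by (rule conjunct1)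
  have Z2: "\<bar>real_of_int (g s x) - f s x\<bar> \<le> 12 * real (card S) + 2" if "x \<notin> Z" "s \<in> S" for x s
    using Zg[rule_format, OF that(1), THEN conjunct1, THEN conjunct1, rule_format, OF that(2)] by (rule conjunct2)
  have Z3: "real_of_int (\<Sum>s\<in>S. g s x) = real (wL x) - real (wM x)" if "x \<notin> Z" for x
    using Zg[rule_format, OF that, THEN conjunct1, THEN conjunct2] unfolding f_div .
  have Z4: "x + h \<notin> Z" if "x \<notin> Z" "h \<in> G" for x h
    by (rule Zg[rule_format, OF that(1), THEN conjunct2, rule_format, OF that(2)])
  \<comment> \<open>Positive parts of the integral flow are sent, and the remaining points of
    \<open>DL\<close> stay in their coset. By \<open>le\<close> the subtraction of natural numbers
    is not truncated outside \<open>Z\<close>.\<close>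
  define b where "b s x = (if s = 0 then wL x - (\<Sum>s\<in>S. nat (g s x)) else nat (g s x))" for s x
  have b_S: "b s x = nat (g s x)" if "s \<in> S" for s x
  proof -
    have "s \<noteq> 0" using that S0 by (intro notI) simp
    then show ?thesis by (simp add: b_def)
  qed
  have b_0: "b 0 x = wL x - (\<Sum>s\<in>S. nat (g s x))" for x by (simp add: b_def)
  have b_torus: "b s \<in> measurable torus (count_space UNIV)" if s: "s \<in> insert 0 S" for s
  proof (cases "s = 0")
    case True
    have gb: "(\<lambda>x. real (nat (g s x))) \<in> borel_measurable torus" if "s \<in> S" for s
      using g[rule_format, OF that] by (rule measurable_compose) simp
    have "(\<lambda>x. real (wL x)) = coset_sum (indicat_real DL)"
      by (rule ext) (simp add: wL_def coset_sum_indicator[OF DLb(1)])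
    moreover have "coset_sum (indicat_real DL) \<in> borel_measurable torus"
      by (rule coset_sum_borel[OF DLb(1)]) (use DLb(2) in \<open>simp_all add: indicator_eq_0_iff\<close>)
    ultimately have wm: "(\<lambda>x. real (wL x)) \<in> borel_measurable torus" by simp
    have "(\<lambda>x. max 0 (real (wL x) - (\<Sum>s\<in>S. real (nat (g s x))))) \<in> borel_measurable torus"
      by (intro borel_measurable_max borel_measurable_diff borel_measurable_sum wm gb borel_measurable_const)
    moreover have "real (b 0 x) = max 0 (real (wL x) - (\<Sum>s\<in>S. real (nat (g s x))))" for x
      unfolding b_0 of_nat_sum[symmetric] by linarith
    ultimately have "(\<lambda>x. real (b 0 x)) \<in> borel_measurable torus" by (simp only:)
    then show ?thesis unfolding True by (rule measurable_nat_of_real)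
  next
    case False
    then have sS: "s \<in> S" using s by simp
    have "b s = (\<lambda>x. nat (g s x))" by (rule ext) (rule b_S[OF sS])
    moreover have "(\<lambda>x. nat (g s x)) \<in> measurable torus (count_space UNIV)"
      using g[rule_format, OF sS] by (rule measurable_compose) simp
    ultimately show ?thesis by (simp only:)
  qed
  \<comment> \<open>A positive part exceeds the mass \<open>A s x\<close> by at most the rounding
    error, because what comes back only lowers the net flow. The errors of all steps add up to at
    most \<open>NS * (12 * NS + 2)\<close>, which \<open>A 0 x\<close> covers.\<close>
  have le: "(\<Sum>s\<in>S. nat (g s x)) \<le> wL x" if x: "x \<notin> Z" for x
  proof -
    have "real (nat (g s x)) \<le> A s x + (12 * real (card S) + 2)" if s: "s \<in> S" for s
    proof (cases "g s x \<ge> 0")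
      case True
      then have "real (nat (g s x)) = real_of_int (g s x)" by simp
      then show ?thesis using Z2[OF x s] A_nonneg[of "- s" "x + iota s"] unfolding f_def by linarith
    next
      case False
      then show ?thesis using A_nonneg[of s x] by simp
    qed
    then have "(\<Sum>s\<in>S. real (nat (g s x))) \<le> (\<Sum>s\<in>S. A s x + (12 * real (card S) + 2))" by (rule sum_mono)
    also have "\<dots> = (\<Sum>s\<in>S. A s x) + real (card S) * (12 * real (card S) + 2)" by (simp add: sum.distrib)
    also have "\<dots> \<le> (\<Sum>s\<in>S. A s x) + NS * (12 * NS + 2)" using cardS by (intro add_left_mono mult_mono) simp_all
    also have "\<dots> \<le> (\<Sum>s\<in>S. A s x) + A 0 x" using A_0[of x] by linarith
    also have "\<dots> = real (wL x)" using sumA[of x] finS S0 by simp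
    finally have "real (\<Sum>s\<in>S. nat (g s x)) \<le> real (wL x)" by (simp only: of_nat_sum)
    then show ?thesis by (simp only: of_nat_le_iff)
  qed
  have countL: "(\<Sum>s\<in>insert 0 S. b s x) = wL x" if x: "x \<notin> Z" for x
  proof -
    have "(\<Sum>s\<in>S. b s x) = (\<Sum>s\<in>S. nat (g s x))" by (rule sum.cong[OF refl]) (rule b_S)
    then show ?thesis using le[OF x] finS S0 by (simp add: b_0)
  qed
  \<comment> \<open>By antisymmetry the number arriving by step \<open>s\<close> is the negative
    part of the flow out of \<open>x\<close> by \<open>- s\<close>. Replacing positive by negative
    parts changes the count by the divergence, that is from \<open>wL\<close> to
    \<open>wM\<close>.\<close>
  have countM: "(\<Sum>s\<in>insert 0 S. b s (x - iota s)) = wM x" if x: "x \<notin> Z" for x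
  proof -
    have "b s (x - iota s) = nat (- g (- s) x)" if s: "s \<in> S" for s
    proof -
      have "g (- (- s)) (x + iota (- s)) = - g (- s) x" by (rule Z1[OF x symS[OF s]])
      then have "g s (x - iota s) = - g (- s) x" by (simp add: iota_uminus)
      then show ?thesis by (simp add: b_S[OF s])
    qed
    then have "(\<Sum>s\<in>S. b s (x - iota s)) = (\<Sum>s\<in>S. nat (- g (- s) x))" by (rule sum.cong[OF refl])
    also have "\<dots> = (\<Sum>s\<in>S. nat (- g s x))" by (rule reflect[of "\<lambda>s. nat (- g s x)"])
    finally have 1: "(\<Sum>s\<in>S. b s (x - iota s)) = (\<Sum>s\<in>S. nat (- g s x))" .
    have "(\<Sum>s\<in>S. g s x) = (\<Sum>s\<in>S. int (nat (g s x)) - int (nat (- g s x)))" by (rule sum.cong) simp_all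
    then have "(\<Sum>s\<in>S. g s x) = int (\<Sum>s\<in>S. nat (g s x)) - int (\<Sum>s\<in>S. nat (- g s x))"
      by (simp add: sum_subtractf del: int_nat_eq)
    then have "real (\<Sum>s\<in>S. nat (g s x)) - real (\<Sum>s\<in>S. nat (- g s x)) = real (wL x) - real (wM x)"
      using Z3[OF x] by (simp del: of_nat_sum of_int_sum)
    then have 2: "int (\<Sum>s\<in>S. nat (g s x)) + int (wM x) = int (wL x) + int (\<Sum>s\<in>S. nat (- g s x))" by linarith
    have "(\<Sum>s\<in>insert 0 S. b s (x - iota s)) = b 0 x + (\<Sum>s\<in>S. nat (- g s x))"
      using finS S0 1 by (simp add: iota_0)
    then show ?thesis using 2 le[OF x] unfolding b_0 by linarith
  qed
  show ?thesis
  proof (rule common_domain_from_counts[OF L M \<Lambda> DL DM, where S = "insert 0 S" and v = iota and b = b and Z = Z])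
    show "finite (insert 0 S)" using finS by simp
    show "\<exists>l\<in>L. \<exists>m\<in>M. iota s = l + m" for s by (rule Gsplit[OF iotaG])
    show "\<exists>l\<in>L. \<exists>m\<in>M. x = l + m" if "x \<in> \<Lambda>" for x
      by (rule Gsplit) (rule subsetD[OF \<Lambda>G[folded G_def] that])
    show "b s \<in> measurable borel (count_space UNIV)" if "s \<in> insert 0 S" for s
      by (rule torus_measurable_borel[OF b_torus[OF that]])
    show "b s (x + l) = b s x" if "s \<in> insert 0 S" "l \<in> \<Lambda>" for s x l
      by (rule torus_measurable_invariant[OF b_torus[OF that(1)] that(2)])
    show "Z \<in> null_sets lebesgue" by (rule Z)
    show "x + l + m \<notin> Z" if "x \<notin> Z" "l \<in> L" "m \<in> M" for x l m
    proof -
      have "l + m \<in> G" using that unfolding G_def by blast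
      then show ?thesis using Z4[OF that(1)] by (simp add: add.assoc)
    qed
    show "(\<Sum>s\<in>insert 0 S. b s x) = card {l\<in>\<Lambda>. x + l \<in> DL}" if "x \<notin> Z" for x
      using countL[OF that] by (simp only: wL_def)
    show "(\<Sum>s\<in>insert 0 S. b s (x - iota s)) = card {l\<in>\<Lambda>. x + l \<in> DM}" if "x \<notin> Z" for x
      using countM[OF that] by (simp only: wM_def)
  qed
qed

end

theorem theorem2:
  fixes L M :: "(real ^ 'd) set"
  assumes "is_lattice L" and "is_lattice M"
    and "lattice_volume L = lattice_volume M"
    and "closure {l + m | l m. l \<in> L \<and> m \<in> M} = UNIV"
  shows "\<exists>E :: (real ^ 'd) set. bounded E \<and> E \<in> sets lebesgue \<and>
           (AE x in lebesgue. ((\<lambda>l. indicat_real E (x - l)) has_sum 1) L) \<and>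
           (AE x in lebesgue. ((\<lambda>m. indicat_real E (x - m)) has_sum 1) M)"
proof -
  note L = assms(1) and M = assms(2)
  obtain DL r1 where DL: "fundamental_domain L DL" "measure lebesgue DL = lattice_volume L" "r1 > 0" "ball 0 r1 \<subseteq> DL"
    using is_lattice_domain[OF L] by metis
  obtain DM r2 where DM: "fundamental_domain M DM" "measure lebesgue DM = lattice_volume M" "r2 > 0" "ball 0 r2 \<subseteq> DM"
    using is_lattice_domain[OF M] by metis
  define \<rho> where "\<rho> = min r1 r2 / 2"
  have \<rho>: "\<rho> > 0" using DL(3) DM(3) by (simp add: \<rho>_def)
  have ball: "ball 0 (2 * \<rho>) \<subseteq> DL \<inter> DM" using DL(4) DM(4) by (auto simp: \<rho>_def subset_eq)
  have vol: "measure lebesgue DL = measure lebesgue DM" using DL(2) DM(2) assms(3) by simp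
  obtain T :: "((real ^ 'd) \<times> (real ^ 'd)) set" and c :: "(real ^ 'd) \<times> (real ^ 'd) \<Rightarrow> real ^ 'd \<Rightarrow> real" and \<kappa> :: real
    where T: "finite T" "T \<subseteq> L \<times> M" "0 \<in> T" and \<kappa>: "\<kappa> > 0" and c: "\<And>t. c t \<in> borel_measurable borel" "\<And>t y. c t y \<ge> 0"
    "\<And>t y. c t y \<noteq> 0 \<Longrightarrow> y \<in> DL"
    "\<And>y. (\<Sum>t\<in>T. c t y) = indicat_real DL y" "\<And>z. (\<Sum>t\<in>T. c t (z - (fst t + snd t))) = indicat_real DM z"
    "\<And>y. norm y < \<rho> \<Longrightarrow> c 0 y \<ge> \<kappa>"
    by (rule lattice_transport[OF L M DL(1) DM(1) vol \<rho> ball]) (rule that)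
  \<comment> \<open>Bounds the number of steps for every possible \<open>\<Lambda>\<close>, since
    its complement has rank at most \<open>2 * CARD('d)\<close>. So the fineness of
    \<open>\<Lambda>\<close> can be chosen after \<open>NS\<close>.\<close>
  define NS where "NS = 2 * real (card T) + 4 * real CARD('d)"
  obtain n0 :: nat where n0: "NS * (12 * NS + 2) / \<kappa> \<le> real n0" using real_arch_simple by blast
  define n where "n = max n0 1"
  have n: "n \<ge> 1" "NS * (12 * NS + 2) \<le> \<kappa> * real n"
  proof -
    have "NS * (12 * NS + 2) / \<kappa> \<le> real n" using n0 by (simp add: n_def)
    then show "NS * (12 * NS + 2) \<le> \<kappa> * real n" using \<kappa> by (simp add: field_simps)
  qed (simp add: n_def)
  have r: "\<rho> / (4 * real n) > 0" using \<rho> n by simp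
  obtain \<Lambda> k \<gamma> where lat: "is_lattice \<Lambda>" "\<Lambda> \<subseteq> {l + m | l m. l \<in> L \<and> m \<in> M}"
    and fine: "\<forall>x. \<exists>l\<in>\<Lambda>. norm (x - l) < \<rho> / (4 * real n)" and k: "k \<le> CARD('d) + CARD('d)"
    and gen: "generates {l + m | l m. l \<in> L \<and> m \<in> M} \<Lambda> k \<gamma>"
    and ind: "\<forall>a :: nat \<Rightarrow> int. (\<Sum>i<k. of_int (a i) *\<^sub>R \<gamma> i) \<in> \<Lambda> \<longrightarrow> (\<forall>i<k. a i = 0)"
    using fine_pure_sublattice[OF L M assms(4) r] by (elim exE conjE)
  obtain P0 where fd: "fundamental_domain \<Lambda> P0" using is_lattice_domain[OF lat(1)] by metis
  interpret lattice_action \<Lambda> P0 \<gamma> k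
    by unfold_locales (rule lat(1), rule fd, rule ind[rule_format])
  show ?thesis
  proof (rule common_domain_of_transport[OF L M DL(1) DM(1) gen lat(2) T c(1-5), where NS = NS])
    show "2 * real (card T) + 2 * real k \<le> NS" using k unfolding NS_def by linarith
    fix x
    obtain Y where Y: "finite Y" "Y \<subseteq> \<Lambda>" "card Y = n" "\<forall>l\<in>Y. norm (x + l) < \<rho>"
      using many_lattice_points[OF n(1) \<rho> fine, of x] by (elim exE conjE)
    have fin: "finite {l\<in>\<Lambda>. x + l \<in> DL}"
      by (rule finite_coset_points) (use DL(1) in \<open>simp add: fundamental_domain_def\<close>)
    have sub: "Y \<subseteq> {l\<in>\<Lambda>. x + l \<in> DL}"
    proof
      fix l assume l: "l \<in> Y"
      then have "c 0 (x + l) \<ge> \<kappa>" using Y(4) by (intro c(6)) simp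
      then have "c 0 (x + l) \<noteq> 0" using \<kappa> by linarith
      then show "l \<in> {l\<in>\<Lambda>. x + l \<in> DL}" using l Y(2) c(3) by auto
    qed
    \<comment> \<open>Each of the \<open>n\<close> points of the coset near the origin keeps at
      least \<open>\<kappa>\<close> of its mass in place, and \<open>n\<close> was chosen to make
      this enough.\<close>
    have "NS * (12 * NS + 2) \<le> (\<Sum>l\<in>Y. \<kappa>)" using n(2) Y(3) by (simp add: mult.commute)
    also have "\<dots> \<le> (\<Sum>l\<in>Y. c 0 (x + l))" using Y(4) by (intro sum_mono c(6)) simp
    also have "\<dots> \<le> (\<Sum>l\<in>{l\<in>\<Lambda>. x + l \<in> DL}. c 0 (x + l))" by (rule sum_mono2[OF fin sub]) (rule c(2))
    also have "\<dots> = coset_sum (c 0) x" by (rule coset_sum_superset[symmetric, OF fin]) (auto dest: c(3))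
    finally show "NS * (12 * NS + 2) \<le> coset_sum (c 0) x" .
  qed
qed

end
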